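(* Let $i\in\{0,\dots,n\}$, let $b_0=\emptyset$ and $b_i=(i,\overline{i})$ for $i\ge 1$. Then, with the specialisation $q=e^{-\delta}$ and colours $c_b$ replaced by the formal exponentials described in the context, $$\sum_{\pi\in\mathcal{P}^{\gtrdot}_{c_{b_i}}}C(\pi)q^{|\pi|}=e^{-\Lambda_i}\mathrm{ch}(L(\Lambda_i)),\qquad \sum_{\pi\in\mathcal{P}^{\gg}_{c_{b_i}}}C(\pi)q^{|\pi|}=\frac{e^{-\Lambda_i}\mathrm{ch}(L(\Lambda_i))}{(q;q)_\infty},$$ where $(q;q)_\infty=\prod_{k\ge 0}(1-q^{k+1})$.
   Context: Let $\mathfrak g$ be the affine Lie algebra of type $C_n^{(1)}$ with simple roots $\alpha_0,\dots,\alpha_n$, fundamental weights $\Lambda_0,\dots,\Lambda_n$, null root $\delta=\alpha_0+2\sum_{j=1}^{n-1}\alpha_j+\alpha_n$; $L(\Lambda)$ is the irreducible highest weight module of highest weight $\Lambda$ and $\mathrm{ch}$ its character. Let $\overline{[n]}=\{1,\dots,n,\overline n,\dots,\overline 1\}$ with order $1<\dots<n<\overline n<\dots<\overline 1$ and $\overline{\overline k}=k$. Let $\mathcal{B}=\{\emptyset\}\sqcup\{(x,y):x\le y\in\overline{[n]}\}$ (the vertex set of the Kang--Kashiwara--Misra level $1$ perfect crystal of $C_n^{(1)}$) and let $H$ be the energy function on $\mathcal{B}\otimes\mathcal{B}$ given by $H(\emptyset\otimes\emptyset)=0$, $H(\emptyset\otimes(x,y))=H((x,y)\otimes\emptyset)=1$,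 and for $x\le y$, $x'\le y'$: $H((x,y)\otimes(x',y'))=\chi(x\ge x')+\chi(y\ge y')-\chi(y\ge y'>x\ge x')$ if $\overline{y'}\ne x$, and $=\chi(x>x')+\chi(y>y')-\chi(y>y'>x>x')$ if $\overline{y'}=x$ ($\chi(P)\in\{0,1\}$ is the truth value of $P$). Colours: formal symbols $c_b$, $b\in\mathcal{B}$ (distinct for distinct $b$); a coloured integer $k_{c}$ has size $k\in\mathbb{Z}$ and colour $c$. A grounded partition with ground $c_g$ and relation $R$ is a finite sequence $(\pi_0,\dots,\pi_s)$ of coloured integers with colours in $\{c_b\}$ such that $\pi_j\,R\,\pi_{j+1}$ for all $j<s$, $\pi_s=0_{c_g}$, and $\pi_{s-1}\ne 0_{c_g}$ if $s>0$. $\mathcal{P}^{\gtrdot}_{c_g}$ (resp. $\mathcal{P}^{\gg}_{c_g}$) uses the relation $k_{c_b}\gtrdot k'_{c_{b'}}$ iff $k-k'=H(b'\otimes b)$ (resp. $k_{c_b}\gg k'_{c_{b'}}$ iff $k-k'\ge H(b'\otimes b)$). $|\pi|$ is the sum of the sizes of the parts and $C(\pi)$ the product of their colours. In the generating functions, $c_\emptyset=1$ and $c_{(x,y)}=c_xc_y$ where $c_j=e^{\frac12\alpha_n+\sum_{u=j}^{n-1}\alpha_u}$ and $c_{\overline j}=c_j^{-1}$ for $j\in\{1,\dots,n\}$ (so $c_b=e^{\overline{\mathrm{wt}}\,b}$, the classical weight of $b$). *)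

theory Defs
  imports
    "HOL-Library.Poly_Mapping"
    "HOL-Library.Function_Algebras"
    "HOL-Library.Product_Plus"
    "HOL-Computational_Algebra.Formal_Power_Series"
    "HOL-Analysis.Infinite_Products"
    "Jordan_Normal_Form.Matrix"
begin

section \<open>The affine Lie algebra of type $C_n^{(1)}$\<close>

text \<open>
  The algebra is realised as
  $\mathfrak{sp}_{2n}(\mathbb{C}[t,t^{-1}]) \oplus \mathbb{C}c \oplus \mathbb{C}d$; the triple
  \<open>(X, a, b)\<close> stands for $X + ac + bd$. For $n = 1$ this is $A_1^{(1)}$, the usual reading
  of $C_1^{(1)}$.
\<close>

type_synonym laurent = "int \<Rightarrow>\<^sub>0 complex"

type_synonym affine = "laurent mat \<times> complex \<times> complex"

definition laurent_const :: "complex \<Rightarrow> laurent" where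
  "laurent_const a = Poly_Mapping.single 0 a"

text \<open>The derivation $t\,\frac{d}{dt}$.\<close>

definition euler :: "laurent \<Rightarrow> laurent" where
  "euler p = Poly_Mapping.mapp (\<lambda>m a. of_int m * a) p"

definition mat_trace :: "'a::comm_ring_1 mat \<Rightarrow> 'a" where
  "mat_trace X = (\<Sum>i<dim_row X. X $$ (i, i))"

definition symplectic_form :: "nat \<Rightarrow> laurent mat" where
  "symplectic_form n =
     mat (2 * n) (2 * n) (\<lambda>(i, j). if j = i + n then 1 else if i = j + n then - 1 else 0)"

definition loop_sp :: "nat \<Rightarrow> laurent mat set" where
  "loop_sp n = {X \<in> carrier_mat (2 * n) (2 * n).
     transpose_mat X * symplectic_form n + symplectic_form n * X = 0\<^sub>m (2 * n) (2 * n)}"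

definition affine_C :: "nat \<Rightarrow> affine set" where
  "affine_C n = loop_sp n \<times> UNIV \<times> UNIV"

definition affine_scale :: "complex \<Rightarrow> affine \<Rightarrow> affine" where
  "affine_scale z = (\<lambda>(X, a, b). (laurent_const z \<cdot>\<^sub>m X, z * a, z * b))"

text \<open>
  The trace form on $\mathfrak{sp}_{2n}$ is the normalised invariant form (the highest root has
  square length 2), so $[xt^m, yt^k] = [x,y]t^{m+k} + m\,\delta_{m,-k}\,\mathrm{tr}(xy)\,c$.
\<close>

definition affine_bracket :: "affine \<Rightarrow> affine \<Rightarrow> affine" where
  "affine_bracket = (\<lambda>(X, a, b) (Y, a', b').
     (X * Y - Y * X
        + (laurent_const b \<cdot>\<^sub>m map_mat euler Y - laurent_const b' \<cdot>\<^sub>m map_mat euler X),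
      Poly_Mapping.lookup (mat_trace (map_mat euler X * Y)) 0,
      0))"

definition unit_mat :: "nat \<Rightarrow> laurent \<Rightarrow> nat \<Rightarrow> nat \<Rightarrow> laurent mat" where
  "unit_mat n p i j = mat (2 * n) (2 * n) (\<lambda>(r, s). if r = i \<and> s = j then p else 0)"

definition chevalley_e :: "nat \<Rightarrow> nat \<Rightarrow> affine" where
  "chevalley_e n i =
     (if i = 0 then unit_mat n (Poly_Mapping.single 1 1) n 0
      else if i = n then unit_mat n 1 (n - 1) (2 * n - 1)
      else unit_mat n 1 (i - 1) i - unit_mat n 1 (n + i) (n + i - 1), 0, 0)"

definition chevalley_f :: "nat \<Rightarrow> nat \<Rightarrow> affine" where
  "chevalley_f n i =
     (if i = 0 then unit_mat n (Poly_Mapping.single (- 1) 1) 0 n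
      else if i = n then unit_mat n 1 (2 * n - 1) (n - 1)
      else unit_mat n 1 i (i - 1) - unit_mat n 1 (n + i - 1) (n + i), 0, 0)"

definition coroot :: "nat \<Rightarrow> nat \<Rightarrow> affine" where
  "coroot n i = affine_bracket (chevalley_e n i) (chevalley_f n i)"

definition scaling_element :: "nat \<Rightarrow> affine" where
  "scaling_element n = (0\<^sub>m (2 * n) (2 * n), 0, 1)"


section \<open>Weights\<close>

text \<open>
  The simple coroots $\alpha_0^\vee, \dots, \alpha_n^\vee$ and $d$ form a basis of the Cartan
  subalgebra $\mathfrak{h}$. A weight $\mu \in \mathfrak{h}^*$ is represented by its values on this
  basis: \<open>\<mu> i\<close> is $\mu(\alpha_i^\vee)$ for \<open>i \<le> n\<close>, and \<open>\<mu> (n + 1)\<close> is $\mu(d)$.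
\<close>

type_synonym weight = "nat \<Rightarrow> complex"

definition weights :: "nat \<Rightarrow> weight set" where
  "weights n = {\<mu>. \<forall>i. n + 1 < i \<longrightarrow> \<mu> i = 0}"

definition weight_scale :: "complex \<Rightarrow> weight \<Rightarrow> weight" where
  "weight_scale z \<mu> = (\<lambda>i. z * \<mu> i)"

text \<open>
  \<open>cartan_C n i j\<close> is $\alpha_j(\alpha_i^\vee)$, for the diagram $0 \Rightarrow 1 - \cdots - (n-1)
  \Leftarrow n$. For \<open>n = 1\<close> both off-diagonal entries are \<open>-2\<close>.
\<close>

definition cartan_C :: "nat \<Rightarrow> nat \<Rightarrow> nat \<Rightarrow> complex" where
  "cartan_C n i j =
     (if i = j then 2
      else if (i = 1 \<and> j = 0) \<or> (i + 1 = n \<and> j = n) then - 2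
      else if i = j + 1 \<or> j = i + 1 then - 1
      else 0)"

definition simple_root :: "nat \<Rightarrow> nat \<Rightarrow> weight" where
  "simple_root n j =
     (\<lambda>i. if i \<le> n then cartan_C n i j else if i = n + 1 \<and> j = 0 then 1 else 0)"

definition null_root :: "nat \<Rightarrow> weight" where
  "null_root n = simple_root n 0 + weight_scale 2 (\<Sum>j = 1..n - 1. simple_root n j) + simple_root n n"

definition fundamental_weight :: "nat \<Rightarrow> weight" where
  "fundamental_weight i = (\<lambda>k. if k = i then 1 else 0)"


section \<open>Highest weight modules and their characters\<close>

definition affine_module ::
  "nat \<Rightarrow> (complex \<Rightarrow> 'v \<Rightarrow> 'v) \<Rightarrow> (affine \<Rightarrow> 'v \<Rightarrow> 'v::ab_group_add) \<Rightarrow> bool" where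
  "affine_module n smul act \<longleftrightarrow>
     vector_space smul \<and>
     (\<forall>x\<in>affine_C n. Vector_Spaces.linear smul smul (act x)) \<and>
     (\<forall>x\<in>affine_C n. \<forall>y\<in>affine_C n. \<forall>v. act (x + y) v = act x v + act y v) \<and>
     (\<forall>z. \<forall>x\<in>affine_C n. \<forall>v. act (affine_scale z x) v = smul z (act x v)) \<and>
     (\<forall>x\<in>affine_C n. \<forall>y\<in>affine_C n. \<forall>v.
        act (affine_bracket x y) v = act x (act y v) - act y (act x v))"

definition submodule ::
  "nat \<Rightarrow> (complex \<Rightarrow> 'v \<Rightarrow> 'v) \<Rightarrow> (affine \<Rightarrow> 'v \<Rightarrow> 'v::ab_group_add) \<Rightarrow> 'v set \<Rightarrow> bool" where
  "submodule n smul act W \<longleftrightarrow>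
     module.subspace smul W \<and> (\<forall>x\<in>affine_C n. \<forall>w\<in>W. act x w \<in> W)"

definition irreducible_module ::
  "nat \<Rightarrow> (complex \<Rightarrow> 'v \<Rightarrow> 'v) \<Rightarrow> (affine \<Rightarrow> 'v \<Rightarrow> 'v::ab_group_add) \<Rightarrow> bool" where
  "irreducible_module n smul act \<longleftrightarrow>
     affine_module n smul act \<and> (\<exists>v::'v. v \<noteq> 0) \<and>
     (\<forall>W. submodule n smul act W \<longrightarrow> W = {0} \<or> W = UNIV)"

definition weight_space ::
  "nat \<Rightarrow> (complex \<Rightarrow> 'v \<Rightarrow> 'v) \<Rightarrow> (affine \<Rightarrow> 'v \<Rightarrow> 'v::ab_group_add) \<Rightarrow> weight \<Rightarrow> 'v set" where
  "weight_space n smul act \<mu> =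
     {v. (\<forall>i\<le>n. act (coroot n i) v = smul (\<mu> i) v) \<and>
         act (scaling_element n) v = smul (\<mu> (n + 1)) v}"

definition highest_weight_module ::
  "nat \<Rightarrow> weight \<Rightarrow> (complex \<Rightarrow> 'v \<Rightarrow> 'v) \<Rightarrow> (affine \<Rightarrow> 'v \<Rightarrow> 'v::ab_group_add) \<Rightarrow> bool" where
  "highest_weight_module n \<Lambda> smul act \<longleftrightarrow>
     affine_module n smul act \<and>
     (\<exists>v. v \<noteq> 0 \<and> v \<in> weight_space n smul act \<Lambda> \<and>
          (\<forall>i\<le>n. act (chevalley_e n i) v = 0) \<and>
          (\<forall>W. submodule n smul act W \<and> v \<in> W \<longrightarrow> W = UNIV))"

text \<open>\<open>is_L n \<Lambda> smul act\<close>: the module is a model of $L(\Lambda)$, which is unique up to isomorphism.\<close>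

definition is_L ::
  "nat \<Rightarrow> weight \<Rightarrow> (complex \<Rightarrow> 'v \<Rightarrow> 'v) \<Rightarrow> (affine \<Rightarrow> 'v \<Rightarrow> 'v::ab_group_add) \<Rightarrow> bool" where
  "is_L n \<Lambda> smul act \<longleftrightarrow>
     irreducible_module n smul act \<and> highest_weight_module n \<Lambda> smul act"

definition finite_weight_multiplicities ::
  "nat \<Rightarrow> (complex \<Rightarrow> 'v \<Rightarrow> 'v) \<Rightarrow> (affine \<Rightarrow> 'v \<Rightarrow> 'v::ab_group_add) \<Rightarrow> bool" where
  "finite_weight_multiplicities n smul act \<longleftrightarrow>
     (\<forall>\<mu>\<in>weights n. \<exists>S. finite S \<and> weight_space n smul act \<mu> \<subseteq> module.span smul S)"

text \<open>
  A formal sum $\sum_\mu F_\mu e^\mu$ over $\mathfrak{h}^*$ is represented by the coefficient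
  function $\mu \mapsto F_\mu$.
\<close>

type_synonym exp_series = "weight \<Rightarrow> rat"

definition formal_exp :: "weight \<Rightarrow> exp_series" where
  "formal_exp \<nu> = (\<lambda>\<mu>. if \<mu> = \<nu> then 1 else 0)"

definition exp_mult :: "exp_series \<Rightarrow> exp_series \<Rightarrow> exp_series" where
  "exp_mult F G = (\<lambda>\<mu>. \<Sum>\<nu> | F \<nu> \<noteq> 0 \<and> G (\<mu> - \<nu>) \<noteq> 0. F \<nu> * G (\<mu> - \<nu>))"

definition character ::
  "nat \<Rightarrow> (complex \<Rightarrow> 'v \<Rightarrow> 'v) \<Rightarrow> (affine \<Rightarrow> 'v \<Rightarrow> 'v::ab_group_add) \<Rightarrow> exp_series" where
  "character n smul act =
     (\<lambda>\<mu>. if \<mu> \<in> weights n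
          then of_nat (vector_space.dim smul (weight_space n smul act \<mu>)) else 0)"

text \<open>The series \<open>F\<close> evaluated at $q = e^{-\delta}$; the index set has at most one element.\<close>

definition subst_q :: "nat \<Rightarrow> rat fps \<Rightarrow> exp_series" where
  "subst_q n F = (\<lambda>\<mu>. \<Sum>k | \<mu> = weight_scale (- of_nat k) (null_root n). fps_nth F k)"

definition q_pochhammer_inf :: "rat fps" where
  "q_pochhammer_inf = prodinf (\<lambda>k. 1 - fps_X ^ (k + 1))"


section \<open>The crystal and its energy function\<close>

datatype letter = Plain nat | Barred nat

instantiation letter :: linorder
begin

fun less_eq_letter :: "letter \<Rightarrow> letter \<Rightarrow> bool" where
  "Plain i \<le> Plain j \<longleftrightarrow> i \<le> j"
| "Plain i \<le> Barred j \<longleftrightarrow> True"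
| "Barred i \<le> Plain j \<longleftrightarrow> False"
| "Barred i \<le> Barred j \<longleftrightarrow> j \<le> i"

definition less_letter :: "letter \<Rightarrow> letter \<Rightarrow> bool" where
  "x < y \<longleftrightarrow> x \<le> y \<and> \<not> y \<le> (x::letter)"

instance
proof
  fix x y z :: letter
  show "x < y \<longleftrightarrow> x \<le> y \<and> \<not> y \<le> x" by (rule less_letter_def)
  show "x \<le> x" by (cases x) auto
  show "x \<le> y \<Longrightarrow> y \<le> z \<Longrightarrow> x \<le> z" by (cases x; cases y; cases z) auto
  show "x \<le> y \<Longrightarrow> y \<le> x \<Longrightarrow> x = y" by (cases x; cases y) auto
  show "x \<le> y \<or> y \<le> x" by (cases x; cases y) auto
qed

end

fun bar :: "letter \<Rightarrow> letter" where
  "bar (Plain k) = Barred k"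
| "bar (Barred k) = Plain k"

definition letters :: "nat \<Rightarrow> letter set" where
  "letters n = Plain ` {1..n} \<union> Barred ` {1..n}"

datatype vertex = Empty | Pair letter letter

definition crystal :: "nat \<Rightarrow> vertex set" where
  "crystal n = {Empty} \<union> {Pair x y | x y. x \<in> letters n \<and> y \<in> letters n \<and> x \<le> y}"

text \<open>\<open>energy b b'\<close> is $H(b \otimes b')$.\<close>

fun energy :: "vertex \<Rightarrow> vertex \<Rightarrow> int" where
  "energy Empty Empty = 0"
| "energy Empty (Pair x y) = 1"
| "energy (Pair x y) Empty = 1"
| "energy (Pair x y) (Pair x' y') =
     (if bar y' \<noteq> x
      then of_bool (x \<ge> x') + of_bool (y \<ge> y') - of_bool (y \<ge> y' \<and> y' > x \<and> x \<ge> x')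
      else of_bool (x > x') + of_bool (y > y') - of_bool (y > y' \<and> y' > x \<and> x > x'))"


section \<open>Grounded partitions\<close>

text \<open>The colours $c_b$ being pairwise distinct, \<open>(k, b)\<close> stands for the coloured integer $k_{c_b}$.\<close>

type_synonym coloured_int = "int \<times> vertex"

definition grounded_partitions ::
  "nat \<Rightarrow> (coloured_int \<Rightarrow> coloured_int \<Rightarrow> bool) \<Rightarrow> vertex \<Rightarrow> coloured_int list set" where
  "grounded_partitions n R g =
     {\<pi>. \<pi> \<noteq> [] \<and> snd ` set \<pi> \<subseteq> crystal n \<and> successively R \<pi> \<and> last \<pi> = (0, g) \<and>
         (length \<pi> > 1 \<longrightarrow> \<pi> ! (length \<pi> - 2) \<noteq> (0, g))}"

fun rel_eq :: "coloured_int \<Rightarrow> coloured_int \<Rightarrow> bool" where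
  "rel_eq (k, b) (k', b') \<longleftrightarrow> k - k' = energy b' b"

fun rel_ge :: "coloured_int \<Rightarrow> coloured_int \<Rightarrow> bool" where
  "rel_ge (k, b) (k', b') \<longleftrightarrow> k - k' \<ge> energy b' b"

fun letter_weight :: "nat \<Rightarrow> letter \<Rightarrow> weight" where
  "letter_weight n (Plain j) =
     weight_scale (1 / 2) (simple_root n n) + (\<Sum>u\<in>{j..<n}. simple_root n u)"
| "letter_weight n (Barred j) =
     - (weight_scale (1 / 2) (simple_root n n) + (\<Sum>u\<in>{j..<n}. simple_root n u))"

fun vertex_weight :: "nat \<Rightarrow> vertex \<Rightarrow> weight" where
  "vertex_weight n Empty = 0"
| "vertex_weight n (Pair x y) = letter_weight n x + letter_weight n y"

text \<open>$C(\pi)q^{|\pi|}$ is the formal exponential of the following weight.\<close>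

definition partition_exponent :: "nat \<Rightarrow> coloured_int list \<Rightarrow> weight" where
  "partition_exponent n \<pi> =
     (\<Sum>(k, b)\<leftarrow>\<pi>. vertex_weight n b) - weight_scale (of_int (\<Sum>(k, b)\<leftarrow>\<pi>. k)) (null_root n)"

text \<open>The sum $\sum_{\pi \in P} C(\pi)q^{|\pi|}$ is meaningful if each exponent occurs finitely often.\<close>

definition locally_finite :: "nat \<Rightarrow> coloured_int list set \<Rightarrow> bool" where
  "locally_finite n P \<longleftrightarrow> (\<forall>\<mu>. finite {\<pi>\<in>P. partition_exponent n \<pi> = \<mu>})"

definition generating_function :: "nat \<Rightarrow> coloured_int list set \<Rightarrow> exp_series" where
  "generating_function n P = (\<lambda>\<mu>. \<Sum>\<pi> | \<pi> \<in> P \<and> partition_exponent n \<pi> = \<mu>. 1)"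

definition ground :: "nat \<Rightarrow> vertex" where
  "ground i = (if i = 0 then Empty else Pair (Plain i) (Barred i))"

end

theory Submission
  imports Defs
begin

text \<open>
  Multiply both the character of $L(\Lambda_i)$ and the generating function of paths by the Weyl
  denominator $e^\rho\prod_{\alpha>0}(1-e^{-\alpha})^{\mathrm{mult}\,\alpha}$. The products are
  antisymmetric under simple reflections (by $\mathfrak{sl}_2$-theory, respectively by reflecting
  $i$-strings of the crystal) and have weights of bounded height, so they are determined by their
  coefficients at strictly dominant weights. At such weights both vanish except for the
  coefficient $1$ at $\Lambda_i+\rho$. For the character this is Kac's argument: the Casimir operator gives
  Freudenthal's formula, and together with $|u|^2=|\rho|^2$ on the support of the denominator it
  forces $|v|^2=|\Lambda_i+\rho|^2$ wherever the product has a nonzero coefficient at $v$. That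
  support property is in turn obtained from a Peterson type recursion for the denominator. For paths, a strictly
  dominant weight of level $n+2$ is some $\Lambda_j+\rho$ up to $\delta$, and a sign-reversing involution, which
  reflects the first string that obstructs dominance, cancels everything but the ground path.
  Finally, a sequence for the relation $\gg$ is a path together with an ordinary partition
  recording the excess over minimal energy.
\<close>

section \<open>The affine root system\<close>

text \<open>The Weyl group is never formed: antisymmetry under simple reflections and a height bound
  already push every weight into the dominant chamber, one reflection at a time. The delicate point
  is the norm on the support of the denominator. Outside the open chamber it follows from
  reflections by induction, but a strictly dominant weight of the support is only known to be \<rho>
  - k\<delta>, and no reflection to a higher weight is left. There the recursion has to be
  evaluated. It vanishes because the n imaginary root vectors contribute 4n(n+1) times a divisor
  sum, and pairs of opposite real roots contribute minus the same divisor sum times the total square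
  length of the finite roots, which is again 4n(n+1). On the path side the corresponding work is
  done by the level: all coroot labels of C_n^(1) are 1, so a strictly dominant weight of level n+2
  pairs to 2 with one simple coroot and to 1 with the others, and only the ground vertex of that
  index fails to obstruct.\<close>

text \<open>Coordinate \<open>0\<close> is the coefficient of $\delta$, the coordinates \<open>1, \<dots>, n\<close> are those of
  $\epsilon_1, \dots, \epsilon_n$, and coordinate \<open>n + 1\<close> is the level.\<close>

type_synonym wt = "nat \<Rightarrow> int"

lemma sum_fun_apply: "(\<Sum>a\<in>A. f a) j = (\<Sum>a\<in>A. f a j)"
  by (induction A rule: infinite_finite_induct) auto

definition unitv :: "nat \<Rightarrow> wt" where
  "unitv k = (\<lambda>j. if j = k then 1 else 0)"

definition sc :: "int \<Rightarrow> wt \<Rightarrow> wt" where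
  "sc k u = (\<lambda>j. k * u j)"

fun lw :: "letter \<Rightarrow> wt" where
  "lw (Plain j) = unitv j"
| "lw (Barred j) = - unitv j"

lemma unitv_simps [simp]: "unitv k k = 1" "j \<noteq> k \<Longrightarrow> unitv k j = 0"
  by (auto simp: unitv_def)

lemma sc_simps [simp]: "sc 0 u = 0" "sc 1 u = u" "sc k u j = k * u j"
  by (auto simp: sc_def fun_eq_iff)

lemma sc_linear:
  "sc k (u + v) = sc k u + sc k v" "sc k (u - v) = sc k u - sc k v"
  "sc (k + l) u = sc k u + sc l u" "sc (k - l) u = sc k u - sc l u"
  "sc (- k) u = - sc k u" "sc k (- u) = - sc k u" "sc k (sc l u) = sc (k * l) u"
  by (auto simp: sc_def fun_eq_iff algebra_simps)

lemma bar_bar [simp]: "bar (bar x) = x"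
  by (cases x) auto

lemma bar_letters [simp]: "bar x \<in> letters n \<longleftrightarrow> x \<in> letters n"
  by (cases x) (auto simp: letters_def)

lemma bar_eq_iff [simp]: "bar x = bar y \<longleftrightarrow> x = y"
  by (metis bar_bar)

lemma bar_neq [simp]: "bar x \<noteq> x" "x \<noteq> bar x"
  by (cases x; simp)+

lemma bar_le_iff [simp]: "bar x \<le> bar y \<longleftrightarrow> y \<le> x"
  by (cases x; cases y) auto

lemma bar_less_iff [simp]: "bar x < bar y \<longleftrightarrow> y < x"
  by (simp add: less_letter_def)

lemma less_letter_simps [simp]:
  "Plain i < Plain j \<longleftrightarrow> i < j" "Plain i < Barred j" "\<not> Barred i < Plain j"
  "Barred i < Barred j \<longleftrightarrow> j < i"
  by (auto simp: less_letter_def)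

lemma lw_bar [simp]: "lw (bar x) = - lw x"
  by (cases x) auto

lemma finite_letters [simp]: "finite (letters n)"
  by (simp add: letters_def)

lemma Plain_letters [simp]: "Plain j \<in> letters n \<longleftrightarrow> 1 \<le> j \<and> j \<le> n"
  and Barred_letters [simp]: "Barred j \<in> letters n \<longleftrightarrow> 1 \<le> j \<and> j \<le> n"
  by (auto simp: letters_def)

fun swap_letter :: "nat \<Rightarrow> nat \<Rightarrow> letter \<Rightarrow> letter" where
  "swap_letter n i (Plain j) = (if i = 0 \<and> j = 1 then Barred 1 else if i = 0 then Plain j
     else if i = n then (if j = n then Barred n else Plain j)
     else if j = i then Plain (i + 1) else if j = i + 1 then Plain i else Plain j)"
| "swap_letter n i (Barred j) = (if i = 0 \<and> j = 1 then Plain 1 else if i = 0 then Barred j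
     else if i = n then (if j = n then Plain n else Barred j)
     else if j = i then Barred (i + 1) else if j = i + 1 then Barred i else Barred j)"

locale type_C =
  fixes n :: nat
  assumes n_pos: "1 \<le> n"
begin

definition delta :: wt where
  "delta = unitv 0"

definition simple :: "nat \<Rightarrow> wt" where
  "simple i = (if i = 0 then delta - sc 2 (unitv 1) else if i = n then sc 2 (unitv n)
               else unitv i - unitv (i + 1))"

text \<open>Values on the simple coroots. The coroot of index 0 is the central element minus the
  coroot of the highest root, hence level minus coordinate 1.\<close>

definition cp :: "nat \<Rightarrow> wt \<Rightarrow> int" where
  "cp i u = (if i = 0 then u (n + 1) - u 1 else if i = n then u n else u i - u (i + 1))"

definition srefl :: "nat \<Rightarrow> wt \<Rightarrow> wt" where
  "srefl i u = u - sc (cp i u) (simple i)"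

text \<open>Twice the normalised form: the \<epsilon>_j are orthonormal, so long roots have square
  length 4, and (\<delta>, v) is twice the level of v. This scale is integral on all weights that
  occur.\<close>

definition form :: "wt \<Rightarrow> wt \<Rightarrow> int" where
  "form u v = (\<Sum>j=1..n. u j * v j) + 2 * (u (n + 1) * v 0 + u 0 * v (n + 1))"

text \<open>Twice the height on the root lattice: simple roots have value 2. The factor two keeps
  the values on the \<epsilon>_j integral, and \<delta> gets 4n, twice the Coxeter number
  2n.\<close>

definition ht :: "wt \<Rightarrow> int" where
  "ht u = 4 * int n * u 0 + (\<Sum>j=1..n. (2 * (int n - int j) + 1) * u j)"

text \<open>The level n+1 is the dual Coxeter number; the \<delta>-coordinate is normalised to
  0.\<close>

definition rho :: wt where
  "rho = (\<lambda>j. if j = 0 then 0 else if j \<le> n + 1 then int (n + 1 - j) else 0) + sc (int n + 1) (unitv (n + 1))"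

lemma form_linear:
  "form (u + u') v = form u v + form u' v" "form u (v + v') = form u v + form u v'"
  "form (u - u') v = form u v - form u' v" "form u (v - v') = form u v - form u v'"
  "form (sc k u) v = k * form u v" "form u (sc k v) = k * form u v"
  "form (- u) v = - form u v" "form u (- v) = - form u v" "form 0 v = 0" "form u 0 = 0"
  by (simp_all add: form_def sum.distrib sum_subtractf sum_distrib_left sum_negf algebra_simps)

lemma form_commute: "form u v = form v u"
  by (simp add: form_def mult.commute add.commute)

lemma form_sum: "form u (\<Sum>a\<in>A. f a) = (\<Sum>a\<in>A. form u (f a))"
  by (induction A rule: infinite_finite_induct)
     (simp_all only: sum.infinite sum.empty sum.insert not_False_eq_True form_linear)

lemma ht_linear:
  "ht (u + v) = ht u + ht v" "ht (u - v) = ht u - ht v" "ht (sc k u) = k * ht u" "ht (- u) = - ht u"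
  "ht 0 = 0"
  by (simp_all add: ht_def sum.distrib sum_subtractf sum_distrib_left sum_negf algebra_simps)

lemma ht_sum: "ht (\<Sum>a\<in>A. f a) = (\<Sum>a\<in>A. ht (f a))"
  by (induction A rule: infinite_finite_induct)
     (simp_all only: sum.infinite sum.empty sum.insert not_False_eq_True ht_linear)

lemma cp_linear:
  "cp i (u + v) = cp i u + cp i v" "cp i (u - v) = cp i u - cp i v" "cp i (sc k u) = k * cp i u"
  "cp i (- u) = - cp i u" "cp i 0 = 0"
  by (simp_all add: cp_def algebra_simps)

lemma sum_unitv: "finite A \<Longrightarrow> (\<Sum>j\<in>A. f j * unitv k j) = (if k \<in> A then f k else 0)"
  by (simp add: unitv_def if_distrib sum.delta cong: if_cong)

lemma sum_unitv': "finite A \<Longrightarrow> (\<Sum>j\<in>A. unitv k j * f j) = (if k \<in> A then f k else 0)"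
  using sum_unitv[of A f k] by (simp add: mult.commute)

lemma form_unitv: "form (unitv k) v =
    (if k = 0 then 2 * v (n + 1) else if k \<le> n then v k else if k = n + 1 then 2 * v 0 else 0)"
  by (auto simp: form_def sum_unitv')

lemma ht_unitv: "ht (unitv k) = (if k = 0 then 4 * int n else if k \<le> n then 2 * (int n - int k) + 1 else 0)"
  by (auto simp: ht_def sum_unitv)

lemma ht_delta: "ht delta = 4 * int n"
  by (simp add: delta_def ht_unitv)

lemma ht_simple: "i \<le> n \<Longrightarrow> ht (simple i) = 2"
  using n_pos by (auto simp: simple_def ht_linear ht_unitv delta_def)

definition half_norm :: "nat \<Rightarrow> int" where
  "half_norm i = (if i = 0 \<or> i = n then 2 else 1)"

lemma form_simple: "i \<le> n \<Longrightarrow> form (simple i) v = half_norm i * cp i v"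
  using n_pos by (auto simp: simple_def form_linear form_unitv delta_def half_norm_def cp_def)

lemma cp_simple: "i \<le> n \<Longrightarrow> cp i (simple i) = 2"
  using n_pos by (auto simp: simple_def cp_def delta_def unitv_def)

lemma form_simple': "i \<le> n \<Longrightarrow> form v (simple i) = half_norm i * cp i v"
  using form_simple form_commute by metis

lemma form_srefl: "i \<le> n \<Longrightarrow> form (srefl i u) (srefl i v) = form u v"
  by (simp add: srefl_def form_linear form_simple form_simple' cp_simple algebra_simps)

lemma srefl_linear: "srefl i (u + v) = srefl i u + srefl i v" "srefl i (u - v) = srefl i u - srefl i v"
  "srefl i (sc k u) = sc k (srefl i u)" "srefl i 0 = 0"
  by (simp_all add: srefl_def cp_linear sc_linear)

lemma srefl_sum: "srefl i (\<Sum>a\<in>A. f a) = (\<Sum>a\<in>A. srefl i (f a))"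
  by (induction A rule: infinite_finite_induct)
     (simp_all only: sum.infinite sum.empty sum.insert not_False_eq_True srefl_linear)

lemma cp_srefl: "i \<le> n \<Longrightarrow> cp i (srefl i u) = - cp i u"
  by (simp add: srefl_def cp_linear cp_simple)

lemma srefl_srefl: "i \<le> n \<Longrightarrow> srefl i (srefl i u) = u"
  using cp_srefl[of i u] by (simp add: srefl_def[of i "srefl i u"]) (simp add: srefl_def sc_linear)

lemma ht_srefl: "i \<le> n \<Longrightarrow> ht (srefl i u) = ht u - 2 * cp i u"
  by (simp add: srefl_def ht_linear ht_simple)

lemma cp_rho: "i \<le> n \<Longrightarrow> cp i rho = 1"
  using n_pos by (auto simp: cp_def rho_def unitv_def)

lemma srefl_rho: "i \<le> n \<Longrightarrow> srefl i rho = rho - simple i"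
  by (simp add: srefl_def cp_rho)

text \<open>A weight on a wall is fixed by its reflection, so F vanishes there; a negative pairing
  makes the reflection raise the height. The climb stays below \<open>b\<close>, so it ends on a
  wall or in the open dominant chamber.\<close>

lemma antisymmetric_zero:
  fixes F :: "wt \<Rightarrow> int"
  assumes anti: "\<And>i u. i \<le> n \<Longrightarrow> F (srefl i u) = - F u"
    and bounded: "\<And>u. F u \<noteq> 0 \<Longrightarrow> ht u \<le> b"
    and dominant: "\<And>u. (\<And>i. i \<le> n \<Longrightarrow> 0 < cp i u) \<Longrightarrow> F u = 0"
  shows "F u = 0"
proof (induction "nat (b - ht u)" arbitrary: u rule: less_induct)
  case less
  show ?case
  proof (rule ccontr)
    assume nz: "F u \<noteq> 0"
    then obtain i where i: "i \<le> n" "cp i u \<le> 0"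
      using dominant[of u] by (meson not_less)
    have "cp i u \<noteq> 0"
    proof
      assume "cp i u = 0"
      then have "srefl i u = u" by (simp add: srefl_def)
      with anti[OF i(1), of u] nz show False by simp
    qed
    with i have "ht u < ht (srefl i u)" by (simp add: ht_srefl)
    moreover have "F (srefl i u) \<noteq> 0" using anti[OF i(1)] nz by simp
    ultimately show False
      using less[of "srefl i u"] bounded[of "srefl i u"] by simp
  qed
qed

section \<open>The Weyl denominator\<close>

text \<open>The index \<open>(x, y, m)\<close> with \<open>x \<le> y\<close> stands for the root vector $xy\otimes t^m$, where $\mathfrak{sp}_{2n}$ is
  the symmetric square of the vector representation; the imaginary root $m\delta$ thus occurs with its multiplicity \<open>n\<close>.\<close>

fun rt :: "letter \<times> letter \<times> int \<Rightarrow> wt" where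
  "rt (x, y, m) = lw x + lw y + sc m delta"

declare rt.simps [simp del]

definition PR :: "(letter \<times> letter \<times> int) set" where
  "PR = {(x, y, m). x \<in> letters n \<and> y \<in> letters n \<and> x \<le> y \<and> 0 < ht (rt (x, y, m))}"

lemma ht_lw_bound: "x \<in> letters n \<Longrightarrow> \<bar>ht (lw x)\<bar> \<le> 2 * int n - 1"
  by (cases x) (auto simp: ht_unitv ht_linear)

lemma ht_lw_less: "x \<in> letters n \<Longrightarrow> y \<in> letters n \<Longrightarrow> ht (lw x) < ht (lw y) \<longleftrightarrow> y < x"
  by (cases x; cases y) (auto simp: ht_unitv ht_linear)

lemma ht_rt: "ht (rt (x, y, m)) = ht (lw x) + ht (lw y) + 4 * int n * m"
  by (simp add: rt.simps ht_linear ht_delta)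

text \<open>The finite part of a root has height at most 4n - 2 in absolute value and \<delta> has
  height 4n, so \<open>m\<close> decides the sign unless it is 0; in degree 0 a larger letter has
  smaller height.\<close>

lemma ht_rt_pos_iff:
  assumes "x \<in> letters n" "y \<in> letters n"
  shows "0 < ht (rt (x, y, m)) \<longleftrightarrow> 1 \<le> m \<or> m = 0 \<and> x < bar y"
proof -
  note b = ht_lw_bound[OF assms(1)] ht_lw_bound[OF assms(2)]
  consider "m \<ge> 1" | "m = 0" | "m \<le> -1" by linarith
  then show ?thesis
  proof cases
    case 1
    then have "4 * int n * 1 \<le> 4 * int n * m" by (intro mult_left_mono) auto
    then show ?thesis using 1 b by (simp add: ht_rt)
  next
    case 2
    then show ?thesis using ht_lw_less[of "bar y" x] assms by (auto simp: ht_rt ht_linear)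
  next
    case 3
    then have "4 * int n * m \<le> 4 * int n * (-1)" by (intro mult_left_mono) auto
    then have "4 * int n * m \<le> - 4 * int n" by simp
    then have "\<not> 0 < ht (rt (x, y, m))" using b unfolding ht_rt by linarith
    then show ?thesis using 3 by auto
  qed
qed

lemma PR_iff: "(x, y, m) \<in> PR \<longleftrightarrow>
    x \<in> letters n \<and> y \<in> letters n \<and> x \<le> y \<and> (1 \<le> m \<or> m = 0 \<and> x < bar y)"
  using ht_rt_pos_iff by (auto simp: PR_def)

lemma PR_ht_pos: "a \<in> PR \<Longrightarrow> 0 < ht (rt a)"
  by (auto simp: PR_def)

lemma finite_PR_le: "finite {a \<in> PR. ht (rt a) \<le> N}"
proof (rule finite_subset)
  show "{a \<in> PR. ht (rt a) \<le> N} \<subseteq> letters n \<times> letters n \<times> {0..\<bar>N\<bar> + 1}"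
  proof
    fix a assume "a \<in> {a \<in> PR. ht (rt a) \<le> N}"
    then obtain x y m where e: "a = (x, y, m)" and a: "(x, y, m) \<in> PR" "ht (rt (x, y, m)) \<le> N"
      by (cases a) auto
    then have l: "x \<in> letters n" "y \<in> letters n" by (auto simp: PR_iff)
    have m: "0 \<le> m" using a by (auto simp: PR_iff)
    have "4 * int n * m \<le> N + (4 * int n - 2)"
      using a ht_lw_bound[of x] ht_lw_bound[of y] by (auto simp: PR_iff ht_rt)
    then have "4 * int n * (m - 1) \<le> \<bar>N\<bar>" by (simp add: algebra_simps)
    moreover have "m - 1 \<le> 4 * int n * (m - 1)" if "m \<ge> 1"
      using that n_pos mult_right_mono[of 1 "4 * int n" "m - 1"] by simp
    ultimately have "m \<in> {0..\<bar>N\<bar> + 1}" using m by (cases "m \<ge> 1") auto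
    then show "a \<in> letters n \<times> letters n \<times> {0..\<bar>N\<bar> + 1}" using l e by simp
  qed
qed auto

definition subsets_to :: "wt \<Rightarrow> (letter \<times> letter \<times> int) set set" where
  "subsets_to g = {A. finite A \<and> A \<subseteq> PR \<and> sum rt A = g}"

text \<open>The coefficient of $e^u$ in the Weyl denominator $e^\rho\prod(1-e^{-\alpha})$.\<close>

definition S :: "wt \<Rightarrow> int" where
  "S u = (\<Sum>A\<in>subsets_to (rho - u). (-1) ^ card A)"

lemma subsets_to_bound: "A \<in> subsets_to g \<Longrightarrow> A \<subseteq> {a \<in> PR. ht (rt a) \<le> ht g}"
proof (clarsimp)
  fix a b c assume A: "A \<in> subsets_to g" and a: "(a, b, c) \<in> A"
  then have *: "finite A" "A \<subseteq> PR" "sum rt A = g" by (auto simp: subsets_to_def)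
  then have "ht g = (\<Sum>a\<in>A. ht (rt a))" by (simp add: ht_sum[symmetric])
  also have "\<dots> \<ge> ht (rt (a, b, c))"
    using * a PR_ht_pos by (intro member_le_sum) (force intro: less_imp_le)+
  finally show "(a, b, c) \<in> PR \<and> ht (rt (a, b, c)) \<le> ht g" using * a by auto
qed

lemma finite_subsets_to: "finite (subsets_to g)"
  by (rule finite_subset[of _ "Pow {a \<in> PR. ht (rt a) \<le> ht g}"])
     (use subsets_to_bound finite_PR_le in auto)

lemma subsets_to_ht: "A \<in> subsets_to g \<Longrightarrow> 0 \<le> ht g \<and> (ht g = 0 \<longrightarrow> A = {})"
proof -
  assume A: "A \<in> subsets_to g"
  then have *: "finite A" "A \<subseteq> PR" "sum rt A = g" by (auto simp: subsets_to_def)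
  then have g: "ht g = (\<Sum>a\<in>A. ht (rt a))" by (simp add: ht_sum[symmetric])
  have pos: "\<And>a. a \<in> A \<Longrightarrow> 0 < ht (rt a)" using * PR_ht_pos by auto
  show ?thesis
  proof (cases "A = {}")
    case False
    then have "0 < (\<Sum>a\<in>A. ht (rt a))" using *(1) pos by (intro sum_pos) auto
    then show ?thesis using g by simp
  qed (use g in simp)
qed

lemma S_bound: "S u \<noteq> 0 \<Longrightarrow> ht u \<le> ht rho"
proof -
  assume "S u \<noteq> 0"
  then obtain A where "A \<in> subsets_to (rho - u)" unfolding S_def by (meson sum.neutral)
  then show ?thesis using subsets_to_ht by (fastforce simp: ht_linear)
qed

lemma S_top: "ht u = ht rho \<Longrightarrow> S u = (if u = rho then 1 else 0)"
proof -
  assume h: "ht u = ht rho"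
  have "A = {}" if "A \<in> subsets_to (rho - u)" for A
    using subsets_to_ht[OF that] h by (simp add: ht_linear)
  moreover have "{} \<in> subsets_to (rho - u) \<longleftrightarrow> u = rho" by (auto simp: subsets_to_def)
  ultimately have c: "A \<in> subsets_to (rho - u) \<longleftrightarrow> A = {} \<and> u = rho" for A by metis
  have "subsets_to (rho - u) = (if u = rho then {{}} else {})"
  proof (cases "u = rho")
    case True
    then have "subsets_to (rho - u) = {{}}" using c by blast
    then show ?thesis using True by simp
  next
    case False
    then have "subsets_to (rho - u) = {}" using c by blast
    then show ?thesis using False by simp
  qed
  then show ?thesis by (simp add: S_def)
qed

lemma S_rho: "S rho = 1"
  by (simp add: S_top)

section \<open>Antisymmetry of the denominator under simple reflections\<close>

lemma swl_swl: "i \<le> n \<Longrightarrow> swap_letter n i (swap_letter n i x) = x"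
  using n_pos by (cases x) auto

lemma swl_letters: "i \<le> n \<Longrightarrow> x \<in> letters n \<Longrightarrow> swap_letter n i x \<in> letters n"
  using n_pos by (cases x) auto

text \<open>Only s_0 leaves the span of the \<epsilon>_j: it swaps the letters 1 and bar 1 and adds
  a multiple of \<delta>. That multiple becomes the shift of the loop degree in
  \<open>srt\<close>.\<close>

lemma srefl_lw: "i \<le> n \<Longrightarrow> x \<in> letters n \<Longrightarrow>
    srefl i (lw x) = lw (swap_letter n i x) + sc (if i = 0 then lw x 1 else 0) delta"
  using n_pos
  by (cases x) (auto simp: srefl_def cp_def simple_def fun_eq_iff delta_def unitv_def)

lemma srefl_delta: "i \<le> n \<Longrightarrow> srefl i delta = delta"
  using n_pos by (auto simp: srefl_def cp_def delta_def unitv_def)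

fun srt :: "nat \<Rightarrow> letter \<times> letter \<times> int \<Rightarrow> letter \<times> letter \<times> int" where
  "srt i (x, y, m) = (min (swap_letter n i x) (swap_letter n i y), max (swap_letter n i x) (swap_letter n i y),
      m + (if i = 0 then lw x 1 + lw y 1 else 0))"

lemma rt_srt: "i \<le> n \<Longrightarrow> x \<in> letters n \<Longrightarrow> y \<in> letters n \<Longrightarrow> rt (srt i (x, y, m)) = srefl i (rt (x, y, m))"
  by (auto simp: rt.simps srefl_linear srefl_lw srefl_delta min_def max_def sc_linear add_ac)

definition simple_index :: "nat \<Rightarrow> letter \<times> letter \<times> int" where
  "simple_index i = (if i = 0 then (Barred 1, Barred 1, 1) else if i = n then (Plain n, Plain n, 0)
     else (Plain i, Barred (i + 1), 0))"

lemma rt_simple_index: "i \<le> n \<Longrightarrow> rt (simple_index i) = simple i"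
  by (auto simp: rt.simps simple_index_def simple_def fun_eq_iff)

lemma simple_index_PR: "i \<le> n \<Longrightarrow> simple_index i \<in> PR"
  using n_pos by (auto simp: simple_index_def PR_iff)

lemma lw_swl_1: "x \<in> letters n \<Longrightarrow> lw (swap_letter n 0 x) (Suc 0) = - lw x (Suc 0)"
  by (cases x) (auto simp: unitv_def)

lemma srt_srt: "i \<le> n \<Longrightarrow> (x, y, m) \<in> PR \<Longrightarrow> srt i (srt i (x, y, m)) = (x, y, m)"
  by (auto simp: PR_iff min_def max_def swl_swl lw_swl_1)

lemma swl_mono:
  assumes "1 \<le> i" "i \<le> n" "x \<in> letters n" "y \<in> letters n" "x < y"
    "(x, y) \<noteq> (Plain i, Plain (i + 1))" "(x, y) \<noteq> (Barred (i + 1), Barred i)"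
    "\<not> (i = n \<and> x = Plain n \<and> y = Barred n)"
  shows "swap_letter n i x < swap_letter n i y"
  using assms by (cases x; cases y) (auto split: if_splits)

lemma swl_bar: "swap_letter n i (bar x) = bar (swap_letter n i x)"
  by (cases x) auto

text \<open>For i >= 1 the letter swap keeps the order of any two letters that it does not exchange
  (\<open>swl_mono\<close>), hence positivity in degree 0; for i = 0 the degree shift compensates
  the exchange of the two extreme letters.\<close>

lemma srt_PR:
  assumes i: "i \<le> n" and a: "(x, y, m) \<in> PR" "(x, y, m) \<noteq> simple_index i"
  shows "srt i (x, y, m) \<in> PR"
proof -
  have l: "x \<in> letters n" "y \<in> letters n" "x \<le> y" and p: "1 \<le> m \<or> m = 0 \<and> x < bar y"
    using a by (auto simp: PR_iff)
  have sl: "swap_letter n i x \<in> letters n" "swap_letter n i y \<in> letters n" using l i swl_letters by auto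
  have comm: "a < bar b \<longleftrightarrow> b < bar a" for a b by (cases a; cases b) auto
  have "1 \<le> m' \<or> m' = 0 \<and> swap_letter n i x < bar (swap_letter n i y)" if "m' = m + (if i = 0 then lw x 1 + lw y 1 else 0)" for m'
  proof (cases "i = 0")
    case True
    then show ?thesis
      using l p a(2) that n_pos
      by (cases x; cases y) (auto simp: simple_index_def unitv_def split: if_splits)
  next
    case False
    show ?thesis
    proof (cases "m = 0")
      case True
      then have "x < bar y" using p by auto
      then have "swap_letter n i x < swap_letter n i (bar y)"
        using False i l a(2) True
        by (intro swl_mono) (cases y; auto simp: simple_index_def split: if_splits)+
      then show ?thesis using that False True by (simp add: swl_bar)
    qed (use that False p in auto)
  qed
  then show ?thesis using sl comm by (auto simp: PR_iff min_def max_def)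
qed

text \<open>Since s_i \<rho> = \<rho> - \<alpha>_i, the product of e^\<rho> and the factor 1 -
  e^{-\<alpha>_i} changes sign, while the other factors are permuted. On subsets: reflect all other
  roots and toggle \<alpha>_i, which changes the parity of the cardinality.\<close>

lemma S_srefl:
  assumes i: "i \<le> n"
  shows "S (srefl i u) = - S u"
proof -
  let ?a = "simple_index i"
  define t where "t A = srt i ` (A - {?a}) \<union> (if ?a \<in> A then {} else {?a})" for A
  have inj: "inj_on (srt i) (PR - {?a})"
    by (rule inj_on_inverseI[where g = "srt i"]) (use srt_srt i in \<open>auto simp del: srt.simps\<close>)
  have stab: "srt i a \<in> PR - {?a}" if "a \<in> PR - {?a}" for a
  proof -
    obtain x y m where [simp]: "a = (x, y, m)" by (cases a)
    have "srt i a \<noteq> ?a"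
    proof
      assume "srt i a = ?a"
      then have "srefl i (rt a) = simple i"
        using rt_srt[OF i, of x y m] rt_simple_index[OF i] that by (auto simp: PR_iff simp del: srt.simps)
      then have "rt a = srefl i (simple i)" using srefl_srefl[OF i, of "rt a"] by simp
      also have "\<dots> = - simple i" by (simp add: srefl_def cp_simple i) (simp add: fun_eq_iff)
      finally have "ht (rt a) = -2" by (simp add: ht_linear ht_simple i)
      then show False using PR_ht_pos[of a] that by auto
    qed
    then show ?thesis using srt_PR[OF i, of x y m] that by auto
  qed
  have rts: "rt (srt i a) = srefl i (rt a)" if "a \<in> PR" for a
    using that rt_srt[OF i] by (cases a) (auto simp: PR_iff simp del: srt.simps)
  have props: "t A \<in> subsets_to (rho - srefl i v) \<and> (-1) ^ card (t A) = - ((-1::int) ^ card A) \<and> t (t A) = A"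
    if A: "A \<in> subsets_to (rho - v)" for A v
  proof -
    have fin: "finite A" and sub: "A \<subseteq> PR" and sm: "sum rt A = rho - v" using A by (auto simp: subsets_to_def)
    let ?B = "srt i ` (A - {?a})"
    have injA: "inj_on (srt i) (A - {?a})" using inj sub by (meson Diff_mono inj_on_subset order_refl)
    have "?B \<subseteq> PR - {?a}" using stab sub by (intro image_subsetI) blast
    then have aB: "?a \<notin> ?B" and Bsub: "?B \<subseteq> PR" by auto
    have sB: "sum rt ?B = srefl i (sum rt (A - {?a}))"
      using injA rts sub by (auto simp add: sum.reindex srefl_sum intro!: sum.cong)
    have cB: "card ?B = card (A - {?a})" using injA by (rule card_image)
    have BB: "srt i ` ?B = A - {?a}"
      unfolding image_image using sub srt_srt[OF i] by (force simp del: srt.simps)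
    show ?thesis
    proof (cases "?a \<in> A")
      case True
      have "sum rt (A - {?a}) = rho - v - simple i"
        using sum.remove[OF fin True, of rt] sm rt_simple_index[OF i] by (simp add: algebra_simps)
      then have "sum rt ?B = rho - srefl i v"
        using sB i by (simp add: srefl_linear srefl_rho) (simp add: srefl_def cp_simple sc_linear(5) fun_eq_iff)
      moreover have "card A = Suc (card (A - {?a}))" using card_Suc_Diff1[OF fin True] by simp
      moreover have "t A = ?B" using True by (simp add: t_def)
      moreover have "t ?B = A" using aB BB True by (auto simp: t_def)
      ultimately show ?thesis using fin Bsub cB by (simp add: subsets_to_def)
    next
      case False
      then have e: "A - {?a} = A" by simp
      have "sum rt (insert ?a ?B) = rho - srefl i v"
        using fin aB sB sm i False by (simp add: e rt_simple_index srefl_linear srefl_rho)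
      moreover have "t A = insert ?a ?B" using False by (simp add: t_def)
      moreover have "t (insert ?a ?B) = A"
        using aB BB False by (simp add: t_def e)
      moreover have "card (insert ?a ?B) = Suc (card A)" using fin aB cB e by simp
      ultimately show ?thesis using fin Bsub simple_index_PR[OF i] by (simp add: subsets_to_def)
    qed
  qed
  have "bij_betw t (subsets_to (rho - u)) (subsets_to (rho - srefl i u))"
    by (rule bij_betw_byWitness[where f' = t])
       (use props[of _ u] props[of _ "srefl i u"] srefl_srefl[OF i] in auto)
  then have "S (srefl i u) = (\<Sum>A\<in>subsets_to (rho - u). (-1) ^ card (t A))"
    unfolding S_def by (rule sum.reindex_bij_betw[symmetric])
  also have "\<dots> = - S u" using props by (simp add: S_def sum_negf)
  finally show ?thesis .
qed

lemma S_support: "S u \<noteq> 0 \<Longrightarrow> \<exists>A. finite A \<and> A \<subseteq> PR \<and> rho - u = sum rt A"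
proof -
  assume "S u \<noteq> 0"
  then obtain A where "A \<in> subsets_to (rho - u)" unfolding S_def by (meson sum.neutral)
  then show ?thesis by (auto simp: subsets_to_def)
qed

section \<open>Logarithmic derivative of the denominator\<close>

definition PK :: "int \<Rightarrow> ((letter \<times> letter \<times> int) \<times> nat) set" where
  "PK N = {(a, k). a \<in> PR \<and> 1 \<le> k \<and> int k * ht (rt a) \<le> N}"

lemma finite_PK: "finite (PK N)"
proof (rule finite_subset)
  show "PK N \<subseteq> {a \<in> PR. ht (rt a) \<le> N} \<times> {..nat N}"
  proof
    fix p assume "p \<in> PK N"
    then obtain a k where p: "p = (a, k)" "a \<in> PR" "1 \<le> k" "int k * ht (rt a) \<le> N"
      by (auto simp: PK_def)
    have h: "1 \<le> ht (rt a)" using PR_ht_pos[OF p(2)] by simp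
    have "1 * ht (rt a) \<le> int k * ht (rt a)" using p h by (intro mult_right_mono) auto
    moreover have "int k * 1 \<le> int k * ht (rt a)" using h by (intro mult_left_mono) auto
    ultimately have "ht (rt a) \<le> N" "int k \<le> N" using p(4) by linarith+
    then show "p \<in> {a \<in> PR. ht (rt a) \<le> N} \<times> {..nat N}" using p by auto
  qed
qed (use finite_PR_le in auto)

text \<open>The logarithmic derivative of e^\<rho> prod (1 - e^{-a}) is \<rho> plus the sum of a
  e^{-ka} over all a and k >= 1. Multiplying back and comparing coefficients of e^v gives the
  recursion, one coordinate at a time. The bound on N ensures that \<open>PK N\<close> drops only
  terms above \<rho>, where S vanishes.\<close>

lemma S_log_derivative:
  assumes N: "ht (rho - v) \<le> N"
  shows "(v j - rho j) * S v = (\<Sum>(a, k)\<in>PK N. rt a j * S (v + sc (int k) (rt a)))"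
proof -
  \<comment> \<open>\<open>Q a\<close> is the product with the factor of \<open>a\<close> left out:
    S = Q - e^{-a} Q is \<open>split\<close>, and its inversion as a geometric series is
    \<open>Qsum\<close>.\<close>
  define Q where "Q a u = (\<Sum>A\<in>{A \<in> subsets_to (rho - u). a \<notin> A}. (-1) ^ card A :: int)" for a u
  define F where "F = {a \<in> PR. ht (rt a) \<le> N}"
  have fF: "finite F" unfolding F_def by (rule finite_PR_le)
  have incl: "(\<Sum>A\<in>{A \<in> subsets_to (rho - u). a \<in> A}. (-1) ^ card A :: int) = - Q a (u + rt a)"
    if a: "a \<in> PR" for a u
  proof -
    have "bij_betw (insert a) {A \<in> subsets_to (rho - (u + rt a)). a \<notin> A} {A \<in> subsets_to (rho - u). a \<in> A}"
      by (rule bij_betw_byWitness[where f' = "\<lambda>A. A - {a}"])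
         (use a in \<open>auto simp: subsets_to_def sum.insert_remove sum_diff1 algebra_simps\<close>)
    then have "(\<Sum>A\<in>{A \<in> subsets_to (rho - u). a \<in> A}. (-1) ^ card A :: int)
        = (\<Sum>A\<in>{A \<in> subsets_to (rho - (u + rt a)). a \<notin> A}. (-1) ^ card (insert a A))"
      by (rule sum.reindex_bij_betw[symmetric])
    also have "\<dots> = - Q a (u + rt a)"
      unfolding Q_def sum_negf[symmetric] by (rule sum.cong) (auto simp: subsets_to_def)
    finally show ?thesis .
  qed
  have split: "S u = Q a u - Q a (u + rt a)" if "a \<in> PR" for a u
  proof -
    have "S u = (\<Sum>A\<in>{A \<in> subsets_to (rho - u). a \<notin> A}. (-1) ^ card A) + (\<Sum>A\<in>{A \<in> subsets_to (rho - u). a \<in> A}. (-1) ^ card A)"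
      unfolding S_def by (subst sum.union_disjoint[symmetric]) (auto simp: finite_subsets_to intro!: sum.cong)
    then show ?thesis using incl[OF that] by (simp add: Q_def)
  qed
  have Q0: "Q a u = 0" if "ht rho < ht u" for a u
  proof -
    have "subsets_to (rho - u) = {}" using subsets_to_ht[of _ "rho - u"] that by (force simp: ht_linear)
    then show ?thesis by (simp add: Q_def)
  qed
  have Qsum: "Q a u = (\<Sum>k<K. S (u + sc (int k) (rt a))) + Q a (u + sc (int K) (rt a))" if "a \<in> PR" for a u K
  proof (induction K)
    case (Suc K)
    have "u + sc (int K) (rt a) + rt a = u + sc (int (Suc K)) (rt a)"
      by (simp add: sc_linear algebra_simps)
    moreover have "Q a u = (\<Sum>k<K. S (u + sc (int k) (rt a))) + Q a (u + sc (int K) (rt a))"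
      by (rule Suc.IH)
    ultimately have "Q a u = (\<Sum>k<Suc K. S (u + sc (int k) (rt a))) + Q a (u + sc (int (Suc K)) (rt a))"
      using split[OF that, of "u + sc (int K) (rt a)"] by (simp only: sum.lessThan_Suc)
    then show ?case .
  qed simp
  have tail: "Q a (v + rt a) = (\<Sum>k\<in>{k. 1 \<le> k \<and> int k * ht (rt a) \<le> N}. S (v + sc (int k) (rt a)))"
    if a: "a \<in> PR" for a
  proof -
    have h: "1 \<le> ht (rt a)" using PR_ht_pos[OF a] by simp
    define K where "K = Suc (nat N)"
    have big: "N < int k * ht (rt a)" if "K \<le> k" for k
    proof -
      have "int k * 1 \<le> int k * ht (rt a)" using h by (intro mult_left_mono) auto
      then show ?thesis using that unfolding K_def by linarith
    qed
    have "Q a (v + rt a) = (\<Sum>k<K. S (v + rt a + sc (int k) (rt a))) + Q a (v + rt a + sc (int K) (rt a))"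
      by (rule Qsum[OF a])
    moreover have "Q a (v + rt a + sc (int K) (rt a)) = 0"
      using big[of K] N h by (intro Q0) (simp add: ht_linear)
    moreover have "(\<Sum>k<K. S (v + rt a + sc (int k) (rt a))) = (\<Sum>k<K. S (v + sc (int (Suc k)) (rt a)))"
      by (intro sum.cong) (auto simp: sc_linear algebra_simps)
    moreover have "\<dots> = (\<Sum>k\<in>{1..K}. S (v + sc (int k) (rt a)))"
      by (rule sum.reindex_bij_witness[where i = "\<lambda>k. k - 1" and j = Suc]) auto
    moreover have "\<dots> = (\<Sum>k\<in>{k. 1 \<le> k \<and> int k * ht (rt a) \<le> N}. S (v + sc (int k) (rt a)))"
    proof (rule sum.mono_neutral_right)
      show "{k. 1 \<le> k \<and> int k * ht (rt a) \<le> N} \<subseteq> {1..K}"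
        using big by (auto simp: not_le) (meson not_le_imp_less less_imp_le not_le)
      show "\<forall>k\<in>{1..K} - {k. 1 \<le> k \<and> int k * ht (rt a) \<le> N}. S (v + sc (int k) (rt a)) = 0"
      proof
        fix k assume "k \<in> {1..K} - {k. 1 \<le> k \<and> int k * ht (rt a) \<le> N}"
        then have "ht rho < ht (v + sc (int k) (rt a))" using N by (auto simp: ht_linear)
        then show "S (v + sc (int k) (rt a)) = 0" using S_bound by force
      qed
    qed auto
    ultimately show ?thesis by simp
  qed
  have "(v j - rho j) * S v = (\<Sum>A\<in>subsets_to (rho - v). (-1) ^ card A * (v j - rho j))"
    by (simp add: S_def sum_distrib_left mult.commute)
  also have "\<dots> = (\<Sum>A\<in>subsets_to (rho - v). \<Sum>a\<in>F. if a \<in> A then - ((-1) ^ card A * rt a j) else 0)"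
  proof (rule sum.cong)
    fix A assume A: "A \<in> subsets_to (rho - v)"
    then have "sum rt A = rho - v" "finite A" by (auto simp: subsets_to_def)
    then have e: "(\<Sum>a\<in>A. rt a j) = rho j - v j" using sum_fun_apply[of rt A j] by simp
    have "A \<subseteq> F" using subsets_to_bound[OF A] N by (auto simp: F_def)
    then have "(\<Sum>a\<in>F. if a \<in> A then - ((-1) ^ card A * rt a j) else 0) = (\<Sum>a\<in>A. - ((-1) ^ card A * rt a j))"
      using fF by (simp add: sum.If_cases Int_absorb1)
    also have "\<dots> = (-1) ^ card A * (v j - rho j)"
      by (simp only: sum_negf sum_distrib_left[symmetric] e) (simp add: algebra_simps)
    finally show "(-1) ^ card A * (v j - rho j) = (\<Sum>a\<in>F. if a \<in> A then - ((-1) ^ card A * rt a j) else 0)" by simp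
  qed simp
  also have "\<dots> = (\<Sum>a\<in>F. \<Sum>A\<in>subsets_to (rho - v). if a \<in> A then - ((-1) ^ card A * rt a j) else 0)"
    by (rule sum.swap)
  also have "\<dots> = (\<Sum>a\<in>F. rt a j * Q a (v + rt a))"
  proof (rule sum.cong)
    fix a assume "a \<in> F"
    then have a: "a \<in> PR" by (simp add: F_def)
    have "(\<Sum>A\<in>subsets_to (rho - v). if a \<in> A then - ((-1) ^ card A * rt a j) else 0)
        = (\<Sum>A\<in>{A \<in> subsets_to (rho - v). a \<in> A}. - ((-1) ^ card A * rt a j))"
      by (rule sum.inter_filter[symmetric, OF finite_subsets_to])
    also have "\<dots> = - (\<Sum>A\<in>{A \<in> subsets_to (rho - v). a \<in> A}. (-1) ^ card A) * rt a j"
      by (simp add: sum_negf sum_distrib_right)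
    finally show "(\<Sum>A\<in>subsets_to (rho - v). if a \<in> A then - ((-1) ^ card A * rt a j) else 0) = rt a j * Q a (v + rt a)"
      using incl[OF a, of v] by (simp add: mult.commute)
  qed simp
  also have "\<dots> = (\<Sum>a\<in>F. \<Sum>k\<in>{k. 1 \<le> k \<and> int k * ht (rt a) \<le> N}. rt a j * S (v + sc (int k) (rt a)))"
    by (intro sum.cong) (auto simp: F_def tail sum_distrib_left)
  also have "\<dots> = (\<Sum>(a, k)\<in>Sigma F (\<lambda>a. {k. 1 \<le> k \<and> int k * ht (rt a) \<le> N}). rt a j * S (v + sc (int k) (rt a)))"
  proof (rule sum.Sigma)
    show "\<forall>a\<in>F. finite {k. 1 \<le> k \<and> int k * ht (rt a) \<le> N}"
    proof
      fix a assume "a \<in> F"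
      have "{k. 1 \<le> k \<and> int k * ht (rt a) \<le> N} = (\<lambda>k. (a, k)) -` PK N"
        using \<open>a \<in> F\<close> by (auto simp: PK_def F_def)
      then show "finite {k. 1 \<le> k \<and> int k * ht (rt a) \<le> N}"
        using finite_vimageI[OF finite_PK, of "\<lambda>k. (a, k)" N] by (simp add: inj_on_def)
    qed
  qed (rule fF)
  also have "Sigma F (\<lambda>a. {k. 1 \<le> k \<and> int k * ht (rt a) \<le> N}) = PK N"
  proof -
    have "ht (rt a) \<le> N" if "a \<in> PR" "1 \<le> k" "int k * ht (rt a) \<le> N" for a k
    proof -
      have "1 * ht (rt a) \<le> int k * ht (rt a)" using that PR_ht_pos[of a] by (intro mult_right_mono) auto
      then show ?thesis using that by simp
    qed
    then show ?thesis by (auto simp: PK_def F_def)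
  qed
  finally show ?thesis .
qed

end

text \<open>Root vectors are unordered pairs of letters, whereas sums over dual bases run over
  ordered pairs and meet each vector off the diagonal twice.\<close>

lemma sum_ordered_pairs:
  fixes f :: "'a::linorder \<Rightarrow> 'a \<Rightarrow> 'b::comm_ring_1"
  assumes "finite L" "\<And>x y. f x y = f y x"
  shows "(\<Sum>x\<in>L. \<Sum>y\<in>L. f x y) = (\<Sum>(x, y)\<in>{(x, y). x \<in> L \<and> y \<in> L \<and> x \<le> y}. (if x = y then 1 else 2) * f x y)"
proof -
  let ?lt = "{(x, y). x \<in> L \<and> y \<in> L \<and> x < y}" and ?gt = "{(x, y). x \<in> L \<and> y \<in> L \<and> y < x}"
    and ?eq = "{(x, y). x \<in> L \<and> y \<in> L \<and> x = y}"
  have fin: "finite ?lt" "finite ?gt" "finite ?eq"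
    by (rule finite_subset[of _ "L \<times> L"]; use assms in auto)+
  have "(\<Sum>x\<in>L. \<Sum>y\<in>L. f x y) = (\<Sum>(x, y)\<in>L \<times> L. f x y)"
    by (simp add: sum.cartesian_product)
  also have "L \<times> L = (?lt \<union> ?gt) \<union> ?eq" by auto
  also have "(\<Sum>(x, y)\<in>(?lt \<union> ?gt) \<union> ?eq. f x y) = (\<Sum>(x, y)\<in>?lt. f x y) + (\<Sum>(x, y)\<in>?gt. f x y) + (\<Sum>(x, y)\<in>?eq. f x y)"
    using fin by (subst sum.union_disjoint; (subst sum.union_disjoint)?; auto)
  also have "(\<Sum>(x, y)\<in>?gt. f x y) = (\<Sum>(x, y)\<in>?lt. f x y)"
    by (rule sum.reindex_bij_witness[where i = prod.swap and j = prod.swap]) (auto simp: assms(2))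
  also have "(\<Sum>(x, y)\<in>?lt. f x y) + (\<Sum>(x, y)\<in>?lt. f x y) + (\<Sum>(x, y)\<in>?eq. f x y)
      = (\<Sum>(x, y)\<in>?lt. (if x = y then 1 else 2) * f x y) + (\<Sum>(x, y)\<in>?eq. (if x = y then 1 else 2) * f x y)"
  proof -
    have "(\<Sum>(x, y)\<in>?lt. (if x = y then 1 else 2) * f x y) = (\<Sum>(x, y)\<in>?lt. f x y + f x y)"
      by (rule sum.cong) (auto simp: algebra_simps)
    moreover have "(\<Sum>(x, y)\<in>?eq. (if x = y then 1 else 2) * f x y) = (\<Sum>(x, y)\<in>?eq. f x y)"
      by (rule sum.cong) auto
    ultimately show ?thesis by (simp add: sum.distrib case_prod_unfold sum_distrib_left)
  qed
  also have "\<dots> = (\<Sum>(x, y)\<in>?lt \<union> ?eq. (if x = y then 1 else 2) * f x y)"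
    using fin by (subst sum.union_disjoint) auto
  also have "?lt \<union> ?eq = {(x, y). x \<in> L \<and> y \<in> L \<and> x \<le> y}" by auto
  finally show ?thesis .
qed

context type_C
begin

lemma lw_outside: "x \<in> letters n \<Longrightarrow> j = 0 \<or> n < j \<Longrightarrow> lw x j = 0"
  by (cases x) auto

lemma rt_outside: "a \<in> PR \<Longrightarrow> n < j \<Longrightarrow> rt a j = 0"
  by (cases a) (auto simp: PR_iff rt.simps lw_outside delta_def)

lemma S_outside: "S u \<noteq> 0 \<Longrightarrow> n < j \<Longrightarrow> u j = rho j"
proof -
  assume "S u \<noteq> 0" and j: "n < j"
  then obtain A where A: "A \<subseteq> PR" "rho - u = sum rt A" using S_support by blast
  have "(rho - u) j = (\<Sum>a\<in>A. rt a j)" using A(2) sum_fun_apply[of rt A j] by simp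
  also have "\<dots> = 0" using A(1) j rt_outside by (intro sum.neutral) auto
  finally show ?thesis by simp
qed

text \<open>Strict dominance at level n+1 gives n >= u_1 > ... > u_n >= 1, which leaves no
  freedom.\<close>

lemma dominant_coordinates:
  assumes dom: "\<And>i. i \<le> n \<Longrightarrow> 0 < cp i u" and level: "u (n + 1) = int n + 1"
  shows "1 \<le> j \<Longrightarrow> j \<le> n \<Longrightarrow> u j = int (n + 1 - j)"
proof -
  have step: "u (i + 1) + 1 \<le> u i" if "1 \<le> i" "i < n" for i
    using dom[of i] that by (simp add: cp_def)
  have "1 \<le> u n" using dom[of n] n_pos by (simp add: cp_def)
  have low: "d < n \<Longrightarrow> int d + 1 \<le> u (n - d)" for d
  proof (induction d)
    case (Suc d)
    then have "1 \<le> n - Suc d" "n - Suc d < n" by auto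
    then show ?case using Suc step[of "n - Suc d"] by (simp add: Suc_diff_Suc)
  qed (use \<open>1 \<le> u n\<close> in simp)
  have "u 1 \<le> int n" using dom[of 0] level by (simp add: cp_def)
  have up: "Suc d \<le> n \<Longrightarrow> u (Suc d) \<le> int n - int d" for d
  proof (induction d)
    case (Suc d)
    then show ?case using step[of "Suc d"] by simp
  qed (use \<open>u 1 \<le> int n\<close> in simp)
  show "1 \<le> j \<Longrightarrow> j \<le> n \<Longrightarrow> u j = int (n + 1 - j)"
    using low[of "n - j"] up[of "j - 1"] by simp
qed

lemma S_dominant:
  assumes "S u \<noteq> 0" "\<And>i. i \<le> n \<Longrightarrow> 0 < cp i u"
  shows "\<exists>k\<ge>0. u = rho - sc k delta"
proof -
  have out: "\<And>j. n < j \<Longrightarrow> u j = rho j" using S_outside assms(1) by blast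
  then have lev: "u (n + 1) = int n + 1" by (simp add: rho_def)
  have "u j = (rho - sc (- u 0) delta) j" for j
  proof -
    consider "j = 0" | "1 \<le> j" "j \<le> n" | "n < j" by linarith
    then show ?thesis
    proof cases
      case 1
      then show ?thesis by (simp add: rho_def delta_def)
    next
      case 2
      then show ?thesis using dominant_coordinates[OF assms(2) lev, of j] by (simp add: rho_def delta_def)
    next
      case 3
      then show ?thesis using out[of j] by (simp add: delta_def)
    qed
  qed
  then have e: "u = rho - sc (- u 0) delta" by blast
  have "ht (rho - sc (- u 0) delta) \<le> ht rho" using S_bound[OF assms(1)] e by simp
  then have "0 \<le> - u 0" using n_pos by (simp add: ht_linear ht_delta mult_le_0_iff)
  with e show ?thesis by blast
qed

text \<open>Contraction with a free vector \<open>w\<close>: the second-order recursion takes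
  \<open>w\<close> to be v - \<rho>, then \<rho>, then each root; the comparison with the character
  takes it to be a weight of the module.\<close>

lemma S_log_form:
  assumes N: "ht (rho - v) \<le> N"
  shows "form w (v - rho) * S v = (\<Sum>(a, k)\<in>PK N. form w (rt a) * S (v + sc (int k) (rt a)))"
proof -
  let ?s = "\<lambda>p. S (v + sc (int (snd p)) (rt (fst p)))"
  have *: "(v j - rho j) * S v = (\<Sum>p\<in>PK N. rt (fst p) j * ?s p)" for j
    using S_log_derivative[OF N] by (simp add: case_prod_unfold)
  have "form w (v - rho) * S v = (\<Sum>j=1..n. w j * ((v j - rho j) * S v)) +
      (2 * w (n + 1) * ((v 0 - rho 0) * S v) + 2 * w 0 * ((v (n + 1) - rho (n + 1)) * S v))"
    by (simp add: form_def algebra_simps sum_distrib_left sum_subtractf)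
  also have "(\<Sum>j=1..n. w j * ((v j - rho j) * S v)) = (\<Sum>p\<in>PK N. (\<Sum>j=1..n. w j * rt (fst p) j) * ?s p)"
    unfolding * sum_distrib_left sum_distrib_right by (subst sum.swap) (simp add: mult.assoc)
  also have "(\<Sum>p\<in>PK N. (\<Sum>j=1..n. w j * rt (fst p) j) * ?s p) +
      (2 * w (n + 1) * ((v 0 - rho 0) * S v) + 2 * w 0 * ((v (n + 1) - rho (n + 1)) * S v))
      = (\<Sum>p\<in>PK N. form w (rt (fst p)) * ?s p)"
    unfolding * by (simp add: form_def sum_distrib_left sum.distrib[symmetric] algebra_simps)
  finally have "form w (v - rho) * S v = (\<Sum>p\<in>PK N. form w (rt (fst p)) * ?s p)" .
  then show ?thesis by (simp add: case_prod_unfold)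
qed

section \<open>Peterson recursion for the denominator\<close>

type_synonym pk = "(letter \<times> letter \<times> int) \<times> nat"

definition pkw :: "(letter \<times> letter \<times> int) \<times> nat \<Rightarrow> wt" where
  "pkw p = sc (int (snd p)) (rt (fst p))"

text \<open>The left summand is one term ka of the logarithmic derivative, the right summand an
  ordered pair of them, as produced by differentiating twice.\<close>

definition peterson_weight :: "((letter \<times> letter \<times> int) \<times> nat) + ((letter \<times> letter \<times> int) \<times> nat) \<times> ((letter \<times> letter \<times> int) \<times> nat) \<Rightarrow> wt" where
  "peterson_weight = case_sum pkw (\<lambda>(p, q). pkw p + pkw q)"

definition peterson_coeff :: "((letter \<times> letter \<times> int) \<times> nat) + ((letter \<times> letter \<times> int) \<times> nat) \<times> ((letter \<times> letter \<times> int) \<times> nat) \<Rightarrow> int" where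
  "peterson_coeff = case_sum (\<lambda>p. 2 * form rho (rt (fst p)) - int (snd p) * form (rt (fst p)) (rt (fst p)))
     (\<lambda>(p, q). form (rt (fst p)) (rt (fst q)))"

definition peterson_set :: "int \<Rightarrow> (((letter \<times> letter \<times> int) \<times> nat) + ((letter \<times> letter \<times> int) \<times> nat) \<times> ((letter \<times> letter \<times> int) \<times> nat)) set" where
  "peterson_set N = PK N <+> PK N \<times> PK N"

text \<open>The coefficient of e^{-g} in (Laplacian - |\<rho>|^2) applied to the denominator and
  divided by the denominator. S no longer enters, so the vanishing of E is a statement about roots
  alone.\<close>

definition E :: "wt \<Rightarrow> int" where
  "E g = (\<Sum>p\<in>{p \<in> peterson_set (ht g). peterson_weight p = g}. peterson_coeff p)"

lemma finite_peterson_set: "finite (peterson_set N)"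
  by (simp add: peterson_set_def finite_PK)

lemma PK_ht: "p \<in> PK N \<longleftrightarrow> fst p \<in> PR \<and> 1 \<le> snd p \<and> ht (pkw p) \<le> N"
  by (cases p) (simp add: PK_def pkw_def ht_linear)

lemma PK_ht_pos: "p \<in> PK N \<Longrightarrow> 0 < ht (pkw p)"
  using PR_ht_pos[of "fst p"] by (simp add: PK_ht pkw_def ht_linear)

lemma peterson_ht_pos: "p \<in> peterson_set N \<Longrightarrow> 0 < ht (peterson_weight p)"
  using PK_ht_pos by (auto simp: peterson_set_def peterson_weight_def ht_linear add_pos_pos)

lemma peterson_set_cong:
  assumes "ht g \<le> N"
  shows "{p \<in> peterson_set N. peterson_weight p = g} = {p \<in> peterson_set (ht g). peterson_weight p = g}"
proof -
  have *: "ht (pkw p) \<le> ht (pkw p + pkw q)" "ht (pkw q) \<le> ht (pkw p + pkw q)"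
    if "p \<in> PK M" "q \<in> PK M" for p q M
    using PK_ht_pos[OF that(1)] PK_ht_pos[OF that(2)] by (simp_all add: ht_linear)
  show ?thesis
    using assms * by (fastforce simp: peterson_set_def peterson_weight_def PK_ht)
qed

text \<open>|v|^2 - |\<rho>|^2 = (v - \<rho>, v - \<rho>) + 2(\<rho>, v - \<rho>), and each factor v
  - \<rho> can be traded for a sum over roots. Before the second trade v is replaced by the shifted
  weight v + ka, at the cost of -k(a, a); this is the negative term of
  \<open>peterson_coeff\<close>.\<close>

lemma S_peterson:
  assumes N: "ht (rho - v) \<le> N"
  shows "(form v v - form rho rho) * S v = (\<Sum>p\<in>peterson_set N. peterson_coeff p * S (v + peterson_weight p))"
proof -
  let ?f = "\<lambda>p. rt (fst p)" and ?u = "\<lambda>p. v + pkw p"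
  have 1: "form w (v - rho) * S v = (\<Sum>p\<in>PK N. form w (?f p) * S (?u p))" for w
    using S_log_form[OF N] by (simp add: case_prod_unfold pkw_def)
  have 2: "form w (?u p - rho) * S (?u p) = (\<Sum>q\<in>PK N. form w (?f q) * S (v + (pkw p + pkw q)))" if "p \<in> PK N" for p w
    using S_log_form[of "?u p" N w] N PK_ht_pos[OF that]
    by (simp add: case_prod_unfold pkw_def[symmetric] ht_linear add.assoc)
  have "form v v - form rho rho = form (v - rho) (v - rho) + 2 * form rho (v - rho)"
    by (simp add: form_linear form_commute[of v rho])
  then have "(form v v - form rho rho) * S v = form (v - rho) (v - rho) * S v + 2 * (form rho (v - rho) * S v)"
    by (simp add: algebra_simps)
  also have "\<dots> = (\<Sum>p\<in>PK N. form (v - rho) (?f p) * S (?u p) + 2 * (form rho (?f p) * S (?u p)))"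
    unfolding 1 by (simp add: sum.distrib sum_distrib_left)
  also have "\<dots> = (\<Sum>p\<in>PK N. (2 * form rho (?f p) - int (snd p) * form (?f p) (?f p)) * S (?u p) +
      form (?f p) (?u p - rho) * S (?u p))"
    by (rule sum.cong) (simp_all add: pkw_def form_linear form_commute[of v] form_commute[of _ rho] algebra_simps)
  also have "\<dots> = (\<Sum>p\<in>PK N. (2 * form rho (?f p) - int (snd p) * form (?f p) (?f p)) * S (?u p)) +
      (\<Sum>p\<in>PK N. \<Sum>q\<in>PK N. form (?f p) (?f q) * S (v + (pkw p + pkw q)))"
    by (simp add: sum.distrib 2)
  also have "\<dots> = (\<Sum>p\<in>peterson_set N. peterson_coeff p * S (v + peterson_weight p))"
    unfolding peterson_set_def
    by (simp add: sum.Plus finite_PK peterson_coeff_def peterson_weight_def sum.cartesian_product case_prod_unfold)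
  finally show ?thesis .
qed

text \<open>Among the terms E g' S(\<rho> - g + g') those of lower height vanish by hypothesis,
  those of greater height lie above \<rho>, and in equal height only g' = g meets the top
  coefficient 1.\<close>

lemma S_peterson_E: "(form (rho - g) (rho - g) - form rho rho) * S (rho - g) = E g"
  if small: "\<And>g'. 0 < ht g' \<Longrightarrow> ht g' < ht g \<Longrightarrow> E g' = 0"
proof -
  let ?I = "peterson_set (ht g)"
  have "(form (rho - g) (rho - g) - form rho rho) * S (rho - g)
      = (\<Sum>p\<in>?I. peterson_coeff p * S (rho - g + peterson_weight p))"
    by (rule S_peterson) simp
  also have "\<dots> = (\<Sum>g'\<in>peterson_weight ` ?I. \<Sum>p\<in>{p \<in> ?I. peterson_weight p = g'}. peterson_coeff p * S (rho - g + peterson_weight p))"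
    by (rule sum.image_gen[OF finite_peterson_set])
  also have "\<dots> = (\<Sum>g'\<in>peterson_weight ` ?I. if g' = g then E g else 0)"
  proof (rule sum.cong)
    fix g' assume g': "g' \<in> peterson_weight ` ?I"
    then have pos: "0 < ht g'" using peterson_ht_pos by auto
    have "(\<Sum>p\<in>{p \<in> ?I. peterson_weight p = g'}. peterson_coeff p * S (rho - g + peterson_weight p))
        = (\<Sum>p\<in>{p \<in> ?I. peterson_weight p = g'}. peterson_coeff p) * S (rho - g + g')"
      by (simp add: sum_distrib_right)
    also have "\<dots> = (if g' = g then E g else 0)"
    proof (cases "ht g' \<le> ht g")
      case True
      then have e: "(\<Sum>p\<in>{p \<in> ?I. peterson_weight p = g'}. peterson_coeff p) = E g'"
        by (simp only: E_def peterson_set_cong[OF True])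
      show ?thesis
      proof (cases "ht g' = ht g")
        case True
        then have "S (rho - g + g') = (if g' = g then 1 else 0)"
          by (subst S_top) (auto simp: ht_linear algebra_simps)
        then show ?thesis using e by auto
      next
        case False
        then show ?thesis using e small[OF pos] \<open>ht g' \<le> ht g\<close> by auto
      qed
    next
      case False
      then have "S (rho - g + g') = 0" using S_bound[of "rho - g + g'"] by (auto simp: ht_linear)
      then show ?thesis using False by auto
    qed
    finally show "(\<Sum>p\<in>{p \<in> ?I. peterson_weight p = g'}. peterson_coeff p * S (rho - g + peterson_weight p)) = (if g' = g then E g else 0)" .
  qed simp
  also have "\<dots> = E g"
  proof (cases "g \<in> peterson_weight ` ?I")
    case True
    then show ?thesis using finite_peterson_set by (simp add: sum.delta)
  next
    case False
    then have "E g = 0" by (auto simp: E_def intro!: sum.neutral)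
    then show ?thesis by (simp add: sum.neutral)
  qed
  finally show ?thesis .
qed

section \<open>The recursion at multiples of \<delta>\<close>

lemma form_lw: "x \<in> letters n \<Longrightarrow> y \<in> letters n \<Longrightarrow>
    form (lw x) (lw y) = (if x = y then 1 else if x = bar y then -1 else 0)"
  by (cases x; cases y) (auto simp: form_linear form_unitv)

lemma form_delta: "form delta v = 2 * v (n + 1)"
  by (simp add: delta_def form_unitv)

text \<open>Pairing the relation with each letter shows that every letter of one root is the bar of
  a letter of the other; then the multiples agree. This singles out the pairs of real roots that
  contribute to \<open>E\<close> at a multiple of \<delta>.\<close>

lemma parallel_roots:
  assumes l: "x \<in> letters n" "y \<in> letters n" "z \<in> letters n" "w \<in> letters n"
    and o: "x \<le> y" "z \<le> w" and ne: "y \<noteq> bar x" and k: "0 < k" "0 < k'"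
    and eq: "sc k (lw x + lw y) + sc k' (lw z + lw w) = 0"
  shows "k = k' \<and> z = bar y \<and> w = bar x"
proof -
  have pair: "k * (form (lw t) (lw x) + form (lw t) (lw y)) + k' * (form (lw t) (lw z) + form (lw t) (lw w)) = 0" for t
    using arg_cong[OF eq, of "form (lw t)"] by (simp add: form_linear)
  have wz: "w \<noteq> bar z"
  proof
    assume "w = bar z"
    then have "k * (1 + form (lw x) (lw y)) = 0" using pair[of x] l by (simp add: form_linear form_lw)
    then show False using k l ne by (auto simp: form_lw split: if_splits)
  qed
  have "0 < k * (form (lw t) (lw x) + form (lw t) (lw y))" if "t = x \<or> t = y" for t
    using that k l ne by (auto simp: form_lw)
  then have "form (lw t) (lw z) + form (lw t) (lw w) < 0" if "t = x \<or> t = y" for t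
    using that pair[of t] k by (smt (verit) mult_nonneg_nonneg)
  then have 1: "t = bar z \<or> t = bar w" if "t = x \<or> t = y" for t
    using that l by (fastforce simp: form_lw split: if_splits)
  have "0 < k' * (form (lw t) (lw z) + form (lw t) (lw w))" if "t = z \<or> t = w" for t
    using that k l wz by (auto simp: form_lw)
  then have "form (lw t) (lw x) + form (lw t) (lw y) < 0" if "t = z \<or> t = w" for t
    using that pair[of t] k by (smt (verit) mult_nonneg_nonneg)
  then have 2: "t = bar x \<or> t = bar y" if "t = z \<or> t = w" for t
    using that l by (fastforce simp: form_lw split: if_splits)
  have zw: "z = bar y \<and> w = bar x"
  proof (cases "x = y")
    case True
    then show ?thesis using 2 by auto
  next
    case False
    show ?thesis
    proof (rule ccontr)
      assume "\<not> ?thesis"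
      then have "z = bar x \<and> w = bar y"
        using False 1[of x] 1[of y] 2[of z] 2[of w] by auto
      then have "bar x \<le> bar y" using o by simp
      then show False using o False by (simp add: antisym)
    qed
  qed
  then have "sc (k - k') (lw x + lw y) = 0"
    using eq by (simp add: sc_linear algebra_simps)
  then have "(k - k') * form (lw x) (lw x + lw y) = 0"
    using form_linear(6,10) by metis
  then have "k = k'" using l ne by (auto simp: form_linear form_lw split: if_splits)
  then show ?thesis using zw by simp
qed

text \<open>There are 2n long roots of square length 4 and 2n(n - 1) short ones of square length 2.
  The value equals n times 2(\<rho>, \<delta>), which makes \<open>E\<close> vanish at multiples of
  \<delta>.\<close>

lemma root_norm_sum:
  "(\<Sum>(x, y)\<in>{(x, y). x \<in> letters n \<and> y \<in> letters n \<and> x \<le> y \<and> y \<noteq> bar x}. form (lw x + lw y) (lw x + lw y)) = 4 * int n * (int n + 1)"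
proof -
  let ?L = "letters n"
  \<comment> \<open>Half the square length off the diagonal and all of it on the diagonal, so that
    summing over ordered pairs counts each root once.\<close>
  let ?g = "\<lambda>x y. if y = bar x then 0 else 1 + (if x = y then 3 else 0) :: int"
  have card: "card ?L = 2 * n"
    unfolding letters_def by (subst card_Un_disjoint) (auto simp: card_image inj_on_def)
  have "(\<Sum>(x, y)\<in>{(x, y). x \<in> ?L \<and> y \<in> ?L \<and> x \<le> y \<and> y \<noteq> bar x}. form (lw x + lw y) (lw x + lw y))
      = (\<Sum>(x, y)\<in>{(x, y). x \<in> ?L \<and> y \<in> ?L \<and> x \<le> y}. (if x = y then 1 else 2) * ?g x y)"
  proof (rule sum.mono_neutral_cong_left)
    show "finite {(x, y). x \<in> ?L \<and> y \<in> ?L \<and> x \<le> y}"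
      by (rule finite_subset[of _ "?L \<times> ?L"]) auto
  qed (auto simp: form_linear form_lw)
  also have "\<dots> = (\<Sum>x\<in>?L. \<Sum>y\<in>?L. ?g x y)"
    by (rule sum_ordered_pairs[symmetric]) auto
  also have "\<dots> = (\<Sum>x\<in>?L. 2 * int n + 2)"
  proof (rule sum.cong)
    fix x assume x: "x \<in> ?L"
    have "(\<Sum>y\<in>?L. ?g x y) = (\<Sum>y\<in>?L. 1 - (if y = bar x then 1 else 0) + (if y = x then 3 else 0))"
      by (rule sum.cong) auto
    also have "\<dots> = 2 * int n + 2"
      using x by (simp add: sum.distrib sum_subtractf card)
    finally show "(\<Sum>y\<in>?L. ?g x y) = 2 * int n + 2" .
  qed simp
  finally show ?thesis by (simp add: card algebra_simps)
qed

text \<open>Let s be the sum of the divisors of j. Single terms k(m\<delta>) with km = j give n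
  times 2(\<rho>, \<delta>) times s. Pairs contribute only for opposite finite parts with a common
  multiple l; the degree j/l can be split in j/l ways for each finite root, so they give -s times
  the sum of square lengths.\<close>

lemma E_delta:
  assumes j: "1 \<le> j"
  shows "E (sc j delta) = 0"
proof -
  let ?G = "sc j delta" and ?N = "ht (sc j delta)"
  define D where "D = {l :: nat. 1 \<le> l \<and> int l dvd j}"
  have "D \<subseteq> {..nat j}" using j zdvd_imp_le by (fastforce simp: D_def)
  then have fD: "finite D" by (rule finite_subset) simp
  have jd: "j div int l * int l = j" "1 \<le> j div int l" if "l \<in> D" for l
    using that j by (auto simp: D_def pos_imp_zdiv_pos_iff zdvd_imp_le intro!: dvd_div_mult_self)
  define sigma where "sigma = (\<Sum>l\<in>D. j div int l)"
  have hN: "?N = 4 * int n * j" by (simp add: ht_linear ht_delta)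
  have rt0: "rt (Plain i, Barred i, m) = sc m delta" for i m by (simp add: rt.simps)
  have first: "(\<Sum>p\<in>{p \<in> PK ?N. pkw p = ?G}. 2 * form rho (rt (fst p)) - int (snd p) * form (rt (fst p)) (rt (fst p)))
      = 4 * int n * (int n + 1) * sigma"
  proof -
    define to where "to p = (case fst (fst p) of Plain i \<Rightarrow> i | Barred i \<Rightarrow> i, snd p)"
      for p :: "(letter \<times> letter \<times> int) \<times> nat"
    define frm where "frm q = ((Plain (fst q), Barred (fst q), j div int (snd q)), snd q)" for q :: "nat \<times> nat"
    have "(\<Sum>p\<in>{p \<in> PK ?N. pkw p = ?G}. 2 * form rho (rt (fst p)) - int (snd p) * form (rt (fst p)) (rt (fst p)))
        = (\<Sum>(i, l)\<in>{1..n} \<times> D. 4 * (int n + 1) * (j div int l))"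
    proof (rule sum.reindex_bij_witness[where
          j = to and i = frm])
      fix p assume "p \<in> {p \<in> PK ?N. pkw p = ?G}"
      then obtain x y m l where p: "p = ((x, y, m), l)" "(x, y, m) \<in> PR" "1 \<le> l" "sc (int l) (rt (x, y, m)) = ?G"
        by (cases p; cases "fst p") (auto simp: PK_ht pkw_def)
      have L: "x \<in> letters n" "y \<in> letters n" "x \<le> y" using p by (auto simp: PR_iff)
      have "int l * (form (lw x) (lw x) + form (lw x) (lw y)) = 0"
        using arg_cong[OF p(4), of "form (lw x)"] L
        by (simp add: rt.simps form_linear form_commute[of _ delta] form_delta lw_outside)
      then have "y = bar x" using p(3) L by (auto simp: form_lw split: if_splits)
      then obtain i where xy: "x = Plain i" "y = Barred i" using L by (cases x) auto
      have "int l * m = j" using fun_cong[OF p(4), of 0] xy L by (simp add: rt0 delta_def)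
      then have m: "l \<in> D" "m = j div int l" using p(3) by (auto simp: D_def)
      show "to p \<in> {1..n} \<times> D" "frm (to p) = p"
        "(case to p of (i, l) \<Rightarrow> 4 * (int n + 1) * (j div int l)) =
          2 * form rho (rt (fst p)) - int (snd p) * form (rt (fst p)) (rt (fst p))"
        using p xy m L by (simp_all add: to_def frm_def rt0 form_linear form_commute[of rho] form_delta) (simp_all add: rho_def delta_def)
    next
      fix q assume "q \<in> {1..n} \<times> D"
      then obtain i l where q: "q = (i, l)" "1 \<le> i" "i \<le> n" "l \<in> D" by auto
      show "to (frm q) = q"
        using q by (simp add: to_def frm_def)
      have e: "sc (int l * (j div int l)) delta = ?G" using jd(1)[OF q(4)] by (simp add: mult.commute)
      show "frm q \<in> {p \<in> PK ?N. pkw p = ?G}"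
        using q jd(2)[OF q(4)] e by (simp add: frm_def PK_ht pkw_def rt0 sc_linear PR_iff) (simp add: D_def)
    qed
    also have "\<dots> = (\<Sum>i\<in>{1..n}. \<Sum>l\<in>D. 4 * (int n + 1) * (j div int l))"
      by (rule sum.cartesian_product[symmetric])
    also have "\<dots> = 4 * int n * (int n + 1) * sigma"
      by (simp add: sigma_def sum_distrib_left[symmetric])
    finally show ?thesis .
  qed
  define Phi where "Phi = {(x, y). x \<in> letters n \<and> y \<in> letters n \<and> x \<le> y \<and> y \<noteq> bar x}"
  \<comment> \<open>The degrees \<open>m\<close> for which both partners are positive roots: 0 to
    j/l - 1 or 1 to j/l according to the sign of the finite root, hence j/l of them in either
    case.\<close>
  define M where "M l x y = {m. (x, y, m) \<in> PR \<and> (bar y, bar x, j div int l - m) \<in> PR}" for l :: nat and x y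
  have fPhi: "finite Phi" unfolding Phi_def by (rule finite_subset[of _ "letters n \<times> letters n"]) auto
  have cM: "card (M l x y) = nat (j div int l) \<and> finite (M l x y)" if l: "l \<in> D" and xy: "(x, y) \<in> Phi" for l x y
  proof -
    have L: "x \<in> letters n" "y \<in> letters n" "x \<le> y" "y \<noteq> bar x" using xy by (auto simp: Phi_def)
    have "x \<noteq> bar y" using L(4) by auto
    then consider "x < bar y" "\<not> bar y < x" | "bar y < x" "\<not> x < bar y" by fastforce
    then show ?thesis
    proof cases
      case 1
      then have "M l x y = {0..j div int l - 1}" using L by (auto simp: M_def PR_iff)
      then show ?thesis by simp
    next
      case 2
      then have "M l x y = {1..j div int l}" using L by (auto simp: M_def PR_iff)
      then show ?thesis by simp
    qed
  qed
  have second: "(\<Sum>r\<in>{r \<in> PK ?N \<times> PK ?N. pkw (fst r) + pkw (snd r) = ?G}. form (rt (fst (fst r))) (rt (fst (snd r))))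
      = - (4 * int n * (int n + 1) * sigma)"
  proof -
    let ?Z = "{r \<in> PK ?N \<times> PK ?N. pkw (fst r) + pkw (snd r) = ?G}"
    let ?Z' = "{r \<in> ?Z. case fst (fst r) of (x, y, m) \<Rightarrow> y \<noteq> bar x}"
    let ?T = "Sigma D (\<lambda>l. Sigma Phi (\<lambda>(x, y). M l x y))"
    let ?v = "\<lambda>(l, (x, y), m). - form (lw x + lw y) (lw x + lw y)"
    define to where "to r = (snd (fst r), (fst (fst (fst r)), fst (snd (fst (fst r)))), snd (snd (fst (fst r))))"
      for r :: "((letter \<times> letter \<times> int) \<times> nat) \<times> ((letter \<times> letter \<times> int) \<times> nat)"
    define frm where "frm t = (case t of (l, (x, y), m) \<Rightarrow> (((x, y, m), l), ((bar y, bar x, j div int l - m), l)))"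
      for t :: "nat \<times> (letter \<times> letter) \<times> int"
    have "(\<Sum>r\<in>?Z. form (rt (fst (fst r))) (rt (fst (snd r)))) = (\<Sum>r\<in>?Z'. form (rt (fst (fst r))) (rt (fst (snd r))))"
    proof (rule sum.mono_neutral_right)
      show "finite ?Z" by (rule finite_subset[of _ "PK ?N \<times> PK ?N"]) (auto simp: finite_PK)
      show "\<forall>r\<in>?Z - ?Z'. form (rt (fst (fst r))) (rt (fst (snd r))) = 0"
      proof
        fix r assume r: "r \<in> ?Z - ?Z'"
        obtain x y m where x: "fst (fst r) = (x, y, m)" by (cases "fst (fst r)")
        then have "y = bar x" using r by auto
        then have "rt (fst (fst r)) = sc m delta" using x by (simp add: rt.simps)
        moreover have "rt (fst (snd r)) (n + 1) = 0" using r by (intro rt_outside) (auto simp: PK_ht)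
        ultimately show "form (rt (fst (fst r))) (rt (fst (snd r))) = 0" by (simp add: form_linear form_delta)
      qed
    qed auto
    also have "\<dots> = (\<Sum>t\<in>?T. ?v t)"
    proof (rule sum.reindex_bij_witness[where
          j = to and i = frm])
      fix r assume r: "r \<in> ?Z'"
      obtain x y m l z w m' l' where e: "r = (((x, y, m), l), ((z, w, m'), l'))" by (metis prod.exhaust)
      have P: "(x, y, m) \<in> PR" "1 \<le> l" "(z, w, m') \<in> PR" "1 \<le> l'" "y \<noteq> bar x"
        and s: "sc (int l) (rt (x, y, m)) + sc (int l') (rt (z, w, m')) = ?G"
        using r e by (auto simp: PK_ht pkw_def)
      have L: "x \<in> letters n" "y \<in> letters n" "x \<le> y" "z \<in> letters n" "w \<in> letters n" "z \<le> w"
        using P by (auto simp: PR_iff)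
      have "int l * m + int l' * m' = j" using fun_cong[OF s, of 0] L
        by (simp add: rt.simps lw_outside delta_def)
      moreover have "sc (int l) (lw x + lw y) + sc (int l') (lw z + lw w) = ?G - sc (int l * m + int l' * m') delta"
        using s by (simp add: rt.simps sc_linear algebra_simps)
      ultimately have "sc (int l) (lw x + lw y) + sc (int l') (lw z + lw w) = 0"
        and jm: "int l * m + int l' * m' = j" by simp_all
      then have q: "int l = int l' \<and> z = bar y \<and> w = bar x"
        using L P by (intro parallel_roots) auto
      then have "int l * (m + m') = j" using jm by (simp add: algebra_simps)
      then have d: "l \<in> D" "m' = j div int l - m" using P(2) by (auto simp: D_def)
      have v: "form (rt (x, y, m)) (rt (z, w, m')) = - form (lw x + lw y) (lw x + lw y)"
      proof -
        define U where "U = lw x + lw y"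
        have "form U delta = 0" "form delta U = 0" "form delta delta = 0"
          using form_commute[of U delta] L by (simp_all add: form_delta U_def lw_outside) (simp add: delta_def)
        moreover have "rt (x, y, m) = U + sc m delta" "rt (z, w, m') = - U + sc m' delta"
          using q by (simp_all add: rt.simps U_def)
        ultimately show ?thesis by (simp add: form_linear U_def[symmetric])
      qed
      show "to r \<in> ?T"
        using e q d L P by (auto simp: to_def Phi_def M_def)
      show "frm (to r) = r"
        using e q d by (simp add: to_def frm_def)
      show "?v (to r) = form (rt (fst (fst r))) (rt (fst (snd r)))"
        using e v by (simp add: to_def)
    next
      fix t assume "t \<in> ?T"
      then obtain l x y m where t: "t = (l, (x, y), m)" "l \<in> D" "(x, y) \<in> Phi" "m \<in> M l x y" by auto
      show "to (frm t) = t"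
        using t by (simp add: to_def frm_def)
      have P: "(x, y, m) \<in> PR" "(bar y, bar x, j div int l - m) \<in> PR" using t by (auto simp: M_def)
      let ?p = "((x, y, m), l)" and ?q = "((bar y, bar x, j div int l - m), l)"
      have "pkw ?p + pkw ?q = sc (j div int l * int l) delta"
        by (simp add: pkw_def rt.simps sc_linear algebra_simps)
      then have s: "pkw ?p + pkw ?q = ?G" using jd(1)[OF t(2)] by simp
      then have "ht (pkw ?p) + ht (pkw ?q) = ?N" by (metis ht_linear(1))
      moreover have "0 < ht (pkw ?p)" "0 < ht (pkw ?q)"
        using P PR_ht_pos t(2) by (auto simp: pkw_def ht_linear D_def)
      ultimately have "?p \<in> PK ?N" "?q \<in> PK ?N" using P t(2) by (auto simp: PK_ht D_def)
      then show "frm t \<in> ?Z'"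
        using s t by (auto simp: Phi_def frm_def)
    qed
    also have "\<dots> = (\<Sum>l\<in>D. \<Sum>s\<in>Sigma Phi (\<lambda>(x, y). M l x y). ?v (l, s))"
      using fD fPhi cM by (subst sum.Sigma) (auto intro!: sum.cong)
    also have "\<dots> = (\<Sum>l\<in>D. \<Sum>(x, y)\<in>Phi. \<Sum>m\<in>M l x y. - form (lw x + lw y) (lw x + lw y))"
    proof (rule sum.cong)
      fix l assume "l \<in> D"
      then have "(\<Sum>q\<in>Phi. \<Sum>m\<in>(case q of (x, y) \<Rightarrow> M l x y). ?v (l, q, m)) = (\<Sum>(q, m)\<in>Sigma Phi (\<lambda>(x, y). M l x y). ?v (l, q, m))"
        using fPhi cM by (intro sum.Sigma) auto
      then show "(\<Sum>s\<in>Sigma Phi (\<lambda>(x, y). M l x y). ?v (l, s)) = (\<Sum>(x, y)\<in>Phi. \<Sum>m\<in>M l x y. - form (lw x + lw y) (lw x + lw y))"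
        by (simp add: case_prod_unfold)
    qed simp
    also have "\<dots> = (\<Sum>l\<in>D. - (j div int l) * (\<Sum>(x, y)\<in>Phi. form (lw x + lw y) (lw x + lw y)))"
    proof (rule sum.cong)
      fix l assume l: "l \<in> D"
      have "(\<Sum>(x, y)\<in>Phi. \<Sum>m\<in>M l x y. - form (lw x + lw y) (lw x + lw y)) = (\<Sum>(x, y)\<in>Phi. - (j div int l) * form (lw x + lw y) (lw x + lw y))"
        using cM[OF l] jd(2)[OF l] by (intro sum.cong) auto
      then show "(\<Sum>(x, y)\<in>Phi. \<Sum>m\<in>M l x y. - form (lw x + lw y) (lw x + lw y)) = - (j div int l) * (\<Sum>(x, y)\<in>Phi. form (lw x + lw y) (lw x + lw y))"
        by (simp add: sum_distrib_left case_prod_unfold)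
    qed simp
    also have "\<dots> = - (4 * int n * (int n + 1) * sigma)"
      unfolding Phi_def root_norm_sum sum_distrib_right[symmetric] sum_negf sigma_def by simp
    finally show ?thesis .
  qed
  have "{p \<in> peterson_set ?N. peterson_weight p = ?G} =
      {p \<in> PK ?N. pkw p = ?G} <+> {r \<in> PK ?N \<times> PK ?N. pkw (fst r) + pkw (snd r) = ?G}"
    by (auto simp: peterson_set_def peterson_weight_def)
  moreover have "finite {p \<in> PK ?N. pkw p = ?G}" "finite {r \<in> PK ?N \<times> PK ?N. pkw (fst r) + pkw (snd r) = ?G}"
    using finite_PK by auto
  ultimately show ?thesis
    using first second by (simp add: E_def sum.Plus peterson_coeff_def case_prod_unfold)
qed

text \<open>Both claims go through one induction on height, as E g is the value at \<rho> - g once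
  smaller heights are settled. Outside the open chamber a reflection leads to a smaller height and
  preserves the form, or S is 0 on a wall; inside, only \<rho> - k\<delta> remains, where
  \<open>E_delta\<close> applies.\<close>

lemma S_norm_aux: "0 \<le> ht g \<Longrightarrow> (form (rho - g) (rho - g) - form rho rho) * S (rho - g) = 0 \<and> E g = 0"
proof (induction "nat (ht g)" arbitrary: g rule: less_induct)
  case less
  let ?T = "\<lambda>v. (form v v - form rho rho) * S v"
  have IH: "?T (rho - g') = 0 \<and> E g' = 0" if "0 \<le> ht g'" "ht g' < ht g" for g'
    using less.hyps[of g'] that by auto
  have TE: "?T (rho - g) = E g"
    by (rule S_peterson_E) (use IH in auto)
  have "?T (rho - g) = 0"
  proof (cases "\<forall>i\<le>n. 0 < cp i (rho - g)")
    case True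
    show ?thesis
    proof (cases "S (rho - g) = 0")
      case False
      then obtain k where k: "0 \<le> k" "rho - g = rho - sc k delta" using S_dominant True by blast
      then have g: "g = sc k delta" by simp
      show ?thesis
      proof (cases "k = 0")
        case True
        then show ?thesis using k by simp
      next
        case False
        then have "E g = 0" using g E_delta k(1) by simp
        then show ?thesis using TE by simp
      qed
    qed simp
  next
    case False
    then obtain i where i: "i \<le> n" "cp i (rho - g) \<le> 0" by (auto simp: not_less)
    show ?thesis
    proof (cases "cp i (rho - g) = 0")
      case True
      then have "srefl i (rho - g) = rho - g" by (simp add: srefl_def)
      then have "S (rho - g) = 0" using S_srefl[OF i(1), of "rho - g"] by simp
      then show ?thesis by simp
    next
      case False
      define g' where "g' = rho - srefl i (rho - g)"
      have e: "srefl i (rho - g) = rho - g'" by (simp add: g'_def)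
      have lt: "ht g' < ht g" using i False by (simp add: g'_def ht_linear(2) ht_srefl)
      have "?T (rho - g') = 0"
      proof (cases "0 \<le> ht g'")
        case False
        then have "S (rho - g') = 0" using S_bound[of "rho - g'"] by (auto simp: ht_linear)
        then show ?thesis by simp
      qed (use IH lt in auto)
      then show ?thesis
        using S_srefl[OF i(1), of "rho - g"] form_srefl[OF i(1), of "rho - g" "rho - g"] e by simp
    qed
  qed
  then show ?case using TE by simp
qed

lemma S_norm: "S u \<noteq> 0 \<Longrightarrow> form u u = form rho rho"
  using S_norm_aux[of "rho - u"] S_bound[of u] by (simp add: ht_linear)

end

section \<open>The crystal\<close>

text \<open>String length in the crystal of the vector representation for i >= 1. For i = n the
  letter bar(n+1) does not exist, so only the letter n counts.\<close>

definition phl :: "nat \<Rightarrow> letter \<Rightarrow> nat" where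
  "phl i z = of_bool (z = Plain i \<or> z = Barred (Suc i))"

definition epl :: "nat \<Rightarrow> letter \<Rightarrow> nat" where
  "epl i z = of_bool (z = Plain (Suc i) \<or> z = Barred i)"

definition fl :: "nat \<Rightarrow> nat \<Rightarrow> letter \<Rightarrow> letter" where
  "fl n i z = (if z = Plain i then (if i = n then Barred n else Plain (Suc i)) else Barred i)"

definition el :: "nat \<Rightarrow> nat \<Rightarrow> letter \<Rightarrow> letter" where
  "el n i z = (if z = Barred i then (if i = n then Plain n else Barred (Suc i)) else Plain i)"

text \<open>For i >= 1 a pair is a tensor product of two letters, and truncated subtraction is the
  maximum with 0 in the tensor product rule. For i = 0 the empty vertex sits in the middle of the
  string from (bar 1, bar 1) to (1, 1).\<close>

fun cphi :: "nat \<Rightarrow> vertex \<Rightarrow> nat" where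
  "cphi i Empty = of_bool (i = 0)"
| "cphi i (Pair x y) =
    (if i = 0 then (if x = Barred 1 then 2 else if y = Barred 1 \<and> x \<noteq> Plain 1 then 1 else 0)
     else phl i x + (phl i y - epl i x))"

fun ceps :: "nat \<Rightarrow> vertex \<Rightarrow> nat" where
  "ceps i Empty = of_bool (i = 0)"
| "ceps i (Pair x y) =
    (if i = 0 then (if y = Plain 1 then 2 else if x = Plain 1 \<and> y \<noteq> Barred 1 then 1 else 0)
     else epl i y + (epl i x - phl i y))"

text \<open>Values are meaningful only where \<open>0 < cphi i b\<close>; in particular the image of
  the empty vertex is that under f_0.\<close>

fun cf :: "nat \<Rightarrow> nat \<Rightarrow> vertex \<Rightarrow> vertex" where
  "cf n i Empty = Pair (Plain 1) (Plain 1)"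
| "cf n i (Pair x y) =
    (if i = 0 then (if x = Barred 1 then Empty else Pair (Plain 1) x)
     else if epl i x < phl i y then Pair x (fl n i y) else Pair (fl n i x) y)"

fun ce :: "nat \<Rightarrow> nat \<Rightarrow> vertex \<Rightarrow> vertex" where
  "ce n i Empty = Pair (Barred 1) (Barred 1)"
| "ce n i (Pair x y) =
    (if i = 0 then (if y = Plain 1 then Empty else Pair y (Barred 1))
     else if epl i x \<le> phl i y then Pair x (el n i y) else Pair (el n i x) y)"

fun vw :: "vertex \<Rightarrow> wt" where
  "vw Empty = 0"
| "vw (Pair x y) = lw x + lw y"

lemma Pair_crystal [simp]: "Pair x y \<in> crystal n \<longleftrightarrow> x \<in> letters n \<and> y \<in> letters n \<and> x \<le> y"
  and Empty_crystal [simp]: "Empty \<in> crystal n"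
  by (auto simp: crystal_def)

lemma finite_crystal: "finite (crystal n)"
proof -
  have "crystal n \<subseteq> {Empty} \<union> (\<lambda>(x, y). Pair x y) ` (letters n \<times> letters n)"
    by (auto simp: crystal_def)
  then show ?thesis by (rule finite_subset) simp
qed

lemma cf_props:
  assumes "b \<in> crystal n" "i \<le> n" "0 < cphi i b" "1 \<le> n"
  shows "cf n i b \<in> crystal n" "ce n i (cf n i b) = b" "ceps i (cf n i b) = Suc (ceps i b)"
    "Suc (cphi i (cf n i b)) = cphi i b"
proof -
  consider "b = Empty" | x y where "b = Pair x y" "i = 0" | x y where "b = Pair x y" "1 \<le> i" by (cases b) force+
  then have "cf n i b \<in> crystal n \<and> ce n i (cf n i b) = b \<and> ceps i (cf n i b) = Suc (ceps i b) \<and> Suc (cphi i (cf n i b)) = cphi i b"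
  proof cases
    case 1
    then show ?thesis using assms by (auto split: if_splits)
  next
    case 2
    then show ?thesis using assms by (cases x; cases y) (auto split: if_splits)
  next
    case 3
    then show ?thesis using assms
      by (cases x; cases y) (auto simp: phl_def epl_def fl_def el_def split: if_splits)
  qed
  then show "cf n i b \<in> crystal n" "ce n i (cf n i b) = b" "ceps i (cf n i b) = Suc (ceps i b)"
    "Suc (cphi i (cf n i b)) = cphi i b" by auto
qed

lemma ce_props:
  assumes "b \<in> crystal n" "i \<le> n" "0 < ceps i b" "1 \<le> n"
  shows "ce n i b \<in> crystal n" "cf n i (ce n i b) = b" "Suc (ceps i (ce n i b)) = ceps i b"
    "cphi i (ce n i b) = Suc (cphi i b)"
proof -
  consider "b = Empty" | x y where "b = Pair x y" "i = 0" | x y where "b = Pair x y" "1 \<le> i" by (cases b) force+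
  then have "ce n i b \<in> crystal n \<and> cf n i (ce n i b) = b \<and> Suc (ceps i (ce n i b)) = ceps i b \<and> cphi i (ce n i b) = Suc (cphi i b)"
  proof cases
    case 1
    then show ?thesis using assms by (auto split: if_splits)
  next
    case 2
    then show ?thesis using assms by (cases x; cases y) (auto split: if_splits)
  next
    case 3
    then show ?thesis using assms
      by (cases x; cases y) (auto simp: phl_def epl_def fl_def el_def split: if_splits)
  qed
  then show "ce n i b \<in> crystal n" "cf n i (ce n i b) = b" "Suc (ceps i (ce n i b)) = ceps i b"
    "cphi i (ce n i b) = Suc (cphi i b)" by auto
qed

section \<open>The energy function along strings\<close>

lemma phl_epl_cases:
  "phl i z = 0 \<or> (phl i z = 1 \<and> (z = Plain i \<or> z = Barred (Suc i)))"
  "epl i z = 0 \<or> (epl i z = 1 \<and> (z = Plain (Suc i) \<or> z = Barred i))"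
  by (auto simp: phl_def epl_def)

lemma energy_cf_left_pos:
  assumes "Pair x' y' \<in> crystal n" "Pair x y \<in> crystal n" "1 \<le> i" "i \<le> n" "ceps i (Pair x y) < cphi i (Pair x' y')"
  shows "energy (cf n i (Pair x' y')) (Pair x y) = energy (Pair x' y') (Pair x y)"
proof -
  have i0: "i \<noteq> 0" using assms by simp
  consider (A1) "y' = Plain i" "epl i x' < phl i y'" | (A2) "y' = Barred (Suc i)" "epl i x' < phl i y'"
    | (B1) "x' = Plain i" "\<not> epl i x' < phl i y'" | (B2) "x' = Barred (Suc i)" "\<not> epl i x' < phl i y'"
    using assms(5) i0 phl_epl_cases[of i x'] phl_epl_cases[of i y'] by (auto split: if_splits)
  then show ?thesis
  proof cases
    case A1
    then obtain k where "x' = Plain k" using assms by (cases x') auto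
    then show ?thesis using A1 assms i0
      by (cases x; cases y) (auto simp: phl_def epl_def fl_def split: if_splits)
  next
    case A2
    then show ?thesis using assms i0
      by (cases x; cases y; cases x') (auto simp: phl_def epl_def fl_def split: if_splits)
  next
    case B1
    then show ?thesis using assms i0
      by (cases x; cases y; cases y') (auto simp: phl_def epl_def fl_def split: if_splits)
  next
    case B2
    then obtain k where "y' = Barred k" using assms by (cases y') auto
    then show ?thesis using B2 assms i0
      by (cases x; cases y) (auto simp: phl_def epl_def fl_def split: if_splits)
  qed
qed

lemma energy_cf_right_pos:
  assumes "Pair x' y' \<in> crystal n" "Pair x y \<in> crystal n" "1 \<le> i" "i \<le> n" "cphi i (Pair x' y') \<le> ceps i (Pair x y)"
    "0 < cphi i (Pair x y)"
  shows "energy (Pair x' y') (cf n i (Pair x y)) = energy (Pair x' y') (Pair x y)"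
proof -
  have i0: "i \<noteq> 0" using assms by simp
  consider (A1) "y = Plain i" "epl i x < phl i y" | (A2) "y = Barred (Suc i)" "epl i x < phl i y"
    | (B1) "x = Plain i" "\<not> epl i x < phl i y" | (B2) "x = Barred (Suc i)" "\<not> epl i x < phl i y"
    using assms(6) i0 phl_epl_cases[of i x] phl_epl_cases[of i y] by (auto split: if_splits)
  then show ?thesis
  proof cases
    case A1
    then obtain k where "x = Plain k" using assms by (cases x) auto
    then show ?thesis using A1 assms i0
      by (cases x'; cases y') (auto simp: phl_def epl_def fl_def split: if_splits)
  next
    case A2
    then show ?thesis using assms i0
      by (cases x'; cases y'; cases x) (auto simp: phl_def epl_def fl_def split: if_splits)
  next
    case B1
    then show ?thesis using assms i0
      by (cases x'; cases y'; cases y) (auto simp: phl_def epl_def fl_def of_bool_def split: if_splits)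
  next
    case B2
    then obtain k where "y = Barred k" using assms by (cases y) auto
    then show ?thesis using B2 assms i0
      by (cases x'; cases y') (auto simp: phl_def epl_def fl_def of_bool_def split: if_splits)
  qed
qed

lemma energy_cf_left_0:
  assumes "b' \<in> crystal n" "b \<in> crystal n" "ceps 0 b < cphi 0 b'"
  shows "energy (cf n 0 b') b = energy b' b - 1"
proof (cases b)
  case Empty
  then show ?thesis using assms by (cases b') (auto split: if_splits)
next
  case (Pair x y)
  note b = this
  show ?thesis
  proof (cases b')
    case Empty
    then show ?thesis using assms b by (cases x; cases y) (auto split: if_splits)
  next
    case (Pair x' y')
    then show ?thesis using assms b by (cases x; cases y; cases x'; cases y') (auto split: if_splits)
  qed
qed

lemma energy_cf_right_0:
  assumes "b' \<in> crystal n" "b \<in> crystal n" "cphi 0 b' \<le> ceps 0 b" "0 < cphi 0 b"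
  shows "energy b' (cf n 0 b) = energy b' b + 1"
proof (cases b)
  case Empty
  note b = this
  show ?thesis
  proof (cases b')
    case (Pair x' y')
    then show ?thesis using assms b by (cases x'; cases y') (auto split: if_splits)
  qed (use b in simp)
next
  case (Pair x y)
  note b = this
  show ?thesis
  proof (cases b')
    case Empty
    then show ?thesis using assms b by (cases x; cases y) (auto split: if_splits)
  next
    case (Pair x' y')
    then show ?thesis using assms b by (cases x; cases y; cases x'; cases y') (auto split: if_splits)
  qed
qed

text \<open>The defining property of an energy function, checked letter by letter: f_i with i >= 1
  preserves it, and f_0 shifts it by -1 when it acts on the left factor and by +1 when it acts on
  the right one (\<open>energy_cf_right\<close>). The condition on string lengths says that the left
  factor is hit.\<close>

lemma energy_cf_left:
  assumes "b' \<in> crystal n" "b \<in> crystal n" "i \<le> n" "ceps i b < cphi i b'"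
  shows "energy (cf n i b') b = energy b' b - of_bool (i = 0)"
proof (cases "i = 0")
  case False
  show ?thesis
  proof (cases b')
    case (Pair x' y')
    show ?thesis
    proof (cases b)
      case Empty
      then show ?thesis using assms False Pair by auto
    next
      case (Pair x y)
      then show ?thesis using energy_cf_left_pos[of x' y' n x y i] assms False \<open>b' = Pair x' y'\<close> by simp
    qed
  qed (use assms False in auto)
qed (use energy_cf_left_0 assms in auto)

lemma energy_cf_right:
  assumes "b' \<in> crystal n" "b \<in> crystal n" "i \<le> n" "cphi i b' \<le> ceps i b" "0 < cphi i b"
  shows "energy b' (cf n i b) = energy b' b + of_bool (i = 0)"
proof (cases "i = 0")
  case False
  show ?thesis
  proof (cases b)
    case (Pair x y)
    show ?thesis
    proof (cases b')
      case Empty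
      then show ?thesis using assms False Pair by auto
    next
      case (Pair x' y')
      then show ?thesis using energy_cf_right_pos[of x' y' n x y i] assms False \<open>b = Pair x y\<close> by simp
    qed
  qed (use assms False in auto)
qed (use energy_cf_right_0 assms in auto)

section \<open>Ground vertices and the obstruction to dominance\<close>

lemma ground_crystal: "j \<le> n \<Longrightarrow> ground j \<in> crystal n"
  by (auto simp: ground_def)

lemma ceps_ground: "ceps i (ground j) = of_bool (i = j)"
  and cphi_ground: "cphi i (ground j) = of_bool (i = j)"
  by (auto simp: ground_def phl_def epl_def)

lemma energy_ground: "energy (ground j) (ground j) = 0"
  by (auto simp: ground_def)

lemma vw_ground: "vw (ground j) = 0"
  by (auto simp: ground_def)

lemma energy_nonneg: "0 \<le> energy b c"
  by (cases "(b, c)" rule: energy.cases) (auto simp: of_bool_def)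

text \<open>The index i such that f_i moves the letter to its successor, with bar 1 assigned to
  f_0.\<close>

fun lphi :: "letter \<Rightarrow> nat" where
  "lphi (Plain k) = k"
| "lphi (Barred k) = k - 1"

text \<open>An index at which \<open>b\<close> obstructs dominance in position $\Lambda_j$; it is constant along the part of the
  string that stays obstructed, which makes the cancelling reflection an involution.\<close>

fun obstruct :: "nat \<Rightarrow> vertex \<Rightarrow> nat" where
  "obstruct j Empty = 0"
| "obstruct j (Pair x y) = (if lphi x \<noteq> j then lphi x else lphi y)"

lemma obstruct_le: "b \<in> crystal n \<Longrightarrow> obstruct j b \<le> n"
  by (cases b; cases "case b of Pair x y \<Rightarrow> x"; cases "case b of Pair x y \<Rightarrow> y") (auto split: if_splits)

text \<open>Perfectness of level one enters here: only the ground vertex of j has its lengths \<phi>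
  bounded by those of \<Lambda>_j, and any other vertex exceeds the bound at the chosen
  index.\<close>

lemma obstruct_cphi:
  assumes "b \<in> crystal n" "j \<le> n" "b \<noteq> ground j" "1 \<le> n"
  shows "of_bool (obstruct j b = j) < cphi (obstruct j b) b"
proof (cases b)
  case (Pair x y)
  then show ?thesis using assms
    by (cases x; cases y) (auto simp: ground_def phl_def epl_def split: if_splits)
next
  case Empty
  then show ?thesis using assms by (cases "j = 0") (auto simp: ground_def)
qed

lemma obstruct_cf:
  assumes "b \<in> crystal n" "j \<le> n" "b \<noteq> ground j" "1 \<le> n" "i = obstruct j b"
    "of_bool (i = j) < cphi i (cf n i b)"
  shows "obstruct j (cf n i b) = i \<and> cf n i b \<noteq> ground j"
proof (cases b)
  case (Pair x y)
  show ?thesis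
  proof (cases "lphi x = j")
    case True
    then have i: "i = lphi y" using assms Pair by simp
    show ?thesis
    proof (cases x)
      case (Plain a)
      with True have "a = j" "1 \<le> a" using assms \<open>b = Pair x y\<close> by auto
      with Plain i show ?thesis using assms \<open>b = Pair x y\<close>
        by (cases y) (auto simp: ground_def phl_def epl_def fl_def of_bool_def split: if_splits)
    next
      case (Barred a)
      with True have "a = Suc j" using assms \<open>b = Pair x y\<close> by auto
      moreover obtain c where "y = Barred c" using Barred assms \<open>b = Pair x y\<close> by (cases y) auto
      ultimately show ?thesis using Barred i assms \<open>b = Pair x y\<close>
        by (cases c) (auto simp: ground_def phl_def epl_def fl_def split: if_splits)
    qed
  next
    case False
    then have i: "i = lphi x" using assms Pair by simp
    show ?thesis
    proof (cases x)
      case (Plain a)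
      with i have "a = i" "1 \<le> i" using assms \<open>b = Pair x y\<close> by auto
      with Plain False show ?thesis using assms(1,2,4,6) \<open>b = Pair x y\<close>
        by (cases y) (auto simp: ground_def phl_def epl_def fl_def split: if_splits)
    next
      case (Barred a)
      with i have a: "a = Suc i" using assms \<open>b = Pair x y\<close> by auto
      moreover obtain c where "y = Barred c" using Barred assms \<open>b = Pair x y\<close> by (cases y) auto
      ultimately show ?thesis using Barred False assms(1,2,4,6) \<open>b = Pair x y\<close>
        by (cases "i = 0") (auto simp: ground_def phl_def epl_def fl_def split: if_splits)
    qed
  qed
qed (use assms in \<open>auto simp: ground_def split: if_splits\<close>)

lemma obstruct_ce:
  assumes "b \<in> crystal n" "j \<le> n" "b \<noteq> ground j" "1 \<le> n" "i = obstruct j b" "0 < ceps i b"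
  shows "obstruct j (ce n i b) = i \<and> ce n i b \<noteq> ground j"
proof (cases b)
  case (Pair x y)
  show ?thesis
  proof (cases "lphi x = j")
    case True
    then have i: "i = lphi y" using assms Pair by simp
    show ?thesis
    proof (cases x)
      case (Plain a)
      with True have "a = j" "1 \<le> a" using assms \<open>b = Pair x y\<close> by auto
      with Plain i show ?thesis using assms \<open>b = Pair x y\<close>
        by (cases y) (auto simp: ground_def phl_def epl_def el_def split: if_splits)
    next
      case (Barred a)
      with True have "a = Suc j" using assms \<open>b = Pair x y\<close> by auto
      moreover obtain c where "y = Barred c" using Barred assms \<open>b = Pair x y\<close> by (cases y) auto
      ultimately show ?thesis using Barred i assms \<open>b = Pair x y\<close>
        by (cases c) (auto simp: ground_def phl_def epl_def el_def split: if_splits)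
    qed
  next
    case False
    then have i: "i = lphi x" using assms Pair by simp
    show ?thesis
    proof (cases x)
      case (Plain a)
      with i have "a = i" "1 \<le> i" using assms \<open>b = Pair x y\<close> by auto
      with Plain False show ?thesis using assms(1,2,4,6) \<open>b = Pair x y\<close>
        by (cases y) (auto simp: ground_def phl_def epl_def el_def split: if_splits)
    next
      case (Barred a)
      with i have a: "a = Suc i" using assms \<open>b = Pair x y\<close> by auto
      moreover obtain c where "y = Barred c" using Barred assms \<open>b = Pair x y\<close> by (cases y) auto
      ultimately show ?thesis using Barred False assms(1,2,4,6) \<open>b = Pair x y\<close>
        by (cases "i = 0") (auto simp: ground_def phl_def epl_def el_def split: if_splits)
    qed
  qed
qed (use assms in \<open>auto simp: ground_def split: if_splits\<close>)

context type_C
begin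

lemma lw_fl: "z \<in> letters n \<Longrightarrow> 1 \<le> i \<Longrightarrow> i \<le> n \<Longrightarrow> 0 < phl i z \<Longrightarrow> lw (fl n i z) = lw z - simple i"
  by (cases z) (auto simp: phl_def fl_def simple_def fun_eq_iff split: if_splits)

lemma vw_cf:
  assumes "b \<in> crystal n" "i \<le> n" "0 < cphi i b"
  shows "vw (cf n i b) = vw b - simple i + sc (of_bool (i = 0)) delta"
proof (cases b)
  case (Pair x y)
  show ?thesis
  proof (cases "i = 0")
    case True
    then show ?thesis using assms Pair
      by (cases y) (auto simp: simple_def sc_def fun_eq_iff split: if_splits)
  next
    case False
    then show ?thesis
    proof (cases "epl i x < phl i y")
      case True
      then show ?thesis using assms Pair False by (simp add: lw_fl)
    next
      case no: False
      then have "0 < phl i x" using assms(3) Pair False by simp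
      then show ?thesis using assms no Pair False by (simp add: lw_fl)
    qed
  qed
qed (use assms in \<open>auto simp: simple_def fun_eq_iff\<close>)

lemma cphi_ceps:
  assumes "b \<in> crystal n" "i \<le> n"
  shows "int (cphi i b) - int (ceps i b) = cp i (vw b)"
proof (cases b)
  case (Pair x y)
  then show ?thesis using assms n_pos
    by (cases x; cases y) (auto simp: phl_def epl_def cp_def unitv_def split: if_splits)
qed (use assms in \<open>auto simp: cp_def\<close>)

end

section \<open>Paths\<close>

locale path_C = type_C +
  fixes i0 :: nat
  assumes i0: "i0 \<le> n"
begin

abbreviation g0 :: vertex where "g0 \<equiv> ground i0"

text \<open>\<Lambda>_i for i = \<open>i0\<close>: \<epsilon>_1 + ... + \<epsilon>_i at level one,
  with \<delta>-coordinate 0.\<close>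

definition lam :: wt where
  "lam = (\<lambda>j. of_bool (1 \<le> j \<and> j \<le> i0)) + unitv (n + 1)"

lemma cp_lam: "i \<le> n \<Longrightarrow> cp i lam = of_bool (i = i0)"
  using i0 n_pos by (auto simp: cp_def lam_def)

text \<open>f_0 changes the energy towards both neighbours by one; raising the size of the part by
  one restores the equalities \<open>rel_eq\<close>.\<close>

definition fz :: "nat \<Rightarrow> coloured_int \<Rightarrow> coloured_int" where
  "fz i a = (fst a + of_bool (i = 0), cf n i (snd a))"

definition ez :: "nat \<Rightarrow> coloured_int \<Rightarrow> coloured_int" where
  "ez i a = (fst a - of_bool (i = 0), ce n i (snd a))"

definition cw :: "coloured_int \<Rightarrow> wt" where
  "cw a = vw (snd a) - sc (fst a) delta"

definition lead :: "coloured_int list \<Rightarrow> coloured_int" where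
  "lead w = (case w of [] \<Rightarrow> (0, g0) | a # _ \<Rightarrow> a)"

lemma lead_simps [simp]: "lead [] = (0, g0)" "lead (a # w) = a"
  by (simp_all add: lead_def)

text \<open>A path is stored without its ground tail, the head of the list being the rightmost tensor factor;
  the empty list stands for the ground path, so it has the string lengths of the highest weight vector.\<close>

fun cpath :: "coloured_int list \<Rightarrow> bool" where
  "cpath [] \<longleftrightarrow> True"
| "cpath (a # w) \<longleftrightarrow> snd a \<in> crystal n \<and> rel_eq a (lead w) \<and> cpath w \<and> \<not> (w = [] \<and> a = (0, g0))"

definition pwt :: "coloured_int list \<Rightarrow> wt" where
  "pwt w = lam + (\<Sum>a\<leftarrow>w. cw a)"

lemma pwt_simps [simp]: "pwt [] = lam" "pwt (a # w) = pwt w + cw a"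
  by (simp_all add: pwt_def add_ac)

text \<open>The tensor product rule, read from the ground tail towards the head, with truncated
  subtraction for the maximum with 0.\<close>

primrec pphi :: "nat \<Rightarrow> coloured_int list \<Rightarrow> nat" where
  "pphi i [] = of_bool (i = i0)"
| "pphi i (a # w) = cphi i (snd a) + (pphi i w - ceps i (snd a))"

primrec peps :: "nat \<Rightarrow> coloured_int list \<Rightarrow> nat" where
  "peps i [] = 0"
| "peps i (a # w) = peps i w + (ceps i (snd a) - pphi i w)"

primrec pf :: "nat \<Rightarrow> coloured_int list \<Rightarrow> coloured_int list" where
  "pf i [] = [fz i (0, g0)]"
| "pf i (a # w) = (if ceps i (snd a) < pphi i w then a # pf i w else fz i a # w)"

text \<open>The branch with value \<open>[]\<close> keeps the list in normal form: a raised last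
  letter that becomes (0, \<open>g0\<close>) belongs to the ground tail and is dropped. The value at
  the empty list is a default, since the raising length is 0 there.\<close>

primrec pe :: "nat \<Rightarrow> coloured_int list \<Rightarrow> coloured_int list" where
  "pe i [] = []"
| "pe i (a # w) = (if ceps i (snd a) \<le> pphi i w then a # pe i w
     else if w = [] \<and> ez i a = (0, g0) then [] else ez i a # w)"

lemma lead_crystal: "cpath w \<Longrightarrow> snd (lead w) \<in> crystal n"
  by (cases w) (auto simp: ground_crystal i0)

lemma pphi_lead: "cphi i (snd (lead w)) \<le> pphi i w"
  by (cases w) (auto simp: cphi_ground)

lemma lead_pf: "lead (pf i w) = lead w \<or> lead (pf i w) = fz i (lead w) \<and> pphi i w = cphi i (snd (lead w))"
  by (cases w) (auto simp: cphi_ground)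

lemma lead_pe: "0 < peps i w \<Longrightarrow> lead (pe i w) = lead w \<or> lead (pe i w) = ez i (lead w) \<and> 0 < ceps i (snd (lead w))"
  by (cases w) auto

lemma rel_fz_left:
  assumes "snd c \<in> crystal n" "snd a \<in> crystal n" "i \<le> n" "ceps i (snd a) < cphi i (snd c)"
  shows "rel_eq a (fz i c) \<longleftrightarrow> rel_eq a c"
  using energy_cf_left[OF assms] by (cases a; cases c) (auto simp: fz_def)

lemma rel_fz_right:
  assumes "snd c \<in> crystal n" "snd a \<in> crystal n" "i \<le> n" "cphi i (snd c) \<le> ceps i (snd a)" "0 < cphi i (snd a)"
  shows "rel_eq (fz i a) c \<longleftrightarrow> rel_eq a c"
  using energy_cf_right[OF assms] by (cases a; cases c) (auto simp: fz_def)

lemma fz_props: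
  assumes "snd a \<in> crystal n" "i \<le> n" "0 < cphi i (snd a)"
  shows "snd (fz i a) \<in> crystal n" "ez i (fz i a) = a" "ceps i (snd (fz i a)) = Suc (ceps i (snd a))"
    "Suc (cphi i (snd (fz i a))) = cphi i (snd a)" "cw (fz i a) = cw a - simple i"
  using cf_props[OF assms n_pos] vw_cf[OF assms]
  by (simp_all add: fz_def ez_def cw_def sc_linear)

lemma ez_props:
  assumes "snd a \<in> crystal n" "i \<le> n" "0 < ceps i (snd a)"
  shows "snd (ez i a) \<in> crystal n" "fz i (ez i a) = a" "Suc (ceps i (snd (ez i a))) = ceps i (snd a)"
    "cphi i (snd (ez i a)) = Suc (cphi i (snd a))"
  using ce_props[OF assms n_pos] by (simp_all add: fz_def ez_def)

lemma pf_props_pointwise: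
  assumes i: "i \<le> n"
  shows "cpath w \<Longrightarrow> 0 < pphi i w \<Longrightarrow>
    cpath (pf i w) \<and> pf i w \<noteq> [] \<and> pe i (pf i w) = w \<and> peps i (pf i w) = Suc (peps i w) \<and> Suc (pphi i (pf i w)) = pphi i w
      \<and> (\<forall>j. pwt (pf i w) j = pwt w j - simple i j)"
proof (induction w)
  case Nil
  then have ii: "i = i0" by (auto split: if_splits)
  have g: "snd (0::int, g0) \<in> crystal n" "0 < cphi i (snd (0::int, g0))" using i0 ii by (simp_all add: ground_crystal cphi_ground)
  note p = fz_props[OF g(1) i g(2)]
  have "rel_eq (fz i (0, g0)) (0, g0)"
    using rel_fz_right[OF g(1) g(1) i _ g(2)] by (simp add: ceps_ground cphi_ground energy_ground)
  moreover have "fz i (0, g0) \<noteq> (0, g0)"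
  proof
    assume "fz i (0, g0) = (0, g0)"
    then have "ceps i g0 = Suc (ceps i g0)" using p(3) by simp
    then show False by simp
  qed
  moreover have "pe i (pf i []) = []" using p ii by (simp add: ceps_ground)
  moreover have "cw (0, g0) = 0" by (simp add: cw_def vw_ground)
  ultimately show ?case using p ii by (simp add: ceps_ground cphi_ground)
next
  case (Cons a w)
  have a: "snd a \<in> crystal n" "rel_eq a (lead w)" "cpath w" "\<not> (w = [] \<and> a = (0, g0))" using Cons.prems by auto
  show ?case
  proof (cases "ceps i (snd a) < pphi i w")
    case True
    then have IH: "cpath (pf i w)" "pf i w \<noteq> []" "pe i (pf i w) = w" "peps i (pf i w) = Suc (peps i w)" "Suc (pphi i (pf i w)) = pphi i w"
      "\<forall>j. pwt (pf i w) j = pwt w j - simple i j" using Cons.IH a(3) by auto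
    have "rel_eq a (lead (pf i w))"
      using lead_pf[of i w] rel_fz_left[OF lead_crystal[OF a(3)] a(1) i] True a(2) by auto
    then show ?thesis using True IH a by (auto simp: algebra_simps)
  next
    case False
    then have pos: "0 < cphi i (snd a)" using Cons.prems by simp
    note p = fz_props[OF a(1) i pos]
    have le: "cphi i (snd (lead w)) \<le> ceps i (snd a)" using False pphi_lead[of i w] by simp
    have "rel_eq (fz i a) (lead w)"
      using rel_fz_right[OF lead_crystal[OF a(3)] a(1) i le pos] a(2) by simp
    moreover have "\<not> (w = [] \<and> fz i a = (0, g0))"
    proof
      assume "w = [] \<and> fz i a = (0, g0)"
      then have "ceps i g0 = Suc (ceps i (snd a))" "of_bool (i = i0) \<le> ceps i (snd a)" using p(3) False by auto
      then show False by (simp add: ceps_ground split: if_splits)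
    qed
    ultimately show ?thesis using False p a by auto
  qed
qed

lemma pf_props:
  assumes "i \<le> n" "cpath w" "0 < pphi i w"
  shows "cpath (pf i w) \<and> pf i w \<noteq> [] \<and> pe i (pf i w) = w \<and> peps i (pf i w) = Suc (peps i w) \<and> Suc (pphi i (pf i w)) = pphi i w
      \<and> pwt (pf i w) = pwt w - simple i"
  using pf_props_pointwise[OF assms] by (simp add: fun_eq_iff)

lemma pe_props:
  assumes i: "i \<le> n"
  shows "cpath w \<Longrightarrow> 0 < peps i w \<Longrightarrow>
    cpath (pe i w) \<and> pf i (pe i w) = w \<and> Suc (peps i (pe i w)) = peps i w \<and> pphi i (pe i w) = Suc (pphi i w)"
proof (induction w)
  case (Cons a w)
  have a: "snd a \<in> crystal n" "rel_eq a (lead w)" "cpath w" "\<not> (w = [] \<and> a = (0, g0))" using Cons.prems by auto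
  show ?case
  proof (cases "ceps i (snd a) \<le> pphi i w")
    case True
    then have IH: "cpath (pe i w)" "pf i (pe i w) = w" "Suc (peps i (pe i w)) = peps i w" "pphi i (pe i w) = Suc (pphi i w)"
      using Cons.IH Cons.prems a(3) by auto
    have lt: "ceps i (snd a) < pphi i (pe i w)" using True IH(4) by simp
    have "rel_eq a (lead (pe i w))"
      using lead_pf[of i "pe i w"] rel_fz_left[OF lead_crystal[OF IH(1)] a(1) i] lt a(2) IH(2) by auto
    moreover have "\<not> (pe i w = [] \<and> a = (0, g0))"
    proof
      assume e: "pe i w = [] \<and> a = (0, g0)"
      then have "pphi i w = 0" "i = i0" using IH(4) by (cases "i = i0"; simp)+
      then show False using True e by (simp add: ceps_ground)
    qed
    ultimately show ?thesis using True IH a lt by auto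
  next
    case False
    then have pos: "0 < ceps i (snd a)" by simp
    note p = ez_props[OF a(1) i pos]
    have le: "cphi i (snd (lead w)) \<le> ceps i (snd (ez i a))" using False pphi_lead[of i w] p(3) by simp
    have rel: "rel_eq (ez i a) (lead w)"
      using rel_fz_right[OF lead_crystal[OF a(3)] p(1) i le] a(2) p(2,4) by simp
    show ?thesis
    proof (cases "w = [] \<and> ez i a = (0, g0)")
      case True
      then have "ceps i (snd a) = Suc (ceps i g0)" "cphi i g0 = Suc (cphi i (snd a))" using p by auto
      then show ?thesis using True False p(2) by (auto simp: ceps_ground cphi_ground split: if_splits)
    next
      case no: False
      have "pphi i w \<le> ceps i (snd (ez i a))" using False p(3) by simp
      then show ?thesis using no False p a rel by auto
    qed
  qed
qed simp

lemma pwt_pe: "i \<le> n \<Longrightarrow> cpath w \<Longrightarrow> 0 < peps i w \<Longrightarrow> pwt (pe i w) = pwt w + simple i"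
  using pe_props[of i w] pf_props[of i "pe i w"] by (simp add: algebra_simps)

lemma pphi_peps: "i \<le> n \<Longrightarrow> cpath w \<Longrightarrow> int (pphi i w) - int (peps i w) = cp i (pwt w)"
proof (induction w)
  case Nil
  then show ?case by (simp add: cp_lam)
next
  case (Cons a w)
  have "cp i delta = 0" using n_pos by (auto simp: cp_def delta_def unitv_def)
  then have "cp i (pwt (a # w)) = cp i (pwt w) + (int (cphi i (snd a)) - int (ceps i (snd a)))"
    using Cons.prems cphi_ceps[of "snd a" i] by (simp add: cw_def cp_linear)
  moreover have "int (pphi i w) - int (peps i w) = cp i (pwt w)" using Cons by simp
  ultimately have "int (pphi i (a # w)) - int (peps i (a # w)) = cp i (pwt (a # w))"
    by (cases "ceps i (snd a) \<le> pphi i w") (simp_all add: of_nat_diff)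
  then show ?case .
qed

text \<open>Reflection of an \<open>i\<close>-string that keeps the first \<open>m\<close> lowering arrows unused.\<close>

definition pref :: "nat \<Rightarrow> nat \<Rightarrow> coloured_int list \<Rightarrow> coloured_int list" where
  "pref m i w = (if peps i w + m \<le> pphi i w then (pf i ^^ (pphi i w - peps i w - m)) w
     else (pe i ^^ (peps i w + m - pphi i w)) w)"

lemma pf_pow:
  assumes i: "i \<le> n" and inv: "\<And>w. cpath w \<Longrightarrow> m < pphi i w \<Longrightarrow> Q w \<Longrightarrow> Q (pf i w)"
  shows "cpath w \<Longrightarrow> Q w \<Longrightarrow> k + m \<le> pphi i w \<Longrightarrow>
    cpath ((pf i ^^ k) w) \<and> Q ((pf i ^^ k) w) \<and> (pe i ^^ k) ((pf i ^^ k) w) = w \<and> peps i ((pf i ^^ k) w) = peps i w + k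
      \<and> pphi i ((pf i ^^ k) w) + k = pphi i w"
proof (induction k)
  case (Suc k)
  let ?w = "(pf i ^^ k) w"
  have IH: "cpath ?w" "Q ?w" "(pe i ^^ k) ?w = w" "peps i ?w = peps i w + k" "pphi i ?w + k = pphi i w"
    using Suc by auto
  have "m < pphi i ?w" using IH(5) Suc.prems(3) by simp
  then show ?case using IH pf_props[OF i IH(1)] inv[OF IH(1)] by (simp add: funpow_swap1)
qed simp

lemma pe_pow:
  assumes i: "i \<le> n" and inv: "\<And>w. cpath w \<Longrightarrow> 0 < peps i w \<Longrightarrow> Q w \<Longrightarrow> Q (pe i w)"
  shows "cpath w \<Longrightarrow> Q w \<Longrightarrow> k \<le> peps i w \<Longrightarrow>
    cpath ((pe i ^^ k) w) \<and> Q ((pe i ^^ k) w) \<and> (pf i ^^ k) ((pe i ^^ k) w) = w \<and> peps i ((pe i ^^ k) w) + k = peps i w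
      \<and> pphi i ((pe i ^^ k) w) = pphi i w + k"
proof (induction k)
  case (Suc k)
  let ?w = "(pe i ^^ k) w"
  have IH: "cpath ?w" "Q ?w" "(pf i ^^ k) ?w = w" "peps i ?w + k = peps i w" "pphi i ?w = pphi i w + k"
    using Suc by auto
  have "0 < peps i ?w" using IH(4) Suc.prems(3) by simp
  then show ?case using IH pe_props[OF i IH(1)] inv[OF IH(1)] by (simp add: funpow_swap1)
qed simp

lemma pwt_pf_pow: "i \<le> n \<Longrightarrow> cpath w \<Longrightarrow> k \<le> pphi i w \<Longrightarrow> pwt ((pf i ^^ k) w) = pwt w - sc (int k) (simple i)"
proof (induction k)
  case (Suc k)
  have IH: "pwt ((pf i ^^ k) w) = pwt w - sc (int k) (simple i)" by (rule Suc.IH) (use Suc.prems in auto)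
  have p: "cpath ((pf i ^^ k) w)" "pphi i ((pf i ^^ k) w) + k = pphi i w"
    using pf_pow[of i 0 "\<lambda>_. True" w k] Suc.prems by auto
  have "pwt ((pf i ^^ Suc k) w) = pwt w - sc (int k) (simple i) - simple i"
    using pf_props[of i "(pf i ^^ k) w"] p Suc.prems IH by simp
  also have "\<dots> = pwt w - sc (int (Suc k)) (simple i)" by (simp add: sc_linear algebra_simps)
  finally show ?case .
qed simp

lemma pwt_pe_pow: "i \<le> n \<Longrightarrow> cpath w \<Longrightarrow> k \<le> peps i w \<Longrightarrow> pwt ((pe i ^^ k) w) = pwt w + sc (int k) (simple i)"
proof (induction k)
  case (Suc k)
  have IH: "pwt ((pe i ^^ k) w) = pwt w + sc (int k) (simple i)" by (rule Suc.IH) (use Suc.prems in auto)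
  have p: "cpath ((pe i ^^ k) w)" "peps i ((pe i ^^ k) w) + k = peps i w"
    using pe_pow[of i "\<lambda>_. True" w k] Suc.prems by auto
  have "pwt ((pe i ^^ Suc k) w) = pwt w + sc (int k) (simple i) + simple i"
    using pwt_pe[of i "(pe i ^^ k) w"] p Suc.prems IH by simp
  also have "\<dots> = pwt w + sc (int (Suc k)) (simple i)" by (simp add: sc_linear algebra_simps)
  finally show ?case .
qed simp

text \<open>With \<phi> replaced by \<phi> - m the string is reflected as usual: \<epsilon> and
  \<phi> - m are exchanged, and the weight moves by s_i up to m\<alpha>_i. \<open>Q\<close> carries
  whatever must survive each single step; \<open>flip\<close> uses it to keep its own choices
  readable in the result.\<close>

lemma pref_props:
  assumes i: "i \<le> n" and w: "cpath w" "m \<le> pphi i w" "Q w"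
    and invf: "\<And>w. cpath w \<Longrightarrow> m < pphi i w \<Longrightarrow> Q w \<Longrightarrow> Q (pf i w)"
    and inve: "\<And>w. cpath w \<Longrightarrow> 0 < peps i w \<Longrightarrow> Q w \<Longrightarrow> Q (pe i w)"
  shows "cpath (pref m i w)" "Q (pref m i w)" "m \<le> pphi i (pref m i w)" "pref m i (pref m i w) = w"
    "pwt (pref m i w) = srefl i (pwt w) + sc (int m) (simple i)"
proof -
  have "cpath (pref m i w) \<and> Q (pref m i w) \<and> m \<le> pphi i (pref m i w) \<and> pref m i (pref m i w) = w \<and>
      pwt (pref m i w) = pwt w - sc (cp i (pwt w) - int m) (simple i)"
  proof (cases "peps i w + m \<le> pphi i w")
    case True
    define k where "k = pphi i w - peps i w - m"
    have r: "pref m i w = (pf i ^^ k) w" using True by (simp add: pref_def k_def)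
    have km: "k + m \<le> pphi i w" using True by (simp add: k_def)
    note p = pf_pow[OF i invf w(1,3) km]
    let ?v = "(pf i ^^ k) w"
    have "pphi i ?v = peps i w + m" "peps i ?v = pphi i w - m" using p True by (auto simp: k_def)
    then have "pref m i ?v = (pe i ^^ k) ?v"
      using True by (cases "k = 0") (auto simp: pref_def k_def)
    moreover have "pwt ?v = pwt w - sc (int k) (simple i)" using km by (intro pwt_pf_pow i w) simp
    moreover have "int k = cp i (pwt w) - int m" using pphi_peps[OF i w(1)] True by (simp add: k_def of_nat_diff)
    ultimately show ?thesis using r p \<open>pphi i ?v = peps i w + m\<close> by simp
  next
    case False
    define k where "k = peps i w + m - pphi i w"
    have r: "pref m i w = (pe i ^^ k) w" using False by (simp add: pref_def k_def)
    have km: "k \<le> peps i w" using w(2) by (simp add: k_def)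
    note p = pe_pow[OF i inve w(1,3) km]
    let ?v = "(pe i ^^ k) w"
    have e: "pphi i ?v = peps i w + m" "peps i ?v = pphi i w - m" using p False w(2) by (auto simp: k_def)
    then have "pref m i ?v = (pf i ^^ k) ?v"
      using False w(2) by (auto simp: pref_def k_def)
    moreover have "pwt ?v = pwt w + sc (int k) (simple i)" using km by (intro pwt_pe_pow i w)
    moreover have "int k = - (cp i (pwt w) - int m)" using pphi_peps[OF i w(1)] False by (simp add: k_def of_nat_diff)
    ultimately show ?thesis using r p e sc_linear(5)[of "cp i (pwt w) - int m" "simple i"] by simp
  qed
  then show "cpath (pref m i w)" "Q (pref m i w)" "m \<le> pphi i (pref m i w)" "pref m i (pref m i w) = w"
    "pwt (pref m i w) = srefl i (pwt w) + sc (int m) (simple i)"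
    by (auto simp: srefl_def sc_linear algebra_simps)
qed


end

context path_C
begin

section \<open>Heights of paths and finiteness\<close>

lemma rel_eq_iff: "rel_eq a c \<longleftrightarrow> fst a - fst c = energy (snd c) (snd a)"
  by (cases a; cases c) simp

lemma lead_nonneg: "cpath w \<Longrightarrow> 0 \<le> fst (lead w)"
proof (induction w)
  case (Cons a w)
  then show ?case using energy_nonneg[of "snd (lead w)" "snd a"] by (auto simp: rel_eq_iff)
qed simp

lemma energy_zero_mono:
  assumes "energy b c = 0" "b \<noteq> c"
  shows "\<exists>x y x' y'. b = Pair x y \<and> c = Pair x' y' \<and> x \<le> x' \<and> y \<le> y'"
proof (cases b)
  case (Pair x y)
  note b = this
  show ?thesis
  proof (cases c)
    case (Pair x' y')
    then show ?thesis using assms b by (auto split: if_splits simp: of_bool_def)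
  qed (use assms b in auto)
next
  case Empty
  then show ?thesis using assms by (cases c) auto
qed

text \<open>Between parts of size 0 the energy vanishes, so both letters can only grow away from the
  ground; the first such part differs from the ground vertex, hence all of them do.\<close>

lemma zero_part:
  assumes "cpath (a # w)" "fst a = 0"
  shows "\<exists>x y. snd a = Pair x y \<and> 1 \<le> i0 \<and> Plain i0 \<le> x \<and> Barred i0 \<le> y \<and> snd a \<noteq> g0"
  using assms
proof (induction w arbitrary: a)
  case Nil
  then have e: "energy g0 (snd a) = 0" and ne: "snd a \<noteq> g0"
    by (cases a; auto simp: rel_eq_iff)+
  obtain x y x' y' where p: "g0 = Pair x y" "snd a = Pair x' y'" "x \<le> x'" "y \<le> y'"
    using energy_zero_mono[OF e] ne by metis
  then have "1 \<le> i0" "x = Plain i0" "y = Barred i0" by (auto simp: ground_def split: if_splits)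
  then show ?case using p ne by auto
next
  case (Cons c w)
  have e: "fst a - fst c = energy (snd c) (snd a)" and c: "cpath (c # w)"
    using Cons.prems by (auto simp: rel_eq_iff)
  have "0 \<le> fst c" using lead_nonneg[OF c] by simp
  then have c0: "fst c = 0" using e energy_nonneg[of "snd c" "snd a"] Cons.prems(2) by simp
  then obtain x y where p: "snd c = Pair x y" "1 \<le> i0" "Plain i0 \<le> x" "Barred i0 \<le> y" "snd c \<noteq> g0"
    using Cons.IH[OF c] by blast
  show ?case
  proof (cases "snd a = snd c")
    case False
    then obtain x' y' where q: "snd a = Pair x' y'" "x \<le> x'" "y \<le> y'"
      using energy_zero_mono[of "snd c" "snd a"] e c0 Cons.prems(2) p(1) by auto
    have "snd a \<noteq> g0"
    proof
      assume "snd a = g0"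
      then have "x' = Plain i0" "y' = Barred i0" using q(1) p(2) by (auto simp: ground_def)
      then have "x = Plain i0" "y = Barred i0" using p q by (auto intro: antisym)
      then show False using p by (simp add: ground_def)
    qed
    then show ?thesis using q p by (meson order_trans)
  qed (use p in auto)
qed

lemma ht_vw: "b \<in> crystal n \<Longrightarrow> ht (vw b) \<le> 4 * int n - 2"
proof (cases b)
  case (Pair x y)
  assume "b \<in> crystal n"
  then show ?thesis using ht_lw_bound[of x] ht_lw_bound[of y] Pair by (simp add: ht_linear)
qed (use n_pos in \<open>simp add: ht_linear\<close>)

text \<open>A part of positive size loses at least 4n through \<delta>, more than the 4n - 2 that
  its vertex can add. A part of size 0 has larger letters than the ground vertex, which has height
  0. So every stored part lowers the height, and this bounds the length and the sizes of paths of
  given weight.\<close>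

lemma ht_cw_neg:
  assumes "cpath (a # w)"
  shows "ht (cw a) \<le> -1"
proof -
  have nn: "0 \<le> fst a" using lead_nonneg[OF assms] by simp
  have b: "snd a \<in> crystal n" using assms by simp
  show ?thesis
  proof (cases "fst a = 0")
    case True
    then obtain x y where p: "snd a = Pair x y" "1 \<le> i0" "Plain i0 \<le> x" "Barred i0 \<le> y" "snd a \<noteq> g0"
      using zero_part[OF assms] by blast
    have l: "x \<in> letters n" "y \<in> letters n" using b p by auto
    have P: "Plain i0 \<in> letters n" "Barred i0 \<in> letters n" using p i0 by auto
    have le: "ht (lw x) \<le> ht (lw (Plain i0))" "ht (lw y) \<le> ht (lw (Barred i0))"
      using ht_lw_less[OF P(1) l(1)] ht_lw_less[OF P(2) l(2)] p by (meson not_less)+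
    have "x \<noteq> Plain i0 \<or> y \<noteq> Barred i0" using p by (auto simp: ground_def)
    then have "Plain i0 < x \<or> Barred i0 < y" using p by (metis order_le_less)
    then have "ht (lw x) < ht (lw (Plain i0)) \<or> ht (lw y) < ht (lw (Barred i0))"
      using ht_lw_less[OF l(1) P(1)] ht_lw_less[OF l(2) P(2)] by blast
    then have "ht (lw x) + ht (lw y) < 0" using le by (auto simp: ht_linear)
    then show ?thesis using p True by (simp add: cw_def ht_linear)
  next
    case False
    then have "4 * int n * 1 \<le> 4 * int n * fst a" using nn by (intro mult_left_mono) auto
    then show ?thesis using ht_vw[OF b] by (simp add: cw_def ht_linear ht_delta algebra_simps)
  qed
qed

lemma ht_pwt: "cpath w \<Longrightarrow> ht (pwt w) + int (length w) \<le> ht lam"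
proof (induction w)
  case (Cons a w)
  have "ht (pwt w) + int (length w) \<le> ht lam" using Cons by simp
  then have "ht (pwt (a # w)) + int (length (a # w)) \<le> ht lam"
    using ht_cw_neg[of a w] Cons.prems by (simp add: ht_linear)
  then show ?case .
qed simp

lemma ht_pwt_part: "cpath w \<Longrightarrow> a \<in> set w \<Longrightarrow> ht (pwt w) \<le> ht lam + ht (cw a)"
proof (induction w)
  case (Cons c w)
  have "ht (pwt (c # w)) \<le> ht lam + ht (cw a)"
  proof (cases "a = c")
    case True
    then show ?thesis using ht_pwt[of w] Cons.prems by (simp add: ht_linear)
  next
    case False
    then have "ht (pwt w) \<le> ht lam + ht (cw a)" using Cons by simp
    then show ?thesis using Cons.prems ht_cw_neg[of c w] by (simp add: ht_linear)
  qed
  then show ?case .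
qed simp

lemma cpath_part: "cpath w \<Longrightarrow> a \<in> set w \<Longrightarrow> 0 \<le> fst a \<and> snd a \<in> crystal n"
proof (induction w)
  case (Cons c w)
  then show ?case using lead_nonneg[of "c # w"] by auto
qed simp

lemma finite_paths: "finite {w. cpath w \<and> b \<le> ht (pwt w)}"
proof (rule finite_subset)
  let ?M = "\<bar>ht lam - b\<bar> + 4 * int n"
  show "{w. cpath w \<and> b \<le> ht (pwt w)} \<subseteq> {w. set w \<subseteq> {0..?M} \<times> crystal n \<and> length w \<le> nat ?M}"
  proof clarify
    fix w assume w: "cpath w" "b \<le> ht (pwt w)"
    have "a \<in> {0..?M} \<times> crystal n" if a: "a \<in> set w" for a
    proof -
      have "b \<le> ht lam + ht (cw a)" using ht_pwt_part[OF w(1) a] w(2) by simp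
      moreover have "ht (cw a) \<le> 4 * int n - 2 - 4 * int n * fst a"
        using ht_vw[of "snd a"] cpath_part[OF w(1) a] by (simp add: cw_def ht_linear ht_delta algebra_simps)
      moreover have "1 * fst a \<le> 4 * int n * fst a" using cpath_part[OF w(1) a] n_pos by (intro mult_right_mono) auto
      ultimately have "fst a \<le> ?M" by linarith
      then show ?thesis using cpath_part[OF w(1) a] by (cases a) auto
    qed
    then show "set w \<subseteq> {0..?M} \<times> crystal n \<and> length w \<le> nat ?M"
      using ht_pwt[OF w(1)] w(2) by auto
  qed
  show "finite {w. set w \<subseteq> {0..?M} \<times> crystal n \<and> length w \<le> nat ?M}"
    by (rule finite_lists_length_le) (simp add: finite_crystal)
qed

text \<open>The character of the path crystal, multiplied by the Weyl denominator.\<close>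

definition SY :: "wt \<Rightarrow> int" where
  "SY v = (\<Sum>w\<in>{w. cpath w \<and> S (v - pwt w) \<noteq> 0}. S (v - pwt w))"

lemma finite_SY: "finite {w. cpath w \<and> S (v - pwt w) \<noteq> 0}"
proof (rule finite_subset[OF _ finite_paths])
  show "{w. cpath w \<and> S (v - pwt w) \<noteq> 0} \<subseteq> {w. cpath w \<and> ht v - ht rho \<le> ht (pwt w)}"
  proof clarify
    fix w assume "S (v - pwt w) \<noteq> 0"
    then show "ht v - ht rho \<le> ht (pwt w)" using S_bound[of "v - pwt w"] by (simp add: ht_linear)
  qed
qed

lemma pref_0:
  assumes "i \<le> n" "cpath w"
  shows "cpath (pref 0 i w)" "pref 0 i (pref 0 i w) = w" "pwt (pref 0 i w) = srefl i (pwt w)"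
  using pref_props[OF assms, of 0 "\<lambda>_. True"] by auto

lemma bij_pref_0:
  assumes i: "i \<le> n"
  shows "bij_betw (pref 0 i) {w. cpath w \<and> P (pwt w)} {w. cpath w \<and> P (srefl i (pwt w))}"
  by (rule bij_betw_byWitness[where f' = "pref 0 i"]) (use pref_0[OF i] srefl_srefl[OF i] in auto)

lemma SY_srefl:
  assumes i: "i \<le> n"
  shows "SY (srefl i v) = - SY v"
proof -
  have e: "S (srefl i v - u) = - S (v - srefl i u)" for u
    using S_srefl[OF i, of "v - srefl i u"] srefl_srefl[OF i] by (simp add: srefl_linear)
  have b: "bij_betw (pref 0 i) {w. cpath w \<and> S (v - pwt w) \<noteq> 0} {w. cpath w \<and> S (v - srefl i (pwt w)) \<noteq> 0}"
    by (rule bij_pref_0[OF i, of "\<lambda>u. S (v - u) \<noteq> 0"])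
  have "SY (srefl i v) = - (\<Sum>w\<in>{w. cpath w \<and> S (v - srefl i (pwt w)) \<noteq> 0}. S (v - srefl i (pwt w)))"
    by (simp add: SY_def e sum_negf)
  also have "\<dots> = - (\<Sum>w\<in>{w. cpath w \<and> S (v - pwt w) \<noteq> 0}. S (v - srefl i (pwt (pref 0 i w))))"
    using sum.reindex_bij_betw[OF b, of "\<lambda>w. S (v - srefl i (pwt w))"] by simp
  also have "\<dots> = - SY v"
    unfolding SY_def using pref_0[OF i] srefl_srefl[OF i] by (intro arg_cong[of _ _ uminus] sum.cong) auto
  finally show ?thesis .
qed

lemma SY_bound: "SY v \<noteq> 0 \<Longrightarrow> ht v \<le> ht rho + ht lam"
proof -
  assume "SY v \<noteq> 0"
  then obtain w where "cpath w" "S (v - pwt w) \<noteq> 0" unfolding SY_def by (metis (mono_tags, lifting) mem_Collect_eq sum.neutral)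
  then show ?thesis using S_bound[of "v - pwt w"] ht_pwt[of w] by (simp add: ht_linear)
qed

section \<open>The sign-reversing involution\<close>

lemma cpath_append_change:
  "cpath (p @ w) \<Longrightarrow> cpath w' \<Longrightarrow> (p \<noteq> [] \<Longrightarrow> cpath (last p # w')) \<Longrightarrow> cpath (p @ w')"
proof (induction p)
  case (Cons a p)
  then show ?case by (cases p) auto
qed simp

lemma cpath_appendD: "cpath (p @ w) \<Longrightarrow> cpath w"
  by (induction p) auto

lemma cpath_last: "cpath (p @ w) \<Longrightarrow> p \<noteq> [] \<Longrightarrow> cpath (last p # w)"
  by (induction p) auto

lemma pwt_append: "pwt (p @ w) = pwt w + (\<Sum>a\<leftarrow>p. cw a)"
  by (simp add: pwt_def algebra_simps)

lemma cp_delta: "i \<le> n \<Longrightarrow> cp i delta = 0"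
  using n_pos by (auto simp: cp_def delta_def unitv_def)

lemma cp_prefix:
  assumes "i \<le> n"
  shows "(\<And>a. a \<in> set p \<Longrightarrow> snd a = ground j) \<Longrightarrow> cp i (\<Sum>a\<leftarrow>p. cw a) = 0"
proof (induction p)
  case (Cons a p)
  have "cp i (\<Sum>a\<leftarrow>p. cw a) = 0" using Cons by auto
  then have "cp i (cw a + (\<Sum>a\<leftarrow>p. cw a)) = 0"
    using Cons.prems[of a] cp_delta[OF assms] by (simp add: cw_def cp_linear vw_ground)
  then have "cp i (\<Sum>a\<leftarrow>a # p. cw a) = 0" by (simp only: list.map sum_list.Cons)
  then show ?case .
qed (simp add: cp_linear)

text \<open>The leading copies of the ground vertex of j are skipped since they pair to 0 with all
  coroots. Keeping m = 1 + [i = j] arrows has two purposes: m is the pairing of the dominant weight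
  v with the i-th coroot, so that the reflection acts as s_i on v minus the weight of the path; and
  m exceeds the raising length of the skipped vertices, so the string operators never touch the
  prefix.\<close>

definition flip :: "nat \<Rightarrow> coloured_int list \<Rightarrow> coloured_int list" where
  "flip j w = (let p = takeWhile (\<lambda>a. snd a = ground j) w; u = dropWhile (\<lambda>a. snd a = ground j) w;
     i = obstruct j (snd (lead u)) in p @ pref (1 + of_bool (i = j)) i u)"

lemma flip_props:
  assumes j: "j \<le> n" and dom: "\<And>i. i \<le> n \<Longrightarrow> cp i v = 1 + of_bool (i = j)"
    and w: "cpath w" and ne: "j = i0 \<Longrightarrow> w \<noteq> []"
  shows "cpath (flip j w)" "flip j (flip j w) = w" "j = i0 \<Longrightarrow> flip j w \<noteq> []" "S (v - pwt (flip j w)) = - S (v - pwt w)"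
proof -
  let ?P = "\<lambda>a :: coloured_int. snd a = ground j"
  define p where "p = takeWhile ?P w"
  define u where "u = dropWhile ?P w"
  define i where "i = obstruct j (snd (lead u))"
  define m :: nat where "m = 1 + of_bool (i = j)"
  have wpu: "w = p @ u" by (simp add: p_def u_def)
  have pu: "cpath (p @ u)" using w wpu by simp
  have u: "cpath u" using pu by (rule cpath_appendD)
  have pP: "\<And>a. a \<in> set p \<Longrightarrow> ?P a" unfolding p_def by (rule set_takeWhileD[THEN conjunct2])
  have lead: "snd (lead u) \<noteq> ground j"
  proof (cases u)
    case (Cons a t)
    then have "\<not> ?P (hd u)" using hd_dropWhile[of ?P w] unfolding u_def by auto
    then show ?thesis using Cons by simp
  next
    \<comment> \<open>With nothing left the lead is the ground tail. If j = i0, the last skipped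
      letter would be a stored (0, \<open>g0\<close>), which a path excludes.\<close>
    case Nil
    show ?thesis
    proof
      assume "snd (lead u) = ground j"
      then have ji: "ground j = g0" using Nil by simp
      then have "cphi i0 (ground j) = 1" by (simp add: cphi_ground)
      then have "j = i0" by (cases "i0 = j") (simp_all add: cphi_ground)
      then have "w \<noteq> []" using ne by simp
      then have p: "p \<noteq> []" using wpu Nil by simp
      have c: "cpath (last p # [])" using cpath_last[OF pu p] Nil by simp
      have "snd (last p) = g0" using pP[OF last_in_set[OF p]] ji by simp
      moreover have "fst (last p) = 0" using c calculation by (simp add: rel_eq_iff energy_ground)
      ultimately show False using c by (cases "last p") simp
    qed
  qed
  have i: "i \<le> n" unfolding i_def by (rule obstruct_le[OF lead_crystal[OF u]])
  have "m \<le> cphi i (snd (lead u))"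
    using obstruct_cphi[OF lead_crystal[OF u] j lead n_pos] by (simp add: m_def i_def)
  then have mu: "m \<le> pphi i u" using pphi_lead[of i u] by simp
  \<comment> \<open>\<open>Q\<close> records what lets a second application find the same prefix,
    the same index and the same tail.\<close>
  define Q where "Q w \<longleftrightarrow> m \<le> pphi i w \<and> cpath (p @ w) \<and> snd (lead w) \<noteq> ground j \<and> obstruct j (snd (lead w)) = i" for w
  have Qu: "Q u" using mu pu lead by (simp add: Q_def i_def)
  have eps_last: "ceps i (snd (last p)) < m" if "p \<noteq> []"
    using pP[OF last_in_set[OF that]] by (simp add: ceps_ground m_def)
  have Qf: "Q (pf i w)" if c: "cpath w" and lt: "m < pphi i w" and q: "Q w" for w
  proof -
    have pw: "cpath (p @ w)" "snd (lead w) \<noteq> ground j" "obstruct j (snd (lead w)) = i" using q by (auto simp: Q_def)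
    have f: "cpath (pf i w)" "Suc (pphi i (pf i w)) = pphi i w" using pf_props[OF i c] lt by auto
    have "cpath (last p # pf i w)" if "p \<noteq> []"
      using pf_props[OF i cpath_last[OF pw(1) that]] eps_last[OF that] lt by auto
    then have 1: "cpath (p @ pf i w)" using cpath_append_change[OF pw(1) f(1)] by blast
    have 2: "obstruct j (snd (lead (pf i w))) = i \<and> snd (lead (pf i w)) \<noteq> ground j"
    proof (cases "lead (pf i w) = lead w")
      case False
      then have e: "snd (lead (pf i w)) = cf n i (snd (lead w))" "pphi i w = cphi i (snd (lead w))"
        using lead_pf[of i w] by (auto simp: fz_def)
      have "Suc (cphi i (cf n i (snd (lead w)))) = cphi i (snd (lead w))"
        using cf_props(4)[OF lead_crystal[OF c] i _ n_pos] lt e(2) by simp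
      then have "of_bool (i = j) < cphi i (cf n i (snd (lead w)))" using lt e(2) by (auto simp: m_def)
      then show ?thesis using obstruct_cf[OF lead_crystal[OF c] j pw(2) n_pos pw(3)[symmetric]] e by simp
    qed (use pw in auto)
    show ?thesis using 1 2 f(2) lt by (simp add: Q_def)
  qed
  have Qe: "Q (pe i w)" if c: "cpath w" and pos: "0 < peps i w" and q: "Q w" for w
  proof -
    have pw: "m \<le> pphi i w" "cpath (p @ w)" "snd (lead w) \<noteq> ground j" "obstruct j (snd (lead w)) = i" using q by (auto simp: Q_def)
    have f: "cpath (pe i w)" "pphi i (pe i w) = Suc (pphi i w)" using pe_props[OF i c pos] by auto
    have "cpath (last p # pe i w)" if "p \<noteq> []"
    proof -
      have "ceps i (snd (last p)) \<le> pphi i w" using eps_last[OF that] pw(1) by simp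
      then show ?thesis using pe_props[OF i cpath_last[OF pw(2) that]] pos by auto
    qed
    then have 1: "cpath (p @ pe i w)" using cpath_append_change[OF pw(2) f(1)] by blast
    have 2: "obstruct j (snd (lead (pe i w))) = i \<and> snd (lead (pe i w)) \<noteq> ground j"
    proof (cases "lead (pe i w) = lead w")
      case False
      then have e: "snd (lead (pe i w)) = ce n i (snd (lead w))" "0 < ceps i (snd (lead w))"
        using lead_pe[OF pos] by (auto simp: ez_def)
      then show ?thesis using obstruct_ce[OF lead_crystal[OF c] j pw(3) n_pos pw(4)[symmetric]] by simp
    qed (use pw in auto)
    show ?thesis using 1 2 f(2) pw(1) by (simp add: Q_def)
  qed
  note r = pref_props[where Q = Q, OF i u mu Qu Qf Qe]
  let ?u = "pref m i u"
  have fl: "flip j w = p @ ?u" by (simp add: flip_def p_def u_def i_def m_def Let_def)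
  have Qr: "cpath (p @ ?u)" "snd (lead ?u) \<noteq> ground j" "obstruct j (snd (lead ?u)) = i" using r(2) by (auto simp: Q_def)
  show "cpath (flip j w)" using Qr fl by simp
  have tw: "takeWhile ?P (p @ ?u) = p" "dropWhile ?P (p @ ?u) = ?u"
    using pP Qr(2) by (cases ?u; auto)+
  show "flip j (flip j w) = w"
  proof -
    have "flip j (p @ ?u) = p @ pref m i ?u" unfolding flip_def Let_def tw Qr(3) m_def[symmetric] by (rule refl)
    then show ?thesis using fl r(4) wpu by simp
  qed
  show "flip j w \<noteq> []" if "j = i0"
    using fl Qr(2) that by (cases ?u) auto
  let ?V = "v - (\<Sum>a\<leftarrow>p. cw a)"
  have "cp i ?V = int m" using dom[OF i] cp_prefix[OF i pP] by (simp add: cp_linear m_def)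
  then have V: "srefl i ?V = ?V - sc (int m) (simple i)" by (simp add: srefl_def)
  have 1: "v - pwt (flip j w) = ?V - (srefl i (pwt u) + sc (int m) (simple i))"
    unfolding fl by (simp add: pwt_append r(5) algebra_simps)
  have 2: "srefl i (?V - pwt u) = srefl i ?V - srefl i (pwt u)" by (rule srefl_linear(2))
  have 3: "?V - pwt u = v - pwt w" using wpu by (simp add: pwt_append algebra_simps)
  have "v - pwt (flip j w) = srefl i (v - pwt w)"
    unfolding 1 3[symmetric] 2 V by (simp add: algebra_simps)
  then show "S (v - pwt (flip j w)) = - S (v - pwt w)" by (simp only: S_srefl[OF i])
qed

text \<open>The central element is the sum of the simple coroots, all labels being 1 in this
  type.\<close>

lemma sum_cp: "(\<Sum>i\<le>n. cp i u) = u (n + 1)"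
proof -
  have "(\<Sum>i<k. cp i u) = u (n + 1) - u k" if "1 \<le> k" "k \<le> n" for k
    using that
  proof (induction k rule: nat_induct_at_least)
    case base
    then show ?case by (simp add: cp_def)
  next
    case (Suc k)
    then show ?case by (simp add: cp_def)
  qed
  from this[OF n_pos order_refl] show ?thesis
    using n_pos by (simp add: lessThan_Suc_atMost[symmetric] cp_def)
qed

text \<open>\<delta> is isotropic and pairs with \<rho> to 2(n+1), so |\<rho> - k\<delta>|^2 =
  |\<rho>|^2 only for k = 0, and \<open>S_norm\<close> applies.\<close>

lemma S_rho_delta: "S (rho - sc k delta) = of_bool (k = 0)"
proof (cases "S (rho - sc k delta) = 0")
  case True
  then show ?thesis using S_rho by (cases "k = 0") auto
next
  case False
  then have "form (rho - sc k delta) (rho - sc k delta) = form rho rho" by (rule S_norm)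
  moreover have "form delta delta = 0" by (simp add: form_delta) (simp add: delta_def)
  ultimately have "k * form delta rho = 0" by (simp add: form_linear form_commute[of rho delta])
  then have "k = 0" by (simp add: form_delta) (simp add: rho_def)
  then show ?thesis using S_rho by simp
qed

text \<open>The n+1 positive pairings sum to n+2, so one of them is 2 and the rest are 1; its index
  j drives \<open>flip\<close>. For j = i0 the empty path has no partner and contributes S(v -
  \<open>lam\<close>), which is nonzero only at \<open>lam + rho\<close>; for other j everything
  cancels.\<close>

lemma SY_dominant:
  assumes dom: "\<And>i. i \<le> n \<Longrightarrow> 0 < cp i v" and level: "v (n + 1) = int n + 2"
  shows "SY v = of_bool (v = lam + rho)"
proof -
  have "(\<Sum>i\<le>n. cp i v - 1) = 1" using sum_cp[of v] level by (simp add: sum_subtractf)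
  moreover have nn: "\<And>i. i \<in> {..n} \<Longrightarrow> 0 \<le> cp i v - 1" using dom by force
  ultimately obtain j where j: "j \<le> n" "cp j v - 1 > 0"
    by (metis (no_types, lifting) atMost_iff less_le sum.neutral zero_neq_one)
  have "(cp j v - 1) + (\<Sum>i\<in>{..n} - {j}. cp i v - 1) = 1"
    using \<open>(\<Sum>i\<le>n. cp i v - 1) = 1\<close> j(1) by (simp add: sum.remove[of "{..n}" j])
  moreover have "0 \<le> (\<Sum>i\<in>{..n} - {j}. cp i v - 1)" using nn by (intro sum_nonneg) auto
  ultimately have "cp j v = 2" "(\<Sum>i\<in>{..n} - {j}. cp i v - 1) = 0" using j(2) by linarith+
  then have c: "cp i v = 1 + of_bool (i = j)" if "i \<le> n" for i
    using that nn sum_nonneg_eq_0_iff[of "{..n} - {j}" "\<lambda>i. cp i v - 1"] by (cases "i = j") auto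
  let ?T = "{w. cpath w \<and> S (v - pwt w) \<noteq> 0 \<and> (j = i0 \<longrightarrow> w \<noteq> [])}"
  have fin: "finite ?T" by (rule finite_subset[OF _ finite_SY[of v]]) auto
  have "bij_betw (flip j) ?T ?T"
    by (rule bij_betw_byWitness[where f' = "flip j"]) (use flip_props[OF j(1) c] in auto)
  then have "(\<Sum>w\<in>?T. S (v - pwt w)) = (\<Sum>w\<in>?T. S (v - pwt (flip j w)))"
    by (rule sum.reindex_bij_betw[symmetric])
  also have "\<dots> = - (\<Sum>w\<in>?T. S (v - pwt w))"
    using flip_props(4)[OF j(1) c] by (simp add: sum_negf[symmetric])
  finally have T0: "(\<Sum>w\<in>?T. S (v - pwt w)) = 0" by simp
  show ?thesis
  proof (cases "j = i0")
    case False
    then have "SY v = 0" using T0 by (simp add: SY_def)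
    moreover have "v \<noteq> lam + rho"
    proof
      assume "v = lam + rho"
      then have "cp i0 v = 2" using cp_lam[OF i0] cp_rho[OF i0] by (simp add: cp_linear)
      then show False using c[OF i0] False by simp
    qed
    ultimately show ?thesis by simp
  next
    case True
    have d: "cp i (v - lam) = 1" if "i \<le> n" for i using c[OF that] cp_lam[OF that] True by (simp add: cp_linear)
    have "S (v - lam) = of_bool (v = lam + rho)"
    proof (cases "S (v - lam) = 0")
      case True
      then show ?thesis using S_rho by (cases "v = lam + rho") auto
    next
      case False
      have "\<exists>k\<ge>0. v - lam = rho - sc k delta" by (rule S_dominant[OF False]) (simp add: d)
      then obtain k where k: "v - lam = rho - sc k delta" by blast
      then have "k = 0" using False S_rho_delta[of k] by (cases "k = 0") auto
      then have "v = lam + rho" using k by (simp add: algebra_simps)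
      then show ?thesis using S_rho by simp
    qed
    moreover have "SY v = (\<Sum>w\<in>?T. S (v - pwt w)) + S (v - lam)"
    proof (cases "S (v - lam) = 0")
      case True
      then have "{w. cpath w \<and> S (v - pwt w) \<noteq> 0} = ?T" by auto
      then show ?thesis using True by (simp add: SY_def)
    next
      case False
      then have "{w. cpath w \<and> S (v - pwt w) \<noteq> 0} = insert [] ?T" using \<open>j = i0\<close> by auto
      moreover have "[] \<notin> ?T" using \<open>j = i0\<close> by simp
      ultimately show ?thesis using fin by (simp add: SY_def)
    qed
    ultimately show ?thesis using T0 by simp
  qed
qed

end

section \<open>The loop algebra\<close>

fun om :: "letter \<Rightarrow> letter \<Rightarrow> int" where
  "om (Plain i) (Barred j) = of_bool (i = j)"
| "om (Barred i) (Plain j) = - of_bool (i = j)"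
| "om (Plain i) (Plain j) = 0"
| "om (Barred i) (Barred j) = 0"

lemma om_antisym: "om x y = - om y x"
  by (cases x; cases y) auto

lemma om_nonzero: "om x y \<noteq> 0 \<longleftrightarrow> y = bar x"
  by (cases x; cases y) auto

lemma om_bar_sq: "om x (bar x) * om x (bar x) = 1"
  by (cases x) auto

text \<open>Rows and columns are renamed by letters, the plain ones first. Matrix sums become sums
  over \<open>letters n\<close>, and the symplectic form becomes \<open>om\<close>.\<close>

definition lt :: "nat \<Rightarrow> nat \<Rightarrow> letter" where
  "lt n r = (if r < n then Plain (r + 1) else Barred (r - n + 1))"

definition ix :: "nat \<Rightarrow> letter \<Rightarrow> nat" where
  "ix n x = (case x of Plain j \<Rightarrow> j - 1 | Barred j \<Rightarrow> n + j - 1)"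

lemma lt_letters: "r < 2 * n \<Longrightarrow> lt n r \<in> letters n"
  by (auto simp: lt_def)

lemma lt_ix: "x \<in> letters n \<Longrightarrow> lt n (ix n x) = x"
  by (cases x) (auto simp: lt_def ix_def)

lemma ix_lt: "r < 2 * n \<Longrightarrow> ix n (lt n r) = r"
  by (auto simp: lt_def ix_def)

lemma ix_less: "x \<in> letters n \<Longrightarrow> ix n x < 2 * n"
  by (cases x) (auto simp: ix_def)

lemma bij_lt: "bij_betw (lt n) {..<2 * n} (letters n)"
  by (rule bij_betw_byWitness[where f' = "ix n"]) (auto simp: lt_ix ix_lt lt_letters ix_less)

lemma sum_lt: "(\<Sum>r<2 * n. f (lt n r)) = (\<Sum>x\<in>letters n. f x)"
  by (rule sum.reindex_bij_betw[OF bij_lt])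

definition LM :: "nat \<Rightarrow> (letter \<Rightarrow> letter \<Rightarrow> laurent) \<Rightarrow> laurent mat" where
  "LM n f = mat (2 * n) (2 * n) (\<lambda>(r, s). f (lt n r) (lt n s))"

lemma LM_carrier [simp]: "LM n f \<in> carrier_mat (2 * n) (2 * n)" "dim_row (LM n f) = 2 * n" "dim_col (LM n f) = 2 * n"
  by (simp_all add: LM_def)

lemma LM_index: "r < 2 * n \<Longrightarrow> s < 2 * n \<Longrightarrow> LM n f $$ (r, s) = f (lt n r) (lt n s)"
  by (simp add: LM_def)

lemma LM_cong: "(\<And>a b. a \<in> letters n \<Longrightarrow> b \<in> letters n \<Longrightarrow> f a b = g a b) \<Longrightarrow> LM n f = LM n g"
  by (rule eq_matI) (auto simp: LM_index lt_letters)

lemma LM_mult: "LM n f * LM n g = LM n (\<lambda>a b. \<Sum>c\<in>letters n. f a c * g c b)"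
proof (rule eq_matI)
  fix r s assume rs: "r < dim_row (LM n (\<lambda>a b. \<Sum>c\<in>letters n. f a c * g c b))" "s < dim_col (LM n (\<lambda>a b. \<Sum>c\<in>letters n. f a c * g c b))"
  then have "(LM n f * LM n g) $$ (r, s) = (\<Sum>k<2 * n. f (lt n r) (lt n k) * g (lt n k) (lt n s))"
    by (simp add: scalar_prod_def LM_index lessThan_atLeast0)
  then show "(LM n f * LM n g) $$ (r, s) = LM n (\<lambda>a b. \<Sum>c\<in>letters n. f a c * g c b) $$ (r, s)"
    using rs sum_lt[of "\<lambda>c. f (lt n r) c * g c (lt n s)" n] by (simp add: LM_index)
qed auto

lemma LM_add: "LM n f + LM n g = LM n (\<lambda>a b. f a b + g a b)"
  and LM_minus: "LM n f - LM n g = LM n (\<lambda>a b. f a b - g a b)"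
  and LM_smult: "p \<cdot>\<^sub>m LM n f = LM n (\<lambda>a b. p * f a b)"
  and LM_map: "map_mat h (LM n f) = LM n (\<lambda>a b. h (f a b))"
  and LM_transpose: "transpose_mat (LM n f) = LM n (\<lambda>a b. f b a)"
  and LM_zero: "0\<^sub>m (2 * n) (2 * n) = LM n (\<lambda>a b. 0)"
  by (rule eq_matI; simp add: LM_index)+

lemma LM_trace: "mat_trace (LM n f) = (\<Sum>a\<in>letters n. f a a)"
  using sum_lt[of "\<lambda>a. f a a" n] by (simp add: mat_trace_def LM_index)

lemma LM_surj: "Z \<in> carrier_mat (2 * n) (2 * n) \<Longrightarrow> Z = LM n (\<lambda>a b. Z $$ (ix n a, ix n b))"
  by (rule eq_matI) (auto simp: LM_index ix_lt)

lemma LM_eqD: "LM n f = LM n g \<Longrightarrow> a \<in> letters n \<Longrightarrow> b \<in> letters n \<Longrightarrow> f a b = g a b"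
  using LM_index[of "ix n a" n "ix n b" f] LM_index[of "ix n a" n "ix n b" g] by (simp add: ix_less lt_ix)

lemma LM_eq_iff: "LM n f = LM n g \<longleftrightarrow> (\<forall>a\<in>letters n. \<forall>b\<in>letters n. f a b = g a b)"
  by (blast intro: LM_cong dest: LM_eqD)

lemma symplectic_form_LM: "symplectic_form n = LM n (\<lambda>a b. of_int (om a b))"
proof (rule eq_matI)
  fix r s assume "r < dim_row (LM n (\<lambda>a b. of_int (om a b) :: laurent))" "s < dim_col (LM n (\<lambda>a b. of_int (om a b) :: laurent))"
  then show "symplectic_form n $$ (r, s) = LM n (\<lambda>a b. of_int (om a b)) $$ (r, s)"
    by (auto simp: symplectic_form_def LM_index lt_def)
qed (auto simp: symplectic_form_def)

lemma unit_mat_LM: "x \<in> letters n \<Longrightarrow> y \<in> letters n \<Longrightarrow>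
    unit_mat n p (ix n x) (ix n y) = LM n (\<lambda>a b. if a = x \<and> b = y then p else 0)"
  by (rule eq_matI) (auto simp: unit_mat_def LM_index ix_lt lt_ix)

lemma loop_sp_LM: "LM n f \<in> loop_sp n \<longleftrightarrow>
    (\<forall>a\<in>letters n. \<forall>b\<in>letters n. (\<Sum>c\<in>letters n. f c a * of_int (om c b)) + (\<Sum>c\<in>letters n. of_int (om a c) * f c b) = 0)"
proof -
  have "transpose_mat (LM n f) * symplectic_form n + symplectic_form n * LM n f =
      LM n (\<lambda>a b. (\<Sum>c\<in>letters n. f c a * of_int (om c b)) + (\<Sum>c\<in>letters n. of_int (om a c) * f c b))"
    by (simp add: symplectic_form_LM LM_transpose LM_mult LM_add)
  then have "LM n f \<in> loop_sp n \<longleftrightarrow>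
      LM n (\<lambda>a b. (\<Sum>c\<in>letters n. f c a * of_int (om c b)) + (\<Sum>c\<in>letters n. of_int (om a c) * f c b)) = LM n (\<lambda>a b. 0)"
    by (simp add: loop_sp_def LM_zero)
  then show ?thesis unfolding LM_eq_iff .
qed

definition xc :: "letter \<Rightarrow> letter \<Rightarrow> letter \<Rightarrow> letter \<Rightarrow> int" where
  "xc x y a b = of_bool (a = x) * om y b + of_bool (a = y) * om x b"

text \<open>The element $xy\otimes t^m$, acting on the vector representation by $v\mapsto\omega(y,v)x+\omega(x,v)y$.\<close>

definition X :: "nat \<Rightarrow> letter \<Rightarrow> letter \<Rightarrow> int \<Rightarrow> affine" where
  "X n x y m = (LM n (\<lambda>a b. Poly_Mapping.single m (of_int (xc x y a b))), 0, 0)"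

lemma sum_bool_left: "finite L \<Longrightarrow> x \<in> L \<Longrightarrow> (\<Sum>c\<in>L. of_bool (c = x) * f c) = (f x :: 'a::comm_ring_1)"
  by (simp add: of_bool_def if_distrib[of "\<lambda>t. t * _"] sum.delta cong: if_cong)

lemma sum_xc_left: "x \<in> letters n \<Longrightarrow> y \<in> letters n \<Longrightarrow>
    (\<Sum>c\<in>letters n. xc x y c a * g c) = om y a * g x + om x a * g y"
proof -
  assume l: "x \<in> letters n" "y \<in> letters n"
  have "(\<Sum>c\<in>letters n. xc x y c a * g c) = (\<Sum>c\<in>letters n. of_bool (c = x) * (om y a * g c)) + (\<Sum>c\<in>letters n. of_bool (c = y) * (om x a * g c))"
    by (simp add: xc_def sum.distrib[symmetric] algebra_simps)
  then show ?thesis using l by (simp add: sum_bool_left)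
qed

lemma sum_xc_mult:
  assumes "z \<in> letters n" "w \<in> letters n"
  shows "(\<Sum>c\<in>letters n. xc x y a c * xc z w c b) =
    of_bool (a = x) * (om y z * om w b + om y w * om z b) + of_bool (a = y) * (om x z * om w b + om x w * om z b)"
proof -
  have "(\<Sum>c\<in>letters n. xc z w c b * xc x y a c) = om w b * xc x y a z + om z b * xc x y a w"
    by (rule sum_xc_left[OF assms])
  then show ?thesis by (simp add: mult.commute xc_def algebra_simps)
qed

lemma single_sum: "Poly_Mapping.single m (\<Sum>a\<in>A. f a) = (\<Sum>a\<in>A. Poly_Mapping.single m (f a :: complex))"
  by (induction A rule: infinite_finite_induct) (simp_all add: single_add)

lemma of_int_laurent: "of_int k = Poly_Mapping.single (0::int) (of_int k :: complex)"
  by (metis of_int_0 single_of_int)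

lemma single_mult_of_int: "Poly_Mapping.single (m::int) (a::complex) * of_int k = Poly_Mapping.single m (a * of_int k)"
  by (subst of_int_laurent) (simp only: mult_single add_0_right)

lemma of_int_mult_single: "of_int k * Poly_Mapping.single (m::int) (a::complex) = Poly_Mapping.single m (a * of_int k)"
  by (subst mult.commute) (rule single_mult_of_int)

lemma poly_mapping_eq_sum_single: "p = (\<Sum>m\<in>Poly_Mapping.keys p. Poly_Mapping.single m (Poly_Mapping.lookup p m))"
proof (rule poly_mapping_eqI)
  fix k
  have "Poly_Mapping.lookup (\<Sum>m\<in>Poly_Mapping.keys p. Poly_Mapping.single m (Poly_Mapping.lookup p m)) k =
      (\<Sum>m\<in>Poly_Mapping.keys p. if m = k then Poly_Mapping.lookup p m else 0)"
    by (simp add: lookup_sum lookup_single when_def)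
  then show "Poly_Mapping.lookup p k = Poly_Mapping.lookup (\<Sum>m\<in>Poly_Mapping.keys p. Poly_Mapping.single m (Poly_Mapping.lookup p m)) k"
    by (simp add: sum.delta in_keys_iff)
qed

text \<open>\<open>A\<close>, \<open>B\<close>, \<open>C\<close>, \<open>D\<close> stand for the
  indicators that the row letter is x, y, z, w, and a name such as \<open>yz\<close> for the value
  of the symplectic form; its antisymmetry is already inserted in the second product.\<close>

lemma bracket_identity:
  fixes A :: int
  shows "A * (yz * wb + yw * zb) + B * (xz * wb + xw * zb) - (C * (- xw * yb + - yw * xb) + D * (- xz * yb + - yz * xb)) =
    yz * (A * wb + D * xb) + xz * (B * wb + D * yb) + yw * (C * xb + A * zb) + xw * (C * yb + B * zb)"
  by (simp add: algebra_simps)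

lemma X_affine_C:
  assumes "x \<in> letters n" "y \<in> letters n"
  shows "X n x y m \<in> affine_C n"
proof -
  have "(\<Sum>c\<in>letters n. Poly_Mapping.single m (of_int (xc x y c a)) * of_int (om c b)) +
      (\<Sum>c\<in>letters n. of_int (om a c) * Poly_Mapping.single m (of_int (xc x y c b))) = (0 :: laurent)" for a b
  proof -
    have "(\<Sum>c\<in>letters n. Poly_Mapping.single m (of_int (xc x y c a)) * of_int (om c b)) +
      (\<Sum>c\<in>letters n. of_int (om a c) * Poly_Mapping.single m (of_int (xc x y c b))) =
      Poly_Mapping.single m (of_int ((\<Sum>c\<in>letters n. xc x y c a * om c b) + (\<Sum>c\<in>letters n. xc x y c b * om a c)) :: complex)"
      by (simp add: single_mult_of_int of_int_mult_single single_add single_sum)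
    also have "(\<Sum>c\<in>letters n. xc x y c a * om c b) + (\<Sum>c\<in>letters n. xc x y c b * om a c) = 0"
      using om_antisym[of a x] om_antisym[of a y] by (simp add: sum_xc_left[OF assms])
    finally show ?thesis by simp
  qed
  then show ?thesis by (simp add: X_def affine_C_def loop_sp_LM)
qed

lemma euler_single: "euler (Poly_Mapping.single m a) = Poly_Mapping.single m (of_int m * a)"
  by (rule poly_mapping_eqI) (auto simp: euler_def lookup_mapp lookup_single when_def in_keys_iff)

text \<open>The trace of the product of xy and zw in the vector representation, hence the
  coefficient of the central term.\<close>

definition xtr :: "letter \<Rightarrow> letter \<Rightarrow> letter \<Rightarrow> letter \<Rightarrow> int" where
  "xtr x y z w = -2 * (om x w * om y z + om x z * om y w)"

lemma X_bracket:
  assumes l: "x \<in> letters n" "y \<in> letters n" "z \<in> letters n" "w \<in> letters n"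
  shows "affine_bracket (X n x y m) (X n z w k) =
    affine_scale (of_int (om y z)) (X n x w (m + k)) + affine_scale (of_int (om x z)) (X n y w (m + k)) +
    affine_scale (of_int (om y w)) (X n z x (m + k)) + affine_scale (of_int (om x w)) (X n z y (m + k)) +
    affine_scale (if m + k = 0 then of_int (m * xtr x y z w) else 0) (LM n (\<lambda>a b. 0), 1, 0)"
proof -
  let ?s = "Poly_Mapping.single (m + k) :: complex \<Rightarrow> laurent"
  have mult: "(\<Sum>c\<in>letters n. Poly_Mapping.single m' (of_int (xc x y a c)) * Poly_Mapping.single k' (of_int (xc z w c b))) =
      Poly_Mapping.single (m' + k') (of_int (\<Sum>c\<in>letters n. xc x y a c * xc z w c b) :: complex)" for a b x y z w and m' k' :: int
    by (simp add: mult_single single_sum)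
  have tr: "(\<Sum>a\<in>letters n. \<Sum>c\<in>letters n. xc x y a c * xc z w c a) = xtr x y z w"
  proof -
    have "(\<Sum>a\<in>letters n. \<Sum>c\<in>letters n. xc x y a c * xc z w c a) =
        (\<Sum>a\<in>letters n. of_bool (a = x) * (om y z * om w a + om y w * om z a)) + (\<Sum>a\<in>letters n. of_bool (a = y) * (om x z * om w a + om x w * om z a))"
      by (simp add: sum_xc_mult[OF l(3,4)] sum.distrib)
    also have "\<dots> = (om y z * om w x + om y w * om z x) + (om x z * om w y + om x w * om z y)"
      using l by (simp add: sum_bool_left)
    also have "\<dots> = xtr x y z w"
      using om_antisym[of w x] om_antisym[of z x] om_antisym[of w y] om_antisym[of z y] by (simp add: xtr_def algebra_simps)
    finally show ?thesis .
  qed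
  have central: "Poly_Mapping.lookup (mat_trace (map_mat euler (fst (X n x y m)) * fst (X n z w k))) 0 =
      (if m + k = 0 then of_int (m * xtr x y z w) else 0)"
  proof -
    have "mat_trace (map_mat euler (fst (X n x y m)) * fst (X n z w k)) =
        (\<Sum>a\<in>letters n. \<Sum>c\<in>letters n. Poly_Mapping.single m (of_int (m * xc x y a c)) * Poly_Mapping.single k (of_int (xc z w c a)))"
      by (simp add: X_def LM_map LM_mult LM_trace euler_single)
    also have "\<dots> = ?s (of_int (m * (\<Sum>a\<in>letters n. \<Sum>c\<in>letters n. xc x y a c * xc z w c a)))"
      by (simp add: mult_single single_sum sum_distrib_left mult.assoc)
    finally show ?thesis by (simp add: tr lookup_single when_def)
  qed
  have e: "(\<Sum>c\<in>letters n. xc x y a c * xc z w c b) - (\<Sum>c\<in>letters n. xc z w a c * xc x y c b) =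
      om y z * xc x w a b + om x z * xc y w a b + om y w * xc z x a b + om x w * xc z y a b" for a b
    unfolding sum_xc_mult[OF l(3,4)] sum_xc_mult[OF l(1,2)]
    unfolding xc_def om_antisym[of w x] om_antisym[of z x] om_antisym[of w y] om_antisym[of z y] by (rule bracket_identity)
  have "fst (X n x y m) * fst (X n z w k) - fst (X n z w k) * fst (X n x y m) =
      LM n (\<lambda>a b. ?s (of_int (om y z * xc x w a b + om x z * xc y w a b + om y w * xc z x a b + om x w * xc z y a b)))"
    unfolding e[symmetric] by (simp add: X_def LM_mult mult LM_minus single_diff[symmetric] add.commute[of k m])
  then have "affine_bracket (X n x y m) (X n z w k) =
     (LM n (\<lambda>a b. ?s (of_int (om y z * xc x w a b + om x z * xc y w a b + om y w * xc z x a b + om x w * xc z y a b))),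
      (if m + k = 0 then of_int (m * xtr x y z w) else 0), 0)"
    using central by (simp add: affine_bracket_def X_def laurent_const_def LM_map LM_smult LM_minus LM_add)
  then show ?thesis
    by (simp add: X_def affine_scale_def laurent_const_def LM_smult LM_add of_int_mult_single mult_single single_add[symmetric] mult.commute)
qed

lemma X_commute: "X n x y m = X n y x m"
  by (simp add: X_def xc_def add.commute)

lemma affine_C_zero: "(LM n (\<lambda>a b. 0), a, b) \<in> affine_C n"
  by (simp add: affine_C_def loop_sp_LM)

text \<open>A matrix is in the symplectic algebra exactly when its product with the form is
  symmetric, so it is a combination of the elements xy with Laurent coefficients; splitting these
  into monomials reaches the \<open>X\<close>.\<close>

lemma affine_span:
  assumes add: "\<And>u v. u \<in> affine_C n \<Longrightarrow> v \<in> affine_C n \<Longrightarrow> P u \<Longrightarrow> P v \<Longrightarrow> P (u + v)"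
    and scale: "\<And>z u. u \<in> affine_C n \<Longrightarrow> P u \<Longrightarrow> P (affine_scale z u)"
    and X: "\<And>x y m. x \<in> letters n \<Longrightarrow> y \<in> letters n \<Longrightarrow> P (X n x y m)"
    and c: "P (LM n (\<lambda>a b. 0), 1, 0)" and d: "P (LM n (\<lambda>a b. 0), 0, 1)"
    and u: "u \<in> affine_C n"
  shows "P u"
proof -
  define Q where "Q f \<longleftrightarrow> (LM n f, 0, 0) \<in> affine_C n \<and> P (LM n f, 0, 0)" for f
  have lin: "(LM n (\<lambda>a b. f a b + g a b), 0, 0) \<in> affine_C n"
    if "(LM n f, 0, 0) \<in> affine_C n" "(LM n g, 0, 0) \<in> affine_C n" for f g
  proof -
    have "(\<Sum>c\<in>letters n. (f c a + g c a) * of_int (om c b)) + (\<Sum>c\<in>letters n. of_int (om a c) * (f c b + g c b)) =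
        ((\<Sum>c\<in>letters n. f c a * of_int (om c b)) + (\<Sum>c\<in>letters n. of_int (om a c) * f c b)) +
        ((\<Sum>c\<in>letters n. g c a * of_int (om c b)) + (\<Sum>c\<in>letters n. of_int (om a c) * g c b))" for a b
      by (simp add: distrib_left distrib_right sum.distrib algebra_simps)
    then show ?thesis using that by (simp add: affine_C_def loop_sp_LM)
  qed
  have lin2: "(LM n (\<lambda>a b. p * f a b), 0, 0) \<in> affine_C n" if "(LM n f, 0, 0) \<in> affine_C n" for f p
  proof -
    have "(\<Sum>c\<in>letters n. p * f c a * of_int (om c b)) + (\<Sum>c\<in>letters n. of_int (om a c) * (p * f c b)) =
        p * ((\<Sum>c\<in>letters n. f c a * of_int (om c b)) + (\<Sum>c\<in>letters n. of_int (om a c) * f c b))" for a b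
      by (simp add: sum_distrib_left algebra_simps)
    then show ?thesis using that by (simp add: affine_C_def loop_sp_LM)
  qed
  have Q_add: "Q (\<lambda>a b. f a b + g a b)" if "Q f" "Q g" for f g
    using add[of "(LM n f, 0, 0)" "(LM n g, 0, 0)"] that lin by (simp add: Q_def LM_add)
  have Q_scale: "Q (\<lambda>a b. Poly_Mapping.single 0 z * f a b)" if "Q f" for f z
    using scale[of "(LM n f, 0, 0)" z] that lin2 by (simp add: Q_def affine_scale_def LM_smult laurent_const_def)
  have Q_X: "Q (\<lambda>a b. Poly_Mapping.single m (of_int (xc x y a b)))" if "x \<in> letters n" "y \<in> letters n" for x y m
    using X[OF that] X_affine_C[OF that] by (simp add: Q_def X_def)
  have "affine_scale 0 (LM n (\<lambda>a b. 0), 1, 0) = (LM n (\<lambda>a b. 0), 0, 0)"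
    by (simp add: affine_scale_def LM_smult)
  then have Q_0: "Q (\<lambda>a b. 0)" using scale[OF affine_C_zero c, of 0] affine_C_zero by (simp add: Q_def)
  have Q_sum: "Q (\<lambda>a b. \<Sum>t\<in>F. f t a b)" if "\<And>t. t \<in> F \<Longrightarrow> Q (f t)" for F :: "'t set" and f
    using that
  proof (induction F rule: infinite_finite_induct)
    case (insert t F)
    then show ?case using Q_add[of "f t" "\<lambda>a b. \<Sum>t\<in>F. f t a b"] by simp
  qed (use Q_0 in simp_all)
  have Q_poly: "Q (\<lambda>a b. p * of_int (xc x y a b))" if l: "x \<in> letters n" "y \<in> letters n" for x y p
  proof -
    have p: "p = (\<Sum>m\<in>Poly_Mapping.keys p. Poly_Mapping.single m (Poly_Mapping.lookup p m))"
      by (rule poly_mapping_eq_sum_single)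
    have "Q (\<lambda>a b. \<Sum>m\<in>Poly_Mapping.keys p. Poly_Mapping.single 0 (Poly_Mapping.lookup p m) * Poly_Mapping.single m (of_int (xc x y a b)))"
      by (rule Q_sum) (rule Q_scale[OF Q_X[OF l]])
    moreover have "(\<Sum>m\<in>Poly_Mapping.keys p. Poly_Mapping.single 0 (Poly_Mapping.lookup p m) * Poly_Mapping.single m (of_int k)) = p * of_int k" for k
    proof -
      have "p * of_int k = (\<Sum>m\<in>Poly_Mapping.keys p. Poly_Mapping.single m (Poly_Mapping.lookup p m)) * of_int k"
        using p by simp
      then show ?thesis by (simp add: sum_distrib_right mult_single single_mult_of_int)
    qed
    ultimately show ?thesis by simp
  qed
  obtain Z a b where Z: "u = (Z, a, b)" "Z \<in> loop_sp n" using u by (auto simp: affine_C_def)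
  then have "Z \<in> carrier_mat (2 * n) (2 * n)" by (simp add: loop_sp_def)
  then obtain f where f: "Z = LM n f" using LM_surj by blast
  define s where "s x = om x (bar x)" for x
  have om_s: "om x b = (if b = bar x then s x else 0)" for x b using om_nonzero[of x b] by (auto simp: s_def)
  have s1: "s x * s x = 1" "s (bar x) = - s x" for x using om_bar_sq om_antisym[of "bar x" x] by (auto simp: s_def)
  have sum_om: "(\<Sum>c\<in>letters n. of_int (om a c) * g c) = of_int (s a) * g (bar a)" if "a \<in> letters n" for a and g :: "letter \<Rightarrow> laurent"
  proof -
    have "(\<Sum>c\<in>letters n. of_int (om a c) * g c) = (\<Sum>c\<in>letters n. if c = bar a then of_int (s a) * g c else 0)"
      by (rule sum.cong) (auto simp: om_s)
    then show ?thesis using that by (simp add: sum.delta)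
  qed
  have sum_om': "(\<Sum>c\<in>letters n. g c * of_int (om c b)) = of_int (s (bar b)) * g (bar b)" if "b \<in> letters n" for b and g :: "letter \<Rightarrow> laurent"
  proof -
    have "(\<Sum>c\<in>letters n. g c * of_int (om c b)) = (\<Sum>c\<in>letters n. - (of_int (om b c) * g c))"
      by (rule sum.cong) (simp_all add: om_antisym[of _ b])
    then show ?thesis using sum_om[OF that, of g] s1 by (simp add: sum_negf)
  qed
  \<comment> \<open>Multiplying by the form turns the symplectic condition into symmetry of
    \<open>h\<close>. Summing over ordered pairs gives 2f, since each of the two terms of
    \<open>xc\<close> reproduces f; hence the factor 1/2 below.\<close>
  define h where "h x y = of_int (s y) * f x (bar y)" for x y
  have sym: "h x y = h y x" if "x \<in> letters n" "y \<in> letters n" for x y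
  proof -
    have "(\<Sum>c\<in>letters n. f c (bar x) * of_int (om c (bar y))) + (\<Sum>c\<in>letters n. of_int (om (bar x) c) * f c (bar y)) = 0"
      using Z(2) that by (simp add: f loop_sp_LM)
    then have "of_int (s y) * f y (bar x) - of_int (s x) * f x (bar y) = 0"
      using that s1 by (simp add: sum_om sum_om')
    then have e: "of_int (s y) * f y (bar x) = of_int (s x) * f x (bar y)" by simp
    have "h x y = of_int (s y * (s x * s x)) * f x (bar y)" using s1 by (simp add: h_def)
    also have "\<dots> = of_int (s y * s x) * (of_int (s x) * f x (bar y))" by (simp add: algebra_simps)
    also have "\<dots> = of_int ((s y * s y) * s x) * f y (bar x)" unfolding e[symmetric] by (simp add: algebra_simps)
    also have "\<dots> = h y x" using s1 by (simp add: h_def)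
    finally show ?thesis .
  qed
  have expand: "f a b = (\<Sum>x\<in>letters n. \<Sum>y\<in>letters n. Poly_Mapping.single 0 (1/2) * (h x y * of_int (xc x y a b)))"
    if l: "a \<in> letters n" "b \<in> letters n" for a b
  proof -
    have hb: "(\<Sum>y\<in>letters n. h a y * of_int (om y b)) = f a b"
      using l s1(1)[of "bar b"] by (simp add: sum_om' h_def) (metis (no_types, lifting) mult.assoc mult_1 of_int_1 of_int_mult)
    have "(\<Sum>x\<in>letters n. \<Sum>y\<in>letters n. h x y * of_int (xc x y a b)) =
        (\<Sum>x\<in>letters n. of_bool (x = a) * (\<Sum>y\<in>letters n. h x y * of_int (om y b))) +
        (\<Sum>x\<in>letters n. \<Sum>y\<in>letters n. of_bool (y = a) * (h x y * of_int (om x b)))"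
      by (simp add: xc_def sum.distrib[symmetric] sum_distrib_left eq_commute[of a] algebra_simps)
    also have "\<dots> = f a b + (\<Sum>x\<in>letters n. h a x * of_int (om x b))"
    proof -
      have "(\<Sum>x\<in>letters n. h x a * of_int (om x b)) = (\<Sum>x\<in>letters n. h a x * of_int (om x b))"
        using sym l by (intro sum.cong) auto
      then show ?thesis using l by (simp add: sum_bool_left hb)
    qed
    also have "\<dots> = f a b + f a b" by (simp add: hb)
    finally have "(\<Sum>x\<in>letters n. \<Sum>y\<in>letters n. h x y * of_int (xc x y a b)) = f a b + f a b" .
    then have "(\<Sum>x\<in>letters n. \<Sum>y\<in>letters n. Poly_Mapping.single 0 (1/2) * (h x y * of_int (xc x y a b))) = Poly_Mapping.single 0 (1/2) * (f a b + f a b)"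
      by (simp only: sum_distrib_left[symmetric])
    also have "\<dots> = (Poly_Mapping.single 0 (1/2) + Poly_Mapping.single 0 (1/2)) * f a b" by (simp only: distrib_left distrib_right)
    also have "\<dots> = f a b" by (simp add: single_add[symmetric])
    finally show ?thesis by simp
  qed
  have "Q (\<lambda>a b. \<Sum>x\<in>letters n. \<Sum>y\<in>letters n. Poly_Mapping.single 0 (1/2) * (h x y * of_int (xc x y a b)))"
    by (intro Q_sum Q_scale Q_poly)
  then have Qf: "Q f"
    using LM_cong[of n f] expand by (simp add: Q_def)
  have m0: "LM n (\<lambda>a b. 0) = 0\<^sub>m (2 * n) (2 * n)" by (simp add: LM_zero)
  have sc: "affine_scale z (LM n (\<lambda>a b. 0), p, q) = (LM n (\<lambda>a b. 0), z * p, z * q)" for z p q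
    by (simp add: affine_scale_def LM_smult)
  have "P (LM n (\<lambda>a b. 0), a, 0)" "P (LM n (\<lambda>a b. 0), 0, b)"
    using scale[OF affine_C_zero c, of a] scale[OF affine_C_zero d, of b] by (simp_all add: sc)
  then have "P (LM n (\<lambda>a b. 0), a, b)"
    using add[OF affine_C_zero affine_C_zero, of a 0 0 b] by (simp add: LM_add)
  then have "P ((LM n f, 0, 0) + (LM n (\<lambda>a b. 0), a, b))"
    using Qf affine_C_zero by (intro add) (auto simp: Q_def)
  then show ?thesis by (simp add: Z f LM_add)
qed

section \<open>Traces and $\mathfrak{sl}_2$-strings\<close>

locale vspace = vector_space scale
  for scale :: "'a::field \<Rightarrow> 'b::ab_group_add \<Rightarrow> 'b" (infixr \<open>\<odot>\<close> 75)
begin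

abbreviation lin :: "('b \<Rightarrow> 'b) \<Rightarrow> bool" where
  "lin f \<equiv> Vector_Spaces.linear scale scale f"

lemma lin_iff: "lin f \<longleftrightarrow> (\<forall>x y. f (x + y) = f x + f y) \<and> (\<forall>c x. f (c \<odot> x) = c \<odot> f x)"
  by (simp add: Vector_Spaces.linear_iff vector_space_axioms)

lemma lin_add: "lin f \<Longrightarrow> f (x + y) = f x + f y"
  and lin_scale: "lin f \<Longrightarrow> f (c \<odot> x) = c \<odot> f x"
  by (simp_all add: lin_iff)

lemma lin_zero: "lin f \<Longrightarrow> f 0 = 0"
  using lin_scale[of f 0 0] by simp

lemma lin_minus: "lin f \<Longrightarrow> f (- x) = - f x"
  using lin_scale[of f "-1" x] by simp

lemma lin_diff: "lin f \<Longrightarrow> f (x - y) = f x - f y"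
  using lin_add[of f x "- y"] lin_minus[of f y] by simp

lemma lin_sum: "lin f \<Longrightarrow> f (\<Sum>i\<in>I. g i) = (\<Sum>i\<in>I. f (g i))"
  by (induction I rule: infinite_finite_induct) (simp_all add: lin_zero lin_add)

lemma lin_scaled: "lin f \<Longrightarrow> lin (\<lambda>x. c \<odot> f x)"
  by (simp add: lin_iff scale_right_distrib mult.commute)

lemma lin_pow: "lin f \<Longrightarrow> lin (f ^^ k)"
  by (induction k) (simp_all add: lin_iff)

lemma lin_span:
  assumes "lin f" "\<And>b. b \<in> S \<Longrightarrow> f b \<in> span S'" "x \<in> span S"
  shows "f x \<in> span S'"
  using assms(3)
proof (induction rule: span_induct_alt)
  case base
  then show ?case using lin_zero[OF assms(1)] span_zero by simp
next
  case (step c b y)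
  then show ?case using lin_add[OF assms(1)] lin_scale[OF assms(1)] assms(2) by (simp add: span_add span_scale)
qed

definition basis_of :: "'b set \<Rightarrow> 'b set" where
  "basis_of U = (SOME B. B \<subseteq> U \<and> independent B \<and> U \<subseteq> span B \<and> card B = dim U)"

lemma basis_of: "basis_of U \<subseteq> U" "independent (basis_of U)" "U \<subseteq> span (basis_of U)" "card (basis_of U) = dim U"
proof -
  have "\<exists>B. B \<subseteq> U \<and> independent B \<and> U \<subseteq> span B \<and> card B = dim U"
    using basis_exists[of U] by metis
  from someI_ex[OF this] show "basis_of U \<subseteq> U" "independent (basis_of U)" "U \<subseteq> span (basis_of U)" "card (basis_of U) = dim U"
    unfolding basis_of_def by auto
qed

definition fin_dim :: "'b set \<Rightarrow> bool" where
  "fin_dim U \<longleftrightarrow> (\<exists>S. finite S \<and> U \<subseteq> span S)"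

lemma finite_basis_of: "fin_dim U \<Longrightarrow> finite (basis_of U)"
  unfolding fin_dim_def using independent_span_bound basis_of(1,2) by (meson order_trans)

text \<open>The operators live on the whole space but preserve only U, so the trace is taken in a
  chosen basis of U. Cyclicity between two different subspaces (\<open>trace_commute\<close>) is
  what moves a trace from one weight space to another.\<close>

definition trace_on :: "'b set \<Rightarrow> ('b \<Rightarrow> 'b) \<Rightarrow> 'a" where
  "trace_on U f = (\<Sum>b\<in>basis_of U. representation (basis_of U) (f b) b)"

lemma rep_expand:
  assumes "fin_dim U" "x \<in> U"
  shows "(\<Sum>b\<in>basis_of U. representation (basis_of U) x b \<odot> b) = x"
  using basis_of(2,3)[of U] finite_basis_of[OF assms(1)] assms(2) by (intro sum_representation_eq) auto

lemma trace_commute: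
  assumes fd: "fin_dim U" "fin_dim W" and lin: "lin f" "lin g"
    and maps: "\<And>x. x \<in> U \<Longrightarrow> f x \<in> W" "\<And>x. x \<in> W \<Longrightarrow> g x \<in> U"
  shows "trace_on U (\<lambda>x. g (f x)) = trace_on W (\<lambda>x. f (g x))"
proof -
  let ?B = "basis_of U" and ?C = "basis_of W"
  have *: "representation (basis_of U) (g (f b)) b = (\<Sum>c\<in>basis_of W. representation (basis_of W) (f b) c * representation (basis_of U) (g c) b)"
    if fd: "fin_dim U" "fin_dim W" and lin: "lin f" "lin g"
    and maps: "\<And>x. x \<in> U \<Longrightarrow> f x \<in> W" "\<And>x. x \<in> W \<Longrightarrow> g x \<in> U" and b: "b \<in> basis_of U" for b U W f g
  proof -
    have "f b \<in> W" using b maps basis_of(1) by blast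
    then have "g (f b) = g (\<Sum>c\<in>basis_of W. representation (basis_of W) (f b) c \<odot> c)" using rep_expand[OF fd(2)] by simp
    also have "\<dots> = (\<Sum>c\<in>basis_of W. representation (basis_of W) (f b) c \<odot> g c)" by (simp add: lin_sum[OF lin(2)] lin_scale[OF lin(2)])
    finally have "g (f b) = (\<Sum>c\<in>basis_of W. representation (basis_of W) (f b) c \<odot> g c)" .
    moreover have s: "g c \<in> span (basis_of U)" if "c \<in> basis_of W" for c
      using that maps(2) basis_of(1)[of W] basis_of(3)[of U] by blast
    ultimately show ?thesis
      by (simp add: representation_sum[OF basis_of(2)] representation_scale[OF basis_of(2)] span_scale)
  qed
  have "trace_on U (\<lambda>x. g (f x)) = (\<Sum>b\<in>?B. \<Sum>c\<in>?C. representation ?C (f b) c * representation ?B (g c) b)"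
    unfolding trace_on_def using *[OF fd lin maps] by simp
  also have "\<dots> = (\<Sum>c\<in>?C. \<Sum>b\<in>?B. representation ?B (g c) b * representation ?C (f b) c)"
    by (subst sum.swap) (simp add: mult.commute)
  also have "\<dots> = trace_on W (\<lambda>x. f (g x))"
    unfolding trace_on_def using *[OF fd(2,1) lin(2,1) maps(2,1)] by simp
  finally show ?thesis .
qed

lemma trace_cong: "(\<And>x. x \<in> U \<Longrightarrow> f x = g x) \<Longrightarrow> trace_on U f = trace_on U g"
  unfolding trace_on_def using basis_of(1)[of U] by (intro sum.cong) (auto simp: subset_iff)

lemma trace_add:
  assumes "\<And>x. x \<in> U \<Longrightarrow> f x \<in> U" "\<And>x. x \<in> U \<Longrightarrow> g x \<in> U"
  shows "trace_on U (\<lambda>x. f x + g x) = trace_on U f + trace_on U g"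
proof -
  have "f b \<in> span (basis_of U)" "g b \<in> span (basis_of U)" if "b \<in> basis_of U" for b
    using that assms basis_of(1,3) by blast+
  then show ?thesis by (simp add: trace_on_def representation_add[OF basis_of(2)] sum.distrib)
qed

lemma trace_sum:
  assumes "subspace U" "\<And>i x. i \<in> I \<Longrightarrow> x \<in> U \<Longrightarrow> f i x \<in> U"
  shows "trace_on U (\<lambda>x. \<Sum>i\<in>I. f i x) = (\<Sum>i\<in>I. trace_on U (f i))"
proof -
  have "f i b \<in> span (basis_of U)" if "b \<in> basis_of U" "i \<in> I" for b i
    using that assms basis_of(1,3) by blast
  then have "representation (basis_of U) (\<Sum>i\<in>I. f i b) b = (\<Sum>i\<in>I. representation (basis_of U) (f i b) b)" if "b \<in> basis_of U" for b
    using that by (simp add: representation_sum[OF basis_of(2)])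
  then have "trace_on U (\<lambda>x. \<Sum>i\<in>I. f i x) = (\<Sum>b\<in>basis_of U. \<Sum>i\<in>I. representation (basis_of U) (f i b) b)"
    by (simp add: trace_on_def)
  then show ?thesis unfolding trace_on_def by (subst (asm) sum.swap)
qed

lemma trace_scale: "trace_on U (\<lambda>x. c \<odot> x) = c * of_nat (dim U)"
proof -
  have "representation (basis_of U) (c \<odot> b) b = c" if "b \<in> basis_of U" for b
    using that by (simp add: representation_scale[OF basis_of(2)] span_base representation_basis[OF basis_of(2)])
  then show ?thesis by (simp add: trace_on_def basis_of(4)[symmetric] mult.commute)
qed

lemma dim_le_inj:
  assumes fd: "fin_dim W" and lin: "lin f" and U: "subspace U" and maps: "\<And>x. x \<in> U \<Longrightarrow> f x \<in> W"
    and inj: "\<And>x. x \<in> U \<Longrightarrow> f x = 0 \<Longrightarrow> x = 0"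
  shows "dim U \<le> dim W"
proof -
  let ?B = "basis_of U"
  have inj_on: "inj_on f (span ?B)"
  proof (rule inj_onI)
    fix x y assume "x \<in> span ?B" "y \<in> span ?B" "f x = f y"
    moreover have "span ?B \<subseteq> U" using basis_of(1) U by (rule span_minimal)
    ultimately have "x - y \<in> U" "f (x - y) = 0" using U subspace_diff lin_diff[OF lin] by auto
    then show "x = y" using inj[of "x - y"] by simp
  qed
  interpret vp: vector_space_pair scale scale ..
  have "independent (f ` ?B)"
    using vp.linear_independent_injective_image[OF lin basis_of(2) inj_on] by simp
  moreover have "f ` ?B \<subseteq> span (basis_of W)" using basis_of(1)[of U] maps basis_of(3)[of W] by blast
  ultimately have "card (f ` ?B) \<le> card (basis_of W)"
    using independent_span_bound[OF finite_basis_of[OF fd]] by blast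
  moreover have "card (f ` ?B) = card ?B"
    using inj_on by (intro card_image) (meson inj_on_subset span_superset)
  ultimately show ?thesis by (simp add: basis_of(4))
qed

text \<open>\<open>G t w\<close> says that w has weight t; keeping it abstract allows the same
  computation with raising and lowering exchanged and t negated. The coefficient is the sum t + (t -
  2) + ... + (t - 2k).\<close>

lemma sl2_raise_pow:
  assumes F: "lin F" and G: "\<And>t w. G t w \<Longrightarrow> G (t - 2) (F w)"
    and EF: "\<And>t w. G t w \<Longrightarrow> E (F w) = F (E w) + of_int t \<odot> w"
  shows "G t w \<Longrightarrow> E ((F ^^ Suc k) w) = (F ^^ Suc k) (E w) + of_int (int (Suc k) * (t - int k)) \<odot> (F ^^ k) w \<and> G (t - 2 * int (Suc k)) ((F ^^ Suc k) w)"
proof (induction k)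
  case 0
  then show ?case using G EF by auto
next
  case (Suc k)
  let ?w = "(F ^^ Suc k) w"
  have IH: "E ?w = (F ^^ Suc k) (E w) + of_int (int (Suc k) * (t - int k)) \<odot> (F ^^ k) w" "G (t - 2 * int (Suc k)) ?w"
    using Suc by auto
  have "E (F ?w) = F (E ?w) + of_int (t - 2 * int (Suc k)) \<odot> ?w" by (rule EF[OF IH(2)])
  also have "F (E ?w) = (F ^^ Suc (Suc k)) (E w) + of_int (int (Suc k) * (t - int k)) \<odot> ?w"
    unfolding IH(1) by (simp add: lin_add[OF F] lin_scale[OF F])
  also have "\<dots> + of_int (t - 2 * int (Suc k)) \<odot> ?w = (F ^^ Suc (Suc k)) (E w) + of_int (int (Suc k) * (t - int k) + (t - 2 * int (Suc k))) \<odot> ?w"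
    by (simp only: add.assoc scale_left_distrib[symmetric] of_int_add)
  also have "int (Suc k) * (t - int k) + (t - 2 * int (Suc k)) = int (Suc (Suc k)) * (t - int (Suc k))"
    by (simp add: algebra_simps)
  finally have "E ((F ^^ Suc (Suc k)) w) = (F ^^ Suc (Suc k)) (E w) + of_int (int (Suc (Suc k)) * (t - int (Suc k))) \<odot> ?w" by simp
  moreover have "G (t - 2 * int (Suc (Suc k))) ((F ^^ Suc (Suc k)) w)"
    using G[OF IH(2)] by (simp add: algebra_simps)
  ultimately show ?case by simp
qed

end

text \<open>Induction on the nilpotency of E at w. If F^k w = 0, moving E through F^k gives F^{k+2}
  E w = 0, and E w has weight k+2, so E w = 0 by induction. For singular w the relation E F^{i+1} w
  = (i+1)(k-i) F^i w has nonzero coefficients for i < k and carries the vanishing down from F^k w to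
  w.\<close>

lemma (in vspace) sl2_inj:
  assumes F: "lin F" and E: "lin E"
    and GF: "\<And>t w. G t w \<Longrightarrow> G (t - 2) (F w)" and GE: "\<And>t w. G t w \<Longrightarrow> G (t + 2) (E w)"
    and EF: "\<And>t w. G t w \<Longrightarrow> E (F w) = F (E w) + of_int t \<odot> w"
    and char0: "\<And>j. j \<noteq> 0 \<Longrightarrow> of_int j \<noteq> (0 :: 'a)"
  shows "G (int k) w \<Longrightarrow> (E ^^ N) w = 0 \<Longrightarrow> (F ^^ k) w = 0 \<Longrightarrow> w = 0"
proof (induction N arbitrary: k w)
  case (Suc N)
  show ?case
  proof (cases k)
    case 0
    then show ?thesis using Suc.prems by simp
  next
    case (Suc k')
    note rp = sl2_raise_pow[where G = G, OF F GF EF Suc.prems(1)]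
    have z: "(F ^^ Suc k') w = 0" using Suc.prems(3) Suc by simp
    have "0 = (F ^^ k) (E w) + of_int (int k) \<odot> (F ^^ k') w"
      using rp[of k'] z Suc lin_zero[OF E] by simp
    then have e: "(F ^^ k) (E w) = - (of_int (int k) \<odot> (F ^^ k') w)" by (simp add: eq_neg_iff_add_eq_0)
    have "(F ^^ Suc k) (E w) = - (of_int (int k) \<odot> (F ^^ k) w)"
      using arg_cong[OF e, of F] Suc by (simp add: lin_minus[OF F] lin_scale[OF F])
    then have "(F ^^ Suc (Suc k)) (E w) = 0" using Suc.prems(3) lin_zero[OF F] by simp
    moreover have "G (int (Suc (Suc k))) (E w)" using GE[OF Suc.prems(1)] by (simp add: add.commute)
    moreover have "(E ^^ N) (E w) = 0" using Suc.prems(2) by (simp add: funpow_swap1)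
    ultimately have Ew: "E w = 0" using Suc.IH by blast
    have "(F ^^ (k - j)) w = 0" if "j \<le> k" for j
      using that
    proof (induction j)
      case (Suc j)
      then have z: "(F ^^ (k - j)) w = 0" by simp
      define i where "i = k - Suc j"
      have ki: "k - j = Suc i" "i < k" using Suc.prems by (auto simp: i_def)
      define q where "q = int (Suc i) * (int k - int i)"
      have "of_int q \<odot> (F ^^ i) w = 0"
        using rp[of i] z ki lin_zero[OF E] lin_zero[OF lin_pow[OF F]] Ew by (simp add: lin_zero[OF F] q_def)
      moreover have "q \<noteq> 0" using ki by (simp add: q_def)
      ultimately have "(F ^^ i) w = 0" using char0[of q] by simp
      then show ?case by (simp only: i_def)
    qed (use Suc.prems in simp)
    from this[of k] show ?thesis by simp
  qed
qed simp

text \<open>\<open>cubic\<close> says (ad A)^3 B = 0. It rewrites A^3 B by terms in which at least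
  one A acts before B, so the induction hypothesis applies to A w, A^2 w and A^3 w.\<close>

lemma (in vspace) nilpotent_shift:
  assumes A: "lin A"
    and cubic: "\<And>v. A (A (A (B v))) = 3 \<odot> A (A (B (A v))) - 3 \<odot> A (B (A (A v))) + B (A (A (A v)))"
    and B: "lin B"
  shows "(A ^^ k) w = 0 \<Longrightarrow> (A ^^ (k + 2)) (B w) = 0"
proof (induction k arbitrary: w rule: less_induct)
  case (less k)
  have A0: "(A ^^ j) 0 = 0" for j by (rule lin_zero[OF lin_pow[OF A]])
  have key: "(A ^^ (i + 2)) (B w') = 0" if "i < k" "(A ^^ i) w' = 0" for i w' using less that by blast
  show ?case
  proof (cases k)
    case 0
    then show ?thesis using less.prems lin_zero[OF B] lin_zero[OF A] by simp
  next
    case (Suc j)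
    have pow3: "(A ^^ (k + 2)) (B w) = (A ^^ j) (A (A (A (B w))))"
      using Suc by (simp add: funpow_swap1)
    have t1: "(A ^^ j) (A (A (B (A w)))) = 0"
      using key[of j "A w"] less.prems Suc by (simp add: funpow_swap1)
    have t2: "(A ^^ j) (A (B (A (A w)))) = 0"
    proof (cases j)
      case 0
      then show ?thesis using less.prems Suc lin_zero[OF A] lin_zero[OF B] by simp
    next
      case (Suc i)
      then show ?thesis using key[of i "A (A w)"] less.prems \<open>k = Suc j\<close> by (simp add: funpow_swap1)
    qed
    have t3: "(A ^^ j) (B (A (A (A w)))) = 0"
    proof -
      consider "j = 0" | "j = 1" | i where "j = i + 2" by (metis One_nat_def add_2_eq_Suc' not0_implies_Suc)
      then show ?thesis
      proof cases
        case 1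
        then show ?thesis using less.prems Suc lin_zero[OF A] lin_zero[OF B] by simp
      next
        case 2
        then show ?thesis using less.prems Suc lin_zero[OF A] lin_zero[OF B] by simp
      next
        case (3 i)
        then show ?thesis using key[of i "A (A (A w))"] less.prems Suc by (simp add: funpow_swap1)
      qed
    qed
    have L: "lin (A ^^ j)" by (rule lin_pow[OF A])
    have "(A ^^ (k + 2)) (B w) = 3 \<odot> (A ^^ j) (A (A (B (A w)))) - 3 \<odot> (A ^^ j) (A (B (A (A w)))) + (A ^^ j) (B (A (A (A w))))"
      unfolding pow3 cubic by (simp only: lin_add[OF L] lin_diff[OF L] lin_scale[OF L])
    then show ?thesis using t1 t2 t3 by simp
  qed
qed

section \<open>The irreducible module\<close>

fun nx :: "nat \<Rightarrow> letter \<Rightarrow> letter" where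
  "nx n (Plain j) = (if j = n then Barred n else Plain (j + 1))"
| "nx n (Barred j) = Barred (j - 1)"

lemma nx_letters: "x \<in> letters n \<Longrightarrow> x \<noteq> Barred 1 \<Longrightarrow> nx n x \<in> letters n"
  by (cases x) auto

lemma nx_le: "x \<in> letters n \<Longrightarrow> z \<in> letters n \<Longrightarrow> x < z \<Longrightarrow> nx n x \<le> z"
  by (cases x; cases z) auto

context type_C
begin

lemma ht_nx: "x \<in> letters n \<Longrightarrow> x \<noteq> Barred 1 \<Longrightarrow> ht (lw (nx n x)) < ht (lw x)"
  by (subst ht_lw_less) (auto simp: nx_letters, cases x, auto)

text \<open>The bracket of xy t^m with bar(y) w t^k is a multiple of xw t^(m+k); the side condition
  keeps it a single root vector, since for w = bar x and x different from y two Cartan elements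
  would mix. By induction on height, a letter is replaced by its successor through the simple root
  vector that joins them. Imaginary roots and the letter bar 1, which has no successor, need their
  own steps.\<close>

lemma positive_generation:
  assumes sym: "\<And>x y m. P x y m \<Longrightarrow> P y x m"
    and simple: "\<And>i x y m. i \<le> n \<Longrightarrow> simple_index i = (x, y, m) \<Longrightarrow> P x y m"
    and rule: "\<And>x y w m k. x \<in> letters n \<Longrightarrow> y \<in> letters n \<Longrightarrow> w \<in> letters n \<Longrightarrow> 0 \<le> m \<Longrightarrow> 0 \<le> k \<Longrightarrow>
      w \<noteq> bar x \<or> x = y \<Longrightarrow> P x y m \<Longrightarrow> P (bar y) w k \<Longrightarrow> P x w (m + k)"
  shows "x \<in> letters n \<Longrightarrow> y \<in> letters n \<Longrightarrow> 0 < ht (rt (x, y, m)) \<Longrightarrow> P x y m"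
proof (induction "nat (ht (rt (x, y, m)))" arbitrary: x y m rule: less_induct)
  case less
  have IH: "P x' y' m'" if "x' \<in> letters n" "y' \<in> letters n" "0 < ht (rt (x', y', m'))" "ht (rt (x', y', m')) < ht (rt (x, y, m))" for x' y' m'
    using less.hyps[of x' y' m'] that by simp
  note l = less.prems(1,2)
  have pos: "1 \<le> m \<or> m = 0 \<and> x < bar y" using less.prems ht_rt_pos_iff by blast
  have nx_simple: "P z (bar (nx n z)) 0" if z: "z \<in> letters n" "z \<noteq> Barred 1" for z
  proof (cases z)
    case (Plain j)
    show ?thesis
    proof (cases "j = n")
      case True
      then show ?thesis using simple[of n "Plain n" "Plain n" 0] Plain n_pos by (simp add: simple_index_def)
    next
      case False
      then show ?thesis using simple[of j "Plain j" "Barred (j + 1)" 0] Plain z by (simp add: simple_index_def)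
    qed
  next
    case (Barred j)
    then have "2 \<le> j" "j \<le> n" using z by auto
    then have "P (Plain (j - 1)) (Barred j) 0" using simple[of "j - 1" "Plain (j - 1)" "Barred j" 0] by (auto simp: simple_index_def)
    then show ?thesis using sym Barred by simp
  qed
  have up: "P z w m" if z: "z \<in> letters n" "w \<in> letters n" "z \<noteq> Barred 1" "w \<noteq> bar z"
    and e: "ht (rt (z, w, m)) = ht (rt (x, y, m))" and p: "1 \<le> m \<or> m = 0 \<and> z < bar w" for z w
  proof (cases "m = 0 \<and> nx n z = bar w")
    case True
    then show ?thesis using nx_simple[OF z(1,3)] by simp
  next
    case False
    have nz: "nx n z \<in> letters n" using nx_letters z by simp
    have "1 \<le> m \<or> m = 0 \<and> nx n z < bar w"
      using p False nx_le[of z n "bar w"] z by auto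
    then have "0 < ht (rt (nx n z, w, m))" using ht_rt_pos_iff nz z by blast
    moreover have "ht (rt (nx n z, w, m)) < ht (rt (x, y, m))" using e ht_nx[OF z(1,3)] by (simp add: ht_rt)
    ultimately have "P (nx n z) w m" using IH nz z by blast
    moreover have "0 \<le> m" using p by auto
    ultimately show ?thesis using rule[of z "bar (nx n z)" w 0 m] nx_simple[OF z(1,3)] z nz by simp
  qed
  show ?case
  proof (cases "y = bar x")
    case True
    then have m: "1 \<le> m" using pos by auto
    \<comment> \<open>An imaginary root vector z bar(z) t^m comes from zz and bar(z) bar(z) t^m,
      both of smaller height.\<close>
    have cartan: "P z (bar z) m" if z: "z \<in> letters n" "z = Plain j" and h: "ht (rt (x, y, m)) = 4 * int n * m" for z j
    proof -
      have zb: "0 < ht (lw z)" "ht (lw z) \<le> 2 * int n - 1" using z ht_lw_bound[of z] by (auto simp: ht_unitv)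
      have m4: "4 * int n * 1 \<le> 4 * int n * m" using m by (intro mult_left_mono) auto
      have "P z z 0"
      proof (rule IH[OF z(1) z(1)])
        show "0 < ht (rt (z, z, 0))" "ht (rt (z, z, 0)) < ht (rt (x, y, m))"
          using zb m4 unfolding h unfolding ht_rt by linarith+
      qed
      moreover have "P (bar z) (bar z) m"
      proof (rule IH)
        show "0 < ht (rt (bar z, bar z, m))" "ht (rt (bar z, bar z, m)) < ht (rt (x, y, m))"
          using zb m4 unfolding h unfolding ht_rt lw_bar ht_linear(4) by linarith+
      qed (use z in auto)
      ultimately show ?thesis using rule[of z z "bar z" 0 m] z m by simp
    qed
    have h: "ht (rt (x, y, m)) = 4 * int n * m" using True by (simp add: ht_rt ht_linear)
    show ?thesis
    proof (cases x)
      case (Plain j)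
      then show ?thesis using cartan[of x j] l True h by simp
    next
      case (Barred j)
      then show ?thesis using cartan[of y j] l True h sym by simp
    qed
  next
    case False
    consider "x \<noteq> Barred 1" | "x = Barred 1" "y \<noteq> Barred 1" | "x = Barred 1" "y = Barred 1" by blast
    then show ?thesis
    proof cases
      case 1
      then show ?thesis using up[of x y] l False pos by simp
    next
      case 2
      have "y < bar x" if "x < bar y" using that bar_less_iff[of x "bar y"] by (cases x; cases y) auto
      moreover have "x \<noteq> bar y" using False by auto
      ultimately have "P y x m" using up[of y x] l pos 2 by (auto simp: ht_rt)
      then show ?thesis by (rule sym)
    next
      case 3
      \<comment> \<open>Both letters are bar 1: degree one is \<alpha>_0, and higher degrees come
        from \<alpha>_0 and the imaginary root (m - 1)\<delta>.\<close>
      then have m: "1 \<le> m" using pos by auto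
      have a0: "P (Barred 1) (Barred 1) 1" using simple[of 0] by (simp add: simple_index_def)
      show ?thesis
      proof (cases "m = 1")
        case True
        then show ?thesis using a0 3 by simp
      next
        case False
        have L: "Plain 1 \<in> letters n" "Barred 1 \<in> letters n" using n_pos by auto
        have "ht (rt (Plain 1, Barred 1, m - 1)) < ht (rt (x, y, m))"
          using 3 n_pos by (simp add: ht_rt ht_linear ht_unitv algebra_simps)
        moreover have "0 < ht (rt (Plain 1, Barred 1, m - 1))" using ht_rt_pos_iff[OF L] False m by auto
        ultimately have "P (Plain 1) (Barred 1) (m - 1)" using IH L by blast
        then show ?thesis using rule[of "Barred 1" "Barred 1" "Barred 1" 1 "m - 1"] a0 3 m L by simp
      qed
    qed
  qed
qed

end

text \<open>What the action of the Lie algebra provides, with the central element already replaced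
  by 1. The eigenvalue is minus \<open>lam j\<close> because the element with letters j and bar j
  acts on the basis vector j by -1.\<close>

locale affine_ops = path_C n i0 + vspace smul
  for n i0 and smul :: "complex \<Rightarrow> 'v \<Rightarrow> 'v::ab_group_add" (infixr \<open>\<odot>\<close> 75) +
  fixes T :: "letter \<Rightarrow> letter \<Rightarrow> int \<Rightarrow> 'v \<Rightarrow> 'v" and d :: "'v \<Rightarrow> 'v" and v0 :: 'v
  assumes T_lin: "x \<in> letters n \<Longrightarrow> y \<in> letters n \<Longrightarrow> lin (T x y m)"
    and T_commute: "T x y m = T y x m"
    and T_bracket: "x \<in> letters n \<Longrightarrow> y \<in> letters n \<Longrightarrow> z \<in> letters n \<Longrightarrow> w \<in> letters n \<Longrightarrow>
      T x y m (T z w k v) = T z w k (T x y m v) +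
        (of_int (om y z) \<odot> T x w (m + k) v + of_int (om x z) \<odot> T y w (m + k) v +
         of_int (om y w) \<odot> T z x (m + k) v + of_int (om x w) \<odot> T z y (m + k) v +
         (if m + k = 0 then of_int (m * xtr x y z w) else 0) \<odot> v)"
    and d_lin: "lin d"
    and d_bracket: "x \<in> letters n \<Longrightarrow> y \<in> letters n \<Longrightarrow> d (T x y m v) = T x y m (d v) + of_int m \<odot> T x y m v"
    and irreducible: "subspace W \<Longrightarrow> (\<And>x y m v. x \<in> letters n \<Longrightarrow> y \<in> letters n \<Longrightarrow> v \<in> W \<Longrightarrow> T x y m v \<in> W) \<Longrightarrow>
      (\<And>v. v \<in> W \<Longrightarrow> d v \<in> W) \<Longrightarrow> W = {0} \<or> W = UNIV"
    and v0_nonzero: "v0 \<noteq> 0"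
    and v0_weight: "j \<in> {1..n} \<Longrightarrow> T (Plain j) (Barred j) 0 v0 = of_int (- lam j) \<odot> v0" "d v0 = 0"
    and v0_singular: "i \<le> n \<Longrightarrow> simple_index i = (x, y, m) \<Longrightarrow> T x y m v0 = 0"
begin

definition sg :: "letter \<Rightarrow> int" where
  "sg x = om x (bar x)"

lemma sg_simps [simp]: "sg (Plain j) = 1" "sg (Barred j) = -1" "sg (bar x) = - sg x" "sg x * sg x = 1"
  using om_antisym[of "bar x" x] om_bar_sq[of x] by (auto simp: sg_def)

lemma sg_cancel [simp]: "sg x * (sg x * t) = t"
  using sg_simps(4)[of x] by (metis mult.assoc mult_1)

lemma sg_nonzero [simp]: "sg x \<noteq> 0"
  using sg_simps(4)[of x] by (metis mult_zero_left zero_neq_one)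

lemma om_sg: "om x y = (if y = bar x then sg x else 0)"
  using om_nonzero[of x y] by (auto simp: sg_def)

definition wsp :: "wt \<Rightarrow> 'v set" where
  "wsp l = {v. (\<forall>j\<in>{1..n}. T (Plain j) (Barred j) 0 v = of_int (- l j) \<odot> v) \<and> d v = of_int (l 0) \<odot> v}"

lemma wsp_subspace: "subspace (wsp l)"
proof -
  have "lin (T (Plain j) (Barred j) 0)" if "j \<in> {1..n}" for j using that by (intro T_lin) auto
  then show ?thesis
    unfolding subspace_def wsp_def
    by (auto simp: lin_zero lin_add lin_scale d_lin scale_right_distrib mult.commute)
qed

lemma wsp_letter:
  assumes "v \<in> wsp l" "x \<in> letters n"
  shows "T x (bar x) 0 v = of_int (- sg x * form (lw x) l) \<odot> v"
  using assms T_commute by (cases x) (auto simp: wsp_def form_unitv form_linear)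

lemma wsp_T:
  assumes v: "v \<in> wsp l" and l: "x \<in> letters n" "y \<in> letters n"
  shows "T x y m v \<in> wsp (l + rt (x, y, m))"
proof -
  note L = T_lin[OF l, of m]
  have "T (Plain j) (Barred j) 0 (T x y m v) = of_int (- (l + rt (x, y, m)) j) \<odot> T x y m v" if j: "j \<in> {1..n}" for j
  proof -
    let ?P = "Plain j" and ?B = "Barred j"
    have P: "?P \<in> letters n" "?B \<in> letters n" using j by auto
    have wv: "T ?P ?B 0 v = of_int (- l j) \<odot> v" using v j by (auto simp: wsp_def)
    have e1: "of_int (om ?B z) \<odot> T ?P w m v + of_int (om ?P z) \<odot> T ?B w m v = of_int (- lw z j) \<odot> T z w m v" for z w
      by (cases z) (auto simp: unitv_def)
    have "T ?P ?B 0 (T x y m v) = T x y m (T ?P ?B 0 v) +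
        ((of_int (om ?B x) \<odot> T ?P y m v + of_int (om ?P x) \<odot> T ?B y m v) + (of_int (om ?B y) \<odot> T ?P x m v + of_int (om ?P y) \<odot> T ?B x m v))"
      using T_bracket[OF P l, of 0 m v] T_commute[of x ?P] T_commute[of x ?B] by (simp add: add.assoc)
    also have "\<dots> = of_int (- l j) \<odot> T x y m v + (of_int (- lw x j) \<odot> T x y m v + of_int (- lw y j) \<odot> T x y m v)"
      unfolding e1 wv lin_scale[OF L] T_commute[of y x] ..
    also have "\<dots> = of_int (- l j + (- lw x j + - lw y j)) \<odot> T x y m v"
      by (simp only: scale_left_distrib of_int_add)
    also have "- l j + (- lw x j + - lw y j) = - (l + rt (x, y, m)) j"
      using j by (simp add: rt.simps delta_def)
    finally show ?thesis .
  qed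
  moreover have "d (T x y m v) = of_int ((l + rt (x, y, m)) 0) \<odot> T x y m v"
  proof -
    have "d v = of_int (l 0) \<odot> v" using v by (simp add: wsp_def)
    then have "d (T x y m v) = of_int (l 0) \<odot> T x y m v + of_int m \<odot> T x y m v"
      using d_bracket[OF l] lin_scale[OF L] by simp
    moreover have "rt (x, y, m) 0 = m" using l by (simp add: rt.simps lw_outside delta_def)
    ultimately show ?thesis by (simp add: scale_left_distrib)
  qed
  ultimately show ?thesis by (simp add: wsp_def)
qed

definition cc :: "letter \<Rightarrow> letter \<Rightarrow> int" where
  "cc x y = (if x = y then 2 else 1)"

text \<open>The relation [e, f] = h for all roots at once, imaginary ones included: the bracket is a
  Cartan element plus a central term, and together they act on weight l by (l, root) up to
  normalisation. \<open>cc\<close> is 2 for the long roots, where x = y.\<close>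

lemma T_opposite:
  assumes v: "v \<in> wsp l" and lev: "l (n + 1) = 1" and L: "x \<in> letters n" "y \<in> letters n"
  shows "T x y m (T (bar x) (bar y) (- m) v) = T (bar x) (bar y) (- m) (T x y m v) +
    of_int (- (sg x * sg y) * cc x y * form l (rt (x, y, m))) \<odot> v"
proof -
  have wx: "T x (bar x) 0 v = of_int (- sg x * form (lw x) l) \<odot> v" "T y (bar y) 0 v = of_int (- sg y * form (lw y) l) \<odot> v"
    using wsp_letter v L by auto
  have fm: "form l (rt (x, y, m)) = form (lw x) l + form (lw y) l + 2 * m"
    using lev by (simp add: rt.simps form_linear form_commute[of l] form_delta)
  have Lb: "bar x \<in> letters n" "bar y \<in> letters n" using L by auto
  have br: "T x y m (T (bar x) (bar y) (- m) v) = T (bar x) (bar y) (- m) (T x y m v) +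
      (of_int (om y (bar x)) \<odot> T x (bar y) 0 v + of_int (om x (bar x)) \<odot> T y (bar y) 0 v +
       of_int (om y (bar y)) \<odot> T x (bar x) 0 v + of_int (om x (bar y)) \<odot> T (bar x) y 0 v +
       of_int (m * xtr x y (bar x) (bar y)) \<odot> v)"
    using T_bracket[OF L Lb, of m "- m" v] T_commute[of "bar x" x] by simp
  consider "x = y" | "y = bar x" | "x \<noteq> y" "y \<noteq> bar x" by blast
  then show ?thesis
  proof cases
    case 1
    define a where "a = complex_of_int (- form (lw x) l)"
    have h: "of_int (sg x) \<odot> T x (bar x) 0 v = a \<odot> v" using wx(1) by (simp add: a_def flip: of_int_mult)
    have "T x x m (T (bar x) (bar x) (- m) v) = T (bar x) (bar x) (- m) (T x x m v) +
        (a \<odot> v + a \<odot> v + a \<odot> v + a \<odot> v + of_int (m * (-4)) \<odot> v)"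
      using br 1 T_commute[of "bar x" x] by (simp add: om_sg xtr_def h[unfolded 1])
    also have "a \<odot> v + a \<odot> v + a \<odot> v + a \<odot> v + of_int (m * (-4)) \<odot> v = (a + a + a + a + of_int (m * (-4))) \<odot> v"
      by (simp only: scale_left_distrib)
    also have "a + a + a + a + of_int (m * (-4)) = of_int (- (sg x * sg x) * cc x x * form l (rt (x, x, m)))"
      using fm 1 by (simp add: a_def cc_def)
    finally show ?thesis using 1 by simp
  next
    case 2
    then show ?thesis using br wx T_commute[of "bar x" x]
      by (simp add: om_sg xtr_def cc_def fm[unfolded 2] form_linear)
  next
    case 3
    then have "x \<noteq> bar y" by auto
    then show ?thesis using br wx 3
      by (simp add: om_sg xtr_def cc_def fm scale_left_distrib[symmetric] of_int_mult[symmetric] of_int_add[symmetric] algebra_simps del: of_int_mult of_int_add)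
  qed
qed

lemma T_single:
  assumes L: "x \<in> letters n" "y \<in> letters n" "w \<in> letters n" and c: "w \<noteq> bar x \<or> x = y" "m + k \<noteq> 0 \<or> m = 0"
  shows "\<exists>c. c \<noteq> 0 \<and> (\<forall>v. T x w (m + k) v = c \<odot> (T x y m (T (bar y) w k v) - T (bar y) w k (T x y m v)))"
proof -
  have Lb: "bar y \<in> letters n" using L by simp
  have cen: "(if m + k = 0 then of_int (m * xtr x y (bar y) w) else 0) = (0::complex)" using c(2) by auto
  have br: "T x y m (T (bar y) w k v) - T (bar y) w k (T x y m v) =
      of_int (sg y) \<odot> T x w (m + k) v + of_int (om x (bar y)) \<odot> T y w (m + k) v +
      of_int (om y w) \<odot> T (bar y) x (m + k) v + of_int (om x w) \<odot> T (bar y) y (m + k) v" for v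
    using T_bracket[OF L(1,2) Lb L(3), of m k v] unfolding cen by (simp add: om_sg[of y "bar y"])
  define e :: int where "e = sg y * (if x = y then (if w = bar x then 4 else 2) else (if w = bar y then 2 else 1))"
  have "T x y m (T (bar y) w k v) - T (bar y) w k (T x y m v) = of_int e \<odot> T x w (m + k) v" for v
  proof (cases "x = y")
    case True
    then show ?thesis using br[of v] T_commute[of "bar x" x]
      by (auto simp: om_sg e_def scale_left_distrib[symmetric])
  next
    case False
    then have "w \<noteq> bar x" "x \<noteq> y" using c by auto
    then show ?thesis using br[of v] T_commute[of "bar y" x]
      by (auto simp: om_sg e_def scale_left_distrib[symmetric])
  qed
  moreover have "e \<noteq> 0" by (auto simp: e_def)
  ultimately show ?thesis by (intro exI[of _ "inverse (of_int e)"]) auto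
qed

section \<open>Chevalley operators and lowering words\<close>

definition eop :: "nat \<Rightarrow> 'v \<Rightarrow> 'v" where
  "eop i = (case simple_index i of (x, y, m) \<Rightarrow> T x y m)"

definition fop :: "nat \<Rightarrow> 'v \<Rightarrow> 'v" where
  "fop i = (case simple_index i of (x, y, m) \<Rightarrow> T (bar x) (bar y) (- m))"

lemma simple_index_letters: "i \<le> n \<Longrightarrow> simple_index i = (x, y, m) \<Longrightarrow> x \<in> letters n \<and> y \<in> letters n \<and> 0 \<le> m"
  using simple_index_PR[of i] by (auto simp: PR_iff)

lemma eop_lin: "i \<le> n \<Longrightarrow> lin (eop i)" and fop_lin: "i \<le> n \<Longrightarrow> lin (fop i)"
  by (cases "simple_index i"; use simple_index_letters in \<open>force simp: eop_def fop_def intro!: T_lin\<close>)+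

lemma eop_wsp: "i \<le> n \<Longrightarrow> v \<in> wsp l \<Longrightarrow> eop i v \<in> wsp (l + simple i)"
  and fop_wsp: "i \<le> n \<Longrightarrow> v \<in> wsp l \<Longrightarrow> fop i v \<in> wsp (l - simple i)"
proof -
  assume i: "i \<le> n" and v: "v \<in> wsp l"
  obtain x y m where s: "simple_index i = (x, y, m)" by (cases "simple_index i")
  have L: "x \<in> letters n" "y \<in> letters n" using simple_index_letters[OF i s] by auto
  have r: "rt (x, y, m) = simple i" using rt_simple_index[OF i] s by simp
  then have "rt (bar x, bar y, - m) = - simple i" by (simp add: rt.simps sc_linear algebra_simps fun_eq_iff)
  then show "eop i v \<in> wsp (l + simple i)" "fop i v \<in> wsp (l - simple i)"
    using wsp_T[OF v L, of m] wsp_T[OF v, of "bar x" "bar y" "- m"] L r by (simp_all add: eop_def fop_def s)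
qed

lemma eop_fop_ne:
  assumes i: "i \<le> n" "j \<le> n" "i \<noteq> j"
  shows "eop i (fop j v) = fop j (eop i v)"
proof -
  obtain x y m where s: "simple_index i = (x, y, m)" by (cases "simple_index i")
  obtain x' y' m' where s': "simple_index j = (x', y', m')" by (cases "simple_index j")
  have ne: "x' \<noteq> x" "x' \<noteq> y" "y' \<noteq> x" "y' \<noteq> y"
    using s s' i by (auto simp: simple_index_def split: if_splits)
  have "T x y m (T (bar x') (bar y') (- m') v) = T (bar x') (bar y') (- m') (T x y m v)"
    using T_bracket[of x y "bar x'" "bar y'" m "- m'" v] simple_index_letters[OF i(1) s] simple_index_letters[OF i(2) s'] ne
    by (simp add: om_sg xtr_def)
  then show ?thesis by (simp add: eop_def fop_def s s')
qed

text \<open>The scalar by which the bracket of \<open>eop\<close> and \<open>fop\<close> differs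
  from the coroot; dividing \<open>fop\<close> by it later gives an sl_2-triple.\<close>

definition kap :: "nat \<Rightarrow> complex" where
  "kap i = (case simple_index i of (x, y, m) \<Rightarrow> of_int (- (sg x * sg y) * cc x y * half_norm i))"

lemma kap_nonzero: "kap i \<noteq> 0"
proof -
  obtain x y m where s: "simple_index i = (x, y, m)" by (cases "simple_index i")
  show ?thesis by (simp add: kap_def s cc_def half_norm_def)
qed

lemma eop_fop:
  assumes i: "i \<le> n" and v: "v \<in> wsp l" "l (n + 1) = 1"
  shows "eop i (fop i v) = fop i (eop i v) + (kap i * of_int (cp i l)) \<odot> v"
proof -
  obtain x y m where s: "simple_index i = (x, y, m)" by (cases "simple_index i")
  have L: "x \<in> letters n" "y \<in> letters n" using simple_index_letters[OF i s] by auto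
  have "form l (rt (x, y, m)) = half_norm i * cp i l" using rt_simple_index[OF i] s form_simple'[OF i] by simp
  then show ?thesis using T_opposite[OF v L, of m] by (simp add: eop_def fop_def kap_def s mult.assoc)
qed

definition wtw :: "wt \<Rightarrow> nat list \<Rightarrow> wt" where
  "wtw l is = l - (\<Sum>i\<leftarrow>is. simple i)"

definition fwords :: "'v \<Rightarrow> nat list \<Rightarrow> 'v" where
  "fwords u is = foldr fop is u"

lemma wtw_simps: "wtw l [] = l" "wtw l (i # is) = wtw l is - simple i"
  by (simp_all add: wtw_def algebra_simps)

lemma fwords_simps [simp]: "fwords u [] = u" "fwords u (i # is) = fop i (fwords u is)"
  by (simp_all add: fwords_def)

lemma simple_level: "i \<le> n \<Longrightarrow> simple i (n + 1) = 0"
  using n_pos by (auto simp: simple_def delta_def unitv_def)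

lemma wtw_level: "set is \<subseteq> {..n} \<Longrightarrow> wtw l is (n + 1) = l (n + 1)"
proof (induction "is")
  case (Cons i "is")
  have "wtw l (i # is) (n + 1) = l (n + 1)" using Cons simple_level[of i] by (simp add: wtw_simps)
  then show ?case .
qed (simp add: wtw_simps)

lemma fwords_wsp: "u \<in> wsp l \<Longrightarrow> set is \<subseteq> {..n} \<Longrightarrow> fwords u is \<in> wsp (wtw l is)"
proof (induction "is")
  case (Cons i "is")
  have "fwords u (i # is) \<in> wsp (wtw l (i # is))"
    using Cons fop_wsp[of i "fwords u is" "wtw l is"] by (simp add: wtw_simps)
  then show ?case .
qed (simp add: wtw_simps)

definition fspan :: "'v \<Rightarrow> 'v set" where
  "fspan u = span (fwords u ` {is. set is \<subseteq> {..n}})"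

text \<open>Lowering words span a subspace closed under raising, since an \<open>eop\<close> moves
  through a word at the cost of scalars and dies on u. By \<open>positive_generation\<close> it is
  closed under all root vectors, and irreducibility finishes. It serves the highest weight vector
  and also refutes singular vectors of lower weight.\<close>

lemma fspan_UNIV:
  assumes u: "u \<in> wsp l" "l (n + 1) = 1" "u \<noteq> 0" and sing: "\<And>i. i \<le> n \<Longrightarrow> eop i u = 0"
  shows "fspan u = UNIV"
proof -
  let ?W = "fwords u ` {is. set is \<subseteq> {..n}}"
  have fop: "fop i w \<in> fspan u" if "i \<le> n" "w \<in> fspan u" for i w
    using that(2) unfolding fspan_def
  proof (rule lin_span[OF fop_lin[OF that(1)], rotated])
    fix b assume "b \<in> ?W"
    then obtain "is" where "b = fwords u is" "set is \<subseteq> {..n}" by auto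
    then have "fop i b = fwords u (i # is)" "set (i # is) \<subseteq> {..n}" using that by auto
    then show "fop i b \<in> span ?W" by (metis (mono_tags, lifting) image_eqI mem_Collect_eq span_base)
  qed
  have eop_word: "eop i (fwords u is) \<in> fspan u" if "i \<le> n" "set is \<subseteq> {..n}" for i "is"
    using that(2)
  proof (induction "is")
    case Nil
    then show ?case using sing[OF that(1)] by (simp add: fspan_def span_zero)
  next
    case (Cons j "is")
    have w: "fwords u is \<in> wsp (wtw l is)" "wtw l is (n + 1) = 1" "fwords u is \<in> fspan u"
      using fwords_wsp[OF u(1)] wtw_level u(2) Cons.prems by (auto simp: fspan_def intro!: span_base)
    have IH: "fop j (eop i (fwords u is)) \<in> fspan u" using Cons fop by auto
    show ?case
    proof (cases "i = j")
      case True
      have "eop i (fop i (fwords u is)) = fop i (eop i (fwords u is)) + (kap i * of_int (cp i (wtw l is))) \<odot> fwords u is"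
        by (rule eop_fop[OF that(1) w(1,2)])
      then show ?thesis using IH w(3) True by (simp add: fspan_def span_add span_scale)
    next
      case False
      then show ?thesis using eop_fop_ne[of i j] that Cons.prems IH by simp
    qed
  qed
  have eop: "eop i w \<in> fspan u" if "i \<le> n" "w \<in> fspan u" for i w
    using that(2) unfolding fspan_def
  proof (rule lin_span[OF eop_lin[OF that(1)], rotated])
    fix b assume "b \<in> ?W"
    then show "eop i b \<in> span ?W" using eop_word[OF that(1)] by (auto simp: fspan_def)
  qed
  have sub: "subspace (fspan u)" by (simp add: fspan_def)
  have rule: "T x w (m + k) v \<in> fspan u"
    if "x \<in> letters n" "y \<in> letters n" "w \<in> letters n" "m + k \<noteq> 0 \<or> m = 0" "w \<noteq> bar x \<or> x = y"
      "\<And>v. v \<in> fspan u \<Longrightarrow> T x y m v \<in> fspan u" "\<And>v. v \<in> fspan u \<Longrightarrow> T (bar y) w k v \<in> fspan u" "v \<in> fspan u" for x y w m k v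
  proof -
    have "\<exists>c. T x w (m + k) v = c \<odot> (T x y m (T (bar y) w k v) - T (bar y) w k (T x y m v))"
      using T_single[OF that(1-3,5,4)] by blast
    then obtain c where "T x w (m + k) v = c \<odot> (T x y m (T (bar y) w k v) - T (bar y) w k (T x y m v))" by blast
    then show ?thesis using that(6-8) sub by (simp add: subspace_scale subspace_diff)
  qed
  have pos: "T x y m v \<in> fspan u" if "x \<in> letters n" "y \<in> letters n" "0 < ht (rt (x, y, m))" "v \<in> fspan u" for x y m v
  proof -
    have "\<forall>v\<in>fspan u. T x y m v \<in> fspan u"
    proof (rule positive_generation[of "\<lambda>x y m. \<forall>v\<in>fspan u. T x y m v \<in> fspan u", OF _ _ _ that(1-3)])
      fix i x y m assume "i \<le> n" "simple_index i = (x, y, m)"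
      then show "\<forall>v\<in>fspan u. T x y m v \<in> fspan u" using eop[of i] by (simp add: eop_def)
    qed (use T_commute rule in auto)
    then show ?thesis using that by blast
  qed
  \<comment> \<open>Barring letters and negating degrees turns the same generation argument into one
    for negative root vectors.\<close>
  have neg: "T (bar x) (bar y) (- m) v \<in> fspan u" if "x \<in> letters n" "y \<in> letters n" "0 < ht (rt (x, y, m))" "v \<in> fspan u" for x y m v
  proof -
    have "\<forall>v\<in>fspan u. T (bar x) (bar y) (- m) v \<in> fspan u"
    proof (rule positive_generation[of "\<lambda>x y m. \<forall>v\<in>fspan u. T (bar x) (bar y) (- m) v \<in> fspan u", OF _ _ _ that(1-3)])
      fix i x y m assume "i \<le> n" "simple_index i = (x, y, m)"
      then show "\<forall>v\<in>fspan u. T (bar x) (bar y) (- m) v \<in> fspan u" using fop[of i] by (simp add: fop_def)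
    next
      fix x y w m k
      assume a: "x \<in> letters n" "y \<in> letters n" "w \<in> letters n" "0 \<le> m" "0 \<le> k" "w \<noteq> bar x \<or> x = y"
        "\<forall>v\<in>fspan u. T (bar x) (bar y) (- m) v \<in> fspan u" "\<forall>v\<in>fspan u. T (bar (bar y)) (bar w) (- k) v \<in> fspan u"
      have "T (bar x) (bar w) (- m + - k) v \<in> fspan u" if "v \<in> fspan u" for v
        using a that by (intro rule[of "bar x" "bar y" "bar w" "- m" "- k"]) (auto simp: bar_eq_iff[of w "bar x", symmetric] simp del: bar_eq_iff)
      then show "\<forall>v\<in>fspan u. T (bar x) (bar w) (- (m + k)) v \<in> fspan u" by simp
    qed (use T_commute in auto)
    then show ?thesis using that by blast
  qed
  have wt_closed: "A w \<in> fspan u" if A: "lin A" and ev: "\<And>l' v. v \<in> wsp l' \<Longrightarrow> \<exists>c. A v = c \<odot> v" and w: "w \<in> fspan u" for A w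
    using w unfolding fspan_def
  proof (rule lin_span[OF A, rotated])
    fix b assume b: "b \<in> ?W"
    then obtain "is" where "b = fwords u is" "set is \<subseteq> {..n}" by auto
    then obtain c where "A b = c \<odot> b" using ev fwords_wsp[OF u(1)] by blast
    then show "A b \<in> span ?W" using b by (simp add: span_base span_scale)
  qed
  have all: "T x y m v \<in> fspan u" if "x \<in> letters n" "y \<in> letters n" "v \<in> fspan u" for x y m v
  proof -
    consider "0 < ht (rt (x, y, m))" | "0 < ht (rt (bar x, bar y, - m))" | "m = 0" "y = bar x"
    proof (cases "m = 0")
      case True
      have "bar x < bar (bar y)" if "bar y < x" using that bar_less_iff by blast
      then consider "x < bar y" | "bar x < bar (bar y)" | "x = bar y" using less_linear[of x "bar y"] by blast
      then show thesis
        using ht_rt_pos_iff[of x y m] ht_rt_pos_iff[of "bar x" "bar y" "- m"] that \<open>x \<in> letters n\<close> \<open>y \<in> letters n\<close> True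
        by cases auto
    next
      case False
      then consider "1 \<le> m" | "1 \<le> - m" by linarith
      then show thesis
        using ht_rt_pos_iff[of x y m] ht_rt_pos_iff[of "bar x" "bar y" "- m"] that \<open>x \<in> letters n\<close> \<open>y \<in> letters n\<close>
        by cases auto
    qed
    then show ?thesis
    proof cases
      case 1
      then show ?thesis using pos that by blast
    next
      case 2
      then show ?thesis using neg[of "bar x" "bar y" "- m" v] that by simp
    next
      case 3
      have "lin (T x (bar x) 0)" using that by (intro T_lin) auto
      then show ?thesis using wt_closed[of "T x (bar x) 0" v] wsp_letter that 3 by blast
    qed
  qed
  have "d v \<in> fspan u" if "v \<in> fspan u" for v
    using wt_closed[OF d_lin _ that] by (auto simp: wsp_def)
  then have "fspan u = {0} \<or> fspan u = UNIV" using irreducible[OF sub] all by blast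
  moreover have "u \<in> fspan u"
    unfolding fspan_def by (rule span_base) (auto intro!: image_eqI[of _ _ "[]"])
  ultimately show ?thesis using u(3) by auto
qed

end

context affine_ops
begin

lemma lam_level: "lam (n + 1) = 1"
  using i0 by (simp add: lam_def)

lemma v0_wsp: "v0 \<in> wsp lam"
  using v0_weight by (simp add: wsp_def lam_def)

lemma eop_v0: "i \<le> n \<Longrightarrow> eop i v0 = 0"
  using v0_singular by (cases "simple_index i") (simp add: eop_def)

lemma span_words: "fspan v0 = UNIV"
  by (rule fspan_UNIV[OF v0_wsp lam_level v0_nonzero eop_v0])

section \<open>Weight spaces and their finite dimension\<close>

definition latt :: "wt set" where
  "latt = {l. l (n + 1) = 1 \<and> (\<forall>j>n + 1. l j = 0)}"

lemma lam_latt: "lam \<in> latt"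
  using i0 by (auto simp: latt_def lam_def)

lemma simple_latt: "i \<le> n \<Longrightarrow> n < j \<Longrightarrow> simple i j = 0"
  using n_pos by (auto simp: simple_def delta_def unitv_def)

lemma rt_latt: "x \<in> letters n \<Longrightarrow> y \<in> letters n \<Longrightarrow> n < j \<Longrightarrow> rt (x, y, m) j = 0"
  by (simp add: rt.simps lw_outside delta_def)

lemma latt_add: "l \<in> latt \<Longrightarrow> (\<And>j. n < j \<Longrightarrow> u j = 0) \<Longrightarrow> l + u \<in> latt"
  and latt_diff: "l \<in> latt \<Longrightarrow> (\<And>j. n < j \<Longrightarrow> u j = 0) \<Longrightarrow> l - u \<in> latt"
  by (simp_all add: latt_def)

lemma latt_eqI: "l \<in> latt \<Longrightarrow> l' \<in> latt \<Longrightarrow> (\<And>j. j \<le> n \<Longrightarrow> l j = l' j) \<Longrightarrow> l = l'"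
proof
  fix j assume "l \<in> latt" "l' \<in> latt" "\<And>j. j \<le> n \<Longrightarrow> l j = l' j"
  then show "l j = l' j" by (cases "j \<le> n"; cases "j = n + 1") (auto simp: latt_def)
qed

text \<open>Choose a coordinate where \<open>l\<close> and \<open>a\<close> differ. Its Cartan
  operator minus its eigenvalue on weight a removes the summand of a and rescales that of l by a
  nonzero factor.\<close>

lemma wsp_sum_zero:
  assumes "finite A"
  shows "A \<subseteq> latt \<Longrightarrow> (\<And>l. l \<in> A \<Longrightarrow> w l \<in> wsp l) \<Longrightarrow> (\<Sum>l\<in>A. w l) = 0 \<Longrightarrow> l \<in> A \<Longrightarrow> w l = 0"
  using assms
proof (induction A arbitrary: w l rule: finite_induct)
  case (insert a A)
  have other: "w l = 0" if l: "l \<in> A" for l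
  proof -
    have "l \<noteq> a" using insert l by auto
    then obtain j where j: "j \<le> n" "l j \<noteq> a j" using latt_eqI[of l a] insert.prems(1) l by auto
    define D where "D v = (if j = 0 then d v else - T (Plain j) (Barred j) 0 v)" for v
    have Dlin: "lin D"
    proof (cases "j = 0")
      case True
      then show ?thesis using d_lin by (simp add: D_def[abs_def])
    next
      case False
      then have "lin (T (Plain j) (Barred j) 0)" using j by (intro T_lin) auto
      then show ?thesis using False by (simp add: D_def[abs_def] lin_iff)
    qed
    have Dw: "D v = of_int (l' j) \<odot> v" if "v \<in> wsp l'" for v l'
      using that j by (auto simp: D_def wsp_def)
    have "0 = D (\<Sum>l\<in>insert a A. w l) - of_int (a j) \<odot> (\<Sum>l\<in>insert a A. w l)"
      using insert.prems(3) lin_zero[OF Dlin] by simp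
    also have "\<dots> = (\<Sum>l\<in>insert a A. D (w l) - of_int (a j) \<odot> w l)"
      by (simp only: lin_sum[OF Dlin] scale_sum_right sum_subtractf)
    also have "\<dots> = (\<Sum>l\<in>insert a A. of_int (l j - a j) \<odot> w l)"
    proof (rule sum.cong)
      fix l assume "l \<in> insert a A"
      then have "D (w l) = of_int (l j) \<odot> w l" by (intro Dw insert.prems(2))
      then show "D (w l) - of_int (a j) \<odot> w l = of_int (l j - a j) \<odot> w l" by (simp add: scale_left_diff_distrib)
    qed simp
    also have "\<dots> = (\<Sum>l\<in>A. of_int (l j - a j) \<odot> w l)" using insert.hyps by simp
    finally have "(\<Sum>l\<in>A. of_int (l j - a j) \<odot> w l) = 0" by simp
    then have "of_int (l j - a j) \<odot> w l = 0"
      using insert.IH[of "\<lambda>l. of_int (l j - a j) \<odot> w l" l] insert.prems l wsp_subspace by (simp add: subspace_scale)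
    then show ?thesis using j by simp
  qed
  then have "w a = 0" using insert by simp
  then show ?case using other insert.prems by auto
qed simp

definition words_to :: "wt \<Rightarrow> wt \<Rightarrow> nat list set" where
  "words_to l l' = {is. set is \<subseteq> {..n} \<and> wtw l is = l'}"

lemma ht_wtw: "set is \<subseteq> {..n} \<Longrightarrow> ht (wtw l is) = ht l - 2 * int (length is)"
proof (induction "is")
  case (Cons i "is")
  have "ht (wtw l (i # is)) = ht l - 2 * int (length (i # is))"
    using Cons by (simp add: wtw_simps ht_linear ht_simple)
  then show ?case .
qed (simp add: wtw_simps)

lemma wtw_latt: "l \<in> latt \<Longrightarrow> set is \<subseteq> {..n} \<Longrightarrow> wtw l is \<in> latt"
proof (induction "is")
  case (Cons i "is")
  have "wtw l (i # is) \<in> latt"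
    using Cons simple_latt[of i] by (simp add: wtw_simps latt_diff)
  then show ?case .
qed (simp add: wtw_simps)

lemma finite_words_to: "finite (words_to l l')"
proof (rule finite_subset)
  show "words_to l l' \<subseteq> {is. set is \<subseteq> {..n} \<and> length is \<le> nat (ht l - ht l')}"
    using ht_wtw by (fastforce simp: words_to_def)
qed (rule finite_lists_length_le, simp)

lemma fspan_decompose:
  assumes l: "l \<in> latt" and v: "v \<in> fspan u"
  shows "\<exists>A w. finite A \<and> A \<subseteq> latt \<and> (\<forall>m. w m \<in> span (fwords u ` words_to l m)) \<and> v = (\<Sum>m\<in>A. w m)"
proof -
  define Z where "Z m = span (fwords u ` words_to l m)" for m
  have Z0: "0 \<in> Z m" for m by (simp add: Z_def span_zero)
  show ?thesis
    using v unfolding fspan_def Z_def[symmetric]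
  proof (induction rule: span_induct_alt)
    case base
    show ?case by (rule exI[of _ "{}"], rule exI[of _ "\<lambda>_. 0"]) (simp add: Z0)
  next
    case (step c b y)
    then obtain A w where A: "finite A" "A \<subseteq> latt" "\<forall>m. w m \<in> Z m" "y = (\<Sum>m\<in>A. w m)" by blast
    obtain "is" where b: "b = fwords u is" "set is \<subseteq> {..n}" using step by auto
    let ?m = "wtw l is"
    have bz: "b \<in> Z ?m" using b by (auto simp: Z_def words_to_def intro!: span_base)
    define w' where "w' m = (if m \<in> A then w m else 0) + (if m = ?m then c \<odot> b else 0)" for m
    have "\<forall>m. w' m \<in> Z m"
      using A(3) bz Z0 by (auto simp: w'_def Z_def span_add span_scale span_zero)
    moreover have "c \<odot> b + y = (\<Sum>m\<in>insert ?m A. w' m)"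
    proof -
      have "(\<Sum>m\<in>insert ?m A. w' m) = (\<Sum>m\<in>insert ?m A. if m \<in> A then w m else 0) + (\<Sum>m\<in>insert ?m A. if m = ?m then c \<odot> b else 0)"
        by (simp only: w'_def sum.distrib)
      also have "(\<Sum>m\<in>insert ?m A. if m \<in> A then w m else 0) = y"
        using A by (simp add: sum.If_cases insert_absorb Int_absorb1 Int_insert_left)
      also have "(\<Sum>m\<in>insert ?m A. if m = ?m then c \<odot> b else 0) = c \<odot> b" using A(1) by (simp add: sum.delta)
      finally show ?thesis by (simp add: add.commute)
    qed
    moreover have "insert ?m A \<subseteq> latt" "finite (insert ?m A)" using A wtw_latt[OF l b(2)] by auto
    ultimately show ?case by blast
  qed
qed

text \<open>Sort a spanning expression by weight; independence of the weight spaces leaves only the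
  words of weight l'. There are finitely many of them, so weight spaces have finite
  dimension.\<close>

lemma wsp_decompose:
  assumes l: "l \<in> latt" and u: "u \<in> wsp l" "fspan u = UNIV" and l': "l' \<in> latt"
  shows "wsp l' = span (fwords u ` words_to l l')"
proof
  show "span (fwords u ` words_to l l') \<subseteq> wsp l'"
    using fwords_wsp[OF u(1)] by (intro span_minimal wsp_subspace) (auto simp: words_to_def)
  define Z where "Z m = span (fwords u ` words_to l m)" for m
  have Zw: "Z m \<subseteq> wsp m" for m
    unfolding Z_def using fwords_wsp[OF u(1)] by (intro span_minimal wsp_subspace) (auto simp: words_to_def)
  have Z0: "0 \<in> Z m" for m by (simp add: Z_def span_zero)
  show "wsp l' \<subseteq> span (fwords u ` words_to l l')"
  proof
    fix v assume v: "v \<in> wsp l'"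
    have "\<exists>A w. finite A \<and> A \<subseteq> latt \<and> (\<forall>m. w m \<in> Z m) \<and> v = (\<Sum>m\<in>A. w m)"
      unfolding Z_def by (rule fspan_decompose[OF l]) (simp add: u(2))
    then obtain A w where A: "finite A" "A \<subseteq> latt" "\<forall>m. w m \<in> Z m" "v = (\<Sum>m\<in>A. w m)"
      by (elim exE conjE)
    have wm: "w m \<in> wsp m" for m using A(3) Zw by blast
    define w' where "w' m = (if m \<in> A then w m else 0) - (if m = l' then v else 0)" for m
    have "w' l' = 0"
    proof (rule wsp_sum_zero[of "insert l' A" w' l'])
      show "w' m \<in> wsp m" if "m \<in> insert l' A" for m
        using wm v that wsp_subspace by (auto simp: w'_def subspace_diff subspace_neg subspace_0)
      have "(\<Sum>m\<in>insert l' A. w' m) = (\<Sum>m\<in>insert l' A. if m \<in> A then w m else 0) - (\<Sum>m\<in>insert l' A. if m = l' then v else 0)"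
        by (simp only: w'_def sum_subtractf)
      also have "(\<Sum>m\<in>insert l' A. if m \<in> A then w m else 0) = v"
        using A by (simp add: sum.If_cases insert_absorb Int_absorb1 Int_insert_left)
      also have "(\<Sum>m\<in>insert l' A. if m = l' then v else 0) = v" using A(1) by (simp add: sum.delta)
      finally show "(\<Sum>m\<in>insert l' A. w' m) = 0" by simp
    qed (use A l' in auto)
    then have "v \<in> Z l'" using A(3) Z0 by (auto simp: w'_def split: if_splits)
    then show "v \<in> span (fwords u ` words_to l l')" by (simp add: Z_def)
  qed
qed

lemma wsp_span: "l \<in> latt \<Longrightarrow> wsp l = span (fwords v0 ` words_to lam l)"
  by (rule wsp_decompose[OF lam_latt v0_wsp span_words])

lemma wsp_fin_dim: "l \<in> latt \<Longrightarrow> fin_dim (wsp l)"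
  unfolding fin_dim_def using wsp_span finite_words_to by (metis finite_imageI order_refl)

definition mlt :: "wt \<Rightarrow> nat" where
  "mlt l = dim (wsp l)"

lemma mlt_zero: "l \<in> latt \<Longrightarrow> words_to lam l = {} \<Longrightarrow> wsp l = {0}"
  using wsp_span by simp

lemma wsp_nonzero: "l \<in> latt \<Longrightarrow> v \<in> wsp l \<Longrightarrow> v \<noteq> 0 \<Longrightarrow> \<exists>is. set is \<subseteq> {..n} \<and> wtw lam is = l"
  using mlt_zero by (force simp: words_to_def)

lemma wsp_ht: "l \<in> latt \<Longrightarrow> v \<in> wsp l \<Longrightarrow> v \<noteq> 0 \<Longrightarrow> ht l \<le> ht lam"
  using wsp_nonzero ht_wtw by fastforce

lemma wtw_0: "set is \<subseteq> {..n} \<Longrightarrow> wtw l is 0 \<le> l 0"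
proof (induction "is")
  case (Cons i "is")
  have "0 \<le> simple i 0" using Cons.prems by (auto simp: simple_def delta_def unitv_def)
  then have "wtw l (i # is) 0 \<le> l 0" using Cons by (simp add: wtw_simps)
  then show ?case .
qed (simp add: wtw_simps)

lemma wsp_0: "l \<in> latt \<Longrightarrow> v \<in> wsp l \<Longrightarrow> v \<noteq> 0 \<Longrightarrow> l 0 \<le> 0"
proof -
  assume "l \<in> latt" "v \<in> wsp l" "v \<noteq> 0"
  then obtain "is" where "set is \<subseteq> {..n}" "wtw lam is = l" using wsp_nonzero by blast
  then show ?thesis using wtw_0[of "is" lam] by (auto simp: lam_def)
qed

lemma mlt_nonzero: "mlt l \<noteq> 0 \<Longrightarrow> \<exists>v\<in>wsp l. v \<noteq> 0"
proof (rule ccontr)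
  assume "mlt l \<noteq> 0" "\<not> (\<exists>v\<in>wsp l. v \<noteq> 0)"
  then have "basis_of (wsp l) \<subseteq> {0}" using basis_of(1)[of "wsp l"] by blast
  moreover have "0 \<notin> basis_of (wsp l)" using basis_of(2)[of "wsp l"] dependent_zero by blast
  ultimately have "basis_of (wsp l) = {}" by blast
  then show False using basis_of(4)[of "wsp l"] \<open>mlt l \<noteq> 0\<close> by (simp add: mlt_def)
qed

lemma mlt_lam: "mlt lam = 1"
proof -
  have "words_to lam lam = {[]}"
  proof -
    have "is = []" if "is \<in> words_to lam lam" for "is"
      using that ht_wtw[of "is" lam] by (auto simp: words_to_def)
    moreover have "[] \<in> words_to lam lam" by (simp add: words_to_def wtw_simps)
    ultimately show ?thesis by blast
  qed
  then have "wsp lam = span {v0}" using wsp_span[OF lam_latt] by simp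
  moreover have "independent {v0}" using v0_nonzero by simp
  ultimately show ?thesis using dim_span_eq_card_independent[of "{v0}"] by (simp add: mlt_def)
qed

section \<open>Integrability and reflection symmetry of the multiplicities\<close>

definition Fn :: "nat \<Rightarrow> 'v \<Rightarrow> 'v" where
  "Fn i v = inverse (kap i) \<odot> fop i v"

lemma Fn_lin: "i \<le> n \<Longrightarrow> lin (Fn i)"
  unfolding Fn_def[abs_def] by (rule lin_scaled) (rule fop_lin)

definition hwt :: "nat \<Rightarrow> int \<Rightarrow> 'v \<Rightarrow> bool" where
  "hwt i t w \<longleftrightarrow> (\<exists>l\<in>latt. w \<in> wsp l \<and> cp i l = t)"

lemma sl2:
  assumes i: "i \<le> n"
  shows "hwt i t w \<Longrightarrow> hwt i (t - 2) (Fn i w)" "hwt i t w \<Longrightarrow> hwt i (t + 2) (eop i w)"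
    "hwt i t w \<Longrightarrow> eop i (Fn i w) = Fn i (eop i w) + of_int t \<odot> w"
proof -
  assume "hwt i t w"
  then obtain l where l: "l \<in> latt" "w \<in> wsp l" "cp i l = t" by (auto simp: hwt_def)
  have "Fn i w \<in> wsp (l - simple i)"
    using fop_wsp[OF i l(2)] wsp_subspace by (simp add: Fn_def subspace_scale)
  moreover have "cp i (l - simple i) = t - 2" using l by (simp add: cp_linear cp_simple i)
  moreover have "l - simple i \<in> latt" using l simple_latt[OF i] by (simp add: latt_diff)
  ultimately show "hwt i (t - 2) (Fn i w)" unfolding hwt_def by blast
  have "cp i (l + simple i) = t + 2" using l by (simp add: cp_linear cp_simple i)
  moreover have "l + simple i \<in> latt" using l simple_latt[OF i] by (simp add: latt_add)
  ultimately show "hwt i (t + 2) (eop i w)" using eop_wsp[OF i l(2)] unfolding hwt_def by blast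
  have "l (n + 1) = 1" using l by (simp add: latt_def)
  then show "eop i (Fn i w) = Fn i (eop i w) + of_int t \<odot> w"
    using eop_fop[OF i l(2)] kap_nonzero[of i] l(3)
    by (simp add: Fn_def lin_scale[OF eop_lin[OF i]] scale_right_distrib mult.assoc[symmetric])
qed

lemma Fn_pow_wsp: "i \<le> n \<Longrightarrow> v \<in> wsp l \<Longrightarrow> (Fn i ^^ k) v \<in> wsp (l - sc (int k) (simple i))"
proof (induction k)
  case (Suc k)
  have "(Fn i ^^ k) v \<in> wsp (l - sc (int k) (simple i))" by (rule Suc.IH[OF Suc.prems])
  then have "Fn i ((Fn i ^^ k) v) \<in> wsp (l - sc (int k) (simple i) - simple i)"
    using fop_wsp[of i] Suc.prems wsp_subspace by (simp add: Fn_def subspace_scale)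
  moreover have "l - sc (int k) (simple i) - simple i = l - sc (int (Suc k)) (simple i)" by (simp add: sc_linear algebra_simps)
  ultimately have "(Fn i ^^ Suc k) v \<in> wsp (l - sc (int (Suc k)) (simple i))" by simp
  then show ?case .
qed simp

lemma eop_pow_wsp: "i \<le> n \<Longrightarrow> v \<in> wsp l \<Longrightarrow> (eop i ^^ k) v \<in> wsp (l + sc (int k) (simple i))"
proof (induction k)
  case (Suc k)
  have "(eop i ^^ k) v \<in> wsp (l + sc (int k) (simple i))" by (rule Suc.IH[OF Suc.prems])
  then have "eop i ((eop i ^^ k) v) \<in> wsp (l + sc (int k) (simple i) + simple i)"
    using eop_wsp[of i] Suc.prems by simp
  moreover have "l + sc (int k) (simple i) + simple i = l + sc (int (Suc k)) (simple i)" by (simp add: sc_linear algebra_simps)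
  ultimately have "(eop i ^^ Suc k) v \<in> wsp (l + sc (int (Suc k)) (simple i))" by simp
  then show ?case .
qed simp

lemma eop_nilpotent:
  assumes "i \<le> n" "l \<in> latt" "v \<in> wsp l"
  shows "\<exists>N. (eop i ^^ N) v = 0"
proof -
  define N where "N = nat (ht lam - ht l) + 1"
  have "l + sc (int N) (simple i) \<in> latt" using assms simple_latt[of i] by (simp add: latt_add)
  moreover have "ht lam < ht (l + sc (int N) (simple i))" using assms(1) by (simp add: ht_linear ht_simple N_def)
  ultimately have "(eop i ^^ N) v = 0" using wsp_ht[OF _ eop_pow_wsp[OF assms(1,3), of N]] by force
  then show ?thesis by blast
qed

text \<open>The vector is singular. Were it nonzero, \<open>fspan_UNIV\<close> would recover v0 from
  it by lowering, yet lowering decreases the height.\<close>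

lemma Fn_v0:
  assumes i: "i \<le> n"
  shows "(Fn i ^^ (1 + of_bool (i = i0))) v0 = 0"
proof (rule ccontr)
  define k where "k = (of_bool (i = i0) :: nat)"
  let ?u = "(Fn i ^^ Suc k) v0"
  assume "(Fn i ^^ (1 + of_bool (i = i0))) v0 \<noteq> 0"
  then have u0: "?u \<noteq> 0" by (simp add: k_def)
  let ?l = "lam - sc (int (Suc k)) (simple i)"
  have u: "?u \<in> wsp ?l" by (rule Fn_pow_wsp[OF i v0_wsp])
  have ll: "?l \<in> latt" using lam_latt simple_latt[OF i] by (simp add: latt_diff)
  have h: "hwt i (int k) v0" using v0_wsp lam_latt cp_lam[OF i] by (auto simp: hwt_def k_def)
  have sing: "eop j ?u = 0" if j: "j \<le> n" for j
  proof (cases "j = i")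
    case True
    have "eop i ?u = (Fn i ^^ Suc k) (eop i v0) + of_int (int (Suc k) * (int k - int k)) \<odot> (Fn i ^^ k) v0"
      using sl2_raise_pow[where G = "hwt i" and F = "Fn i" and E = "eop i", OF Fn_lin[OF i] sl2(1)[OF i] sl2(3)[OF i] h, of k] by blast
    then show ?thesis using True eop_v0[OF i] lin_zero[OF lin_pow[OF Fn_lin[OF i], of "Suc k"]] by simp
  next
    case False
    have c: "eop j (Fn i v) = Fn i (eop j v)" for v
      using eop_fop_ne[OF j i False] by (simp add: Fn_def lin_scale[OF eop_lin[OF j]])
    have e: "eop j ((Fn i ^^ m) v0) = (Fn i ^^ m) (eop j v0)" for m by (induction m) (simp_all add: c)
    show ?thesis unfolding e eop_v0[OF j] by (rule lin_zero[OF lin_pow[OF Fn_lin[OF i]]])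
  qed
  have "fspan ?u = UNIV" by (rule fspan_UNIV[OF u _ u0 sing]) (use ll in \<open>auto simp: latt_def\<close>)
  then have "wsp lam = span (fwords ?u ` words_to ?l lam)" by (rule wsp_decompose[OF ll u _ lam_latt])
  moreover have "words_to ?l lam = {}"
  proof -
    have "False" if "is \<in> words_to ?l lam" for "is"
      using that ht_wtw[of "is" ?l] i by (auto simp: words_to_def ht_linear ht_simple)
    then show ?thesis by blast
  qed
  ultimately show False using v0_wsp v0_nonzero by simp
qed

text \<open>This is (ad f_i)^3 f_j = 0. Bracketing with the product pq is a derivation that sends
  any letter into the span of p and q and kills p and q. So each of the two letters of f_j can be
  hit once: the second bracket is a combination of pp, pq and qq (\<open>D\<close>), which commute
  with pq.\<close>

lemma fop_cubic:
  assumes i: "i \<le> n" and j: "j \<le> n"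
  shows "fop i (fop i (fop i (fop j v))) = 3 \<odot> fop i (fop i (fop j (fop i v))) - 3 \<odot> fop i (fop j (fop i (fop i v))) + fop j (fop i (fop i (fop i v)))"
proof -
  obtain x y m where s: "simple_index i = (x, y, m)" by (cases "simple_index i")
  obtain z w k where s': "simple_index j = (z, w, k)" by (cases "simple_index j")
  define p q r where "p = bar x" and "q = bar y" and "r = - m"
  have L: "p \<in> letters n" "q \<in> letters n" "bar z \<in> letters n" "bar w \<in> letters n"
    using simple_index_letters[OF i s] simple_index_letters[OF j s'] by (auto simp: p_def q_def)
  have ne: "q \<noteq> bar p" "p \<noteq> bar q" using s i by (auto simp: simple_index_def p_def q_def split: if_splits)
  define A where "A = fop i"
  define B where "B = fop j"
  have A: "A = T p q r" "lin A" using fop_lin[OF i] by (simp_all add: A_def fop_def s p_def q_def r_def)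
  have Blin: "lin B" using fop_lin[OF j] by (simp add: B_def)
  have om0: "om p q = 0" "om q p = 0" "om p p = 0" "om q q = 0" using ne by (auto simp: om_sg)
  have AT: "A (T p u t v) = T p u t (A v) + (of_int (om q u) \<odot> T p p (r + t) v + of_int (om p u) \<odot> T p q (r + t) v)"
    "A (T q u t v) = T q u t (A v) + (of_int (om q u) \<odot> T q p (r + t) v + of_int (om p u) \<odot> T q q (r + t) v)"
    if "u \<in> letters n" for u t v
    using T_bracket[OF L(1,2,1) that, of r t v] T_bracket[OF L(1,2,2) that, of r t v] by (simp_all add: A om0 xtr_def)
  have comm: "A (T a b t v) = T a b t (A v)" if "a \<in> {p, q}" "b \<in> {p, q}" for a b t v
  proof -
    have "a \<in> letters n" "b \<in> letters n" using that L by auto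
    then show ?thesis using T_bracket[OF L(1,2), of a b r t v] that om0 by (auto simp: A xtr_def)
  qed
  define c where "c = (if r + - k = 0 then of_int (r * xtr p q (bar z) (bar w)) else (0::complex))"
  define t where "t = r + - k"
  define C where "C v = of_int (om q (bar z)) \<odot> T p (bar w) t v + of_int (om p (bar z)) \<odot> T q (bar w) t v +
      of_int (om q (bar w)) \<odot> T p (bar z) t v + of_int (om p (bar w)) \<odot> T q (bar z) t v + c \<odot> v" for v
  have AB: "A (B v) = B (A v) + C v" for v
    using T_bracket[OF L, of r "- k" v] T_commute[of "bar z" p] T_commute[of "bar z" q]
    by (simp add: A(1) B_def fop_def s' C_def c_def t_def)
  define D where "D v = of_int (om q (bar z)) \<odot> (of_int (om q (bar w)) \<odot> T p p (r + t) v + of_int (om p (bar w)) \<odot> T p q (r + t) v) +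
      of_int (om p (bar z)) \<odot> (of_int (om q (bar w)) \<odot> T q p (r + t) v + of_int (om p (bar w)) \<odot> T q q (r + t) v) +
      of_int (om q (bar w)) \<odot> (of_int (om q (bar z)) \<odot> T p p (r + t) v + of_int (om p (bar z)) \<odot> T p q (r + t) v) +
      of_int (om p (bar w)) \<odot> (of_int (om q (bar z)) \<odot> T q p (r + t) v + of_int (om p (bar z)) \<odot> T q q (r + t) v)" for v
  have AC: "A (C v) = C (A v) + D v" for v
    unfolding C_def lin_add[OF A(2)] lin_scale[OF A(2)] AT[OF L(4)] AT[OF L(3)] D_def
    by (simp add: scale_right_distrib algebra_simps)
  have AD: "A (D v) = D (A v)" for v
    unfolding D_def by (simp add: lin_add[OF A(2)] lin_scale[OF A(2)] comm)
  have Ceq: "C v = A (B v) - B (A v)" for v using AB by simp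
  have Deq: "D v = A (A (B v)) - 2 \<odot> A (B (A v)) + B (A (A v))" for v
  proof -
    have "D v = A (C v) - C (A v)" using AC by simp
    also have "\<dots> = A (A (B v)) - A (B (A v)) - (A (B (A v)) - B (A (A v)))" by (simp add: Ceq lin_diff[OF A(2)])
    also have "\<dots> = A (A (B v)) - 2 \<odot> A (B (A v)) + B (A (A v))"
      using scale_left_distrib[of 1 1 "A (B (A v))"] by (simp add: algebra_simps)
    finally show ?thesis .
  qed
  have two: "2 \<odot> a = a + a" and three: "3 \<odot> a = a + a + a" for a :: 'v
    using scale_left_distrib[of 1 1 a] scale_left_distrib[of 2 1 a] by simp_all
  have "A (A (A (B v))) - 2 \<odot> A (A (B (A v))) + A (B (A (A v))) = A (A (B (A v))) - 2 \<odot> A (B (A (A v))) + B (A (A (A v)))"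
    using AD[of v] by (simp add: Deq lin_add[OF A(2)] lin_diff[OF A(2)] lin_scale[OF A(2)])
  then have "A (A (A (B v))) = 3 \<odot> A (A (B (A v))) - 3 \<odot> A (B (A (A v))) + B (A (A (A v)))"
    unfolding two three by (simp add: algebra_simps)
  then show ?thesis by (simp add: A_def B_def)
qed

text \<open>\<open>nilpotent_shift\<close> carries nilpotency along lowering words from v0, where
  \<open>Fn_v0\<close> gives it, and the words span the module.\<close>

lemma fop_nilpotent:
  assumes i: "i \<le> n"
  shows "\<exists>N. (fop i ^^ N) v = 0"
proof -
  let ?K = "{v. \<exists>N. (fop i ^^ N) v = 0}"
  have L: "lin (fop i ^^ N)" for N by (rule lin_pow[OF fop_lin[OF i]])
  have mono: "(fop i ^^ M) v = 0" if "(fop i ^^ N) v = 0" "N \<le> M" for N M v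
  proof -
    have "(fop i ^^ M) v = (fop i ^^ (M - N)) ((fop i ^^ N) v)" using that(2) by (simp add: funpow_add[symmetric, THEN fun_cong, simplified o_def])
    then show ?thesis using that(1) lin_zero[OF L] by simp
  qed
  have "subspace ?K"
    unfolding subspace_def
  proof (intro conjI ballI allI)
    show "0 \<in> ?K" by (auto intro: exI[of _ 0])
    fix x y assume "x \<in> ?K" "y \<in> ?K"
    then obtain N M where "(fop i ^^ N) x = 0" "(fop i ^^ M) y = 0" by auto
    then have "(fop i ^^ max N M) (x + y) = 0" using mono[of N x "max N M"] mono[of M y "max N M"] lin_add[OF L] by simp
    then show "x + y \<in> ?K" by blast
  next
    fix c x assume "x \<in> ?K"
    then show "c \<odot> x \<in> ?K" using lin_scale[OF L] by auto
  qed
  moreover have "fwords v0 is \<in> ?K" if "set is \<subseteq> {..n}" for "is"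
    using that
  proof (induction "is")
    case Nil
    let ?k = "1 + of_bool (i = i0) :: nat"
    have "Fn i ^^ m = (\<lambda>v. (inverse (kap i) ^ m) \<odot> (fop i ^^ m) v)" for m
      by (induction m) (auto simp: Fn_def lin_scale[OF fop_lin[OF i]] mult.commute)
    then have "(inverse (kap i) ^ ?k) \<odot> (fop i ^^ ?k) v0 = 0" using Fn_v0[OF i] by metis
    then have "(fop i ^^ ?k) v0 = 0" using kap_nonzero[of i] by simp
    then show ?case by (metis (mono_tags, lifting) fwords_simps(1) mem_Collect_eq)
  next
    case (Cons j "is")
    then obtain N where N: "(fop i ^^ N) (fwords v0 is) = 0" by auto
    have j: "j \<le> n" using Cons.prems by simp
    have "(fop i ^^ (N + 2)) (fop j (fwords v0 is)) = 0"
      by (rule nilpotent_shift[OF fop_lin[OF i] fop_cubic[OF i j] fop_lin[OF j] N])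
    then show ?case by (metis (mono_tags, lifting) fwords_simps(2) mem_Collect_eq)
  qed
  ultimately have "fspan v0 \<subseteq> ?K" unfolding fspan_def by (intro span_minimal) auto
  then show ?thesis using span_words by auto
qed

lemma Fn_nilpotent: "i \<le> n \<Longrightarrow> \<exists>N. (Fn i ^^ N) v = 0"
proof -
  assume i: "i \<le> n"
  have "Fn i ^^ m = (\<lambda>v. (inverse (kap i) ^ m) \<odot> (fop i ^^ m) v)" for m
    by (induction m) (auto simp: Fn_def lin_scale[OF fop_lin[OF i]] mult.commute)
  then show ?thesis using fop_nilpotent[OF i, of v] by auto
qed

lemma srefl_latt: "i \<le> n \<Longrightarrow> l \<in> latt \<Longrightarrow> srefl i l \<in> latt"
  unfolding srefl_def using simple_latt[of i] by (intro latt_diff) auto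

text \<open>A power of the lowering operator, or of the raising one for negative pairing, embeds the
  weight space into the reflected one by \<open>sl2_inj\<close>. The nilpotency required of the
  opposite operator is bounded height in the first case and integrability in the second.\<close>

lemma mlt_srefl_le:
  assumes i: "i \<le> n" and l: "l \<in> latt"
  shows "mlt l \<le> mlt (srefl i l)"
proof -
  have char0: "\<And>j. j \<noteq> 0 \<Longrightarrow> of_int j \<noteq> (0 :: complex)" by simp
  have fd: "fin_dim (wsp (srefl i l))" by (rule wsp_fin_dim[OF srefl_latt[OF i l]])
  show ?thesis
  proof (cases "0 \<le> cp i l")
    case True
    define k where "k = nat (cp i l)"
    have e: "srefl i l = l - sc (int k) (simple i)" using True by (simp add: srefl_def k_def)
    show ?thesis
      unfolding mlt_def
    proof (rule dim_le_inj[OF fd lin_pow[OF Fn_lin[OF i], of k] wsp_subspace])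
      fix v assume v: "v \<in> wsp l"
      show "(Fn i ^^ k) v \<in> wsp (srefl i l)" unfolding e by (rule Fn_pow_wsp[OF i v])
      obtain N where N: "(eop i ^^ N) v = 0" using eop_nilpotent[OF i l v] by blast
      have h: "hwt i (int k) v" using v l True by (auto simp: hwt_def k_def)
      show "v = 0" if "(Fn i ^^ k) v = 0"
        by (rule sl2_inj[where G = "hwt i" and E = "eop i" and F = "Fn i",
              OF Fn_lin[OF i] eop_lin[OF i] sl2(1)[OF i] sl2(2)[OF i] sl2(3)[OF i] char0 h N that])
    qed
  next
    case False
    define k where "k = nat (- cp i l)"
    have e: "srefl i l = l + sc (int k) (simple i)"
      using False sc_linear(5)[of "cp i l" "simple i"] by (simp add: srefl_def k_def)
    \<comment> \<open>Raising and lowering exchange roles, with weights negated.\<close>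
    let ?G = "\<lambda>t w. hwt i (- t) w"
    have g1: "?G (t - 2) (eop i w)" if "?G t w" for t w using sl2(2)[OF i that] by simp
    have g2: "?G (t + 2) (Fn i w)" if "?G t w" for t w using sl2(1)[OF i that] by simp
    have g3: "Fn i (eop i w) = eop i (Fn i w) + of_int t \<odot> w" if "?G t w" for t w using sl2(3)[OF i that] by simp
    show ?thesis
      unfolding mlt_def
    proof (rule dim_le_inj[OF fd lin_pow[OF eop_lin[OF i], of k] wsp_subspace])
      fix v assume v: "v \<in> wsp l"
      show "(eop i ^^ k) v \<in> wsp (srefl i l)" unfolding e by (rule eop_pow_wsp[OF i v])
      obtain N where N: "(Fn i ^^ N) v = 0" using Fn_nilpotent[OF i] by blast
      have h: "?G (int k) v" using v l False by (auto simp: hwt_def k_def)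
      show "v = 0" if "(eop i ^^ k) v = 0"
        by (rule sl2_inj[where G = ?G and E = "Fn i" and F = "eop i",
              OF eop_lin[OF i] Fn_lin[OF i] g1 g2 g3 char0 h N that])
    qed
  qed
qed

lemma mlt_srefl: "i \<le> n \<Longrightarrow> l \<in> latt \<Longrightarrow> mlt (srefl i l) = mlt l"
  using mlt_srefl_le[of i l] mlt_srefl_le[of i "srefl i l"] srefl_latt[of i l] srefl_srefl[of i l] by simp

end

section \<open>The Casimir operator\<close>

context affine_ops
begin

lemma bij_bar: "bij_betw bar (letters n) (letters n)"
  by (rule bij_betw_byWitness[where f' = bar]) auto

lemma sum_bar: "(\<Sum>x\<in>letters n. f (bar x)) = (\<Sum>x\<in>letters n. f x)"
  by (rule sum.reindex_bij_betw[OF bij_bar])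

lemma sum_om_bar:
  assumes "z \<in> letters n"
  shows "(\<Sum>y\<in>letters n. of_int (a * sg y) \<odot> (of_int (om (bar y) z) \<odot> g y)) = of_int (- a) \<odot> g z"
proof -
  have "(\<Sum>y\<in>letters n. of_int (a * sg y) \<odot> (of_int (om (bar y) z) \<odot> g y)) = (\<Sum>y\<in>letters n. if y = z then of_int (- a) \<odot> g y else 0)"
    by (rule sum.cong) (auto simp: om_sg mult.assoc simp flip: of_int_mult)
  then show ?thesis using assms by (simp add: sum.delta)
qed

lemma sum_om:
  assumes "z \<in> letters n"
  shows "(\<Sum>y\<in>letters n. of_int (a * sg y) \<odot> (of_int (om y z) \<odot> g y)) = of_int a \<odot> g (bar z)"
proof -
  have "(\<Sum>y\<in>letters n. of_int (a * sg y) \<odot> (of_int (om y z) \<odot> g y)) = (\<Sum>y\<in>letters n. if y = bar z then of_int a \<odot> g y else 0)"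
    by (rule sum.cong) (auto simp: om_sg mult.assoc simp flip: of_int_mult)
  then show ?thesis using assms by (simp add: sum.delta)
qed

text \<open>The cross terms left when zw is commuted through one factor of the quadratic sums
  \<open>Y\<close>; over successive degrees they telescope.\<close>

definition U :: "letter \<Rightarrow> letter \<Rightarrow> int \<Rightarrow> int \<Rightarrow> 'v \<Rightarrow> 'v" where
  "U z w p q v = of_int (-2) \<odot> (\<Sum>x\<in>letters n. of_int (sg x) \<odot> (T x z p (T (bar x) w q v) + T x w p (T (bar x) z q v)))"

text \<open>The degree m part of the Casimir element: up to a scalar, the elements bar(x) bar(y)
  with sign \<open>sg x * sg y\<close> are dual to the elements xy for the trace form.\<close>

definition Y :: "int \<Rightarrow> 'v \<Rightarrow> 'v" where
  "Y m v = (\<Sum>x\<in>letters n. \<Sum>y\<in>letters n. of_int (sg x * sg y) \<odot> T x y (- m) (T (bar x) (bar y) m v))"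

lemma two_scale: "of_int 2 \<odot> a = a + a" for a :: 'v
  using scale_left_distrib[of 1 1 a] by simp

text \<open>Here zw passes the right factor. The sums over dual letters collapse by
  \<open>sum_om_bar\<close> to \<open>U\<close>, and the central term survives only when the degrees
  cancel. In \<open>casimir_left\<close> the degree condition removes the central term.\<close>

lemma casimir_right:
  assumes L: "z \<in> letters n" "w \<in> letters n"
  shows "(\<Sum>x\<in>letters n. \<Sum>y\<in>letters n. of_int (sg x * sg y) \<odot> T x y p (T (bar x) (bar y) q (T z w k v))) =
    (\<Sum>x\<in>letters n. \<Sum>y\<in>letters n. of_int (sg x * sg y) \<odot> T x y p (T z w k (T (bar x) (bar y) q v))) + U z w p (q + k) v +
    (if q + k = 0 then of_int (- 4 * q) else 0) \<odot> T z w p v"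
proof -
  define r where "r = q + k"
  define c where "c = (if q + k = 0 then of_int q else (0::complex))"
  define g where "g z w x y = of_int (sg x * sg y) \<odot> (of_int (om (bar y) z) \<odot> T x y p (T (bar x) w r v))" for z w x y
  define h where "h z w x y = of_int (-2 * sg x * sg y) \<odot> (of_int (om (bar y) z) \<odot> (of_int (om (bar x) w) \<odot> T x y p v))" for z w x y
  define k1 where "k1 z w x = of_int (- sg x) \<odot> T x z p (T (bar x) w r v)" for z w x
  have tm: "of_int (sg x * sg y) \<odot> T x y p (T (bar x) (bar y) q (T z w k v)) =
      of_int (sg x * sg y) \<odot> T x y p (T z w k (T (bar x) (bar y) q v)) +
      (g z w x y + g z w y x + g w z x y + g w z y x) + c \<odot> (h z w x y + h w z x y)"
    if x: "x \<in> letters n" "y \<in> letters n" for x y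
  proof -
    have xb: "bar x \<in> letters n" "bar y \<in> letters n" using x by auto
    have A: "lin (T x y p)" using T_lin x by blast
    have c: "(if q + k = 0 then of_int (q * xtr (bar x) (bar y) z w) else 0) =
        c * (of_int (-2 * om (bar y) z * om (bar x) w) + of_int (-2 * om (bar y) w * om (bar x) z))"
      by (simp add: xtr_def c_def algebra_simps)
    have "T x y p (T (bar x) (bar y) q (T z w k v)) = T x y p (T z w k (T (bar x) (bar y) q v)) +
      (of_int (om (bar y) z) \<odot> T x y p (T (bar x) w r v) + of_int (om (bar x) z) \<odot> T x y p (T (bar y) w r v) +
       of_int (om (bar y) w) \<odot> T x y p (T z (bar x) r v) + of_int (om (bar x) w) \<odot> T x y p (T z (bar y) r v) +
       (c * (of_int (-2 * om (bar y) z * om (bar x) w) + of_int (-2 * om (bar y) w * om (bar x) z))) \<odot> T x y p v)"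
      by (subst T_bracket[OF xb L], subst c) (simp only: lin_add[OF A] lin_scale[OF A] r_def)
    then show ?thesis
      using T_commute[of y x p] T_commute[of z "bar x" r] T_commute[of z "bar y" r]
      by (simp add: g_def h_def scale_right_distrib scale_left_distrib scale_right_diff_distrib scale_left_diff_distrib right_diff_distrib distrib_left mult_ac add_ac)
  qed
  have s1: "(\<Sum>x\<in>letters n. \<Sum>y\<in>letters n. g z w x y) = (\<Sum>x\<in>letters n. k1 z w x)" if "z \<in> letters n" for z w
    unfolding g_def k1_def using sum_om_bar[OF that] by simp
  have s2: "(\<Sum>x\<in>letters n. \<Sum>y\<in>letters n. g z w y x) = (\<Sum>x\<in>letters n. k1 z w x)" if "z \<in> letters n" for z w
    by (subst sum.swap) (rule s1[OF that])
  have s3: "(\<Sum>x\<in>letters n. \<Sum>y\<in>letters n. h z w x y) = of_int (-2) \<odot> T z w p v" if "z \<in> letters n" "w \<in> letters n" for z w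
  proof -
    have "(\<Sum>x\<in>letters n. \<Sum>y\<in>letters n. h z w x y) = (\<Sum>x\<in>letters n. of_int (2 * sg x) \<odot> (of_int (om (bar x) w) \<odot> T x z p v))"
      unfolding h_def sum_om_bar[OF that(1)] by simp
    also have "\<dots> = of_int (-2) \<odot> T w z p v" by (rule sum_om_bar[OF that(2)])
    finally show ?thesis using T_commute[of w z] by simp
  qed
  have "(\<Sum>x\<in>letters n. \<Sum>y\<in>letters n. of_int (sg x * sg y) \<odot> T x y p (T (bar x) (bar y) q (T z w k v))) =
    (\<Sum>x\<in>letters n. \<Sum>y\<in>letters n. of_int (sg x * sg y) \<odot> T x y p (T z w k (T (bar x) (bar y) q v))) +
    (sum (k1 z w) (letters n) + sum (k1 z w) (letters n) + sum (k1 w z) (letters n) + sum (k1 w z) (letters n)) +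
    c \<odot> (of_int (-2) \<odot> T z w p v + of_int (-2) \<odot> T w z p v)"
    unfolding s3[OF L, symmetric] s3[OF L(2,1), symmetric]
    using s1[OF L(1), of w] s2[OF L(1), of w] s1[OF L(2), of z] s2[OF L(2), of z]
    by (simp only: tm sum.distrib scale_sum_right scale_right_distrib cong: sum.cong)
  also have "sum (k1 z w) (letters n) + sum (k1 z w) (letters n) + sum (k1 w z) (letters n) + sum (k1 w z) (letters n) = U z w p r v"
    unfolding U_def k1_def
    by (simp add: scale_right_distrib sum.distrib sum_negf two_scale[simplified])
  also have "c \<odot> (of_int (-2) \<odot> T z w p v + of_int (-2) \<odot> T w z p v) = (if q + k = 0 then of_int (- 4 * q) else 0) \<odot> T z w p v"
    unfolding T_commute[of w z] scale_left_distrib[symmetric] scale_scale c_def by simp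
  finally show ?thesis by (simp only: r_def)
qed

lemma casimir_left:
  assumes L: "z \<in> letters n" "w \<in> letters n" and pk: "p + k \<noteq> 0 \<or> p = 0"
  shows "(\<Sum>x\<in>letters n. \<Sum>y\<in>letters n. of_int (sg x * sg y) \<odot> T x y p (T z w k (T (bar x) (bar y) q v))) =
    T z w k (\<Sum>x\<in>letters n. \<Sum>y\<in>letters n. of_int (sg x * sg y) \<odot> T x y p (T (bar x) (bar y) q v)) - U z w (p + k) q v"
proof -
  define r where "r = p + k"
  have Z: "lin (T z w k)" using T_lin L by blast
  define g where "g z w x y = of_int (sg x * sg y) \<odot> (of_int (om y z) \<odot> T x w r (T (bar x) (bar y) q v))" for z w x y
  define k1 where "k1 z w x = of_int (sg x) \<odot> T x w r (T (bar x) z q v)" for z w x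
  have tm: "of_int (sg x * sg y) \<odot> T x y p (T z w k (T (bar x) (bar y) q v)) =
      T z w k (of_int (sg x * sg y) \<odot> T x y p (T (bar x) (bar y) q v)) + (g z w x y + g z w y x + g w z x y + g w z y x)"
    if x: "x \<in> letters n" "y \<in> letters n" for x y
  proof -
    have c: "(if p + k = 0 then of_int (p * xtr x y z w) else 0) = (0::complex)" using pk by auto
    have "T x y p (T z w k (T (bar x) (bar y) q v)) = T z w k (T x y p (T (bar x) (bar y) q v)) +
      (of_int (om y z) \<odot> T x w r (T (bar x) (bar y) q v) + of_int (om x z) \<odot> T y w r (T (bar x) (bar y) q v) +
       of_int (om y w) \<odot> T z x r (T (bar x) (bar y) q v) + of_int (om x w) \<odot> T z y r (T (bar x) (bar y) q v))"
      by (subst T_bracket[OF x L], subst c) (simp add: r_def)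
    then show ?thesis
      using T_commute[of "bar y" "bar x" q] T_commute[of z x r] T_commute[of z y r]
      by (simp add: g_def lin_scale[OF Z] scale_right_distrib mult.commute add_ac)
  qed
  have s1: "(\<Sum>x\<in>letters n. \<Sum>y\<in>letters n. g z w x y) = (\<Sum>x\<in>letters n. k1 z w x)" if "z \<in> letters n" for z w
    unfolding g_def k1_def using sum_om[OF that] by simp
  have s2: "(\<Sum>x\<in>letters n. \<Sum>y\<in>letters n. g z w y x) = (\<Sum>x\<in>letters n. k1 z w x)" if "z \<in> letters n" for z w
    by (subst sum.swap) (rule s1[OF that])
  have "(\<Sum>x\<in>letters n. \<Sum>y\<in>letters n. of_int (sg x * sg y) \<odot> T x y p (T z w k (T (bar x) (bar y) q v))) =
    T z w k (\<Sum>x\<in>letters n. \<Sum>y\<in>letters n. of_int (sg x * sg y) \<odot> T x y p (T (bar x) (bar y) q v)) +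
    (sum (k1 z w) (letters n) + sum (k1 z w) (letters n) + sum (k1 w z) (letters n) + sum (k1 w z) (letters n))"
    using s1[OF L(1), of w] s2[OF L(1), of w] s1[OF L(2), of z] s2[OF L(2), of z]
    by (simp only: tm sum.distrib lin_sum[OF Z] cong: sum.cong)
  also have "sum (k1 z w) (letters n) + sum (k1 z w) (letters n) + sum (k1 w z) (letters n) + sum (k1 w z) (letters n) = - U z w r q v"
    unfolding U_def k1_def by (simp add: scale_right_distrib sum.distrib two_scale[simplified] add_ac)
  finally show ?thesis by (simp add: r_def)
qed

lemma Y_comm:
  assumes L: "z \<in> letters n" "w \<in> letters n" and m: "0 \<le> m" and k: "k = 0 \<or> k = -1"
  shows "Y m (T z w k v) = T z w k (Y m v) + U z w (- m) (m + k) v - U z w (k - m) m v +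
    (if m + k = 0 then of_int (- 4 * m) else 0) \<odot> T z w (- m) v"
proof -
  have "- m + k \<noteq> 0 \<or> - m = 0" using m k by auto
  from casimir_left[OF L this, of m v] show ?thesis
    unfolding Y_def casimir_right[OF L] by (simp add: algebra_simps)
qed

text \<open>The two sums differ by commutators, which collapse to a multiple of zw. The factor
  -8(n+1), with n+1 the dual Coxeter number, is the value of \<open>Y 0\<close> in the adjoint
  representation.\<close>

lemma U_casimir:
  assumes L: "z \<in> letters n" "w \<in> letters n"
  shows "U z w 0 (-1) v + U z w (-1) 0 v = of_int (- 8 * (int n + 1)) \<odot> T z w (-1) v"
proof -
  define K where "K z w = (\<Sum>x\<in>letters n. of_int (sg x) \<odot> (T x z 0 (T (bar x) w (-1) v) - T (bar x) w (-1) (T x z 0 v)))" for z w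
  have cardL: "card (letters n) = 2 * n"
    unfolding letters_def by (subst card_Un_disjoint) (auto simp: card_image inj_on_def)
  have K: "K z w = of_int (2 * int n + 2) \<odot> T z w (-1) v" if L: "z \<in> letters n" "w \<in> letters n" for z w
  proof -
    have "K z w = (\<Sum>x\<in>letters n. of_int (- 1 * sg (bar x)) \<odot> (of_int (om z (bar x)) \<odot> T x w (-1) v)) +
        (\<Sum>x\<in>letters n. T z w (-1) v) + of_int (om z w) \<odot> (\<Sum>x\<in>letters n. of_int (sg x) \<odot> T x (bar x) (-1) v) +
        (\<Sum>x\<in>letters n. of_int (1 * sg x) \<odot> (of_int (om x w) \<odot> T (bar x) z (-1) v))"
      unfolding K_def scale_sum_right sum.distrib[symmetric]
    proof (rule sum.cong)
      fix x assume x: "x \<in> letters n"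
      have xb: "bar x \<in> letters n" using x by simp
      have "sg x * om x (bar x) = 1" by (simp add: om_sg)
      then have o: "of_int (sg x) * of_int (om x (bar x)) = (1::complex)" by (metis of_int_1 of_int_mult)
      show "of_int (sg x) \<odot> (T x z 0 (T (bar x) w (-1) v) - T (bar x) w (-1) (T x z 0 v)) =
          of_int (- 1 * sg (bar x)) \<odot> (of_int (om z (bar x)) \<odot> T x w (-1) v) + T z w (-1) v +
          of_int (om z w) \<odot> (of_int (sg x) \<odot> T x (bar x) (-1) v) + of_int (1 * sg x) \<odot> (of_int (om x w) \<odot> T (bar x) z (-1) v)"
        unfolding T_bracket[OF x L(1) xb L(2)] using o
        by (simp add: scale_right_distrib T_commute[of "bar x" x] mult.commute[of "of_int (om z w)"])
    qed simp
    also have "(\<Sum>x\<in>letters n. of_int (- 1 * sg (bar x)) \<odot> (of_int (om z (bar x)) \<odot> T x w (-1) v)) =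
        (\<Sum>x\<in>letters n. of_int (1 * sg (bar x)) \<odot> (of_int (om (bar x) z) \<odot> T x w (-1) v))"
      by (rule sum.cong) (simp_all add: om_antisym[of z])
    also have "\<dots> = (\<Sum>x\<in>letters n. of_int (1 * sg x) \<odot> (of_int (om x z) \<odot> T (bar x) w (-1) v))"
      using sum_bar[of "\<lambda>x. of_int (1 * sg x) \<odot> (of_int (om x z) \<odot> T (bar x) w (-1) v)"] by simp
    also have "\<dots> = T z w (-1) v" unfolding sum_om[OF L(1)] by simp
    also have "(\<Sum>x\<in>letters n. of_int (1 * sg x) \<odot> (of_int (om x w) \<odot> T (bar x) z (-1) v)) = T w z (-1) v" unfolding sum_om[OF L(2)] by simp
    also have "(\<Sum>x\<in>letters n. of_int (sg x) \<odot> T x (bar x) (-1) v) = 0"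
    proof -
      let ?s = "\<Sum>x\<in>letters n. of_int (sg x) \<odot> T x (bar x) (-1) v"
      have "?s = (\<Sum>x\<in>letters n. of_int (sg (bar x)) \<odot> T (bar x) (bar (bar x)) (-1) v)"
        by (rule sum_bar[symmetric])
      also have "\<dots> = - ?s" by (simp add: T_commute[of "bar _"] sum_negf)
      finally have "?s + ?s = 0" by (simp add: eq_neg_iff_add_eq_0)
      then have "of_int 2 \<odot> ?s = 0" unfolding two_scale .
      then show ?thesis by simp
    qed
    also have "(\<Sum>x\<in>letters n. T z w (-1) v) = of_int (2 * int n) \<odot> T z w (-1) v"
      by (simp add: sum_constant_scale cardL)
    finally show ?thesis by (simp add: T_commute[of w z] scale_left_distrib two_scale[simplified])
  qed
  have u2: "U z w (-1) 0 v = of_int 2 \<odot> (\<Sum>x\<in>letters n. of_int (sg x) \<odot> (T (bar x) z (-1) (T x w 0 v) + T (bar x) w (-1) (T x z 0 v)))"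
  proof -
    have "(\<Sum>x\<in>letters n. of_int (sg x) \<odot> (T x z (-1) (T (bar x) w 0 v) + T x w (-1) (T (bar x) z 0 v))) =
        (\<Sum>x\<in>letters n. of_int (sg (bar x)) \<odot> (T (bar x) z (-1) (T (bar (bar x)) w 0 v) + T (bar x) w (-1) (T (bar (bar x)) z 0 v)))"
      by (rule sum_bar[symmetric])
    then show ?thesis by (simp add: U_def sum_negf)
  qed
  have "U z w 0 (-1) v + U z w (-1) 0 v = of_int (-2) \<odot> (K z w + K w z)"
    unfolding u2 unfolding K_def U_def
    by (simp add: scale_right_distrib scale_right_diff_distrib sum.distrib sum_subtractf algebra_simps)
  also have "\<dots> = of_int (-2) \<odot> (of_int (2 * int n + 2) \<odot> T z w (-1) v + of_int (2 * int n + 2) \<odot> T z w (-1) v)"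
    using K[OF L] K[OF L(2,1)] T_commute[of w z] by simp
  also have "\<dots> = of_int (- 8 * (int n + 1)) \<odot> T z w (-1) v"
    by (simp only: scale_left_distrib[symmetric] scale_scale of_int_mult[symmetric] of_int_add[symmetric]) (simp add: algebra_simps)
  finally show ?thesis .
qed

text \<open>The Casimir operator cut off at degree M and without its term in c and d. On weights
  with -l 0 <= M the cut-off changes nothing, as higher degrees act by zero
  (\<open>Y_vanish\<close>); the omitted term appears as the shift by 8(n+2) in
  \<open>Cas_comm_1\<close>.\<close>

definition Cas :: "nat \<Rightarrow> 'v \<Rightarrow> 'v" where
  "Cas M v = Y 0 v + of_int 2 \<odot> (\<Sum>m=1..M. Y (int m) v)"

lemma Y_lin: "lin (Y m)"
proof -
  have "lin (T x y (- m))" "lin (T (bar x) (bar y) m)" if "x \<in> letters n" "y \<in> letters n" for x y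
    using that T_lin by auto
  then show ?thesis
    unfolding lin_iff Y_def
    by (simp add: lin_add lin_scale scale_right_distrib sum.distrib scale_sum_right mult.commute cong: sum.cong)
qed

lemma Cas_lin: "lin (Cas M)"
  using Y_lin unfolding lin_iff Cas_def
  by (simp add: sum.distrib scale_right_distrib scale_sum_right mult.commute)

lemma Cas_comm_0:
  assumes "z \<in> letters n" "w \<in> letters n"
  shows "Cas M (T z w 0 v) = T z w 0 (Cas M v)"
proof -
  have "Y (int m) (T z w 0 v) = T z w 0 (Y (int m) v)" for m
    using Y_comm[OF assms, of "int m" 0 v] by (cases "m = 0") auto
  from this this[of 0] show ?thesis
    using T_lin[OF assms] by (simp add: Cas_def lin_add lin_scale lin_sum)
qed

text \<open>The cross terms telescope in m. The upper end vanishes by \<open>van\<close>, the lower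
  end joins that of \<open>Y 0\<close> to give -8(n+1) by \<open>U_casimir\<close>, and the central
  term at m = 1, counted twice, gives -8. The total is -8 times dual Coxeter number plus
  level.\<close>

lemma Cas_comm_1:
  assumes L: "z \<in> letters n" "w \<in> letters n" and M: "1 \<le> M" and van: "\<And>x y. x \<in> letters n \<Longrightarrow> y \<in> letters n \<Longrightarrow> T x y (int M) v = 0"
  shows "Cas M (T z w (-1) v) = T z w (-1) (Cas M v) + of_int (- 8 * (int n + 2)) \<odot> T z w (-1) v"
proof -
  define a where "a m = U z w (- int m - 1) (int m) v" for m :: nat
  have Z: "lin (T z w (-1))" using T_lin L by blast
  have y0: "Y 0 (T z w (-1) v) = T z w (-1) (Y 0 v) + U z w 0 (-1) v - a 0"
    using Y_comm[OF L, of 0 "-1" v] by (simp add: a_def)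
  have ym: "Y (int m) (T z w (-1) v) = T z w (-1) (Y (int m) v) + (a (m - 1) - a m) + (if m = 1 then of_int (-4) \<odot> T z w (-1) v else 0)"
    if "1 \<le> m" for m
  proof -
    have e: "- int (m - 1) - 1 = - int m" "int (m - 1) = int m + - 1" "- 1 - int m = - int m - 1" using that by auto
    have "(if int m + - 1 = 0 then of_int (- 4 * int m) else 0) \<odot> T z w (- int m) v = (if m = 1 then of_int (-4) \<odot> T z w (-1) v else 0)"
      by auto
    then show ?thesis
      using Y_comm[OF L, of "int m" "-1" v] unfolding a_def e by (simp only: diff_conv_add_uminus) (simp add: add_ac)
  qed
  have tel: "(\<Sum>m=1..K. a (m - 1) - a m) = a 0 - a K" for K
    by (induction K) (auto simp: algebra_simps)
  have "(\<Sum>m=1..M. Y (int m) (T z w (-1) v)) = (\<Sum>m=1..M. T z w (-1) (Y (int m) v) + (a (m - 1) - a m) + (if m = 1 then of_int (-4) \<odot> T z w (-1) v else 0))"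
    by (rule sum.cong) (use ym in auto)
  also have "\<dots> = T z w (-1) (\<Sum>m=1..M. Y (int m) v) + (a 0 - a M) + of_int (-4) \<odot> T z w (-1) v"
    using M by (simp only: sum.distrib tel lin_sum[OF Z]) (simp add: sum.delta)
  finally have s: "(\<Sum>m=1..M. Y (int m) (T z w (-1) v)) = T z w (-1) (\<Sum>m=1..M. Y (int m) v) + (a 0 - a M) + of_int (-4) \<odot> T z w (-1) v" .
  have aM: "a M = 0"
  proof -
    have "T x z' (- int M - 1) (T (bar x) w' (int M) v) = 0" if "x \<in> letters n" "z' \<in> letters n" "w' \<in> letters n" for x z' w'
      using van[of "bar x" w'] that lin_zero[OF T_lin[OF that(1,2)]] by simp
    then show ?thesis using L by (simp add: a_def U_def)
  qed
  have "Cas M (T z w (-1) v) = T z w (-1) (Cas M v) + (U z w 0 (-1) v + a 0) + of_int (-8) \<odot> T z w (-1) v"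
    unfolding Cas_def y0 s aM by (simp add: lin_add[OF Z] lin_scale[OF Z] scale_right_distrib two_scale[simplified] algebra_simps)
  also have "U z w 0 (-1) v + a 0 = of_int (- 8 * (int n + 1)) \<odot> T z w (-1) v"
    using U_casimir[OF L, of v] by (simp add: a_def)
  finally have "Cas M (T z w (-1) v) = T z w (-1) (Cas M v) + (of_int (- 8 * (int n + 1)) \<odot> T z w (-1) v + of_int (-8) \<odot> T z w (-1) v)"
    by (simp only: add.assoc)
  also have "of_int (- 8 * (int n + 1)) \<odot> T z w (-1) v + of_int (-8) \<odot> T z w (-1) v = of_int (- 8 * (int n + 2)) \<odot> T z w (-1) v"
    by (simp only: scale_left_distrib[symmetric] of_int_add[symmetric]) (simp add: algebra_simps)
  finally show ?thesis .
qed

end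

context affine_ops
begin

section \<open>Normal ordering and the Casimir eigenvalue\<close>

lemma T_vanish:
  assumes "x \<in> letters n" "y \<in> letters n" "l \<in> latt" "w \<in> wsp l" "0 < l 0 + m"
  shows "T x y m w = 0"
proof (rule ccontr)
  assume "T x y m w \<noteq> 0"
  moreover have "l + rt (x, y, m) \<in> latt" using assms rt_latt by (intro latt_add) auto
  ultimately have "(l + rt (x, y, m)) 0 \<le> 0" using wsp_T[OF assms(4,1,2)] wsp_0 by blast
  then show False using assms by (simp add: rt.simps lw_outside delta_def)
qed

lemma Y_vanish: "l \<in> latt \<Longrightarrow> w \<in> wsp l \<Longrightarrow> 0 < l 0 + m \<Longrightarrow> Y m w = 0"
  unfolding Y_def by (intro sum.neutral ballI) (simp add: T_vanish lin_zero[OF T_lin])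

text \<open>Twice |l|^2 + 2(\<rho>, l) on the finite parts: minus the value of \<open>Y 0\<close> on
  a vector of weight l killed by the positive finite root vectors.\<close>

definition qn :: "wt \<Rightarrow> int" where
  "qn l = 2 * (\<Sum>j=1..n. l j * l j + 2 * (rho j * l j))"

definition up :: "(letter \<times> letter) set" where
  "up = {(x, y). x \<in> letters n \<and> y \<in> letters n \<and> x < bar y}"

lemma finite_up [simp]: "finite up"
  by (rule finite_subset[of _ "letters n \<times> letters n"]) (auto simp: up_def)

lemma sum_letters: "(\<Sum>x\<in>letters n. f x) = (\<Sum>j=1..n. f (Plain j) + f (Barred j))" for f :: "letter \<Rightarrow> 'b::comm_monoid_add"
  unfolding letters_def
  by (subst sum.union_disjoint) (auto simp: sum.reindex inj_on_def sum.distrib)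

lemma card_below:
  assumes "x \<in> letters n"
  shows "int (card {y \<in> letters n. y < bar x}) = (case x of Plain j \<Rightarrow> 2 * int n - int j | Barred j \<Rightarrow> int j - 1)"
proof (cases x)
  case (Plain j)
  have "{y \<in> letters n. y < bar x} = Plain ` {1..n} \<union> Barred ` {j + 1..n}"
    using Plain assms by (auto simp: letters_def)
  moreover have "card (Plain ` {1..n} \<union> Barred ` {j + 1..n}) = n + (n - j)"
    by (subst card_Un_disjoint) (auto simp: card_image inj_on_def)
  ultimately show ?thesis using Plain assms by simp
next
  case (Barred j)
  have "{y \<in> letters n. y < bar x} = Plain ` {1..<j}"
    using Barred assms by (auto simp: letters_def)
  moreover have "card (Plain ` {1..<j}) = j - 1" by (simp add: card_image inj_on_def)
  ultimately show ?thesis using Barred assms by simp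
qed

lemma less_bar_swap: "x < bar y \<longleftrightarrow> y < bar x"
  by (cases x; cases y) auto

lemma sum_up: "(\<Sum>p\<in>up. f p) = (\<Sum>x\<in>letters n. \<Sum>y\<in>{y \<in> letters n. y < bar x}. f (x, y))" for f :: "letter \<times> letter \<Rightarrow> 'b::comm_monoid_add"
proof -
  have "up = Sigma (letters n) (\<lambda>x. {y \<in> letters n. y < bar x})" using less_bar_swap by (auto simp: up_def)
  then show ?thesis by (simp add: sum.Sigma)
qed

text \<open>In the first sum each positive finite root has total weight 2, from two ordered pairs or
  from one diagonal pair with \<open>cc\<close> equal to 2, which gives 2(l, 2\<rho>); the second
  sum gives 2|l|^2.\<close>

lemma qn_roots: "(\<Sum>p\<in>up. cc (fst p) (snd p) * form l (rt (fst p, snd p, 0))) + (\<Sum>x\<in>letters n. form (lw x) l * form (lw x) l) = qn l"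
proof -
  let ?a = "\<lambda>x. form l (lw x)"
  have inv: "(\<Sum>p\<in>up. cc (fst p) (snd p) * ?a (snd p)) = (\<Sum>p\<in>up. cc (fst p) (snd p) * ?a (fst p))"
  proof (rule sum.reindex_bij_witness[where i = "\<lambda>p. (snd p, fst p)" and j = "\<lambda>p. (snd p, fst p)"])
    fix p assume "p \<in> up"
    then show "(snd p, fst p) \<in> up" using less_bar_swap by (auto simp: up_def)
    from \<open>p \<in> up\<close> show "(snd p, fst p) \<in> up" using less_bar_swap by (auto simp: up_def)
  qed (auto simp: cc_def)
  have "(\<Sum>y\<in>{y \<in> letters n. y < bar x}. cc x y) = (case x of Plain j \<Rightarrow> 2 * int n - int j + 1 | Barred j \<Rightarrow> int j - 1)" if x: "x \<in> letters n" for x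
  proof -
    have "(\<Sum>y\<in>{y \<in> letters n. y < bar x}. cc x y) = (\<Sum>y\<in>{y \<in> letters n. y < bar x}. 1 + (if x = y then 1 else 0))"
      by (rule sum.cong) (auto simp: cc_def)
    also have "\<dots> = int (card {y \<in> letters n. y < bar x}) + of_bool (x < bar x)"
      using x by (simp add: sum.distrib sum.delta')
    finally show ?thesis using card_below[OF x] by (cases x) auto
  qed
  then have "(\<Sum>p\<in>up. cc (fst p) (snd p) * ?a (fst p)) =
      (\<Sum>x\<in>letters n. (case x of Plain j \<Rightarrow> 2 * int n - int j + 1 | Barred j \<Rightarrow> int j - 1) * ?a x)"
    unfolding sum_up by (simp add: sum_distrib_right[symmetric])
  also have "\<dots> = (\<Sum>j=1..n. 2 * (rho j * l j))"
    unfolding sum_letters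
  proof (rule sum.cong)
    fix j assume "j \<in> {1..n}"
    then show "(case Plain j of Plain j \<Rightarrow> 2 * int n - int j + 1 | Barred j \<Rightarrow> int j - 1) * ?a (Plain j) +
        (case Barred j of Plain j \<Rightarrow> 2 * int n - int j + 1 | Barred j \<Rightarrow> int j - 1) * ?a (Barred j) = 2 * (rho j * l j)"
      by (simp add: form_commute[of l] form_unitv form_linear rho_def algebra_simps)
  qed simp
  finally have s: "(\<Sum>p\<in>up. cc (fst p) (snd p) * ?a (fst p)) = (\<Sum>j=1..n. 2 * (rho j * l j))" .
  have "(\<Sum>p\<in>up. cc (fst p) (snd p) * form l (rt (fst p, snd p, 0))) = (\<Sum>p\<in>up. cc (fst p) (snd p) * ?a (fst p)) + (\<Sum>p\<in>up. cc (fst p) (snd p) * ?a (snd p))"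
    by (simp add: rt.simps form_linear distrib_left sum.distrib)
  moreover have "(\<Sum>x\<in>letters n. form (lw x) l * form (lw x) l) = (\<Sum>j=1..n. 2 * (l j * l j))"
    unfolding sum_letters by (rule sum.cong) (auto simp: form_unitv form_linear)
  ultimately show ?thesis
    unfolding inv s qn_def by (simp add: sum.distrib sum_distrib_left[symmetric])
qed

lemma qn_form:
  assumes "l \<in> latt"
  shows "2 * form (l + rho) (l + rho) = qn l + 8 * (int n + 2) * l 0 + 2 * (\<Sum>j=1..n. rho j * rho j)"
proof -
  have "l (n + 1) = 1" using assms by (simp add: latt_def)
  moreover have "rho (n + 1) = int n + 1" "rho 0 = 0" by (simp_all add: rho_def unitv_def)
  ultimately show ?thesis
    by (simp add: form_def qn_def sum.distrib sum_distrib_left algebra_simps)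
qed

definition pos0 :: "'v \<Rightarrow> 'v" where
  "pos0 w = (\<Sum>p\<in>up. of_int (sg (fst p) * sg (snd p)) \<odot> T (bar (fst p)) (bar (snd p)) 0 (T (fst p) (snd p) 0 w))"

text \<open>Pairs whose right factor is a positive root vector are already in order and form
  \<open>pos0\<close>; those in \<open>up\<close> are exchanged by \<open>T_opposite\<close>, which
  yields \<open>pos0\<close> again and scalars; the Cartan pairs act by squares.\<close>

lemma Y_0:
  assumes w: "w \<in> wsp l" and l: "l \<in> latt"
  shows "Y 0 w = of_int 2 \<odot> pos0 w - of_int (qn l) \<odot> w"
proof -
  let ?dn = "{(x, y). x \<in> letters n \<and> y \<in> letters n \<and> bar y < x}" and ?di = "{(x, y). x \<in> letters n \<and> y = bar x}"
  let ?g = "\<lambda>p. of_int (sg (fst p) * sg (snd p)) \<odot> T (fst p) (snd p) 0 (T (bar (fst p)) (bar (snd p)) 0 w)"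
  have lev: "l (n + 1) = 1" using l by (simp add: latt_def)
  have fin: "finite ?dn" "finite ?di"
    by (rule finite_subset[of _ "letters n \<times> letters n"]; auto)+
  have un: "letters n \<times> letters n = up \<union> (?dn \<union> ?di)"
  proof -
    have "x < bar y \<or> bar y < x \<or> y = bar x" for x y using less_linear[of x "bar y"] by auto
    then show ?thesis by (auto simp: up_def)
  qed
  have "Y 0 w = (\<Sum>p\<in>letters n \<times> letters n. ?g p)"
    by (simp add: Y_def sum.cartesian_product split_beta)
  also have "\<dots> = sum ?g up + (sum ?g ?dn + sum ?g ?di)"
  proof -
    have "up \<inter> (?dn \<union> ?di) = {}" "?dn \<inter> ?di = {}" by (auto simp: up_def)
    then show ?thesis unfolding un by (simp only: sum.union_disjoint fin finite_up finite_UnI)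
  qed
  also have "sum ?g ?dn = pos0 w"
    unfolding pos0_def
    by (rule sum.reindex_bij_witness[where i = "\<lambda>p. (bar (fst p), bar (snd p))" and j = "\<lambda>p. (bar (fst p), bar (snd p))"])
       (auto simp: up_def bar_less_iff[of _ "bar _", simplified])
  also have "sum ?g up = (\<Sum>p\<in>up. of_int (sg (fst p) * sg (snd p)) \<odot> T (bar (fst p)) (bar (snd p)) 0 (T (fst p) (snd p) 0 w) +
      of_int (- (cc (fst p) (snd p) * form l (rt (fst p, snd p, 0)))) \<odot> w)"
  proof (rule sum.cong[OF HOL.refl])
    fix p assume "p \<in> up"
    then have L: "fst p \<in> letters n" "snd p \<in> letters n" by (auto simp: up_def)
    have e: "sg (fst p) * sg (snd p) * (- (sg (fst p) * sg (snd p)) * cc (fst p) (snd p) * form l (rt (fst p, snd p, 0))) =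
        - (cc (fst p) (snd p) * form l (rt (fst p, snd p, 0)))"
      using sg_cancel[of "fst p"] sg_cancel[of "snd p"] by (simp add: mult_ac)
    have "T (fst p) (snd p) 0 (T (bar (fst p)) (bar (snd p)) 0 w) = T (bar (fst p)) (bar (snd p)) 0 (T (fst p) (snd p) 0 w) +
        of_int (- (sg (fst p) * sg (snd p)) * cc (fst p) (snd p) * form l (rt (fst p, snd p, 0))) \<odot> w"
      using T_opposite[OF w lev L, of 0] by simp
    then show "?g p = of_int (sg (fst p) * sg (snd p)) \<odot> T (bar (fst p)) (bar (snd p)) 0 (T (fst p) (snd p) 0 w) +
        of_int (- (cc (fst p) (snd p) * form l (rt (fst p, snd p, 0)))) \<odot> w"
      by (simp only: scale_right_distrib scale_scale of_int_mult[symmetric] e)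
  qed
  also have "\<dots> = pos0 w + of_int (- (\<Sum>p\<in>up. cc (fst p) (snd p) * form l (rt (fst p, snd p, 0)))) \<odot> w"
    unfolding sum.distrib pos0_def sum_negf[symmetric] of_int_sum scale_sum_left ..
  also have "sum ?g ?di = of_int (- (\<Sum>x\<in>letters n. form (lw x) l * form (lw x) l)) \<odot> w"
  proof -
    have "sum ?g ?di = (\<Sum>x\<in>letters n. ?g (x, bar x))"
      by (rule sum.reindex_bij_witness[where i = "\<lambda>x. (x, bar x)" and j = fst]) (auto simp del: of_int_mult)
    also have "\<dots> = (\<Sum>x\<in>letters n. of_int (- (form (lw x) l * form (lw x) l)) \<odot> w)"
    proof (rule sum.cong[OF HOL.refl])
      fix x assume x: "x \<in> letters n"
      then have "T x (bar x) 0 w = of_int (- sg x * form (lw x) l) \<odot> w" using wsp_letter[OF w] by blast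
      moreover have "lin (T x (bar x) 0)" using x by (simp add: T_lin)
      ultimately have "T x (bar x) 0 (T x (bar x) 0 w) = of_int (- sg x * form (lw x) l) \<odot> (of_int (- sg x * form (lw x) l) \<odot> w)"
        by (simp only: lin_scale)
      then show "?g (x, bar x) = of_int (- (form (lw x) l * form (lw x) l)) \<odot> w"
        using T_commute[of "bar x" x] sg_simps(4)[of x] by (simp add: of_int_mult[symmetric] mult_ac del: of_int_mult)
    qed
    finally show ?thesis by (simp only: sum_negf[symmetric] of_int_sum scale_sum_left)
  qed
  finally have "Y 0 w = (pos0 w + pos0 w) + (of_int (- (\<Sum>p\<in>up. cc (fst p) (snd p) * form l (rt (fst p, snd p, 0)))) \<odot> w +
      of_int (- (\<Sum>x\<in>letters n. form (lw x) l * form (lw x) l)) \<odot> w)" by (simp only: add_ac)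
  also have "\<dots> = of_int 2 \<odot> pos0 w + of_int (- qn l) \<odot> w"
  proof -
    have "- (\<Sum>p\<in>up. cc (fst p) (snd p) * form l (rt (fst p, snd p, 0))) + - (\<Sum>x\<in>letters n. form (lw x) l * form (lw x) l) = - qn l"
      using qn_roots[of l] by linarith
    then show ?thesis by (simp only: two_scale scale_left_distrib[symmetric] of_int_add[symmetric])
  qed
  finally show ?thesis by simp
qed

lemma pos0_v0: "pos0 v0 = 0"
  unfolding pos0_def
proof (intro sum.neutral ballI)
  fix p assume p: "p \<in> up"
  then have L: "fst p \<in> letters n" "snd p \<in> letters n" "0 < ht (rt (fst p, snd p, 0))"
    using ht_rt_pos_iff[of "fst p" "snd p" 0] by (auto simp: up_def)
  have "T (fst p) (snd p) 0 v0 = 0"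
  proof (rule ccontr)
    assume "T (fst p) (snd p) 0 v0 \<noteq> 0"
    moreover have "lam + rt (fst p, snd p, 0) \<in> latt" using L rt_latt lam_latt by (intro latt_add) auto
    ultimately have "ht (lam + rt (fst p, snd p, 0)) \<le> ht lam" using wsp_T[OF v0_wsp L(1,2)] wsp_ht by blast
    then show False using L(3) by (simp add: ht_linear)
  qed
  then show "of_int (sg (fst p) * sg (snd p)) \<odot> T (bar (fst p)) (bar (snd p)) 0 (T (fst p) (snd p) 0 v0) = 0"
    using L by (simp add: lin_zero[OF T_lin])
qed

text \<open>On v0 the eigenvalue is minus \<open>qn lam\<close>. Only f_0 changes the degree, and
  each use shifts the eigenvalue by -8(n+2). The bound on M covers the last degree reached, as
  \<open>Cas_comm_1\<close> requires.\<close>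

lemma Cas_word:
  "set is \<subseteq> {..n} \<Longrightarrow> - wtw lam is 0 \<le> int M \<Longrightarrow>
    Cas M (fwords v0 is) = of_int (- qn lam + 8 * (int n + 2) * wtw lam is 0) \<odot> fwords v0 is"
proof (induction "is")
  case Nil
  have l0: "lam 0 = 0" by (simp add: lam_def)
  have "Y (int m) v0 = 0" if "m \<in> {1..M}" for m
    by (rule Y_vanish[OF lam_latt v0_wsp]) (use that l0 in auto)
  then have "Cas M v0 = of_int (- qn lam + 8 * (int n + 2) * lam 0) \<odot> v0"
    using Y_0[OF v0_wsp lam_latt] l0 by (simp add: Cas_def pos0_v0)
  then show ?case by (simp only: fwords_simps wtw_simps)
next
  case (Cons i "is")
  let ?u = "fwords v0 is" and ?l = "wtw lam is"
  obtain x y m where s: "simple_index i = (x, y, m)" by (cases "simple_index i")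
  have i: "i \<le> n" "set is \<subseteq> {..n}" using Cons.prems by auto
  have L: "bar x \<in> letters n" "bar y \<in> letters n" using simple_index_letters[OF i(1) s] by auto
  have m: "m = of_bool (i = 0)" using s by (auto simp: simple_index_def split: if_splits)
  have si: "simple i 0 = m" using i n_pos m by (auto simp: simple_def delta_def unitv_def)
  have u: "?u \<in> wsp ?l" "?l \<in> latt" using fwords_wsp[OF v0_wsp i(2)] wtw_latt[OF lam_latt i(2)] by auto
  have f: "fop i ?u = T (bar x) (bar y) (- m) ?u" by (simp add: fop_def s)
  have l0: "?l 0 \<le> 0" using wtw_0[OF i(2), of lam] by (simp add: lam_def)
  have M: "- ?l 0 + m \<le> int M" using Cons.prems(2) si by (simp add: wtw_simps)
  have IH: "Cas M ?u = of_int (- qn lam + 8 * (int n + 2) * ?l 0) \<odot> ?u"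
    by (rule Cons.IH[OF i(2)]) (use M m in \<open>cases "i = 0"; simp\<close>)
  note Z = T_lin[OF L, of "- m"]
  have "Cas M (fop i ?u) = of_int (- qn lam + 8 * (int n + 2) * (?l 0 - m)) \<odot> fop i ?u"
  proof (cases "i = 0")
    case False
    then show ?thesis using Cas_comm_0[OF L, of M ?u] IH f m lin_scale[OF Z] by simp
  next
    case True
    have "T x' y' (int M) ?u = 0" if "x' \<in> letters n" "y' \<in> letters n" for x' y'
      by (rule T_vanish[OF that u(2,1)]) (use M True m in auto)
    moreover have "1 \<le> M" using M l0 True m by auto
    ultimately have "Cas M (T (bar x) (bar y) (-1) ?u) = T (bar x) (bar y) (-1) (Cas M ?u) + of_int (- 8 * (int n + 2)) \<odot> T (bar x) (bar y) (-1) ?u"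
      by (intro Cas_comm_1[OF L]) auto
    also have "\<dots> = of_int (- qn lam + 8 * (int n + 2) * ?l 0 + - 8 * (int n + 2)) \<odot> T (bar x) (bar y) (-1) ?u"
      by (simp only: IH lin_scale[OF T_lin[OF L]] scale_left_distrib[symmetric] of_int_add[symmetric])
    also have "- qn lam + 8 * (int n + 2) * ?l 0 + - 8 * (int n + 2) = - qn lam + 8 * (int n + 2) * (?l 0 - m)"
      using True m by (simp add: algebra_simps)
    finally show ?thesis using f True m by simp
  qed
  then have "Cas M (fwords v0 (i # is)) = of_int (- qn lam + 8 * (int n + 2) * wtw lam (i # is) 0) \<odot> fwords v0 (i # is)"
    using si by (simp add: wtw_simps)
  then show ?case .
qed

lemma Cas_wsp:
  assumes w: "w \<in> wsp l" and l: "l \<in> latt" and M: "- l 0 \<le> int M"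
  shows "Cas M w = of_int (- qn lam + 8 * (int n + 2) * l 0) \<odot> w"
proof -
  let ?c = "of_int (- qn lam + 8 * (int n + 2) * l 0)"
  have "w \<in> span (fwords v0 ` words_to lam l)" using w wsp_span[OF l] by simp
  then have "Cas M w - ?c \<odot> w \<in> span {0}"
  proof (rule lin_span[rotated 2])
    show "lin (\<lambda>w. Cas M w - ?c \<odot> w)"
      using Cas_lin[of M] by (simp add: lin_iff scale_right_distrib scale_right_diff_distrib mult.commute)
    fix b assume "b \<in> fwords v0 ` words_to lam l"
    then obtain "is" where "b = fwords v0 is" "set is \<subseteq> {..n}" "wtw lam is = l" by (auto simp: words_to_def)
    then have "Cas M b = ?c \<odot> b" using Cas_word[of "is" M] M by simp
    then show "Cas M b - ?c \<odot> b \<in> span {0}" by simp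
  qed
  then show ?thesis by simp
qed

text \<open>The eigenvalue is equated with the normally ordered form. \<open>qn\<close> and the
  degree term complete the squares by \<open>qn_form\<close>, and a common factor 2 is
  cancelled.\<close>

lemma Cas_roots:
  assumes w: "w \<in> wsp l" and l: "l \<in> latt" and M: "- l 0 \<le> int M"
  shows "pos0 w + (\<Sum>m=1..M. Y (int m) w) = of_int (form (l + rho) (l + rho) - form (lam + rho) (lam + rho)) \<odot> w"
proof -
  have l0: "lam 0 = 0" by (simp add: lam_def)
  have "of_int 2 \<odot> (pos0 w + (\<Sum>m=1..M. Y (int m) w)) = Cas M w + of_int (qn l) \<odot> w"
    unfolding Cas_def Y_0[OF w l] by (simp add: scale_right_distrib)
  also have "\<dots> = of_int (- qn lam + 8 * (int n + 2) * l 0 + qn l) \<odot> w"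
    unfolding Cas_wsp[OF assms] by (simp only: scale_left_distrib of_int_add)
  also have "- qn lam + 8 * (int n + 2) * l 0 + qn l = 2 * (form (l + rho) (l + rho) - form (lam + rho) (lam + rho))"
    using qn_form[OF l] qn_form[OF lam_latt] l0 by simp
  finally have "of_int 2 \<odot> (pos0 w + (\<Sum>m=1..M. Y (int m) w)) = of_int 2 \<odot> (of_int (form (l + rho) (l + rho) - form (lam + rho) (lam + rho)) \<odot> w)"
    by (simp only: scale_scale of_int_mult)
  then show ?thesis by (rule scale_left_imp_eq[rotated]) simp
qed

section \<open>Freudenthal's formula by traces\<close>

definition tr :: "letter \<Rightarrow> letter \<Rightarrow> int \<Rightarrow> wt \<Rightarrow> complex" where
  "tr x y m l = trace_on (wsp l) (\<lambda>w. of_int (sg x * sg y) \<odot> T (bar x) (bar y) (- m) (T x y m w))"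

lemma wsp_TT:
  assumes "w \<in> wsp l" "x \<in> letters n" "y \<in> letters n"
  shows "T (bar x) (bar y) (- m) (T x y m w) \<in> wsp l"
proof -
  have "T (bar x) (bar y) (- m) (T x y m w) \<in> wsp (l + rt (x, y, m) + rt (bar x, bar y, - m))"
    using assms by (intro wsp_T) auto
  moreover have "l + rt (x, y, m) + rt (bar x, bar y, - m) = l" by (simp add: rt.simps sc_linear)
  ultimately show ?thesis by simp
qed

text \<open>Cyclicity moves the trace to the weight space of l plus the root, where
  \<open>T_opposite\<close> restores the order of the factors at the cost of a scalar times the
  dimension. Iterating ends above \<open>lam\<close>, where the traces vanish.\<close>

lemma tr_step:
  assumes L: "x \<in> letters n" "y \<in> letters n" and l: "l \<in> latt"
  shows "tr x y m l = tr x y m (l + rt (x, y, m)) - of_int (cc x y * form (l + rt (x, y, m)) (rt (x, y, m)) * int (mlt (l + rt (x, y, m))))"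
proof -
  let ?a = "rt (x, y, m)" and ?s = "of_int (sg x * sg y) :: complex"
  have Lb: "bar x \<in> letters n" "bar y \<in> letters n" using L by auto
  have l': "l + ?a \<in> latt" using l rt_latt[OF L] by (intro latt_add) auto
  then have lev: "(l + ?a) (n + 1) = 1" by (simp add: latt_def)
  let ?e = "- (sg x * sg y) * cc x y * form (l + ?a) ?a"
  have e: "sg x * sg y * ?e = - (cc x y * form (l + ?a) ?a)"
    using sg_cancel[of x] sg_cancel[of y] by (simp add: mult_ac)
  have bk: "l + ?a + rt (bar x, bar y, - m) = l" by (simp add: rt.simps sc_linear)
  have "tr x y m l = trace_on (wsp l) (\<lambda>w. (\<lambda>u. ?s \<odot> T (bar x) (bar y) (- m) u) (T x y m w))" by (simp add: tr_def)
  also have "\<dots> = trace_on (wsp (l + ?a)) (\<lambda>w. T x y m (?s \<odot> T (bar x) (bar y) (- m) w))"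
  proof (rule trace_commute)
    show "lin (T x y m)" "lin (\<lambda>u. ?s \<odot> T (bar x) (bar y) (- m) u)" using T_lin[OF L] T_lin[OF Lb] by (auto intro: lin_scaled)
    show "T x y m w \<in> wsp (l + ?a)" if "w \<in> wsp l" for w using wsp_T[OF that L] by simp
    show "?s \<odot> T (bar x) (bar y) (- m) w \<in> wsp l" if "w \<in> wsp (l + ?a)" for w
      using wsp_T[OF that Lb, of "- m"] unfolding bk by (intro subspace_scale[OF wsp_subspace])
  qed (use wsp_fin_dim l l' in auto)
  also have "\<dots> = trace_on (wsp (l + ?a)) (\<lambda>w. ?s \<odot> T (bar x) (bar y) (- m) (T x y m w) + of_int (- (cc x y * form (l + ?a) ?a)) \<odot> w)"
  proof (rule trace_cong)
    fix w assume w: "w \<in> wsp (l + ?a)"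
    show "T x y m (?s \<odot> T (bar x) (bar y) (- m) w) = ?s \<odot> T (bar x) (bar y) (- m) (T x y m w) + of_int (- (cc x y * form (l + ?a) ?a)) \<odot> w"
      unfolding lin_scale[OF T_lin[OF L]] T_opposite[OF w lev L] by (simp only: scale_right_distrib scale_scale of_int_mult[symmetric] e)
  qed
  also have "\<dots> = tr x y m (l + ?a) + of_int (- (cc x y * form (l + ?a) ?a)) * of_nat (mlt (l + ?a))"
    unfolding tr_def mlt_def trace_scale[symmetric]
    by (rule trace_add) (use wsp_TT[OF _ L] wsp_subspace in \<open>auto simp: subspace_scale subspace_neg\<close>)
  finally show ?thesis by simp
qed

lemma mlt_ht: "l \<in> latt \<Longrightarrow> mlt l \<noteq> 0 \<Longrightarrow> ht l \<le> ht lam"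
  using mlt_nonzero wsp_ht by blast

lemma tr_vanish: "l \<in> latt \<Longrightarrow> ht lam < ht l \<Longrightarrow> tr x y m l = 0"
proof -
  assume l: "l \<in> latt" "ht lam < ht l"
  then have "mlt l = 0" using mlt_ht by force
  then have "basis_of (wsp l) = {}" using basis_of(4)[of "wsp l"] finite_basis_of[OF wsp_fin_dim] l by (simp add: mlt_def)
  then show ?thesis by (simp add: tr_def trace_on_def)
qed

lemma tr_iter:
  assumes L: "x \<in> letters n" "y \<in> letters n" and l: "l \<in> latt"
  shows "tr x y m l = tr x y m (l + sc (int K) (rt (x, y, m))) -
    of_int (cc x y * (\<Sum>k=1..K. form (l + sc (int k) (rt (x, y, m))) (rt (x, y, m)) * int (mlt (l + sc (int k) (rt (x, y, m))))))"
proof (induction K)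
  case 0
  have "l + sc (int 0) (rt (x, y, m)) = l" by simp
  then show ?case by simp
next
  case (Suc K)
  let ?a = "rt (x, y, m)"
  have l': "l + sc (int K) ?a \<in> latt" using l rt_latt[OF L] by (intro latt_add) auto
  have e: "l + sc (int K) ?a + ?a = l + sc (int (Suc K)) ?a"
    by (simp add: sc_linear add_ac)
  have IH: "tr x y m l = tr x y m (l + sc (int K) ?a) - of_int (cc x y * (\<Sum>k=1..K. form (l + sc (int k) ?a) ?a * int (mlt (l + sc (int k) ?a))))"
    by (rule Suc.IH)
  have "tr x y m l = tr x y m (l + sc (int (Suc K)) ?a) - of_int (cc x y * (\<Sum>k=1..Suc K. form (l + sc (int k) ?a) ?a * int (mlt (l + sc (int k) ?a))))"
    unfolding IH tr_step[OF L l', of m] e by (simp add: distrib_left mult.assoc)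
  then show ?case .
qed

lemma tr_sum:
  assumes L: "x \<in> letters n" "y \<in> letters n" and l: "l \<in> latt" and a: "0 < ht (rt (x, y, m))" and K: "ht lam - ht l < int K"
  shows "tr x y m l = of_int (- (cc x y * (\<Sum>k=1..K. form (l + sc (int k) (rt (x, y, m))) (rt (x, y, m)) * int (mlt (l + sc (int k) (rt (x, y, m)))))))"
proof -
  let ?a = "rt (x, y, m)"
  have l': "l + sc (int K) ?a \<in> latt" using l rt_latt[OF L] by (intro latt_add) auto
  have "int K * 1 \<le> int K * ht ?a" using a by (intro mult_left_mono) auto
  then have "ht lam < ht (l + sc (int K) ?a)" using K by (simp add: ht_linear)
  then show ?thesis using tr_iter[OF L l, of m K] tr_vanish[OF l'] by simp
qed

lemma Y_bar: "Y m w = (\<Sum>x\<in>letters n. \<Sum>y\<in>letters n. of_int (sg x * sg y) \<odot> T (bar x) (bar y) (- m) (T x y m w))"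
  using sum_bar[of "\<lambda>x. \<Sum>y\<in>letters n. of_int (sg x * sg (bar y)) \<odot> T x (bar y) (- m) (T (bar x) y m w)"]
    sum_bar[of "\<lambda>y. of_int (sg _ * sg y) \<odot> T _ y (- m) (T (bar _) (bar y) m w)"]
  by (simp add: Y_def)

text \<open>Take the trace of \<open>Cas_roots\<close> on the weight space and evaluate the trace of
  each root along its string by \<open>tr_sum\<close>. The rest reindexes degrees and ordered pairs
  of letters by the positive root vectors.\<close>

lemma freudenthal:
  assumes l: "l \<in> latt" and N: "ht lam - ht l \<le> N"
  shows "(form (lam + rho) (lam + rho) - form (l + rho) (l + rho)) * int (mlt l) =
    2 * (\<Sum>p\<in>PK N. form (l + sc (int (snd p)) (rt (fst p))) (rt (fst p)) * int (mlt (l + sc (int (snd p)) (rt (fst p)))))"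
proof -
  \<comment> \<open>The largest degree by which a vector of weight l can still be raised.\<close>
  define M where "M = nat (- l 0)"
  define K where "K = nat (N + 1)"
  let ?h = "\<lambda>a k. form (l + sc (int k) (rt a)) (rt a) * int (mlt (l + sc (int k) (rt a)))"
  define B where "B = {a \<in> PR. snd (snd a) \<le> int M}"
  have K: "ht lam - ht l < int K" using N by (simp add: K_def)
  have t1: "trace_on (wsp l) pos0 = (\<Sum>p\<in>up. tr (fst p) (snd p) 0 l)"
    unfolding pos0_def tr_def
  proof (subst trace_sum[OF wsp_subspace])
    fix p w assume "p \<in> up" "w \<in> wsp l"
    then show "of_int (sg (fst p) * sg (snd p)) \<odot> T (bar (fst p)) (bar (snd p)) 0 (T (fst p) (snd p) 0 w) \<in> wsp l"
      using wsp_TT[of w l "fst p" "snd p" 0] wsp_subspace by (auto simp: up_def subspace_scale)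
  qed simp
  have Yw: "Y m w \<in> wsp l" if "w \<in> wsp l" for m w
    unfolding Y_bar using that wsp_TT by (intro subspace_sum[OF wsp_subspace] subspace_scale[OF wsp_subspace]) auto
  have t2: "trace_on (wsp l) (Y m) = (\<Sum>x\<in>letters n. \<Sum>y\<in>letters n. tr x y m l)" for m
  proof -
    have "trace_on (wsp l) (Y m) = trace_on (wsp l) (\<lambda>w. \<Sum>x\<in>letters n. \<Sum>y\<in>letters n. of_int (sg x * sg y) \<odot> T (bar x) (bar y) (- m) (T x y m w))"
      by (rule trace_cong) (simp add: Y_bar)
    also have "\<dots> = (\<Sum>x\<in>letters n. trace_on (wsp l) (\<lambda>w. \<Sum>y\<in>letters n. of_int (sg x * sg y) \<odot> T (bar x) (bar y) (- m) (T x y m w)))"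
      by (rule trace_sum[OF wsp_subspace])
         (use wsp_TT in \<open>auto intro!: subspace_sum[OF wsp_subspace] subspace_scale[OF wsp_subspace]\<close>)
    also have "\<dots> = (\<Sum>x\<in>letters n. \<Sum>y\<in>letters n. tr x y m l)"
      unfolding tr_def
      by (intro sum.cong[OF HOL.refl] trace_sum[OF wsp_subspace])
         (use wsp_TT in \<open>auto intro!: subspace_scale[OF wsp_subspace]\<close>)
    finally show ?thesis .
  qed
  have pw: "pos0 w \<in> wsp l" if "w \<in> wsp l" for w
  proof -
    have "T (bar (fst p)) (bar (snd p)) 0 (T (fst p) (snd p) 0 w) \<in> wsp l" if "p \<in> up" for p
      using wsp_TT[of w l "fst p" "snd p" 0] \<open>w \<in> wsp l\<close> that by (auto simp: up_def)
    then show ?thesis unfolding pos0_def by (intro subspace_sum[OF wsp_subspace] subspace_scale[OF wsp_subspace]) auto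
  qed
  have finOP: "finite {(x, y). x \<in> letters n \<and> y \<in> letters n \<and> x \<le> y}"
    by (rule finite_subset[of _ "letters n \<times> letters n"]) auto
  let ?G = "\<lambda>x y m. if 0 < ht (rt (x, y, m)) then tr x y m l else 0"
  have "of_int (form (l + rho) (l + rho) - form (lam + rho) (lam + rho)) * of_nat (mlt l) =
      trace_on (wsp l) (\<lambda>w. of_int (form (l + rho) (l + rho) - form (lam + rho) (lam + rho)) \<odot> w)"
    by (simp add: trace_scale mlt_def)
  also have "\<dots> = trace_on (wsp l) (\<lambda>w. pos0 w + (\<Sum>m=1..M. Y (int m) w))"
    by (rule trace_cong) (use Cas_roots[OF _ l, of _ M] in \<open>simp add: M_def\<close>)
  also have "\<dots> = (\<Sum>p\<in>up. tr (fst p) (snd p) 0 l) + (\<Sum>m=1..M. \<Sum>x\<in>letters n. \<Sum>y\<in>letters n. tr x y (int m) l)"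
  proof -
    have "(\<Sum>m=1..M. Y (int m) w) \<in> wsp l" if "w \<in> wsp l" for w by (intro subspace_sum[OF wsp_subspace] Yw that)
    moreover have "trace_on (wsp l) (\<lambda>w. \<Sum>m=1..M. Y (int m) w) = (\<Sum>m=1..M. trace_on (wsp l) (Y (int m)))"
      by (rule trace_sum[OF wsp_subspace]) (rule Yw)
    ultimately show ?thesis using pw by (simp add: trace_add t1 t2)
  qed
  also have "(\<Sum>p\<in>up. tr (fst p) (snd p) 0 l) = (\<Sum>x\<in>letters n. \<Sum>y\<in>letters n. ?G x y 0)"
  proof -
    have "(\<Sum>p\<in>up. tr (fst p) (snd p) 0 l) = (\<Sum>p\<in>letters n \<times> letters n. ?G (fst p) (snd p) 0)"
      by (rule sum.mono_neutral_cong_left) (auto simp: up_def ht_rt_pos_iff)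
    then show ?thesis by (simp add: sum.cartesian_product split_beta)
  qed
  also have "(\<Sum>m=1..M. \<Sum>x\<in>letters n. \<Sum>y\<in>letters n. tr x y (int m) l) = (\<Sum>m=1..M. \<Sum>x\<in>letters n. \<Sum>y\<in>letters n. ?G x y (int m))"
    by (intro sum.cong) (auto simp: ht_rt_pos_iff)
  also have "(\<Sum>x\<in>letters n. \<Sum>y\<in>letters n. ?G x y 0) + (\<Sum>m=1..M. \<Sum>x\<in>letters n. \<Sum>y\<in>letters n. ?G x y (int m)) =
      (\<Sum>m=0..M. \<Sum>x\<in>letters n. \<Sum>y\<in>letters n. ?G x y (int m))"
    by (simp add: sum.atLeast_Suc_atMost cong: if_cong)
  also have "\<dots> = (\<Sum>m=0..M. \<Sum>(x, y)\<in>{(x, y). x \<in> letters n \<and> y \<in> letters n \<and> x \<le> y}. (if x = y then 1 else 2) * ?G x y (int m))"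
  proof (intro sum.cong[OF HOL.refl] sum_ordered_pairs)
    fix m x y
    show "?G x y (int m) = ?G y x (int m)"
      by (simp add: tr_def ht_rt add.commute mult.commute T_commute[of "bar y" "bar x"] T_commute[of y x])
  qed simp
  also have "\<dots> = (\<Sum>q\<in>{0..M} \<times> {(x, y). x \<in> letters n \<and> y \<in> letters n \<and> x \<le> y}. (if fst (snd q) = snd (snd q) then 1 else 2) * ?G (fst (snd q)) (snd (snd q)) (int (fst q)))"
    by (simp add: sum.cartesian_product split_beta)
  also have "\<dots> = (\<Sum>q\<in>{q \<in> {0..M} \<times> {(x, y). x \<in> letters n \<and> y \<in> letters n \<and> x \<le> y}. 0 < ht (rt (fst (snd q), snd (snd q), int (fst q)))}. (if fst (snd q) = snd (snd q) then 1 else 2) * tr (fst (snd q)) (snd (snd q)) (int (fst q)) l)"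
    by (rule sum.mono_neutral_cong_right) (use finOP in auto)
  also have "\<dots> = (\<Sum>a\<in>B. (if fst a = fst (snd a) then 1 else 2) * tr (fst a) (fst (snd a)) (snd (snd a)) l)"
    by (rule sum.reindex_bij_witness[where j = "\<lambda>q. (fst (snd q), snd (snd q), int (fst q))" and i = "\<lambda>a. (nat (snd (snd a)), fst a, fst (snd a))"])
       (auto simp: B_def PR_iff ht_rt_pos_iff)
  also have "\<dots> = (\<Sum>a\<in>B. of_int (- 2 * (\<Sum>k=1..K. ?h a k)))"
  proof (rule sum.cong[OF HOL.refl])
    fix a assume "a \<in> B"
    then have a: "fst a \<in> letters n" "fst (snd a) \<in> letters n" "0 < ht (rt (fst a, fst (snd a), snd (snd a)))" by (auto simp: B_def PR_def)
    \<comment> \<open>The multiplicity 1 or 2 of the ordered pairs times \<open>cc\<close> is 2 in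
      all cases.\<close>
    show "(if fst a = fst (snd a) then 1 else 2) * tr (fst a) (fst (snd a)) (snd (snd a)) l = of_int (- 2 * (\<Sum>k=1..K. ?h a k))"
      unfolding tr_sum[OF a(1,2) l a(3) K] by (simp add: cc_def)
  qed
  also have "\<dots> = of_int (- 2 * (\<Sum>p\<in>B \<times> {1..K}. ?h (fst p) (snd p)))"
    by (simp add: sum.cartesian_product split_beta sum_distrib_left sum_negf)
  \<comment> \<open>The two index sets differ only where the multiplicity is 0: a nonzero
    multiplicity bounds both the degree and the height.\<close>
  also have "(\<Sum>p\<in>B \<times> {1..K}. ?h (fst p) (snd p)) = (\<Sum>p\<in>PK N. ?h (fst p) (snd p))"
  proof (rule sum.mono_neutral_cong)
    have "B \<subseteq> letters n \<times> letters n \<times> {0..int M}" by (auto simp: B_def PR_iff)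
    then have "finite B" by (rule finite_subset) simp
    then show "finite (B \<times> {1..K})" by simp
    show "finite (PK N)" by (rule finite_PK)
    have key: "p \<in> B \<times> {1..K} \<and> p \<in> PK N" if p: "fst p \<in> PR" "1 \<le> snd p" and ne: "?h (fst p) (snd p) \<noteq> 0" for p
    proof -
      obtain x y m k where pp: "p = ((x, y, m), k)" by (metis prod.collapse)
      have L: "x \<in> letters n" "y \<in> letters n" "0 \<le> m" using p pp by (auto simp: PR_iff)
      have l': "l + sc (int k) (rt (x, y, m)) \<in> latt" using l rt_latt[OF L(1,2)] by (intro latt_add) auto
      have ml: "mlt (l + sc (int k) (rt (x, y, m))) \<noteq> 0" using ne pp by auto
      have h: "ht l + int k * ht (rt (x, y, m)) \<le> ht lam" using mlt_ht[OF l' ml] by (simp add: ht_linear)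
      obtain v where "v \<in> wsp (l + sc (int k) (rt (x, y, m)))" "v \<noteq> 0" using mlt_nonzero[OF ml] by blast
      then have "l 0 + int k * m \<le> 0" using wsp_0[OF l'] L by (simp add: rt.simps lw_outside delta_def)
      moreover have "1 * m \<le> int k * m" using p pp L by (intro mult_right_mono) auto
      ultimately have mM: "m \<le> int M" by (simp add: M_def)
      have "int k * 1 \<le> int k * ht (rt (x, y, m))" using p pp PR_ht_pos[of "(x, y, m)"] by (intro mult_left_mono) auto
      then have "int k \<le> N" using h N by linarith
      then show ?thesis using p pp h N mM by (simp add: B_def PK_def K_def)
    qed
    show "?h (fst p) (snd p) = 0" if "p \<in> PK N - B \<times> {1..K}" for p
      using key[of p] that by (cases p) (auto simp: PK_def)
    show "?h (fst p) (snd p) = 0" if "p \<in> B \<times> {1..K} - PK N" for p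
      using key[of p] that by (cases p) (auto simp: B_def)
  qed simp
  finally have "of_int (form (l + rho) (l + rho) - form (lam + rho) (lam + rho)) * of_nat (mlt l) = (of_int (- 2 * (\<Sum>p\<in>PK N. ?h (fst p) (snd p))) :: complex)" .
  then have "of_int ((form (l + rho) (l + rho) - form (lam + rho) (lam + rho)) * int (mlt l)) = (of_int (- 2 * (\<Sum>p\<in>PK N. ?h (fst p) (snd p))) :: complex)"
    by (simp only: of_int_mult of_int_of_nat_eq)
  then have "(form (l + rho) (l + rho) - form (lam + rho) (lam + rho)) * int (mlt l) = - 2 * (\<Sum>p\<in>PK N. ?h (fst p) (snd p))"
    by (simp only: of_int_eq_iff)
  then show ?thesis by (simp add: algebra_simps)
qed

end

section \<open>Multiplicities and paths\<close>

text \<open>Positivity on the simple roots propagates, because each step of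
  \<open>positive_generation\<close> adds two roots.\<close>

lemma (in type_C) form_rt_pos:
  assumes dom: "\<And>i. i \<le> n \<Longrightarrow> 0 < cp i w" and a: "a \<in> PR"
  shows "0 < form w (rt a)"
proof -
  obtain x y m where aa: "a = (x, y, m)" by (cases a)
  have "0 < form w (rt (x, y, m))"
  proof (rule positive_generation[of "\<lambda>x y m. 0 < form w (rt (x, y, m))"])
    fix x y m assume "0 < form w (rt (x, y, m))"
    then show "0 < form w (rt (y, x, m))" by (simp add: rt.simps add.commute)
  next
    fix i x y m assume "i \<le> n" "simple_index i = (x, y, m)"
    then have "form w (rt (x, y, m)) = half_norm i * cp i w" "0 < cp i w"
      using rt_simple_index[of i] form_simple'[of i w] dom by auto
    then show "0 < form w (rt (x, y, m))" by (simp add: half_norm_def)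
  next
    fix x y z m k assume "0 < form w (rt (x, y, m))" "0 < form w (rt (bar y, z, k))"
    moreover have "rt (x, z, m + k) = rt (x, y, m) + rt (bar y, z, k)" by (simp add: rt.simps sc_linear)
    ultimately show "0 < form w (rt (x, z, m + k))" by (simp add: form_linear)
  qed (use a aa in \<open>auto simp: PR_def\<close>)
  then show ?thesis using aa by simp
qed

lemma (in type_C) finite_S: "finite {u. S u \<noteq> 0 \<and> b \<le> ht u}"
proof (rule finite_subset)
  let ?P = "{a \<in> PR. ht (rt a) \<le> ht rho - b}"
  show "{u. S u \<noteq> 0 \<and> b \<le> ht u} \<subseteq> (\<lambda>A. rho - sum rt A) ` Pow ?P"
  proof clarify
    fix u assume u: "S u \<noteq> 0" "b \<le> ht u"
    then obtain A where A: "finite A" "A \<subseteq> PR" "rho - u = sum rt A" using S_support by blast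
    then have "A \<in> subsets_to (rho - u)" by (simp add: subsets_to_def)
    then have "A \<subseteq> ?P" using subsets_to_bound[of A "rho - u"] u by (force simp: ht_linear)
    moreover have "u = rho - sum rt A" unfolding A(3)[symmetric] by simp
    ultimately show "u \<in> (\<lambda>A. rho - sum rt A) ` Pow ?P" by blast
  qed
  show "finite ((\<lambda>A. rho - sum rt A) ` Pow ?P)" using finite_PR_le by simp
qed

context affine_ops
begin

definition mm :: "wt \<Rightarrow> int" where
  "mm l = (if l \<in> latt then int (mlt l) else 0)"

definition yy :: "wt \<Rightarrow> int" where
  "yy l = int (card {w. cpath w \<and> pwt w = l})"

text \<open>The coefficient of e^v in the product of the denominator with the series f.\<close>

definition conv :: "(wt \<Rightarrow> int) \<Rightarrow> wt \<Rightarrow> int" where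
  "conv f v = (\<Sum>u | S u \<noteq> 0 \<and> f (v - u) \<noteq> 0. S u * f (v - u))"

lemma mm_ht: "mm l \<noteq> 0 \<Longrightarrow> ht l \<le> ht lam"
  using mlt_ht by (auto simp: mm_def split: if_splits)

lemma finite_paths_to: "finite {w. cpath w \<and> pwt w = l}"
  by (rule finite_subset[OF _ finite_paths[of "ht l"]]) auto

lemma yy_nonzero: "yy l \<noteq> 0 \<longleftrightarrow> (\<exists>w. cpath w \<and> pwt w = l)"
  using finite_paths_to[of l] by (auto simp: yy_def)

lemma yy_ht: "yy l \<noteq> 0 \<Longrightarrow> ht l \<le> ht lam"
  using ht_pwt yy_nonzero[of l] by fastforce

lemma cw_level: "snd a \<in> crystal n \<Longrightarrow> n < j \<Longrightarrow> cw a j = 0"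
  by (cases "snd a") (auto simp: cw_def crystal_def lw_outside delta_def)

lemma pwt_latt: "cpath w \<Longrightarrow> pwt w \<in> latt"
proof (induction w)
  case Nil
  then show ?case using lam_latt by simp
next
  case (Cons a w)
  have "pwt (a # w) \<in> latt" using Cons cw_level[of a] latt_add[of "pwt w" "cw a"] by simp
  then show ?case .
qed

lemma conv_eq:
  assumes "finite F" "{u. S u \<noteq> 0 \<and> f (v - u) \<noteq> 0} \<subseteq> F"
  shows "conv f v = (\<Sum>u\<in>F. S u * f (v - u))"
  unfolding conv_def by (rule sum.mono_neutral_left) (use assms in auto)

lemma conv_F:
  assumes "\<And>l. f l \<noteq> 0 \<Longrightarrow> ht l \<le> ht lam"
  shows "conv f v = (\<Sum>u\<in>{u. S u \<noteq> 0 \<and> ht v - ht lam \<le> ht u}. S u * f (v - u))"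
proof (rule conv_eq[OF finite_S])
  show "{u. S u \<noteq> 0 \<and> f (v - u) \<noteq> 0} \<subseteq> {u. S u \<noteq> 0 \<and> ht v - ht lam \<le> ht u}"
    using assms by (force simp: ht_linear)
qed

lemma freudenthal_mm:
  assumes N: "ht lam - ht l \<le> N"
  shows "(form (lam + rho) (lam + rho) - form (l + rho) (l + rho)) * mm l =
    2 * (\<Sum>p\<in>PK N. form (l + pkw p) (rt (fst p)) * mm (l + pkw p))"
proof -
  have out: "pkw p j = 0" if "p \<in> PK N" "n < j" for p j
    using that rt_outside by (cases p) (auto simp: PK_def pkw_def)
  show ?thesis
  proof (cases "l \<in> latt")
    case True
    then have "l + pkw p \<in> latt" if "p \<in> PK N" for p using out[OF that] by (intro latt_add) auto
    then show ?thesis using freudenthal[OF True N] True by (simp add: mm_def pkw_def cong: sum.cong)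
  next
    case False
    have "l + pkw p \<notin> latt" if "p \<in> PK N" for p
    proof
      assume "l + pkw p \<in> latt"
      then have "l + pkw p - pkw p \<in> latt" using out[OF that] by (intro latt_diff) auto
      then show False using False by simp
    qed
    then show ?thesis using False by (simp add: mm_def)
  qed
qed

lemma sum_shift:
  fixes f :: "wt \<Rightarrow> int"
  assumes fin: "finite G" and supp: "\<And>u. f u \<noteq> 0 \<Longrightarrow> u \<in> F" and F: "F \<subseteq> G" "(\<lambda>u. u - b) ` F \<subseteq> G"
  shows "(\<Sum>u\<in>G. f (u + b)) = (\<Sum>u\<in>G. f u)"
proof -
  have "(\<Sum>u\<in>G. f (u + b)) = (\<Sum>u\<in>(\<lambda>u. u + b) ` G. f u)" by (simp add: sum.reindex inj_on_def)
  also have "\<dots> = (\<Sum>u\<in>F. f u)"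
  proof (rule sum.mono_neutral_right)
    show "F \<subseteq> (\<lambda>u. u + b) ` G"
    proof
      fix u assume "u \<in> F"
      then have "u - b \<in> G" "u = u - b + b" using F by auto
      then show "u \<in> (\<lambda>u. u + b) ` G" by blast
    qed
  qed (use fin supp in auto)
  also have "\<dots> = (\<Sum>u\<in>G. f u)"
    by (rule sum.mono_neutral_left) (use fin supp F in auto)
  finally show ?thesis .
qed

text \<open>For v = u + l with u in the support of S, |u|^2 = |\<rho>|^2 gives |v|^2 = |l +
  \<rho>|^2 + 2(l, u - \<rho>). \<open>freudenthal_mm\<close> turns the first part into a sum over
  roots, and \<open>S_log_form\<close> turns the second into the same sum with u shifted by ka;
  after summation over u the two cancel.\<close>

lemma conv_mm_norm: "(form (lam + rho) (lam + rho) - form v v) * conv mm v = 0"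
proof -
  define A where "A = form (lam + rho) (lam + rho)"
  define N where "N = ht lam + ht rho - ht v"
  define F where "F = {u. S u \<noteq> 0 \<and> ht v - ht lam \<le> ht u}"
  \<comment> \<open>\<open>G\<close> holds the supports of all \<open>f p\<close> together with
    their translates, so that shifting the summation variable loses nothing.\<close>
  define G where "G = F \<union> (\<Union>p\<in>PK N. (\<lambda>u. u - pkw p) ` F)"
  define f where "f p u = S u * (form (v - u + pkw p) (rt (fst p)) * mm (v - u + pkw p))" for p u
  have finF: "finite F" unfolding F_def by (rule finite_S)
  have finG: "finite G" using finF by (simp add: G_def finite_PK)
  have e: "(A - form v v) * (S u * mm (v - u)) = (\<Sum>p\<in>PK N. 2 * f p u - 2 * f p (u + pkw p))" for u
  proof -
    define l where "l = v - u"
    have a: "S u * ((A - form (l + rho) (l + rho)) * mm l) = (\<Sum>p\<in>PK N. 2 * f p u)"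
    proof (cases "S u = 0")
      case False
      then have "ht lam - ht l \<le> N" using S_bound[of u] by (simp add: N_def l_def ht_linear)
      from freudenthal_mm[OF this] show ?thesis
        by (simp only: A_def f_def l_def sum_distrib_left mult_ac)
    qed (simp add: f_def)
    have b: "mm l * (form l (u - rho) * S u) = (\<Sum>p\<in>PK N. f p (u + pkw p))"
    proof (cases "mm l = 0")
      case True
      have "v - (u + pkw p) + pkw p = l" for p by (simp add: l_def)
      then show ?thesis using True by (simp add: f_def)
    next
      case False
      then have "ht (rho - u) \<le> N" using mm_ht[of l] by (simp add: N_def l_def ht_linear)
      from S_log_form[OF this, of l] have "form l (u - rho) * S u = (\<Sum>p\<in>PK N. form l (rt (fst p)) * S (u + pkw p))"
        by (simp add: split_beta pkw_def)
      moreover have "v - (u + pkw p) + pkw p = l" for p by (simp add: l_def)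
      ultimately show ?thesis by (simp add: f_def sum_distrib_left mult_ac)
    qed
    have "(A - form v v) * (S u * mm l) = S u * ((A - form (l + rho) (l + rho)) * mm l) - 2 * (mm l * (form l (u - rho) * S u))"
    proof (cases "S u = 0")
      case False
      have "v = u + l" by (simp add: l_def)
      then have "form v v = form (l + rho) (l + rho) + 2 * form l (u - rho)"
        using S_norm[OF False] form_commute[of u l] form_commute[of rho l] by (simp add: form_linear)
      then show ?thesis by (simp add: algebra_simps)
    qed simp
    then show ?thesis unfolding a b by (simp add: l_def sum_subtractf sum_distrib_left)
  qed
  have sub: "{u. S u \<noteq> 0 \<and> mm (v - u) \<noteq> 0} \<subseteq> G" using mm_ht by (force simp: G_def F_def ht_linear)
  have z: "(\<Sum>u\<in>G. 2 * f p u - 2 * f p (u + pkw p)) = 0" if p: "p \<in> PK N" for p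
  proof -
    have "(\<Sum>u\<in>G. f p (u + pkw p)) = (\<Sum>u\<in>G. f p u)"
    proof (rule sum_shift[OF finG])
      fix u assume "f p u \<noteq> 0"
      then have "S u \<noteq> 0" "mm (v - u + pkw p) \<noteq> 0" by (auto simp: f_def)
      then show "u \<in> F" using mm_ht[of "v - u + pkw p"] PK_ht_pos[OF p] by (simp add: F_def ht_linear)
    qed (use p in \<open>auto simp: G_def\<close>)
    then show ?thesis by (simp add: sum_subtractf sum_distrib_left[symmetric])
  qed
  have "(A - form v v) * conv mm v = (\<Sum>u\<in>G. (A - form v v) * (S u * mm (v - u)))"
    unfolding conv_eq[OF finG sub] sum_distrib_left ..
  also have "\<dots> = (\<Sum>u\<in>G. \<Sum>p\<in>PK N. 2 * f p u - 2 * f p (u + pkw p))" unfolding e ..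
  also have "\<dots> = (\<Sum>p\<in>PK N. \<Sum>u\<in>G. 2 * f p u - 2 * f p (u + pkw p))" by (rule sum.swap)
  also have "\<dots> = 0" using z by simp
  finally show ?thesis unfolding A_def .
qed

lemma conv_nonzero: "conv f v \<noteq> 0 \<Longrightarrow> \<exists>u. S u \<noteq> 0 \<and> f (v - u) \<noteq> 0"
proof (rule ccontr)
  assume "conv f v \<noteq> 0" "\<not> (\<exists>u. S u \<noteq> 0 \<and> f (v - u) \<noteq> 0)"
  then have "{u. S u \<noteq> 0 \<and> f (v - u) \<noteq> 0} = {}" by blast
  then show False using \<open>conv f v \<noteq> 0\<close> unfolding conv_def by (metis sum.empty)
qed

lemma form_words:
  assumes dom: "\<And>i. i \<le> n \<Longrightarrow> 0 < cp i w"
  shows "set ws \<subseteq> {..n} \<Longrightarrow> form w (wtw lam ws) \<le> form w lam \<and> (ws \<noteq> [] \<longrightarrow> form w (wtw lam ws) < form w lam)"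
proof (induction ws)
  case Nil
  have "form w (wtw lam []) = form w lam" by (simp add: wtw_simps)
  then show ?case by simp
next
  case (Cons i ws)
  have "form w (wtw lam (i # ws)) = form w (wtw lam ws) - form w (simple i)" by (simp add: wtw_simps form_linear)
  moreover have "0 < form w (simple i)" using Cons.prems dom[of i] by (simp add: form_simple' half_norm_def)
  moreover have "form w (wtw lam ws) \<le> form w lam" using Cons by simp
  ultimately have "form w (wtw lam (i # ws)) < form w lam" by linarith
  then show ?case by simp
qed

text \<open>\<open>conv_mm_norm\<close> gives (\<open>lam + rho + v\<close>,
  \<open>lam + rho - v\<close>) = 0. The second argument is a sum of simple roots from a weight of
  the module and of positive roots from S, and the first is strictly dominant, so both sums are
  empty.\<close>

lemma conv_mm_dominant:
  assumes dom: "\<And>i. i \<le> n \<Longrightarrow> 0 < cp i v"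
  shows "conv mm v = of_bool (v = lam + rho)"
proof (cases "v = lam + rho")
  case True
  have "{u. S u \<noteq> 0 \<and> mm (v - u) \<noteq> 0} = {rho}"
  proof (intro equalityI subsetI)
    fix u assume "u \<in> {u. S u \<noteq> 0 \<and> mm (v - u) \<noteq> 0}"
    then have u: "S u \<noteq> 0" "ht (v - u) \<le> ht lam" using mm_ht by auto
    then have "ht u = ht rho" using S_bound[OF u(1)] True by (simp add: ht_linear)
    then show "u \<in> {rho}" using S_top[of u] u(1) by (auto split: if_splits)
  qed (use True lam_latt mlt_lam S_rho in \<open>auto simp: mm_def\<close>)
  then show ?thesis using True S_rho lam_latt mlt_lam by (simp add: conv_def mm_def)
next
  case False
  have "conv mm v = 0"
  proof (rule ccontr)
    assume ne: "conv mm v \<noteq> 0"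
    then obtain u where u: "S u \<noteq> 0" "mm (v - u) \<noteq> 0" using conv_nonzero by blast
    have "form v v = form (lam + rho) (lam + rho)" using conv_mm_norm[of v] ne by simp
    then have z: "form (lam + rho + v) (lam + rho - v) = 0"
      using form_commute[of v "lam + rho"] by (simp add: form_linear)
    have dom': "0 < cp i (lam + rho + v)" if "i \<le> n" for i
      using dom[OF that] cp_rho[OF that] cp_lam[OF that] unfolding cp_linear by (cases "i = i0") auto
    let ?w = "lam + rho + v"
    obtain ws where ws: "set ws \<subseteq> {..n}" "wtw lam ws = v - u"
      using u(2) mlt_nonzero[of "v - u"] wsp_nonzero by (fastforce simp: mm_def split: if_splits)
    obtain A where A: "finite A" "A \<subseteq> PR" "rho - u = sum rt A" using S_support u(1) by blast
    have fA: "form ?w (rho - u) = (\<Sum>a\<in>A. form ?w (rt a))" unfolding A(3) by (rule form_sum)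
    have pA: "0 < form ?w (rt a)" if "a \<in> A" for a using form_rt_pos[OF dom'] A(2) that by blast
    have q: "A \<noteq> {} \<Longrightarrow> 0 < form ?w (rho - u)" unfolding fA by (rule sum_pos[OF A(1) _ pA])
    then have q0: "0 \<le> form ?w (rho - u)" using fA by (cases "A = {}") auto
    have "lam + rho - v = lam - wtw lam ws + (rho - u)" unfolding ws(2) by simp
    then have s: "form ?w lam - form ?w (wtw lam ws) + form ?w (rho - u) = 0" using z by (simp only: form_linear)
    have "ws = []" using form_words[OF dom' ws(1)] q0 s by fastforce
    moreover have "A = {}" using form_words[OF dom' ws(1)] q s by fastforce
    ultimately have "v - u = lam" "rho - u = 0" using ws(2) A(3) by (auto simp: wtw_simps)
    then have "v = lam + rho" by (metis add.commute diff_add_cancel eq_iff_diff_eq_0)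
    then show False using False by simp
  qed
  then show ?thesis using False by simp
qed

lemma mm_srefl: "i \<le> n \<Longrightarrow> mm (srefl i l) = mm l"
  using mlt_srefl srefl_latt[of i l] srefl_latt[of i "srefl i l"] srefl_srefl by (auto simp: mm_def)

lemma conv_mm_srefl:
  assumes i: "i \<le> n"
  shows "conv mm (srefl i v) = - conv mm v"
proof -
  have m: "mm (srefl i v - u) = mm (v - srefl i u)" for u
    using mm_srefl[OF i, of "v - srefl i u"] srefl_srefl[OF i] by (simp add: srefl_linear)
  have "conv mm (srefl i v) = (\<Sum>u | S u \<noteq> 0 \<and> mm (v - u) \<noteq> 0. - (S u * mm (v - u)))"
    unfolding conv_def
    by (rule sum.reindex_bij_witness[where i = "srefl i" and j = "srefl i"])
       (auto simp: m srefl_srefl[OF i] S_srefl[OF i])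
  then show ?thesis by (simp add: conv_def sum_negf)
qed

lemma conv_yy: "conv yy v = SY v"
proof -
  let ?W = "{w. cpath w \<and> S (v - pwt w) \<noteq> 0}"
  have "SY v = (\<Sum>u\<in>(\<lambda>w. v - pwt w) ` ?W. \<Sum>w\<in>{w \<in> ?W. v - pwt w = u}. S (v - pwt w))"
    unfolding SY_def by (rule sum.image_gen[OF finite_SY])
  also have "(\<lambda>w. v - pwt w) ` ?W = {u. S u \<noteq> 0 \<and> yy (v - u) \<noteq> 0}"
  proof (intro equalityI subsetI)
    fix u assume "u \<in> {u. S u \<noteq> 0 \<and> yy (v - u) \<noteq> 0}"
    then obtain w where w: "S u \<noteq> 0" "cpath w" "pwt w = v - u" using yy_nonzero by blast
    then have "u = v - pwt w" by simp
    then show "u \<in> (\<lambda>w. v - pwt w) ` ?W" using w by blast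
  next
    fix u assume "u \<in> (\<lambda>w. v - pwt w) ` ?W"
    then obtain w where w: "cpath w" "S (v - pwt w) \<noteq> 0" "u = v - pwt w" by blast
    then have "v - u = pwt w" by simp
    then show "u \<in> {u. S u \<noteq> 0 \<and> yy (v - u) \<noteq> 0}" using w yy_nonzero by auto
  qed
  also have "(\<Sum>u | S u \<noteq> 0 \<and> yy (v - u) \<noteq> 0. \<Sum>w\<in>{w \<in> ?W. v - pwt w = u}. S (v - pwt w)) = conv yy v"
    unfolding conv_def
  proof (rule sum.cong[OF HOL.refl])
    fix u assume u: "u \<in> {u. S u \<noteq> 0 \<and> yy (v - u) \<noteq> 0}"
    have "v - pwt w = u \<longleftrightarrow> pwt w = v - u" for w by (metis add_diff_cancel_left' diff_add_cancel)
    then have "{w \<in> ?W. v - pwt w = u} = {w. cpath w \<and> pwt w = v - u}" using u by auto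
    moreover have "(\<Sum>w\<in>{w \<in> ?W. v - pwt w = u}. S (v - pwt w)) = (\<Sum>w\<in>{w \<in> ?W. v - pwt w = u}. S u)"
      by (rule sum.cong) auto
    ultimately show "(\<Sum>w\<in>{w \<in> ?W. v - pwt w = u}. S (v - pwt w)) = S u * yy (v - u)"
      by (simp add: yy_def)
  qed
  finally show ?thesis by simp
qed

lemma conv_level:
  assumes "conv f v \<noteq> 0" "\<And>l. f l \<noteq> 0 \<Longrightarrow> l \<in> latt"
  shows "v (n + 1) = int n + 2"
proof -
  obtain u where u: "S u \<noteq> 0" "f (v - u) \<noteq> 0"
    using conv_nonzero[OF assms(1)] by blast
  have "u (n + 1) = rho (n + 1)" using S_outside[OF u(1), of "n + 1"] by simp
  moreover have "(v - u) (n + 1) = 1" using assms(2)[OF u(2)] by (simp add: latt_def)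
  ultimately show ?thesis by (simp add: rho_def)
qed

lemma conv_mm_yy: "conv mm v = conv yy v"
proof -
  have "conv mm v - conv yy v = 0"
  proof (rule antisymmetric_zero[of "\<lambda>v. conv mm v - conv yy v" "ht rho + ht lam"])
    fix i u assume "i \<le> n"
    then show "conv mm (srefl i u) - conv yy (srefl i u) = - (conv mm u - conv yy u)"
      by (simp add: conv_mm_srefl conv_yy SY_srefl)
  next
    fix u assume ne: "conv mm u - conv yy u \<noteq> 0"
    show "ht u \<le> ht rho + ht lam"
    proof (cases "conv yy u = 0")
      case True
      then obtain w where "S w \<noteq> 0" "mm (u - w) \<noteq> 0" using ne conv_nonzero[of mm u] by auto
      then show ?thesis using S_bound[of w] mm_ht[of "u - w"] by (simp add: ht_linear)
    qed (use SY_bound conv_yy in auto)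
  next
    fix u assume dom: "\<And>i. i \<le> n \<Longrightarrow> 0 < cp i u"
    show "conv mm u - conv yy u = 0"
    proof (cases "u (n + 1) = int n + 2")
      case True
      then show ?thesis using SY_dominant[OF dom True] conv_mm_dominant[OF dom] conv_yy by simp
    next
      case False
      have "l \<in> latt" if "mm l \<noteq> 0" for l using that by (auto simp: mm_def split: if_splits)
      then have "conv mm u = 0" using conv_level[of mm u] False by blast
      moreover have "l \<in> latt" if "yy l \<noteq> 0" for l using that yy_nonzero pwt_latt by auto
      then have "conv yy u = 0" using conv_level[of yy u] False by blast
      ultimately show ?thesis by simp
    qed
  qed
  then show ?thesis by simp
qed

text \<open>The denominator has leading coefficient 1 at \<rho>, so equality of the products can be
  undone by descending induction on height: at l + \<rho> all terms except u = \<rho> involve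
  weights higher than l.\<close>

theorem multiplicity_paths: "mm l = yy l"
proof (induction "nat (ht lam - ht l)" arbitrary: l rule: less_induct)
  case less
  have hi: "mm l = yy l" if "ht lam < ht l" for l
    using that mm_ht[of l] yy_ht[of l] by force
  have IH: "mm l' = yy l'" if "ht l < ht l'" for l'
  proof (cases "ht lam < ht l'")
    case False
    then show ?thesis using less.hyps[of l'] that by simp
  qed (rule hi)
  let ?v = "l + rho"
  let ?F = "{u. S u \<noteq> 0 \<and> ht ?v - ht lam \<le> ht u}"
  have "(\<Sum>u\<in>?F. S u * (mm (?v - u) - yy (?v - u))) = 0"
    using conv_mm_yy[of ?v] conv_F[of mm ?v, OF mm_ht] conv_F[of yy ?v, OF yy_ht]
    by (simp add: right_diff_distrib sum_subtractf)
  moreover have "S u * (mm (?v - u) - yy (?v - u)) = 0" if "u \<in> ?F - {rho}" for u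
  proof -
    have "S u \<noteq> 0" "u \<noteq> rho" using that by auto
    then have "ht u < ht rho" using S_bound[of u] S_top[of u] by (cases "ht u = ht rho") auto
    then have "ht l < ht (?v - u)" by (simp add: ht_linear)
    then show ?thesis using IH by simp
  qed
  moreover have "mm l = yy l" if "rho \<notin> ?F"
    using that S_rho hi[of l] by (auto simp: ht_linear)
  moreover have "(\<Sum>u\<in>?F. S u * (mm (?v - u) - yy (?v - u))) = S rho * (mm (?v - rho) - yy (?v - rho))"
    if "rho \<in> ?F"
  proof -
    have "(\<Sum>u\<in>?F. S u * (mm (?v - u) - yy (?v - u))) = (\<Sum>u\<in>{rho}. S u * (mm (?v - u) - yy (?v - u)))"
      using that calculation(2) by (intro sum.mono_neutral_right finite_S) auto
    then show ?thesis by simp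
  qed
  ultimately have "mm l = yy l" using S_rho by (cases "rho \<in> ?F") auto
  then show ?case .
qed

end

section \<open>Partitions\<close>

fun hd0 :: "nat list \<Rightarrow> nat" where
  "hd0 [] = 0"
| "hd0 (x # l) = x"

fun part :: "nat list \<Rightarrow> bool" where
  "part [] \<longleftrightarrow> True"
| "part (x # l) \<longleftrightarrow> 0 < x \<and> hd0 l \<le> x \<and> part l"

lemma part_length: "part l \<Longrightarrow> length l \<le> sum_list l"
  by (induction l) auto

lemma hd0_le: "hd0 l \<le> sum_list l"
  by (cases l) auto

lemma finite_part: "finite {l. part l \<and> sum_list l = k}"
proof (rule finite_subset)
  show "{l. part l \<and> sum_list l = k} \<subseteq> {l. set l \<subseteq> {..k} \<and> length l \<le> k}"
    using part_length member_le_sum_list by fastforce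
  show "finite {l :: nat list. set l \<subseteq> {..k} \<and> length l \<le> k}" by (rule finite_lists_length_le) simp
qed

definition npart :: "nat \<Rightarrow> nat" where
  "npart k = card {l. part l \<and> sum_list l = k}"

definition npart_le :: "nat \<Rightarrow> nat \<Rightarrow> nat" where
  "npart_le m k = card {l. part l \<and> hd0 l \<le> m \<and> sum_list l = k}"

lemma npart_le_eq: "k \<le> m \<Longrightarrow> npart_le m k = npart k"
proof -
  assume "k \<le> m"
  then have "{l. part l \<and> hd0 l \<le> m \<and> sum_list l = k} = {l. part l \<and> sum_list l = k}"
    using hd0_le by (auto intro: order_trans)
  then show ?thesis by (simp add: npart_le_def npart_def)
qed

lemma npart_le_0: "npart_le 0 k = of_bool (k = 0)"
proof -
  have "part l \<and> hd0 l \<le> 0 \<and> sum_list l = k \<longleftrightarrow> l = [] \<and> k = 0" for l by (cases l) auto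
  then show ?thesis by (simp add: npart_le_def)
qed

text \<open>Either the largest part is at most m, or one part \<open>Suc m\<close> can be removed
  from the head.\<close>

lemma npart_le_Suc: "npart_le (Suc m) k = npart_le m k + (if Suc m \<le> k then npart_le (Suc m) (k - Suc m) else 0)"
proof -
  let ?A = "{l. part l \<and> hd0 l \<le> m \<and> sum_list l = k}" and ?B = "{l. part l \<and> hd0 l = Suc m \<and> sum_list l = k}"
  have "{l. part l \<and> hd0 l \<le> Suc m \<and> sum_list l = k} = ?A \<union> ?B" by auto
  moreover have "finite ?A" "finite ?B" by (rule finite_subset[OF _ finite_part[of k]]; auto)+
  ultimately have "npart_le (Suc m) k = card ?A + card ?B"
    unfolding npart_le_def by (simp add: card_Un_disjoint disjoint_iff)
  moreover have "card ?B = (if Suc m \<le> k then npart_le (Suc m) (k - Suc m) else 0)"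
  proof (cases "Suc m \<le> k")
    case True
    have "?B = (#) (Suc m) ` {l. part l \<and> hd0 l \<le> Suc m \<and> sum_list l = k - Suc m}"
    proof (intro equalityI subsetI)
      fix l assume "l \<in> ?B"
      then show "l \<in> (#) (Suc m) ` {l. part l \<and> hd0 l \<le> Suc m \<and> sum_list l = k - Suc m}" by (cases l) auto
    qed (use True in auto)
    then show ?thesis using True by (simp add: card_image npart_le_def)
  next
    case False
    have "\<not> (hd0 l = Suc m \<and> sum_list l = k)" for l using False hd0_le[of l] by auto
    then have "?B = {}" by blast
    then show ?thesis using False by (simp only: card.empty if_False)
  qed
  ultimately show ?thesis by (simp add: npart_le_def)
qed

definition euler_prod :: "nat \<Rightarrow> rat fps" where
  "euler_prod m = (\<Prod>i<m. 1 - fps_X ^ (i + 1))"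

lemma euler_prod_npart: "euler_prod m * Abs_fps (\<lambda>k. of_nat (npart_le m k)) = 1"
proof (induction m)
  case 0
  have "Abs_fps (\<lambda>k. of_nat (npart_le 0 k)) = (1 :: rat fps)" by (rule fps_ext) (simp add: npart_le_0)
  then show ?case by (simp add: euler_prod_def)
next
  case (Suc m)
  have "(1 - fps_X ^ Suc m) * Abs_fps (\<lambda>k. of_nat (npart_le (Suc m) k)) = (Abs_fps (\<lambda>k. of_nat (npart_le m k)) :: rat fps)"
  proof (rule fps_ext)
    fix k
    show "fps_nth ((1 - fps_X ^ Suc m) * Abs_fps (\<lambda>k. of_nat (npart_le (Suc m) k))) k = (fps_nth (Abs_fps (\<lambda>k. of_nat (npart_le m k))) k :: rat)"
      unfolding left_diff_distrib by (simp add: fps_X_power_mult_nth npart_le_Suc[of m k] del: power_Suc)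
  qed
  then show ?case using Suc.IH by (simp add: euler_prod_def mult.assoc)
qed

lemma euler_prod_stable: "k \<le> m \<Longrightarrow> fps_nth (euler_prod m) k = fps_nth (euler_prod k) k"
proof (induction m rule: dec_induct)
  case (step m)
  have "euler_prod (Suc m) = euler_prod m - fps_X ^ Suc m * euler_prod m" by (simp add: euler_prod_def algebra_simps)
  then show ?case using step by (simp add: fps_X_power_mult_nth del: power_Suc)
qed simp

text \<open>Coefficient k of the product depends on its first k factors only, and partitions of
  numbers up to k have parts at most k, so each coefficient of \<open>P * Q\<close> is that of a
  finite product times its inverse.\<close>

lemma inverse_q_pochhammer: "fps_nth (inverse q_pochhammer_inf) k = of_nat (npart k)"
proof -
  define P where "P = Abs_fps (\<lambda>k. fps_nth (euler_prod k) k)"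
  define Q :: "rat fps" where "Q = Abs_fps (\<lambda>k. of_nat (npart k))"
  have PQ: "P * Q = 1"
  proof (rule fps_ext)
    fix k
    have "fps_nth (P * Q) k = (\<Sum>i=0..k. fps_nth (euler_prod k) i * fps_nth (Abs_fps (\<lambda>j. of_nat (npart_le k j))) (k - i))"
      unfolding fps_mult_nth
    proof (rule sum.cong[OF HOL.refl])
      fix i assume "i \<in> {0..k}"
      then show "fps_nth P i * fps_nth Q (k - i) = fps_nth (euler_prod k) i * fps_nth (Abs_fps (\<lambda>j. of_nat (npart_le k j))) (k - i)"
        using euler_prod_stable[of i k] npart_le_eq[of "k - i" k] by (simp add: P_def Q_def)
    qed
    also have "\<dots> = fps_nth 1 k" unfolding fps_mult_nth[symmetric] euler_prod_npart ..
    finally show "fps_nth (P * Q) k = fps_nth 1 k" .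
  qed
  have "(\<lambda>m. \<Prod>i\<le>m. 1 - fps_X ^ (i + 1)) \<longlonglongrightarrow> P"
  proof (rule tendsto_fpsI)
    fix k
    have "fps_nth (\<Prod>i\<le>m. 1 - fps_X ^ (i + 1)) k = fps_nth P k" if "k \<le> m" for m
      using euler_prod_stable[of k "Suc m"] that by (simp add: P_def euler_prod_def lessThan_Suc_atMost)
    then show "\<forall>\<^sub>F m in sequentially. fps_nth (\<Prod>i\<le>m. 1 - fps_X ^ (i + 1)) k = fps_nth P k"
      using eventually_sequentially by blast
  qed
  \<comment> \<open>\<open>has_prod\<close> asks for a nonzero limit.\<close>
  moreover have "P \<noteq> 0" using PQ by auto
  ultimately have "(\<lambda>i. 1 - fps_X ^ (i + 1)) has_prod P"
    by (simp add: has_prod_def raw_has_prod_def)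
  then have "q_pochhammer_inf = P" unfolding q_pochhammer_inf_def by (rule has_prod_unique[symmetric])
  moreover have "inverse P = Q" using PQ by (rule fps_inverse_unique)
  ultimately show ?thesis by (simp add: Q_def)
qed

context path_C
begin

section \<open>Sequences whose gaps exceed the energy\<close>

fun qpath :: "coloured_int list \<Rightarrow> bool" where
  "qpath [] \<longleftrightarrow> True"
| "qpath (a # w) \<longleftrightarrow> snd a \<in> crystal n \<and> rel_ge a (lead w) \<and> qpath w \<and> \<not> (w = [] \<and> a = (0, g0))"

lemma rel_ge_iff: "rel_ge a c \<longleftrightarrow> energy (snd c) (snd a) \<le> fst a - fst c"
  by (cases a; cases c) simp

text \<open>Subtracting from a part the size it would have under minimal energy leaves a partition, so a
  \<open>\<gg>\<close>-sequence is a path together with a partition, both aligned at the largest part.\<close>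

fun dec :: "coloured_int list \<Rightarrow> nat list \<Rightarrow> coloured_int list" where
  "dec [] [] = []"
| "dec [] (x # l) = (int x, g0) # dec [] l"
| "dec (a # p) [] = a # dec p []"
| "dec (a # p) (x # l) = (fst a + int x, snd a) # dec p l"

text \<open>The size that \<open>rel_eq\<close> forces on a new first part of colour b, which is
  also the least size that \<open>rel_ge\<close> allows above p.\<close>

definition men :: "coloured_int list \<Rightarrow> vertex \<Rightarrow> int" where
  "men p b = fst (lead p) + energy (snd (lead p)) b"

text \<open>A part of ground colour over an empty path belongs to the ground tail and feeds only the
  partition; a zero excess over an empty partition is not a part. These two tests undo the padding
  in \<open>dec\<close>.\<close>

fun enc :: "coloured_int list \<Rightarrow> coloured_int list \<times> nat list" where
  "enc [] = ([], [])"
| "enc (a # w) = (if fst (enc w) = [] \<and> snd a = g0 then [] else (men (fst (enc w)) (snd a), snd a) # fst (enc w),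
     if snd (enc w) = [] \<and> fst a = men (fst (enc w)) (snd a) then []
     else nat (fst a - men (fst (enc w)) (snd a)) # snd (enc w))"

lemma cpath_men: "cpath (a # p) \<Longrightarrow> a = (men p (snd a), snd a)"
  by (cases a) (auto simp: men_def rel_eq_iff)

lemma cpath_ground: "cpath [a] \<Longrightarrow> snd a \<noteq> g0"
  using cpath_men[of a "[]"] by (auto simp: men_def energy_ground)

lemma men_ground: "men [] g0 = 0"
  by (simp add: men_def energy_ground)

lemma dec_Nil_iff: "dec p l = [] \<longleftrightarrow> p = [] \<and> l = []"
  by (cases p; cases l) auto

lemma lead_dec: "lead (dec p l) = (fst (lead p) + int (hd0 l), snd (lead p))"
  by (cases p; cases l) auto

lemma dec_qpath: "cpath p \<Longrightarrow> part l \<Longrightarrow> qpath (dec p l)"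
proof (induction p l rule: dec.induct)
  case (2 x l)
  then show ?case by (auto simp: rel_ge_iff lead_dec energy_ground ground_crystal i0)
next
  case (3 a p)
  then show ?case by (auto simp: rel_ge_iff rel_eq_iff lead_dec dec_Nil_iff)
next
  case (4 a p x l)
  have "0 \<le> fst a" using lead_nonneg[OF 4(2)] by simp
  then show ?case using 4 by (auto simp: rel_ge_iff rel_eq_iff lead_dec)
qed simp

lemma enc_dec: "cpath p \<Longrightarrow> part l \<Longrightarrow> enc (dec p l) = (p, l)"
proof (induction p l rule: dec.induct)
  case (2 x l)
  then show ?case by (simp add: men_ground)
next
  case (3 a p)
  then have e: "enc (dec p []) = (p, [])" "a = (men p (snd a), snd a)" using cpath_men by auto
  moreover have "\<not> (p = [] \<and> snd a = g0)" using 3(2) by (metis cpath_ground)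
  moreover have "men p (snd a) = fst a" using e(2) by (metis fst_conv)
  ultimately show ?case by simp
next
  case (4 a p x l)
  then have e: "enc (dec p l) = (p, l)" "a = (men p (snd a), snd a)" using cpath_men by auto
  have m: "men p (snd a) = fst a" using e(2) by (metis fst_conv)
  moreover have "\<not> (p = [] \<and> snd a = g0)" using 4(2) by (metis cpath_ground)
  ultimately show ?case using e(1) 4(3) by simp
qed simp

lemma dec_enc: "qpath w \<Longrightarrow> cpath (fst (enc w)) \<and> part (snd (enc w)) \<and> dec (fst (enc w)) (snd (enc w)) = w"
proof (induction w)
  case (Cons a w)
  let ?p = "fst (enc w)" and ?l = "snd (enc w)"
  have IH: "cpath ?p" "part ?l" "dec ?p ?l = w" using Cons by auto
  have ld: "lead w = (fst (lead ?p) + int (hd0 ?l), snd (lead ?p))" using lead_dec[of ?p ?l] IH(3) by simp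
  let ?m = "men ?p (snd a)"
  have ge: "?m + int (hd0 ?l) \<le> fst a" using Cons.prems ld by (simp add: rel_ge_iff men_def)
  have c: "snd a \<in> crystal n" using Cons.prems by simp
  have nil: "?p = [] \<and> ?l = [] \<Longrightarrow> w = []" using IH(3) by auto
  have l: "?l \<noteq> [] \<Longrightarrow> 0 < hd0 ?l" using IH(2) by (cases ?l) auto
  have w0: "\<not> (w = [] \<and> a = (0, g0))" using Cons.prems by simp
  have aa: "a = (fst a, snd a)" by simp
  show ?case
  proof (cases "?p = [] \<and> snd a = g0")
    case True
    then have m0: "?m = 0" by (simp add: men_ground)
    have "\<not> (?l = [] \<and> fst a = 0)" using nil w0 True aa by metis
    then show ?thesis using True m0 ge l IH w0 aa by (cases "?l = []") (auto simp: dec_Nil_iff)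
  next
    case False
    have p': "cpath ((?m, snd a) # ?p)" using False IH(1) c by (auto simp: rel_eq_iff men_def)
    show ?thesis
    proof (cases "?l = [] \<and> fst a = ?m")
      case True
      then have "(?m, snd a) = a" by (intro prod_eqI) simp_all
      then show ?thesis using True False p' IH by auto
    next
      case F2: False
      then have "0 < fst a - ?m" using ge l by (cases "?l = []") auto
      then show ?thesis using False F2 p' IH ge by auto
    qed
  qed
qed simp

lemma pwt_dec: "pwt (dec p l) = pwt p - sc (int (sum_list l)) delta"
proof -
  have "pwt (dec p l) j = (pwt p - sc (int (sum_list l)) delta) j" for j
    by (induction p l rule: dec.induct) (auto simp: cw_def vw_ground algebra_simps)
  then show ?thesis by blast
qed

lemma bij_dec:
  "bij_betw (\<lambda>q. dec (fst q) (snd q)) {q. cpath (fst q) \<and> part (snd q) \<and> P (pwt (fst q) - sc (int (sum_list (snd q))) delta)} {w. qpath w \<and> P (pwt w)}"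
  by (rule bij_betw_byWitness[where f' = enc])
     (use enc_dec dec_enc dec_qpath pwt_dec in \<open>auto simp flip: pwt_dec\<close>)

end

section \<open>The given module\<close>

lemma weight_scale_simps [simp]: "weight_scale z u j = z * u j"
  by (simp add: weight_scale_def)

context type_C
begin

text \<open>The level is not a separate entry because it is the sum of the coroot values.\<close>

definition toW :: "wt \<Rightarrow> weight" where
  "toW u = (\<lambda>j. if j \<le> n then of_int (cp j u) else if j = n + 1 then of_int (u 0) else 0)"

lemma toW_linear: "toW (u + v) = toW u + toW v" "toW (u - v) = toW u - toW v"
  "toW (sc k u) = weight_scale (of_int k) (toW u)" "toW (- u) = - toW u" "toW 0 = 0"
  by (auto simp: toW_def fun_eq_iff cp_linear)

lemma toW_sum: "toW (\<Sum>a\<in>A. f a) = (\<Sum>a\<in>A. toW (f a))"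
  by (induction A rule: infinite_finite_induct)
     (simp_all only: sum.infinite sum.empty sum.insert not_False_eq_True toW_linear)

lemma toW_weights: "toW u \<in> weights n"
  by (simp add: toW_def weights_def)

lemma toW_inj: "toW u = toW v \<Longrightarrow> j \<le> n \<Longrightarrow> u j = v j"
proof -
  assume e: "toW u = toW v" and j: "j \<le> n"
  have c: "cp i u = cp i v" if "i \<le> n" for i using fun_cong[OF e, of i] that by (simp add: toW_def)
  have "u (n - k) = v (n - k)" if "k < n" for k
    using that
  proof (induction k)
    case 0
    then show ?case using c[of n] n_pos by (simp add: cp_def)
  next
    case (Suc k)
    moreover have "n - Suc k \<noteq> 0" "n - Suc k \<noteq> n" "n - Suc k + 1 = n - k" using Suc.prems by auto
    ultimately show ?case using c[of "n - Suc k"] by (simp add: cp_def)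
  qed
  from this[of "n - j"] show ?thesis
    using fun_cong[OF e, of "n + 1"] j by (cases "j = 0") (auto simp: toW_def)
qed

lemma simple_root_toW: "j \<le> n \<Longrightarrow> simple_root n j = toW (simple j)"
  using n_pos
  by (auto simp: fun_eq_iff simple_root_def toW_def cp_def simple_def cartan_C_def delta_def unitv_def)

lemma sum_simple: "j \<le> k \<Longrightarrow> 1 \<le> j \<Longrightarrow> k \<le> n \<Longrightarrow> (\<Sum>u\<in>{j..<k}. simple u) = unitv j - unitv k"
proof (induction k rule: dec_induct)
  case (step k)
  have "(\<Sum>u\<in>{j..<k}. simple u) = unitv j - unitv k" by (rule step.IH) (use step.prems in auto)
  then have "(\<Sum>u\<in>{j..<Suc k}. simple u) = unitv j - unitv (Suc k)" using step by (simp add: simple_def)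
  then show ?case .
qed simp

lemma null_root_toW: "null_root n = toW delta"
proof -
  have "(\<Sum>j = 1..n - 1. simple_root n j) = toW (\<Sum>j\<in>{1..<n}. simple j)"
    unfolding toW_sum by (rule sum.cong) (auto simp: simple_root_toW)
  also have "(\<Sum>j\<in>{1..<n}. simple j) = unitv 1 - unitv n" using sum_simple[of 1 n] n_pos by simp
  finally have "(\<Sum>j = 1..n - 1. simple_root n j) = toW (unitv 1 - unitv n)" .
  then have "null_root n = toW (simple 0 + sc 2 (unitv 1 - unitv n) + simple n)"
    unfolding null_root_def by (simp only: simple_root_toW toW_linear le0 order_refl of_int_numeral)
  also have "simple 0 + sc 2 (unitv 1 - unitv n) + simple n = delta"
    using n_pos by (simp add: simple_def sc_linear)
  finally show ?thesis .
qed

lemma letter_weight_toW: "x \<in> letters n \<Longrightarrow> letter_weight n x = toW (lw x)"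
proof -
  have *: "weight_scale (1 / 2) (simple_root n n) + (\<Sum>u\<in>{j..<n}. simple_root n u) = toW (unitv j)" if "1 \<le> j" "j \<le> n" for j
  proof -
    have "(\<Sum>u\<in>{j..<n}. simple_root n u) = toW (\<Sum>u\<in>{j..<n}. simple u)"
      unfolding toW_sum by (rule sum.cong) (auto simp: simple_root_toW)
    also have "(\<Sum>u\<in>{j..<n}. simple u) = unitv j - unitv n" using sum_simple[of j n] that by simp
    finally have "(\<Sum>u\<in>{j..<n}. simple_root n u) = toW (unitv j - unitv n)" .
    then have "(\<Sum>u\<in>{j..<n}. simple_root n u) = toW (unitv j) - toW (unitv n)" by (simp only: toW_linear)
    moreover have "weight_scale (1 / 2) (simple_root n n) = toW (unitv n)"
      using n_pos by (simp add: simple_root_toW simple_def toW_linear fun_eq_iff)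
    ultimately show ?thesis by simp
  qed
  show "x \<in> letters n \<Longrightarrow> letter_weight n x = toW (lw x)"
    using * by (cases x) (auto simp: toW_linear)
qed

lemma vertex_weight_toW: "b \<in> crystal n \<Longrightarrow> vertex_weight n b = toW (vw b)"
  by (cases b) (auto simp: crystal_def letter_weight_toW toW_linear)

end

context path_C
begin

lemma fundamental_weight_toW: "fundamental_weight i0 = toW lam"
  using i0 by (auto simp: fun_eq_iff fundamental_weight_def toW_def cp_lam) (simp add: lam_def)

text \<open>\<open>P\<close> stands for \<open>cpath\<close> or \<open>qpath\<close>, so both
  relations are served at once. The final clause of its recursion is the condition on the part next
  to the ground.\<close>

lemma grounded_iff:
  assumes P: "P []" "\<And>a w. P (a # w) \<longleftrightarrow> snd a \<in> crystal n \<and> R a (lead w) \<and> P w \<and> \<not> (w = [] \<and> a = (0, g0))"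
  shows "w @ [(0, g0)] \<in> grounded_partitions n R g0 \<longleftrightarrow> P w"
proof -
  have "P w \<longleftrightarrow> snd ` set w \<subseteq> crystal n \<and> successively R (w @ [(0, g0)]) \<and> (w \<noteq> [] \<longrightarrow> last w \<noteq> (0, g0))" for w
  proof (induction w)
    case (Cons a w)
    have "successively R ((a # w) @ [(0, g0)]) \<longleftrightarrow> R a (lead w) \<and> successively R (w @ [(0, g0)])"
      by (cases w) auto
    then show ?case using Cons P(2)[of a w] by auto
  qed (simp add: P)
  moreover have "(w @ [(0, g0)]) ! (length w - Suc 0) = last w" if "w \<noteq> []"
    using that by (simp add: nth_append last_conv_nth)
  ultimately show ?thesis
    using ground_crystal i0 by (auto simp: grounded_partitions_def)
qed

lemma grounded_image:
  assumes P: "P []" "\<And>a w. P (a # w) \<longleftrightarrow> snd a \<in> crystal n \<and> R a (lead w) \<and> P w \<and> \<not> (w = [] \<and> a = (0, g0))"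
  shows "grounded_partitions n R g0 = (\<lambda>w. w @ [(0, g0)]) ` {w. P w}"
proof (intro equalityI subsetI)
  fix \<pi> assume p: "\<pi> \<in> grounded_partitions n R g0"
  then have "\<pi> = butlast \<pi> @ [(0, g0)]" using append_butlast_last_id[of \<pi>] by (simp add: grounded_partitions_def)
  then show "\<pi> \<in> (\<lambda>w. w @ [(0, g0)]) ` {w. P w}" using grounded_iff[of P R "butlast \<pi>", OF P] p by auto
qed (use grounded_iff[of P R, OF P] in auto)

lemma partition_exponent_path:
  assumes "snd ` set w \<subseteq> crystal n"
  shows "partition_exponent n (w @ [(0, g0)]) = toW (pwt w) - fundamental_weight i0"
proof -
  have "(\<Sum>(k, b)\<leftarrow>w. vertex_weight n b) - weight_scale (of_int (\<Sum>(k, b)\<leftarrow>w. k)) (null_root n) = toW (\<Sum>a\<leftarrow>w. cw a)"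
    using assms
  proof (induction w)
    case Nil
    have "(\<Sum>(k, b)\<leftarrow>[]. vertex_weight n b) - weight_scale (of_int (\<Sum>(k, b)\<leftarrow>[]. k)) (null_root n) = toW (\<Sum>a\<leftarrow>[]. cw a)"
      by (simp add: toW_linear fun_eq_iff)
    then show ?case .
  next
    case (Cons a w)
    have IH: "(\<Sum>(k, b)\<leftarrow>w. vertex_weight n b) - weight_scale (of_int (\<Sum>(k, b)\<leftarrow>w. k)) (null_root n) = toW (\<Sum>a\<leftarrow>w. cw a)"
      by (rule Cons.IH) (use Cons.prems in auto)
    have "toW (\<Sum>a\<leftarrow>a # w. cw a) = toW (cw a) + ((\<Sum>(k, b)\<leftarrow>w. vertex_weight n b) - weight_scale (of_int (\<Sum>(k, b)\<leftarrow>w. k)) (null_root n))"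
      unfolding IH by (simp add: toW_linear)
    moreover have "toW (cw a) = vertex_weight n (snd a) - weight_scale (of_int (fst a)) (null_root n)"
      using Cons.prems by (simp add: cw_def toW_linear vertex_weight_toW null_root_toW)
    ultimately have "(\<Sum>(k, b)\<leftarrow>a # w. vertex_weight n b) - weight_scale (of_int (\<Sum>(k, b)\<leftarrow>a # w. k)) (null_root n) = toW (\<Sum>a\<leftarrow>a # w. cw a)"
      by (simp add: split_beta fun_eq_iff algebra_simps)
    then show ?case .
  qed
  moreover have "vertex_weight n g0 = 0" using vertex_weight_toW[OF ground_crystal[OF i0]] vw_ground by (simp add: toW_linear)
  ultimately show ?thesis
    by (simp add: partition_exponent_def pwt_def toW_linear fundamental_weight_toW)
qed

end


locale L_model = path_C n i0
  for n i0 and smul :: "complex \<Rightarrow> 'v \<Rightarrow> 'v::ab_group_add" (infixr \<open>\<odot>\<close> 75) +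
  fixes act :: "affine \<Rightarrow> 'v \<Rightarrow> 'v"
  assumes L: "is_L n (fundamental_weight i0) smul act"
begin

lemma module: "affine_module n smul act"
  using L by (simp add: is_L_def irreducible_module_def)

sublocale vspace smul
  using module by (simp add: affine_module_def vspace_def)

lemma act_lin: "u \<in> affine_C n \<Longrightarrow> lin (act u)"
  and act_add: "u \<in> affine_C n \<Longrightarrow> u' \<in> affine_C n \<Longrightarrow> act (u + u') v = act u v + act u' v"
  and act_scale: "u \<in> affine_C n \<Longrightarrow> act (affine_scale z u) v = z \<odot> act u v"
  and act_bracket: "u \<in> affine_C n \<Longrightarrow> u' \<in> affine_C n \<Longrightarrow> act (affine_bracket u u') v = act u (act u' v) - act u' (act u v)"
  using module by (auto simp: affine_module_def)

definition cen :: affine where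
  "cen = (LM n (\<lambda>a b. 0), 1, 0)"

definition der :: affine where
  "der = (LM n (\<lambda>a b. 0), 0, 1)"

lemma cen_der [simp]: "cen \<in> affine_C n" "der \<in> affine_C n"
  by (simp_all add: cen_def der_def affine_C_zero)

lemma scaling_element_der: "scaling_element n = der"
proof -
  have "0\<^sub>m (2 * n) (2 * n) = LM n (\<lambda>a b. 0)" by (rule eq_matI) (auto simp: LM_index)
  then show ?thesis by (simp add: scaling_element_def der_def)
qed

lemma affine_scale_C: "u \<in> affine_C n \<Longrightarrow> affine_scale z u \<in> affine_C n"
proof -
  assume u: "u \<in> affine_C n"
  obtain Z a b where uu: "u = (Z, a, b)" by (cases u)
  then obtain f where Z: "Z = LM n f" "LM n f \<in> loop_sp n" using u LM_surj[of Z n] by (auto simp: affine_C_def loop_sp_def)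
  have "(\<Sum>c\<in>letters n. laurent_const z * f c a * of_int (om c b)) + (\<Sum>c\<in>letters n. of_int (om a c) * (laurent_const z * f c b)) =
      laurent_const z * ((\<Sum>c\<in>letters n. f c a * of_int (om c b)) + (\<Sum>c\<in>letters n. of_int (om a c) * f c b))" for a b
    by (simp add: sum_distrib_left distrib_left mult_ac)
  then show ?thesis using Z uu by (simp add: affine_scale_def affine_C_def LM_smult loop_sp_LM)
qed

lemma euler_zero: "euler 0 = 0"
  using euler_single[of 0 0] by simp

lemma cen_bracket: "u \<in> affine_C n \<Longrightarrow> affine_bracket cen u = affine_scale 0 cen"
proof -
  assume u: "u \<in> affine_C n"
  obtain Z a b where uu: "u = (Z, a, b)" by (cases u)
  then obtain f where Z: "Z = LM n f" using u LM_surj[of Z n] by (auto simp: affine_C_def loop_sp_def)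
  show ?thesis
    by (simp add: affine_bracket_def cen_def uu Z affine_scale_def LM_mult LM_map LM_smult LM_add LM_minus LM_trace euler_zero laurent_const_def)
qed

lemma der_bracket: "affine_bracket der (X n x y m) = affine_scale (of_int m) (X n x y m)"
  by (simp add: affine_bracket_def der_def X_def affine_scale_def LM_mult LM_map LM_smult LM_add LM_minus LM_trace euler_zero
      laurent_const_def euler_single mult_single of_int_mult_single mult.commute)

lemma act_cen: "u \<in> affine_C n \<Longrightarrow> act cen (act u v) = act u (act cen v)"
  using act_bracket[of cen u v] cen_bracket[of u] act_scale[of cen 0 v] by simp

lemma act_X_lin: "x \<in> letters n \<Longrightarrow> y \<in> letters n \<Longrightarrow> lin (act (X n x y m))"
  by (rule act_lin[OF X_affine_C])

lemma act_X_bracket: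
  assumes l: "x \<in> letters n" "y \<in> letters n" "z \<in> letters n" "w \<in> letters n"
  shows "act (X n x y m) (act (X n z w k) v) = act (X n z w k) (act (X n x y m) v) +
    (of_int (om y z) \<odot> act (X n x w (m + k)) v + of_int (om x z) \<odot> act (X n y w (m + k)) v +
     of_int (om y w) \<odot> act (X n z x (m + k)) v + of_int (om x w) \<odot> act (X n z y (m + k)) v +
     (if m + k = 0 then of_int (m * xtr x y z w) else 0) \<odot> act cen v)"
proof -
  define A where "A x y = X n x y (m + k)" for x y
  have A: "A x y \<in> affine_C n" if "x \<in> letters n" "y \<in> letters n" for x y using X_affine_C that by (simp add: A_def)
  have sum_C: "u + u' \<in> affine_C n" if U: "u \<in> affine_C n" "u' \<in> affine_C n" for u u'
  proof -
    obtain Z a b Z' a' b' where uu: "u = (Z, a, b)" "u' = (Z', a', b')" by (cases u; cases u')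
    obtain f where Z: "Z = LM n f" using U uu LM_surj[of Z n] by (auto simp: affine_C_def loop_sp_def)
    obtain f' where Z': "Z' = LM n f'" using U uu LM_surj[of Z' n] by (auto simp: affine_C_def loop_sp_def)
    have "(\<Sum>c\<in>letters n. (f c a + f' c a) * of_int (om c b)) + (\<Sum>c\<in>letters n. of_int (om a c) * (f c b + f' c b)) =
      ((\<Sum>c\<in>letters n. f c a * of_int (om c b)) + (\<Sum>c\<in>letters n. of_int (om a c) * f c b)) +
      ((\<Sum>c\<in>letters n. f' c a * of_int (om c b)) + (\<Sum>c\<in>letters n. of_int (om a c) * f' c b))" for a b
      by (simp add: sum.distrib distrib_left distrib_right)
    then show ?thesis using U uu Z Z' by (simp add: affine_C_def LM_add loop_sp_LM)
  qed
  have "act (X n x y m) (act (X n z w k) v) - act (X n z w k) (act (X n x y m) v) = act (affine_bracket (X n x y m) (X n z w k)) v"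
    using act_bracket X_affine_C l by simp
  also have "\<dots> = of_int (om y z) \<odot> act (A x w) v + of_int (om x z) \<odot> act (A y w) v +
     of_int (om y w) \<odot> act (A z x) v + of_int (om x w) \<odot> act (A z y) v +
     (if m + k = 0 then of_int (m * xtr x y z w) else 0) \<odot> act cen v"
    unfolding X_bracket[OF l] A_def[symmetric] cen_def[symmetric]
    by (simp only: act_add act_scale sum_C affine_scale_C A l cen_der)
  finally show ?thesis unfolding A_def by (simp add: algebra_simps)
qed

lemma om_simps: "om (Plain j) b = of_bool (b = Barred j)" "om (Barred j) b = - of_bool (b = Plain j)"
  by (cases b; auto)+

text \<open>Scalars that turn symmetric-square elements into the given matrices: a square xx carries
  an extra factor 2, and the signs are those of the symplectic form.\<close>

definition ecoef :: "nat \<Rightarrow> complex" where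
  "ecoef i = (if i = 0 then - 1 / 2 else if i = n then 1 / 2 else - 1)"

definition fcoef :: "nat \<Rightarrow> complex" where
  "fcoef i = (if i = 0 then 1 / 2 else if i = n then - 1 / 2 else - 1)"

lemma ix_simps: "ix n (Plain j) = j - 1" "ix n (Barred j) = n + j - 1"
  by (simp_all add: ix_def)

lemma LM_single_cong:
  assumes "\<And>a b. a \<in> letters n \<Longrightarrow> b \<in> letters n \<Longrightarrow> f a b = z * of_int (xc x y a b)"
  shows "(LM n (\<lambda>a b. Poly_Mapping.single m (f a b)), 0, 0) = affine_scale z (X n x y m)"
  using assms by (simp add: affine_scale_def X_def LM_smult LM_eq_iff laurent_const_def mult_single)

lemma chevalley:
  assumes i: "i \<le> n" and s: "simple_index i = (x, y, m)"
  shows "chevalley_e n i = affine_scale (ecoef i) (X n x y m)"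
    "chevalley_f n i = affine_scale (fcoef i) (X n (bar x) (bar y) (- m))"
proof -
  have m1: "(- 1 :: laurent) = Poly_Mapping.single 0 (- 1)" by (metis single_one single_uminus)
  consider "i = 0" | "i = n" "i \<noteq> 0" | "i \<noteq> 0" "i < n" using i by linarith
  then have "chevalley_e n i = affine_scale (ecoef i) (X n x y m) \<and> chevalley_f n i = affine_scale (fcoef i) (X n (bar x) (bar y) (- m))"
  proof cases
    case 1
    have L: "Plain 1 \<in> letters n" "Barred 1 \<in> letters n" using n_pos by auto
    have "chevalley_e n 0 = (LM n (\<lambda>a b. Poly_Mapping.single 1 (if a = Barred 1 \<and> b = Plain 1 then 1 else 0)), 0, 0)"
      using unit_mat_LM[OF L(2,1), of "Poly_Mapping.single 1 1"] by (simp add: chevalley_e_def ix_simps LM_eq_iff)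
    moreover have "chevalley_f n 0 = (LM n (\<lambda>a b. Poly_Mapping.single (-1) (if a = Plain 1 \<and> b = Barred 1 then 1 else 0)), 0, 0)"
      using unit_mat_LM[OF L(1,2), of "Poly_Mapping.single (-1) 1"] by (simp add: chevalley_f_def ix_simps LM_eq_iff)
    moreover have "x = Barred 1" "y = Barred 1" "m = 1" using 1 s by (auto simp: simple_index_def)
    ultimately show ?thesis using 1
      by (auto simp: ecoef_def fcoef_def xc_def om_simps intro!: LM_single_cong)
  next
    case 2
    have L: "Plain n \<in> letters n" "Barred n \<in> letters n" using n_pos by auto
    have "chevalley_e n n = (LM n (\<lambda>a b. Poly_Mapping.single 0 (if a = Plain n \<and> b = Barred n then 1 else 0)), 0, 0)"
      using unit_mat_LM[OF L, of 1] 2 by (simp add: chevalley_e_def ix_simps LM_eq_iff mult_2)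
    moreover have "chevalley_f n n = (LM n (\<lambda>a b. Poly_Mapping.single 0 (if a = Barred n \<and> b = Plain n then 1 else 0)), 0, 0)"
      using unit_mat_LM[OF L(2,1), of 1] 2 by (simp add: chevalley_f_def ix_simps LM_eq_iff mult_2)
    moreover have "x = Plain n" "y = Plain n" "m = 0" using 2 s by (auto simp: simple_index_def)
    ultimately show ?thesis using 2
      by (auto simp: ecoef_def fcoef_def xc_def om_simps intro!: LM_single_cong)
  next
    case 3
    have L: "Plain i \<in> letters n" "Barred i \<in> letters n" "Plain (i + 1) \<in> letters n" "Barred (i + 1) \<in> letters n" using 3 by auto
    have "chevalley_e n i = (LM n (\<lambda>a b. Poly_Mapping.single 0 ((if a = Plain i \<and> b = Plain (i + 1) then 1 else 0) - (if a = Barred (i + 1) \<and> b = Barred i then 1 else 0))), 0, 0)"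
      using unit_mat_LM[OF L(1,3), of 1] unit_mat_LM[OF L(4,2), of 1] 3 by (simp add: chevalley_e_def ix_simps LM_eq_iff LM_minus m1)
    moreover have "chevalley_f n i = (LM n (\<lambda>a b. Poly_Mapping.single 0 ((if a = Plain (i + 1) \<and> b = Plain i then 1 else 0) - (if a = Barred i \<and> b = Barred (i + 1) then 1 else 0))), 0, 0)"
      using unit_mat_LM[OF L(3,1), of 1] unit_mat_LM[OF L(2,4), of 1] 3 by (simp add: chevalley_f_def ix_simps LM_eq_iff LM_minus m1)
    moreover have "x = Plain i" "y = Barred (i + 1)" "m = 0" using 3 s by (auto simp: simple_index_def)
    ultimately show ?thesis using 3
      by (auto simp: ecoef_def fcoef_def xc_def om_simps intro!: LM_single_cong)
  qed
  then show "chevalley_e n i = affine_scale (ecoef i) (X n x y m)" "chevalley_f n i = affine_scale (fcoef i) (X n (bar x) (bar y) (- m))" by auto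
qed

abbreviation hh :: "nat \<Rightarrow> 'v \<Rightarrow> 'v" where
  "hh j \<equiv> act (X n (Plain j) (Barred j) 0)"

lemma four_scale: "(4 :: complex) \<odot> a = a + a + a + a"
proof -
  have "(4 :: complex) \<odot> a = (1 + 1 + 1 + 1) \<odot> a" by simp
  then show ?thesis by (simp only: scale_left_distrib scale_one)
qed

lemma act_coroot:
  assumes i: "i \<le> n"
  shows "act (coroot n i) v = (if i = 0 then hh 1 v + act cen v else if i = n then - hh n v else hh (i + 1) v - hh i v)"
proof -
  obtain x y m where s: "simple_index i = (x, y, m)" by (cases "simple_index i")
  have L: "x \<in> letters n" "y \<in> letters n" using simple_index_PR[OF i] s by (auto simp: PR_iff)
  have Lb: "bar x \<in> letters n" "bar y \<in> letters n" using L by auto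
  let ?e = "act (X n x y m)" and ?f = "act (X n (bar x) (bar y) (- m))"
  have "act (coroot n i) v = ecoef i \<odot> ?e (fcoef i \<odot> ?f v) - fcoef i \<odot> ?f (ecoef i \<odot> ?e v)"
    unfolding coroot_def using chevalley[OF i s] L Lb by (simp add: act_bracket act_scale affine_scale_C X_affine_C)
  also have "\<dots> = (ecoef i * fcoef i) \<odot> (?e (?f v) - ?f (?e v))"
    using act_X_lin[OF L] act_X_lin[OF Lb] by (simp add: lin_scale scale_right_diff_distrib mult.commute)
  finally have c: "act (coroot n i) v = (ecoef i * fcoef i) \<odot> (?e (?f v) - ?f (?e v))" .
  consider "i = 0" | "i = n" "i \<noteq> 0" | "i \<noteq> 0" "i < n" using i by linarith
  then show ?thesis
  proof cases
    case 1
    then have xy: "x = Barred 1" "y = Barred 1" "m = 1" using s by (auto simp: simple_index_def)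
    have "?e (?f v) - ?f (?e v) = of_int (-4) \<odot> (hh 1 v + act cen v)"
      using act_X_bracket[OF L Lb, of m "- m" v] unfolding xy
      by (simp add: X_commute[of n "Barred _" "Plain _"] xtr_def four_scale algebra_simps)
    then show ?thesis using c 1 by (simp add: ecoef_def fcoef_def)
  next
    case 2
    then have xy: "x = Plain n" "y = Plain n" "m = 0" using s by (auto simp: simple_index_def)
    have "?e (?f v) - ?f (?e v) = of_int 4 \<odot> hh n v"
      using act_X_bracket[OF L Lb, of m "- m" v] unfolding xy
      by (simp add: X_commute[of n "Barred _" "Plain _"] four_scale)
    then show ?thesis using c 2 by (simp add: ecoef_def fcoef_def)
  next
    case 3
    then have xy: "x = Plain i" "y = Barred (i + 1)" "m = 0" using s by (auto simp: simple_index_def)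
    have "?e (?f v) - ?f (?e v) = hh (i + 1) v - hh i v"
      using act_X_bracket[OF L Lb, of m "- m" v] unfolding xy
      by (simp add: X_commute[of n "Barred _" "Plain _"])
    then show ?thesis using c 3 by (simp add: ecoef_def fcoef_def)
  qed
qed

text \<open>For i >= 1 the coroots are successive differences of the \<open>hh j\<close>, so summing
  eigenvalues from j to n recovers \<open>hh j\<close> up to sign; adding the coroot of index 0
  gives the central element.\<close>

lemma weight_space_hh:
  assumes v: "v \<in> weight_space n smul act \<mu>"
  shows "j \<in> {1..n} \<Longrightarrow> hh j v = - (\<Sum>i=j..n. \<mu> i) \<odot> v" "act cen v = (\<Sum>i=0..n. \<mu> i) \<odot> v"
proof -
  have c: "act (coroot n i) v = \<mu> i \<odot> v" if "i \<le> n" for i using v that by (simp add: weight_space_def)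
  have "hh (n - k) v = - (\<Sum>i=n - k..n. \<mu> i) \<odot> v" if "k < n" for k
    using that
  proof (induction k)
    case 0
    then show ?case using c[of n] act_coroot[of n v] n_pos by (simp add: neg_eq_iff_add_eq_0 eq_neg_iff_add_eq_0)
  next
    case (Suc k)
    define i where "i = n - Suc k"
    have i: "i \<noteq> 0" "i < n" "n - k = i + 1" using Suc.prems by (auto simp: i_def)
    have "hh i v = hh (i + 1) v - \<mu> i \<odot> v" using c[of i] act_coroot[of i v] i by (simp add: algebra_simps)
    also have "hh (i + 1) v = - (\<Sum>i=i + 1..n. \<mu> i) \<odot> v" using Suc i by simp
    also have "- (\<Sum>i=i + 1..n. \<mu> i) \<odot> v - \<mu> i \<odot> v = - (\<Sum>i=i..n. \<mu> i) \<odot> v"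
      using i by (simp add: sum.atLeast_Suc_atMost[of i n] scale_left_diff_distrib)
    finally show ?case by (simp add: i_def)
  qed
  then show h: "hh j v = - (\<Sum>i=j..n. \<mu> i) \<odot> v" if "j \<in> {1..n}" for j
    using that diff_diff_cancel[of j n] by (metis atLeastAtMost_iff diff_less less_le_trans One_nat_def zero_less_Suc n_pos)
  have "act cen v = \<mu> 0 \<odot> v - hh 1 v" using c[of 0] act_coroot[of 0 v] by (simp add: algebra_simps)
  then show "act cen v = (\<Sum>i=0..n. \<mu> i) \<odot> v"
    using h[of 1] n_pos by (simp add: sum.atLeast_Suc_atMost[of 0 n] scale_left_distrib)
qed

definition v0 :: 'v where
  "v0 = (SOME v. v \<noteq> 0 \<and> v \<in> weight_space n smul act (fundamental_weight i0) \<and> (\<forall>i\<le>n. act (chevalley_e n i) v = 0) \<and>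
     (\<forall>W. submodule n smul act W \<and> v \<in> W \<longrightarrow> W = UNIV))"

lemma v0: "v0 \<noteq> 0" "v0 \<in> weight_space n smul act (fundamental_weight i0)" "i \<le> n \<Longrightarrow> act (chevalley_e n i) v0 = 0"
  "submodule n smul act W \<Longrightarrow> v0 \<in> W \<Longrightarrow> W = UNIV"
proof -
  have "\<exists>v. v \<noteq> 0 \<and> v \<in> weight_space n smul act (fundamental_weight i0) \<and> (\<forall>i\<le>n. act (chevalley_e n i) v = 0) \<and>
     (\<forall>W. submodule n smul act W \<and> v \<in> W \<longrightarrow> W = UNIV)"
    using L by (simp add: is_L_def highest_weight_module_def)
  from someI_ex[OF this] show "v0 \<noteq> 0" "v0 \<in> weight_space n smul act (fundamental_weight i0)" "i \<le> n \<Longrightarrow> act (chevalley_e n i) v0 = 0"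
    "submodule n smul act W \<Longrightarrow> v0 \<in> W \<Longrightarrow> W = UNIV"
    unfolding v0_def[symmetric] by blast+
qed

text \<open>The central element fixes v0, whose weight has level one, and its fixed vectors form a
  submodule.\<close>

lemma cen_id: "act cen v = v"
proof -
  have cl: "lin (act cen)" by (rule act_lin) simp
  have "act cen v0 = v0"
    using weight_space_hh(2)[OF v0(2)] i0 by (simp add: fundamental_weight_def)
  moreover have "submodule n smul act {v. act cen v = v}"
    unfolding submodule_def subspace_def using cl
    by (auto simp: lin_add lin_scale lin_zero act_cen)
  ultimately have "{v. act cen v = v} = UNIV" using v0(4) by blast
  then show ?thesis by blast
qed

sublocale affine_ops n i0 smul "\<lambda>x y m. act (X n x y m)" "act der" v0
proof (intro affine_ops.intro affine_ops_axioms.intro)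
  show "path_C n i0" "vspace smul" by (rule path_C_axioms vspace_axioms)+
  show "x \<in> letters n \<Longrightarrow> y \<in> letters n \<Longrightarrow> lin (act (X n x y m))" for x y m by (rule act_X_lin)
  show "act (X n x y m) = act (X n y x m)" for x y m by (simp add: X_commute)
  show "act (X n x y m) (act (X n z w k) v) = act (X n z w k) (act (X n x y m) v) +
    (of_int (om y z) \<odot> act (X n x w (m + k)) v + of_int (om x z) \<odot> act (X n y w (m + k)) v +
     of_int (om y w) \<odot> act (X n z x (m + k)) v + of_int (om x w) \<odot> act (X n z y (m + k)) v +
     (if m + k = 0 then of_int (m * xtr x y z w) else 0) \<odot> v)"
    if "x \<in> letters n" "y \<in> letters n" "z \<in> letters n" "w \<in> letters n" for x y z w m k v
    using act_X_bracket[OF that, of m k v] unfolding cen_id .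
  show "lin (act der)" by (rule act_lin) simp
  show "act der (act (X n x y m) v) = act (X n x y m) (act der v) + of_int m \<odot> act (X n x y m) v"
    if "x \<in> letters n" "y \<in> letters n" for x y m v
    using act_bracket[of der "X n x y m" v] der_bracket[of x y m] act_scale X_affine_C[OF that] by (simp add: algebra_simps)
  show "W = {0} \<or> W = UNIV" if W: "subspace W" "\<And>x y m v. x \<in> letters n \<Longrightarrow> y \<in> letters n \<Longrightarrow> v \<in> W \<Longrightarrow> act (X n x y m) v \<in> W"
    "\<And>v. v \<in> W \<Longrightarrow> act der v \<in> W" for W
  proof -
    have "\<forall>w\<in>W. act u w \<in> W" if "u \<in> affine_C n" for u
      using that
    proof (rule affine_span[where P = "\<lambda>u. \<forall>w\<in>W. act u w \<in> W", rotated -1])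
      show "\<forall>w\<in>W. act (LM n (\<lambda>a b. 0), 1, 0) w \<in> W" using cen_id unfolding cen_def by simp
      show "\<forall>w\<in>W. act (LM n (\<lambda>a b. 0), 0, 1) w \<in> W" using W(3) unfolding der_def by simp
    qed (use W in \<open>auto simp: act_add act_scale subspace_add subspace_scale\<close>)
    then have "submodule n smul act W" using W(1) by (simp add: submodule_def)
    then show ?thesis using L by (auto simp: is_L_def irreducible_module_def)
  qed
  show "v0 \<noteq> 0" by (rule v0)
  show "hh j v0 = of_int (- lam j) \<odot> v0" if "j \<in> {1..n}" for j
  proof -
    have "(\<Sum>i=j..n. fundamental_weight i0 i) = of_int (lam j)"
      using that i0 by (simp add: fundamental_weight_def lam_def)
    then show ?thesis using weight_space_hh(1)[OF v0(2) that] by simp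
  qed
  show "act der v0 = 0"
    using v0(2) i0 unfolding scaling_element_der[symmetric] by (simp add: weight_space_def fundamental_weight_def)
  show "act (X n x y m) v0 = 0" if "i \<le> n" "simple_index i = (x, y, m)" for i x y m
  proof -
    have "x \<in> letters n" "y \<in> letters n" using simple_index_PR[OF that(1)] that(2) by (auto simp: PR_iff)
    then have "ecoef i \<odot> act (X n x y m) v0 = 0" using v0(3)[OF that(1)] chevalley(1)[OF that] act_scale X_affine_C by simp
    then show ?thesis by (auto simp: ecoef_def split: if_splits)
  qed
qed

end

lemma (in type_C) sum_cp_from: "1 \<le> j \<Longrightarrow> j \<le> n \<Longrightarrow> (\<Sum>i=j..n. cp i u) = u j"
proof -
  assume j: "1 \<le> j" "j \<le> n"
  have "{j..n} = insert n {j..<n}" using j by auto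
  then have "(\<Sum>i=j..n. cp i u) = u n + (\<Sum>i\<in>{j..<n}. cp i u)" using n_pos by (simp add: cp_def)
  also have "(\<Sum>i\<in>{j..<n}. cp i u) = (\<Sum>i\<in>{j..<n}. - (u (Suc i) - u i))"
    using j by (intro sum.cong) (auto simp: cp_def)
  also have "\<dots> = - (u n - u j)" unfolding sum_negf sum_Suc_diff'[OF j(2)] ..
  finally show ?thesis by simp
qed

lemma subst_q_inverse:
  "subst_q n (inverse q_pochhammer_inf) x = of_nat (card {l. part l \<and> x = weight_scale (- of_nat (sum_list l)) (null_root n)})"
  if "null_root n (n + 1) = 1"
proof -
  have u: "k = k'" if "weight_scale (- of_nat k) (null_root n) = weight_scale (- of_nat k') (null_root n)" for k k'
    using fun_cong[OF that, of "n + 1"] \<open>null_root n (n + 1) = 1\<close> by simp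
  show ?thesis
  proof (cases "\<exists>k. x = weight_scale (- of_nat k) (null_root n)")
    case True
    then obtain k where k: "x = weight_scale (- of_nat k) (null_root n)" by blast
    then have "{k. x = weight_scale (- of_nat k) (null_root n)} = {k}"
      "{l. part l \<and> x = weight_scale (- of_nat (sum_list l)) (null_root n)} = {l. part l \<and> sum_list l = k}"
      using u by blast+
    then show ?thesis unfolding subst_q_def by (simp add: inverse_q_pochhammer npart_def)
  next
    case False
    then have "{k. x = weight_scale (- of_nat k) (null_root n)} = {}"
      "{l. part l \<and> x = weight_scale (- of_nat (sum_list l)) (null_root n)} = {}" by auto
    then show ?thesis unfolding subst_q_def by (simp only: sum.empty card.empty of_nat_0)
  qed
qed

lemma exp_mult_formal_exp: "exp_mult (formal_exp (- \<nu>)) F = (\<lambda>\<mu>. F (\<mu> + \<nu>))"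
proof
  fix \<mu>
  have "{\<nu>'. formal_exp (- \<nu>) \<nu>' \<noteq> 0 \<and> F (\<mu> - \<nu>') \<noteq> 0} = (if F (\<mu> + \<nu>) = 0 then {} else {- \<nu>})"
    by (auto simp: formal_exp_def split: if_splits)
  then show "exp_mult (formal_exp (- \<nu>)) F \<mu> = F (\<mu> + \<nu>)"
    unfolding exp_mult_def by (simp add: formal_exp_def)
qed

context L_model
begin

section \<open>Character and generating functions\<close>

lemma coroot_lin: "i \<le> n \<Longrightarrow> lin (act (coroot n i))"
proof -
  assume i: "i \<le> n"
  have h: "lin (hh j)" if "1 \<le> j" "j \<le> n" for j using that by (intro act_X_lin) auto
  note lins = lin_add[OF h] lin_scale[OF h]
  show ?thesis
    unfolding lin_iff act_coroot[OF i] cen_id using n_pos i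
    by (auto simp: lins scale_right_distrib scale_right_diff_distrib)
qed

lemma weight_space_wsp:
  assumes l: "l \<in> latt"
  shows "weight_space n smul act (toW l) = wsp l"
proof (intro equalityI subsetI)
  fix v assume v: "v \<in> weight_space n smul act (toW l)"
  have "hh j v = of_int (- l j) \<odot> v" if j: "j \<in> {1..n}" for j
  proof -
    have "(\<Sum>i=j..n. toW l i) = of_int (\<Sum>i=j..n. cp i l)" by (simp add: toW_def)
    also have "(\<Sum>i=j..n. cp i l) = l j" using sum_cp_from j by simp
    finally show ?thesis using weight_space_hh(1)[OF v j] by simp
  qed
  moreover have "act der v = of_int (l 0) \<odot> v" using v by (simp add: weight_space_def scaling_element_der toW_def)
  ultimately show "v \<in> wsp l" by (simp add: wsp_def)
next
  fix v assume v: "v \<in> wsp l"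
  have h: "hh j v = of_int (- l j) \<odot> v" if "1 \<le> j" "j \<le> n" for j using v that by (simp add: wsp_def)
  have "act (coroot n i) v = of_int (cp i l) \<odot> v" if i: "i \<le> n" for i
    unfolding act_coroot[OF i] cen_id
    using h[of 1] h[of n] h[of i] h[of "i + 1"] n_pos i l
    by (auto simp: cp_def latt_def scale_left_diff_distrib)
  moreover have "act der v = of_int (l 0) \<odot> v" using v by (simp add: wsp_def)
  ultimately show "v \<in> weight_space n smul act (toW l)" by (simp add: weight_space_def scaling_element_der toW_def)
qed

text \<open>A vector is a finite sum of vectors whose weights lie in the lattice. Each of these
  weights differs from \<mu> on a coroot or on d, and comparing eigenvalues kills the
  component.\<close>

lemma weight_space_other:
  assumes mu: "\<mu> \<in> weights n" and other: "\<And>l. l \<in> latt \<Longrightarrow> \<mu> \<noteq> toW l"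
  shows "weight_space n smul act \<mu> = {0}"
proof -
  have z: "v = 0" if v: "v \<in> weight_space n smul act \<mu>" for v
  proof -
    have "v \<in> fspan v0" using span_words by simp
    then obtain A w where A: "finite A" "A \<subseteq> latt" "\<forall>m. w m \<in> span (fwords v0 ` words_to lam m)" "v = (\<Sum>m\<in>A. w m)"
      using fspan_decompose[OF lam_latt] by blast
    have w: "w m \<in> wsp m" if "m \<in> A" for m using A that wsp_span by auto
    have key: "w m = 0" if m: "m \<in> A" and ex: "\<exists>j. \<mu> j \<noteq> toW m j" for m
    proof -
      have comb: "(a - b m) \<odot> w m = 0" if u: "lin u" "u v = a \<odot> v" "\<And>l. l \<in> A \<Longrightarrow> u (w l) = b l \<odot> w l" for u a b
      proof (rule wsp_sum_zero[OF A(1,2), of "\<lambda>l. (a - b l) \<odot> w l"])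
        have "u v = (\<Sum>l\<in>A. b l \<odot> w l)" unfolding A(4) lin_sum[OF u(1)] using u(3) by simp
        then show "(\<Sum>l\<in>A. (a - b l) \<odot> w l) = 0"
          using u(2) A(4) by (simp add: scale_left_diff_distrib sum_subtractf scale_sum_right)
      qed (use w m wsp_subspace in \<open>auto simp: subspace_scale\<close>)
      obtain j where j: "\<mu> j \<noteq> toW m j" using ex by blast
      have jn: "j \<le> n \<or> j = n + 1"
      proof (rule ccontr)
        assume "\<not> (j \<le> n \<or> j = n + 1)"
        then have "n + 1 < j" by simp
        then show False using mu j by (simp add: weights_def toW_def)
      qed
      have ww: "w l \<in> weight_space n smul act (toW l)" if "l \<in> A" for l using w[OF that] weight_space_wsp A(2) that by blast
      have "(\<mu> j - toW m j) \<odot> w m = 0"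
      proof (cases "j \<le> n")
        case True
        show ?thesis
          by (rule comb[OF coroot_lin[OF True]]) (use v ww True in \<open>auto simp: weight_space_def\<close>)
      next
        case False
        then have "j = n + 1" using jn by simp
        then show ?thesis
          by (intro comb[OF act_lin[of der]]) (use v ww in \<open>auto simp: weight_space_def scaling_element_der\<close>)
      qed
      then show ?thesis using j by simp
    qed
    have "w m = 0" if "m \<in> A" for m
      using key[OF that] other[of m] A(2) that by (metis ext subsetD)
    then show ?thesis using A(4) by simp
  qed
  moreover have "0 \<in> weight_space n smul act \<mu>"
  proof -
    have "act (coroot n j) 0 = 0" if "j \<le> n" for j using lin_zero[OF coroot_lin[OF that]] .
    moreover have "act der 0 = 0" using lin_zero[OF act_lin] by simp
    ultimately show ?thesis by (simp add: weight_space_def scaling_element_der)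
  qed
  ultimately show ?thesis by blast
qed

definition paths_to :: "weight \<Rightarrow> coloured_int list set" where
  "paths_to \<mu> = {w. cpath w \<and> toW (pwt w) = \<mu>}"

lemma toW_latt: "l \<in> latt \<Longrightarrow> l' \<in> latt \<Longrightarrow> toW l = toW l' \<Longrightarrow> l = l'"
  using latt_eqI toW_inj by blast

lemma paths_to_toW: "l \<in> latt \<Longrightarrow> paths_to (toW l) = {w. cpath w \<and> pwt w = l}"
  using toW_latt pwt_latt by (auto simp: paths_to_def)

lemma finite_paths_to_weight: "finite (paths_to \<mu>)"
proof (cases "\<exists>w. w \<in> paths_to \<mu>")
  case True
  then obtain w where w: "cpath w" "toW (pwt w) = \<mu>" by (auto simp: paths_to_def)
  then have "paths_to \<mu> = {w'. cpath w' \<and> pwt w' = pwt w}" using paths_to_toW[OF pwt_latt[OF w(1)]] by simp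
  then show ?thesis using finite_paths_to by simp
next
  case False
  then have "paths_to \<mu> = {}" by blast
  then show ?thesis by simp
qed

lemma character_paths: "character n smul act \<mu> = of_nat (card (paths_to \<mu>))"
proof (cases "\<exists>l\<in>latt. \<mu> = toW l")
  case True
  then obtain l where l: "l \<in> latt" "\<mu> = toW l" by blast
  have "int (mlt l) = int (card {w. cpath w \<and> pwt w = l})"
    using multiplicity_paths[of l] l(1) by (simp add: mm_def yy_def)
  then show ?thesis
    using l weight_space_wsp[OF l(1)] toW_weights[of l] paths_to_toW[OF l(1)]
    by (simp add: character_def mlt_def)
next
  case False
  then have "paths_to \<mu> = {}" using pwt_latt by (auto simp: paths_to_def)
  moreover have "character n smul act \<mu> = 0"
  proof (cases "\<mu> \<in> weights n")
    case True
    then have "weight_space n smul act \<mu> = {0}" using weight_space_other False by blast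
    then show ?thesis using dim_le_card[of "{0}" "{}"] by (simp add: character_def)
  qed (simp add: character_def)
  ultimately show ?thesis by simp
qed

lemma finite_mult: "finite_weight_multiplicities n smul act"
  unfolding finite_weight_multiplicities_def
proof
  fix \<mu> assume mu: "\<mu> \<in> weights n"
  show "\<exists>S. finite S \<and> weight_space n smul act \<mu> \<subseteq> span S"
  proof (cases "\<exists>l\<in>latt. \<mu> = toW l")
    case True
    then show ?thesis using weight_space_wsp wsp_fin_dim unfolding fin_dim_def by metis
  next
    case False
    then have "weight_space n smul act \<mu> = {0}" using weight_space_other[OF mu] by blast
    then show ?thesis by (intro exI[of _ "{}"]) simp
  qed
qed

lemma cpath_crystal: "cpath w \<Longrightarrow> snd ` set w \<subseteq> crystal n"
  using cpath_part by auto

lemma qpath_crystal: "qpath w \<Longrightarrow> snd ` set w \<subseteq> crystal n"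
  by (induction w) auto

lemma exponent_set:
  assumes P: "P []" "\<And>a w. P (a # w) \<longleftrightarrow> snd a \<in> crystal n \<and> R a (lead w) \<and> P w \<and> \<not> (w = [] \<and> a = (0, g0))"
    and cr: "\<And>w. P w \<Longrightarrow> snd ` set w \<subseteq> crystal n"
  shows "{\<pi> \<in> grounded_partitions n R g0. partition_exponent n \<pi> = \<mu>} =
    (\<lambda>w. w @ [(0, g0)]) ` {w. P w \<and> toW (pwt w) = \<mu> + fundamental_weight i0}"
proof -
  have "partition_exponent n (w @ [(0, g0)]) = \<mu> \<longleftrightarrow> toW (pwt w) = \<mu> + fundamental_weight i0" if "P w" for w
    unfolding partition_exponent_path[OF cr[OF that]] by (rule diff_eq_eq)
  then show ?thesis unfolding grounded_image[of P R, OF P] by auto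
qed

lemma generating_function_card:
  assumes "{\<pi> \<in> P. partition_exponent n \<pi> = \<mu>} = (\<lambda>w. w @ [(0, g0)]) ` A"
  shows "generating_function n P \<mu> = of_nat (card A)"
  unfolding generating_function_def assms by (simp add: card_image inj_on_def)

lemma exponent_eq:
  "{\<pi> \<in> grounded_partitions n rel_eq g0. partition_exponent n \<pi> = \<mu>} = (\<lambda>w. w @ [(0, g0)]) ` paths_to (\<mu> + fundamental_weight i0)"
  unfolding paths_to_def by (rule exponent_set) (use cpath_crystal in auto)

lemma exponent_ge:
  "{\<pi> \<in> grounded_partitions n rel_ge g0. partition_exponent n \<pi> = \<mu>} =
    (\<lambda>w. w @ [(0, g0)]) ` {w. qpath w \<and> toW (pwt w) = \<mu> + fundamental_weight i0}"
  by (rule exponent_set) (use qpath_crystal in auto)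

lemma first_identity:
  "generating_function n (grounded_partitions n rel_eq g0) = exp_mult (formal_exp (- fundamental_weight i0)) (character n smul act)"
  unfolding exp_mult_formal_exp
  using generating_function_card[OF exponent_eq] by (simp add: fun_eq_iff character_paths)

definition pairs_to :: "weight \<Rightarrow> (coloured_int list \<times> nat list) set" where
  "pairs_to \<mu> = {q. cpath (fst q) \<and> part (snd q) \<and> toW (pwt (fst q) - sc (int (sum_list (snd q))) delta) = \<mu>}"

text \<open>The height of the total weight is that of the path minus 4n times the size of the
  partition, and paths have height at most that of \<open>lam\<close>; so both components are
  bounded.\<close>

lemma finite_pairs_to: "finite (pairs_to \<mu>)"
proof (cases "pairs_to \<mu> = {}")
  case False
  then obtain q where q: "q \<in> pairs_to \<mu>" by blast
  let ?t = "\<lambda>q. pwt (fst q) - sc (int (sum_list (snd q))) delta"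
  have latt: "?t q \<in> latt" if "q \<in> pairs_to \<mu>" for q
    using that pwt_latt by (intro latt_diff) (auto simp: pairs_to_def delta_def)
  define l where "l = ?t q"
  let ?B = "nat (ht lam - ht l)"
  have "pairs_to \<mu> \<subseteq> {w. cpath w \<and> ht l \<le> ht (pwt w)} \<times> (\<Union>k\<le>?B. {x. part x \<and> sum_list x = k})"
  proof
    fix r assume r: "r \<in> pairs_to \<mu>"
    then have "?t r = l" using toW_latt[OF latt[OF r] latt[OF q]] q by (simp add: pairs_to_def l_def)
    then have "ht (?t r) = ht l" by simp
    then have h: "ht (pwt (fst r)) = ht l + 4 * int n * int (sum_list (snd r))" by (simp add: ht_linear ht_delta algebra_simps)
    have "1 * int (sum_list (snd r)) \<le> 4 * int n * int (sum_list (snd r))" using n_pos by (intro mult_right_mono) auto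
    moreover have "ht (pwt (fst r)) \<le> ht lam" using ht_pwt[of "fst r"] r by (simp add: pairs_to_def)
    ultimately have "int (sum_list (snd r)) \<le> ht lam - ht l" "ht l \<le> ht (pwt (fst r))" using h by linarith+
    then show "r \<in> {w. cpath w \<and> ht l \<le> ht (pwt w)} \<times> (\<Union>k\<le>?B. {x. part x \<and> sum_list x = k})"
      using r by (cases r) (auto simp: pairs_to_def)
  qed
  moreover have "finite ({w. cpath w \<and> ht l \<le> ht (pwt w)} \<times> (\<Union>k\<le>?B. {x. part x \<and> sum_list x = k}))"
    using finite_paths finite_part by blast
  ultimately show ?thesis by (rule finite_subset)
qed simp

lemma bij_pairs_to: "bij_betw (\<lambda>q. dec (fst q) (snd q)) (pairs_to \<mu>) {w. qpath w \<and> toW (pwt w) = \<mu>}"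
  unfolding pairs_to_def by (rule bij_dec)

lemma null_root_level: "null_root n (n + 1) = 1"
  by (simp add: null_root_toW toW_def delta_def)

text \<open>Pairs of a path and a partition are fibred over the weight of the path. The fibre over
  \<nu> is a product set whose two cardinalities are the coefficients of the two factors, and the
  image of the fibration is the index set in \<open>exp_mult\<close>.\<close>

lemma second_identity:
  "generating_function n (grounded_partitions n rel_ge g0) =
    exp_mult (exp_mult (formal_exp (- fundamental_weight i0)) (character n smul act)) (subst_q n (inverse q_pochhammer_inf))"
proof
  fix \<mu>
  let ?L = "fundamental_weight i0" and ?A = "pairs_to (\<mu> + fundamental_weight i0)"
  define F :: "weight \<Rightarrow> rat" where "F \<nu> = of_nat (card (paths_to (\<nu> + ?L)))" for \<nu>
  define D where "D x = {l. part l \<and> x = weight_scale (- of_nat (sum_list l)) (null_root n)}" for x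
  define f where "f q = toW (pwt (fst q)) - ?L" for q :: "coloured_int list \<times> nat list"
  have F: "exp_mult (formal_exp (- ?L)) (character n smul act) = F"
    unfolding exp_mult_formal_exp by (simp add: fun_eq_iff character_paths F_def)
  have G: "subst_q n (inverse q_pochhammer_inf) x = of_nat (card (D x))" for x
    unfolding D_def by (rule subst_q_inverse[OF null_root_level])
  have Amem: "q \<in> ?A \<longleftrightarrow> fst q \<in> paths_to (f q + ?L) \<and> snd q \<in> D (\<mu> - f q)" for q
  proof -
    have "toW (pwt (fst q) - sc (int (sum_list (snd q))) delta) = toW (pwt (fst q)) - weight_scale (of_nat (sum_list (snd q))) (null_root n)"
      by (simp add: toW_linear null_root_toW)
    moreover have "weight_scale (- of_nat k) (null_root n) = - weight_scale (of_nat k) (null_root n)" for k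
      by (simp add: fun_eq_iff)
    moreover have "t - s = \<mu> + ?L \<longleftrightarrow> \<mu> - (t - ?L) = - s" for t s
      by (auto simp: algebra_simps)
    ultimately show ?thesis
      by (simp add: pairs_to_def paths_to_def D_def f_def conj_ac)
  qed
  have fib: "{q \<in> ?A. f q = \<nu>} = paths_to (\<nu> + ?L) \<times> D (\<mu> - \<nu>)" for \<nu>
  proof (intro equalityI subsetI)
    fix q assume "q \<in> paths_to (\<nu> + ?L) \<times> D (\<mu> - \<nu>)"
    then have q: "fst q \<in> paths_to (\<nu> + ?L)" "snd q \<in> D (\<mu> - \<nu>)" by auto
    then have "f q = \<nu>" by (simp add: f_def paths_to_def)
    then show "q \<in> {q \<in> ?A. f q = \<nu>}" using q Amem[of q] by simp
  next
    fix q assume "q \<in> {q \<in> ?A. f q = \<nu>}"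
    then have q: "q \<in> ?A" "f q = \<nu>" by auto
    show "q \<in> paths_to (\<nu> + ?L) \<times> D (\<mu> - \<nu>)" unfolding mem_Times_iff using iffD1[OF Amem q(1)] unfolding q(2) .
  qed
  have finD: "finite (D x)" for x
  proof (cases "D x = {}")
    case False
    then obtain l where l: "l \<in> D x" by blast
    have "D x \<subseteq> {l'. part l' \<and> sum_list l' = sum_list l}"
    proof
      fix l' assume "l' \<in> D x"
      then have "weight_scale (- of_nat (sum_list l')) (null_root n) (n + 1) = weight_scale (- of_nat (sum_list l)) (null_root n) (n + 1)" "part l'"
        using l by (auto simp: D_def)
      then show "l' \<in> {l'. part l' \<and> sum_list l' = sum_list l}" using null_root_level by simp
    qed
    then show ?thesis using finite_part finite_subset by blast
  qed simp
  have im: "f ` ?A = {\<nu>. F \<nu> \<noteq> 0 \<and> of_nat (card (D (\<mu> - \<nu>))) \<noteq> (0 :: rat)}"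
  proof -
    have "\<nu> \<in> f ` ?A \<longleftrightarrow> paths_to (\<nu> + ?L) \<noteq> {} \<and> D (\<mu> - \<nu>) \<noteq> {}" for \<nu>
    proof -
      have "\<nu> \<in> f ` ?A \<longleftrightarrow> {q \<in> ?A. f q = \<nu>} \<noteq> {}" by auto
      then show ?thesis unfolding fib by auto
    qed
    then show ?thesis using finD finite_paths_to_weight by (auto simp: F_def)
  qed
  have "generating_function n (grounded_partitions n rel_ge g0) \<mu> = of_nat (card {w. qpath w \<and> toW (pwt w) = \<mu> + ?L})"
    by (rule generating_function_card[OF exponent_ge])
  also have "card {w. qpath w \<and> toW (pwt w) = \<mu> + ?L} = card ?A" using bij_betw_same_card[OF bij_pairs_to] by simp
  also have "(of_nat (card ?A) :: rat) = (\<Sum>q\<in>?A. 1)" by simp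
  also have "\<dots> = (\<Sum>\<nu>\<in>f ` ?A. \<Sum>q\<in>{q \<in> ?A. f q = \<nu>}. 1)" by (rule sum.image_gen[OF finite_pairs_to])
  also have "\<dots> = (\<Sum>\<nu>\<in>f ` ?A. F \<nu> * of_nat (card (D (\<mu> - \<nu>))))"
    unfolding fib by (simp add: card_cartesian_product F_def)
  also have "\<dots> = exp_mult F (\<lambda>x. of_nat (card (D x))) \<mu>" unfolding im exp_mult_def ..
  finally show "generating_function n (grounded_partitions n rel_ge g0) \<mu> =
      exp_mult (exp_mult (formal_exp (- ?L)) (character n smul act)) (subst_q n (inverse q_pochhammer_inf)) \<mu>"
    unfolding F by (simp add: G[abs_def])
qed

end

theorem theorem1p8:
  fixes n i :: nat
    and smul :: "complex \<Rightarrow> 'v \<Rightarrow> 'v::ab_group_add"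
    and act :: "affine \<Rightarrow> 'v \<Rightarrow> 'v"
  assumes "n \<ge> 1" and "i \<le> n"
    and "is_L n (fundamental_weight i) smul act"
  shows "finite_weight_multiplicities n smul act \<and>
    locally_finite n (grounded_partitions n rel_eq (ground i)) \<and>
    locally_finite n (grounded_partitions n rel_ge (ground i)) \<and>
    (generating_function n (grounded_partitions n rel_eq (ground i)) =
           exp_mult (formal_exp (- fundamental_weight i)) (character n smul act)) \<and>
    (generating_function n (grounded_partitions n rel_ge (ground i)) =
           exp_mult (exp_mult (formal_exp (- fundamental_weight i)) (character n smul act))
             (subst_q n (inverse q_pochhammer_inf)))"
proof -
  interpret L_model n i smul act
    by unfold_locales (use assms in auto)
  have "finite {w. qpath w \<and> toW (pwt w) = \<mu>}" for \<mu>
    using bij_betw_finite[OF bij_pairs_to] finite_pairs_to by blast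
  then show ?thesis
    using finite_mult first_identity second_identity finite_paths_to_weight
    by (simp add: locally_finite_def exponent_eq exponent_ge)
qed

end
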